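(* Let $n,m,l$ be positive integers with $\gcd(m,l)=1$, and let $\mathcal{B}_{m/l,n}$ be the Berezin transform of the generalized Hartogs triangle $\Omega^{n+1}_{m/l}=\{(z,w)\in\mathbb{C}^n\times\mathbb{C}:\ \|z\|^m<|w|^l<1\}$. If $1<p<\infty$, then $$\mathcal{B}_{m/l,n}: L^p(\Omega^{n+1}_{m/l})\to L^p(\Omega^{n+1}_{m/l})$$ is bounded if and only if $p>m+nl$.
   Context: $\|\cdot\|$ is the Euclidean norm on $\mathbb{C}^n$, $dV$ is Lebesgue measure, and $L^p$ spaces are taken with respect to $dV$. The Bergman space $A^2(\Omega^{n+1}_{m/l})$ is the closed subspace of holomorphic functions in $L^2(\Omega^{n+1}_{m/l})$, and $B_{m/l,n}((z,w),(\xi,\eta))$ denotes its reproducing kernel (the Bergman kernel of $\Omega^{n+1}_{m/l}$), holomorphic in $(z,w)$ and antiholomorphic in $(\xi,\eta)$. The Berezin transform is the positive integral operator $$\mathcal{B}_{m/l,n}f(z,w)=\int_{\Omega^{n+1}_{m/l}}\frac{|B_{m/l,n}((z,w),(\xi,\eta))|^2}{B_{m/l,n}((z,w),(z,w))}\,f(\xi,\eta)\,dV(\xi,\eta).$$ *)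

theory Defs
  imports "HOL-Analysis.Analysis"
begin

definition hartogs_triangle :: "nat \<Rightarrow> nat \<Rightarrow> ((complex ^ 'n) \<times> complex) set" where
  "hartogs_triangle m l = {(z, w). norm z ^ m < norm w ^ l \<and> norm w ^ l < 1}"

text \<open>
  The space \<open>(complex ^ 'n) \<times> complex\<close> only carries a real vector space structure in the library;
  \<open>cscale\<close> is its complex scalar multiplication. Holomorphy in several variables on an open set is
  Frechet differentiability with a complex linear derivative.
\<close>

definition cscale :: "complex \<Rightarrow> (complex ^ 'n) \<times> complex \<Rightarrow> (complex ^ 'n) \<times> complex" where
  "cscale c x = (c *s fst x, c * snd x)"

definition holomorphic_several ::
    "((complex ^ 'n) \<times> complex \<Rightarrow> complex) \<Rightarrow> ((complex ^ 'n) \<times> complex) set \<Rightarrow> bool" where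
  "holomorphic_several f \<Omega> \<longleftrightarrow>
     (\<forall>x\<in>\<Omega>. \<exists>D. (f has_derivative D) (at x) \<and> (\<forall>c v. D (cscale c v) = c * D v))"

text \<open>Elements of \<open>Lp_space\<close> are functions, not classes modulo null sets.\<close>

definition Lp_space :: "real \<Rightarrow> 'a measure \<Rightarrow> ('a \<Rightarrow> complex) set" where
  "Lp_space p M = {f \<in> borel_measurable M. integrable M (\<lambda>x. norm (f x) powr p)}"

definition Lp_norm :: "real \<Rightarrow> 'a measure \<Rightarrow> ('a \<Rightarrow> complex) \<Rightarrow> real" where
  "Lp_norm p M f = (\<integral>x. norm (f x) powr p \<partial>M) powr (1 / p)"

definition bergman_space ::
    "((complex ^ 'n) \<times> complex) set \<Rightarrow> ((complex ^ 'n) \<times> complex \<Rightarrow> complex) set" where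
  "bergman_space \<Omega> = {f \<in> Lp_space 2 (lebesgue_on \<Omega>). holomorphic_several f \<Omega>}"

text \<open>
  The reproducing property is \<open>f(y) = \<langle>f, K(\<cdot>, y)\<rangle>\<close>. Functions here are total, so
  \<open>K\<close> is normalised to vanish off \<open>\<Omega> \<times> \<Omega>\<close>; without this it would not be unique.
\<close>

definition is_bergman_kernel ::
    "((complex ^ 'n) \<times> complex) set \<Rightarrow>
     ((complex ^ 'n) \<times> complex \<Rightarrow> (complex ^ 'n) \<times> complex \<Rightarrow> complex) \<Rightarrow> bool" where
  "is_bergman_kernel \<Omega> K \<longleftrightarrow>
     (\<forall>y\<in>\<Omega>. (\<lambda>x. K x y) \<in> bergman_space \<Omega>) \<and>
     (\<forall>y\<in>\<Omega>. \<forall>f\<in>bergman_space \<Omega>. f y = (\<integral>x. f x * cnj (K x y) \<partial>lebesgue_on \<Omega>)) \<and>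
     (\<forall>x y. x \<notin> \<Omega> \<or> y \<notin> \<Omega> \<longrightarrow> K x y = 0)"

lemma is_bergman_kernel_in_bergman_space:
  "is_bergman_kernel \<Omega> K \<Longrightarrow> y \<in> \<Omega> \<Longrightarrow> (\<lambda>x. K x y) \<in> bergman_space \<Omega>"
  unfolding is_bergman_kernel_def by (elim conjE) (erule (1) bspec)

lemma is_bergman_kernel_reproduces:
  "is_bergman_kernel \<Omega> K \<Longrightarrow> y \<in> \<Omega> \<Longrightarrow> f \<in> bergman_space \<Omega> \<Longrightarrow>
     f y = (\<integral>x. f x * cnj (K x y) \<partial>lebesgue_on \<Omega>)"
  unfolding is_bergman_kernel_def by (elim conjE) (drule (1) bspec, erule (1) bspec)

lemma is_bergman_kernel_outside:
  "is_bergman_kernel \<Omega> K \<Longrightarrow> x \<notin> \<Omega> \<or> y \<notin> \<Omega> \<Longrightarrow> K x y = 0"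
  unfolding is_bergman_kernel_def by (elim conjE allE) (erule (1) mp)

lemma is_bergman_kernel_cnj:
  assumes K: "is_bergman_kernel \<Omega> K" and L: "is_bergman_kernel \<Omega> L" and "x \<in> \<Omega>" "y \<in> \<Omega>"
  shows "K x y = cnj (L y x)"
proof -
  have "K x y = (\<integral>t. K t y * cnj (L t x) \<partial>lebesgue_on \<Omega>)"
    by (rule is_bergman_kernel_reproduces[OF L \<open>x \<in> \<Omega>\<close>
          is_bergman_kernel_in_bergman_space[OF K \<open>y \<in> \<Omega>\<close>]])
  also have "\<dots> = (\<integral>t. cnj (L t x * cnj (K t y)) \<partial>lebesgue_on \<Omega>)"
    by (simp add: mult.commute)
  also have "\<dots> = cnj (\<integral>t. L t x * cnj (K t y) \<partial>lebesgue_on \<Omega>)"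
    by (rule Bochner_Integration.integral_cnj)
  also have "(\<integral>t. L t x * cnj (K t y) \<partial>lebesgue_on \<Omega>) = L y x"
    by (rule is_bergman_kernel_reproduces[OF K \<open>y \<in> \<Omega>\<close>
          is_bergman_kernel_in_bergman_space[OF L \<open>x \<in> \<Omega>\<close>], symmetric])
  finally show ?thesis .
qed

lemma is_bergman_kernel_unique:
  assumes "is_bergman_kernel \<Omega> K" "is_bergman_kernel \<Omega> L"
  shows "K = L"
proof (intro ext)
  fix x y
  show "K x y = L x y"
  proof (cases "x \<in> \<Omega> \<and> y \<in> \<Omega>")
    case True
    then show ?thesis
      using is_bergman_kernel_cnj[OF assms, of x y] is_bergman_kernel_cnj[OF assms(2) assms(2), of x y]
      by simp
  next
    case False
    then have "K x y = 0" "L x y = 0"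
      using assms by (simp_all add: is_bergman_kernel_outside)
    then show ?thesis by simp
  qed
qed

definition bergman_kernel ::
    "((complex ^ 'n) \<times> complex) set \<Rightarrow>
     (complex ^ 'n) \<times> complex \<Rightarrow> (complex ^ 'n) \<times> complex \<Rightarrow> complex" where
  "bergman_kernel \<Omega> = (THE K. is_bergman_kernel \<Omega> K)"

definition berezin_kernel ::
    "((complex ^ 'n) \<times> complex) set \<Rightarrow>
     (complex ^ 'n) \<times> complex \<Rightarrow> (complex ^ 'n) \<times> complex \<Rightarrow> complex" where
  "berezin_kernel \<Omega> x y = of_real ((norm (bergman_kernel \<Omega> x y))\<^sup>2) / bergman_kernel \<Omega> x x"

definition berezin_transform ::
    "((complex ^ 'n) \<times> complex) set \<Rightarrow>
     ((complex ^ 'n) \<times> complex \<Rightarrow> complex) \<Rightarrow> (complex ^ 'n) \<times> complex \<Rightarrow> complex" where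
  "berezin_transform \<Omega> f x = (\<integral>y. berezin_kernel \<Omega> x y * f y \<partial>lebesgue_on \<Omega>)"

text \<open>
  A divergent Bochner integral has the value 0, so the almost everywhere absolute convergence of
  the integral defining the transform is required explicitly.
\<close>

definition berezin_bounded_on_Lp :: "((complex ^ 'n) \<times> complex) set \<Rightarrow> real \<Rightarrow> bool" where
  "berezin_bounded_on_Lp \<Omega> p \<longleftrightarrow>
     (\<exists>C. \<forall>f\<in>Lp_space p (lebesgue_on \<Omega>).
        (AE x in lebesgue_on \<Omega>. integrable (lebesgue_on \<Omega>) (\<lambda>y. berezin_kernel \<Omega> x y * f y)) \<and>
        berezin_transform \<Omega> f \<in> Lp_space p (lebesgue_on \<Omega>) \<and>
        Lp_norm p (lebesgue_on \<Omega>) (berezin_transform \<Omega> f) \<le> C * Lp_norm p (lebesgue_on \<Omega>) f)"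

end

theory Submission
  imports Defs "HOL-Complex_Analysis.Complex_Analysis"
begin

text \<open>
  The monomials, grouped by the degree \<open>k\<close> in \<open>z\<close> and the exponent of \<open>w\<close>, are orthogonal by rotation
  invariance, and \<open>un k i y\<close> is the resulting block of the kernel: \<open>KK\<close> is the sum of all blocks
  that are square integrable. In the coordinates \<open>Xc\<close>, \<open>Yc\<close>, with values in \<open>[0, 1)\<close>, all weighted norms of
  blocks become Beta integrals, and \<open>bb k\<close>, the smallest admissible exponent of \<open>Yc\<close> in degree \<open>k\<close>, is at
  least \<open>1 / m\<close>. Hence the Schur test with the weight \<open>GG\<close> succeeds as soon as \<open>p > m + n l\<close>. Conversely
  coprimality of \<open>m\<close> and \<open>l\<close> provides a degree with \<open>bb k = 1 / m\<close>; the truncations of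
  \<open>Yc powr (- 1 / m)\<close> at \<open>exp (- L)\<close> have \<open>p\<close>-th power integral \<open>O(L)\<close> for \<open>p \<le> m + n l\<close>, while their
  transforms grow like \<open>L\<close> pointwise.
\<close>

section \<open>Lebesgue measure on Euclidean spaces\<close>

text \<open>The threshold comes from one exponent. For a weight of the form power of
  \<open>Yc\<close> times \<open>1 / ((1 - Xc) * (1 - Yc))\<close>, integrating a block against
  weight over kernel diagonal gives back, at worst, the exponent \<open>1 / m - \<nu>\<close>; this
  fixes \<open>GG\<close>. The dual integral against \<open>GG powr (1 / (p - 1))\<close> converges
  in degrees with \<open>bb k = 1 / m\<close> exactly when
  \<open>(\<nu> - 1 / m) / (p - 1) < 1 / m\<close>, and as \<open>\<nu> = (m + n l) / m\<close> this
  reads \<open>p > m + n l\<close>. The obstacle is that the diagonal is not comparable to a single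
  product of powers: \<open>bb k\<close> depends on \<open>k mod m\<close>, so the diagonal behaves
  like a sum of \<open>m\<close> different terms, and estimates run on each residue class
  separately. For the reproducing property, \<open>f\<close> is recovered at a point from its double
  Fourier series; absolute convergence follows from Cauchy-Schwarz against the blocks. Homogeneous
  parts are never expanded into monomials: their constants come from the Gaussian (Fock) reproducing
  formula, cut down to degree \<open>k\<close> by a circle average and to the ball by
  homogeneity.\<close>

lemma nn_integral_lborel_affine:
  fixes t :: "'a::euclidean_space" and c :: real
  assumes [measurable]: "f \<in> borel_measurable borel" and c: "c \<noteq> 0"
  shows "(\<integral>\<^sup>+x. f x \<partial>lborel) = ennreal (\<bar>c\<bar> ^ DIM('a)) * (\<integral>\<^sup>+x. f (t + c *\<^sub>R x) \<partial>lborel)"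
  by (subst lborel_affine[OF c, of t])
     (simp add: nn_integral_density nn_integral_distr nn_integral_cmult)

lemma integrable_lborel_affine_iff:
  fixes t :: "'a::euclidean_space" and c :: real
    and f :: "'a \<Rightarrow> 'b::{banach, second_countable_topology}"
  assumes [measurable]: "f \<in> borel_measurable borel" and c: "c \<noteq> 0"
  shows "integrable lborel (\<lambda>x. f (t + c *\<^sub>R x)) \<longleftrightarrow> integrable lborel f"
proof -
  have "(\<integral>\<^sup>+x. norm (f x) \<partial>lborel) = ennreal (\<bar>c\<bar> ^ DIM('a)) * (\<integral>\<^sup>+x. norm (f (t + c *\<^sub>R x)) \<partial>lborel)"
    by (rule nn_integral_lborel_affine) (use c in auto)
  moreover have "(0::ennreal) < ennreal (\<bar>c\<bar> ^ DIM('a))" using c by simp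
  ultimately show ?thesis
    unfolding integrable_iff_bounded by (auto simp: ennreal_mult_less_top less_top)
qed

lemma integral_lborel_affine:
  fixes t :: "'a::euclidean_space" and c :: real
    and f :: "'a \<Rightarrow> 'b::{banach, second_countable_topology}"
  assumes [measurable]: "f \<in> borel_measurable borel" and c: "c \<noteq> 0"
  shows "(\<integral>x. f x \<partial>lborel) = (\<bar>c\<bar> ^ DIM('a)) *\<^sub>R (\<integral>x. f (t + c *\<^sub>R x) \<partial>lborel)"
proof (cases "integrable lborel f")
  case True
  then have 1: "integrable lborel (\<lambda>x. f (t + c *\<^sub>R x))"
    using integrable_lborel_affine_iff[OF assms] by simp
  then have 2: "integrable (distr lborel borel (\<lambda>x. t + c *\<^sub>R x)) f"
    by (subst integrable_distr_eq) auto
  show ?thesis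
    by (subst lborel_affine[OF c, of t]) (simp add: integral_density integral_distr)
next
  case False
  with integrable_lborel_affine_iff[OF assms, of t] show ?thesis
    by (simp add: not_integrable_integral_eq)
qed

text \<open>Both sides of the identity come from integrating \<open>1\<^sub>A(x) 1\<^sub>B(x + T y)\<close> over \<open>x\<close> and \<open>y\<close>,
  with \<open>B\<close> the unit ball, in the two possible orders.\<close>

lemma lborel_distr_linear_isometry:
  fixes T :: "'a::euclidean_space \<Rightarrow> 'a"
  assumes T: "linear T" and nT: "\<And>x. norm (T x) = norm x"
  shows "distr lborel borel T = lborel"
proof (rule measure_eqI)
  have cT: "continuous_on UNIV T"
    using T linear_continuous_on linear_conv_bounded_linear by blast
  have [measurable]: "T \<in> borel_measurable borel"
    by (rule borel_measurable_continuous_onI[OF cT])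
  have inj: "inj T"
    unfolding linear_injective_0[OF T] by (metis nT norm_eq_zero)
  then have sur: "surj T" using T linear_injective_imp_surjective by blast
  fix A :: "'a set" assume "A \<in> sets (distr lborel borel T)"
  then have [measurable]: "A \<in> sets borel" by simp
  define B :: "'a set" where "B = ball 0 1"
  have [measurable]: "B \<in> sets borel" by (simp add: B_def)
  have TB: "T x \<in> B \<longleftrightarrow> x \<in> B" for x by (simp add: B_def nT)
  have tr: "(\<integral>\<^sup>+y. f (c + y) \<partial>lborel) = (\<integral>\<^sup>+y. f y \<partial>lborel)"
    if [measurable]: "f \<in> borel_measurable borel" for f and c :: 'a
    using nn_integral_lborel_affine[of f 1 c] by simp
  have rf: "(\<integral>\<^sup>+y. f (c - y) \<partial>lborel) = (\<integral>\<^sup>+y. f y \<partial>lborel)"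
    if [measurable]: "f \<in> borel_measurable borel" for f and c :: 'a
    using nn_integral_lborel_affine[of f "-1" c] by simp
  let ?I = "\<integral>\<^sup>+x. (\<integral>\<^sup>+y. indicator A x * indicator B (x + T y) \<partial>lborel) \<partial>(lborel :: 'a measure)"
  have 1: "(\<integral>\<^sup>+y. indicator B (x + T y) \<partial>lborel) = emeasure lborel B" for x
  proof -
    obtain x' where x': "x = T x'" using sur by (metis surjD)
    have "indicator B (x + T y) = (indicator B (x' + y) :: ennreal)" for y
      unfolding x' linear_add[OF T, symmetric] by (simp add: indicator_def TB)
    then show ?thesis using tr[of "indicator B" x'] by simp
  qed
  have IA: "?I = emeasure lborel A * emeasure lborel B"
    by (simp add: nn_integral_cmult nn_integral_multc 1)
  have "?I = (\<integral>\<^sup>+y. (\<integral>\<^sup>+x. indicator A x * indicator B (x + T y) \<partial>lborel) \<partial>lborel)"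
    by (rule lborel_pair.Fubini') measurable
  also have "\<dots> = (\<integral>\<^sup>+y. (\<integral>\<^sup>+x. indicator A (x - T y) * indicator B x \<partial>lborel) \<partial>lborel)"
  proof (rule nn_integral_cong)
    fix y
    show "(\<integral>\<^sup>+x. indicator A x * indicator B (x + T y) \<partial>lborel)
        = (\<integral>\<^sup>+x. indicator A (x - T y) * indicator B x \<partial>lborel)"
      using tr[of "\<lambda>x. indicator A (x - T y) * indicator B x" "T y"] by (simp add: add.commute)
  qed
  also have "\<dots> = (\<integral>\<^sup>+x. (\<integral>\<^sup>+y. indicator A (x - T y) * indicator B x \<partial>lborel) \<partial>lborel)"
    by (rule lborel_pair.Fubini') measurable
  also have "\<dots> = (\<integral>\<^sup>+x. emeasure (distr lborel borel T) A * indicator B x \<partial>lborel)"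
  proof (rule nn_integral_cong)
    fix x
    obtain x' where x': "x = T x'" using sur by (metis surjD)
    have "(\<integral>\<^sup>+y. indicator A (x - T y) \<partial>lborel) = (\<integral>\<^sup>+y. indicator A (T (x' - y)) \<partial>lborel)"
      unfolding x' linear_diff[OF T] ..
    also have "\<dots> = (\<integral>\<^sup>+y. indicator A (T y) \<partial>lborel)"
      by (rule rf) measurable
    also have "\<dots> = emeasure (distr lborel borel T) A"
      using nn_integral_distr[of T lborel borel "indicator A"] by simp
    finally show "(\<integral>\<^sup>+y. indicator A (x - T y) * indicator B x \<partial>lborel)
        = emeasure (distr lborel borel T) A * indicator B x"
      by (simp add: nn_integral_multc)
  qed
  also have "\<dots> = emeasure (distr lborel borel T) A * emeasure lborel B"
    by (simp add: nn_integral_cmult)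
  finally have "emeasure (distr lborel borel T) A * emeasure lborel B = emeasure lborel A * emeasure lborel B"
    by (simp add: IA)
  moreover have "emeasure lborel B \<noteq> 0" "emeasure lborel B \<noteq> \<infinity>"
    using emeasure_ball[of 1 "0::'a"] unit_ball_vol_pos[of "real DIM('a)"]
    by (simp_all add: B_def less_imp_neq[symmetric])
  ultimately show "emeasure (distr lborel borel T) A = emeasure lborel A"
    by (metis ennreal_mult_cancel_left mult.commute infinity_ennreal_def)
qed simp

lemma
  fixes T :: "'a::euclidean_space \<Rightarrow> 'a" and f :: "'a \<Rightarrow> 'b::{banach, second_countable_topology}"
  assumes T: "linear T" and nT: "\<And>x. norm (T x) = norm x"
  shows measurable_linear_isometry: "T \<in> borel_measurable borel"
    and nn_integral_linear_isometry:
      "g \<in> borel_measurable borel \<Longrightarrow> (\<integral>\<^sup>+x. g (T x) \<partial>lborel) = (\<integral>\<^sup>+x. g x \<partial>lborel)"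
    and integral_linear_isometry: "f \<in> borel_measurable borel \<Longrightarrow> (\<integral>x. f (T x) \<partial>lborel) = (\<integral>x. f x \<partial>lborel)"
proof -
  have cT: "continuous_on UNIV T"
    using T linear_continuous_on linear_conv_bounded_linear by blast
  show [measurable]: "T \<in> borel_measurable borel"
    by (rule borel_measurable_continuous_onI[OF cT])
  show "(\<integral>\<^sup>+x. g (T x) \<partial>lborel) = (\<integral>\<^sup>+x. g x \<partial>lborel)" if [measurable]: "g \<in> borel_measurable borel"
    by (subst lborel_distr_linear_isometry[OF assms, symmetric]) (simp add: nn_integral_distr)
  show "(\<integral>x. f (T x) \<partial>lborel) = (\<integral>x. f x \<partial>lborel)" if [measurable]: "f \<in> borel_measurable borel"
    by (subst lborel_distr_linear_isometry[OF assms, symmetric]) (simp add: integral_distr)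
qed

lemma nn_integral_powr_Icc:
  fixes d R :: real
  assumes "d > 0" "R \<ge> 0"
  shows "(\<integral>\<^sup>+x. ennreal (x powr (d - 1)) * indicator {0<..<R} x \<partial>lborel) = ennreal (R powr d / d)"
proof -
  have "((\<lambda>x. x powr (d - 1)) has_integral (R powr (d - 1 + 1) / (d - 1 + 1))) {0..R}"
    using assms by (intro has_integral_powr_from_0) auto
  then have "((\<lambda>x. x powr (d - 1)) has_integral (R powr d / d)) {0<..<R}"
    by (simp add: has_integral_Icc_iff_Ioo)
  then have "((\<lambda>x. if x \<in> {0<..<R} then x powr (d - 1) else 0) has_integral (R powr d / d)) UNIV"
    by (simp only: has_integral_restrict_UNIV)
  also have "(\<lambda>x. if x \<in> {0<..<R} then x powr (d - 1) else 0) = (\<lambda>x. x powr (d - 1) * indicator {0<..<R} x)"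
    by (auto simp: indicator_def)
  finally have "(\<integral>\<^sup>+x. ennreal (x powr (d - 1) * indicator {0<..<R} x) \<partial>lborel) = ennreal (R powr d / d)"
    by (intro nn_integral_has_integral_lborel) auto
  then show ?thesis
    by (simp add: ennreal_mult ennreal_indicator)
qed

text \<open>Integration of a homogeneous function against a radial weight: the pushforward under
  \<open>norm\<^sup>2\<close> is computed on the sets \<open>{..<R}\<close> by scaling.\<close>

lemma nn_integral_homogeneous_radial:
  fixes G :: "'a::euclidean_space \<Rightarrow> real" and \<phi> :: "real \<Rightarrow> ennreal" and d M :: real
  assumes [measurable]: "G \<in> borel_measurable borel" "\<phi> \<in> borel_measurable borel"
    and G0: "\<And>z. G z \<ge> 0" and hom: "\<And>r z. r > 0 \<Longrightarrow> G (r *\<^sub>R z) = r ^ (2 * k) * G z"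
    and d: "d = real k + real DIM('a) / 2"
    and M: "(\<integral>\<^sup>+z. ennreal (G z) * indicator (ball 0 1) z \<partial>lborel) = ennreal M" "M \<ge> 0"
  shows "(\<integral>\<^sup>+z. ennreal (G z) * \<phi> ((norm z)\<^sup>2) \<partial>lborel)
       = ennreal (M * d) * (\<integral>\<^sup>+x. ennreal (x powr (d - 1)) * \<phi> x * indicator {0<..} x \<partial>lborel)"
proof -
  have dpos: "d > 0" using DIM_positive[where 'a='a] unfolding d by linarith
  define \<mu> where "\<mu> = distr (density lborel (\<lambda>z::'a. ennreal (G z))) borel (\<lambda>z. (norm z)\<^sup>2)"
  define \<nu> where "\<nu> = density lborel (\<lambda>x. ennreal (M * d) * (ennreal (x powr (d - 1)) * indicator {0<..} x))"
  \<comment> \<open>Scaling by \<open>R\<close> contributes \<open>R ^ DIM('a)\<close> from the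
    measure and \<open>R ^ (2 * k)\<close> from \<open>G\<close>, in total
    \<open>R powr (2 * d)\<close>.\<close>
  have ball: "(\<integral>\<^sup>+z. ennreal (G z) * indicator (ball 0 R) z \<partial>lborel) = ennreal (M * R powr (2 * d))"
    if R: "R > 0" for R
  proof -
    have [measurable]: "ball (0::'a) R \<in> sets borel" "ball (0::'a) 1 \<in> sets borel" by simp_all
    have "(\<integral>\<^sup>+z. ennreal (G z) * indicator (ball 0 R) z \<partial>lborel)
      = ennreal (R ^ DIM('a)) * (\<integral>\<^sup>+z. ennreal (G (R *\<^sub>R z)) * indicator (ball 0 R) (R *\<^sub>R z) \<partial>lborel)"
      by (subst nn_integral_lborel_affine[of _ R 0]) (measurable, use R in simp_all)
    also have "(\<integral>\<^sup>+z. ennreal (G (R *\<^sub>R z)) * indicator (ball 0 R) (R *\<^sub>R z) \<partial>lborel)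
      = (\<integral>\<^sup>+z. ennreal (R ^ (2 * k)) * (ennreal (G z) * indicator (ball 0 1) z) \<partial>lborel)"
      using R by (intro nn_integral_cong) (auto simp: hom G0 ennreal_mult indicator_def)
    also have "\<dots> = ennreal (R ^ (2 * k)) * ennreal M"
      by (subst nn_integral_cmult) (auto simp: M)
    finally have "(\<integral>\<^sup>+z. ennreal (G z) * indicator (ball 0 R) z \<partial>lborel)
      = ennreal (R ^ DIM('a)  * (R ^ (2 * k) * M))"
      using R M by (simp add: ennreal_mult)
    also have "R ^ DIM('a)  * (R ^ (2 * k) * M) = M * R powr (2 * d)"
    proof -
      have "2 * d = real (DIM('a) + 2 * k)" by (simp add: d)
      then have "R powr (2 * d) = R ^ (DIM('a) + 2 * k)"
        using R by (simp only: powr_realpow)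
      then show ?thesis by (simp add: power_add)
    qed
    finally show ?thesis .
  qed
  have eq: "emeasure \<mu> {..<a} = ennreal (M * max 0 a powr d)" for a
  proof (cases "a > 0")
    case True
    have "emeasure \<mu> {..<a} = (\<integral>\<^sup>+z. ennreal (G z) * indicator (ball 0 (sqrt a)) z \<partial>lborel)"
      unfolding \<mu>_def
    proof (subst emeasure_distr, measurable, subst emeasure_density, measurable)
      have "(norm z)\<^sup>2 < a \<longleftrightarrow> norm z < sqrt a" for z :: 'a
        using real_sqrt_less_iff[of "(norm z)\<^sup>2" a] by simp
      then show "(\<integral>\<^sup>+z. ennreal (G z) * indicator ((\<lambda>z. (norm z)\<^sup>2) -` {..<a} \<inter> space (density lborel (\<lambda>z. ennreal (G z)))) z \<partial>lborel) = (\<integral>\<^sup>+z. ennreal (G z) * indicator (ball 0 (sqrt a)) z \<partial>lborel)"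
        by (intro nn_integral_cong) (auto simp: indicator_def)
    qed
    also have "\<dots> = ennreal (M * a powr d)"
      using ball[of "sqrt a"] True by (simp add: powr_half_sqrt[symmetric] powr_powr)
    finally show ?thesis using True by simp
  next
    case False
    then have "(\<lambda>z::'a. (norm z)\<^sup>2) -` {..<a} = {}"
      by (auto simp: not_less) (smt (verit) zero_le_power2)
    then show ?thesis using False unfolding \<mu>_def
      by (subst emeasure_distr) (auto)
  qed
  have eq2: "emeasure \<nu> {..<a} = ennreal (M * max 0 a powr d)" for a
  proof -
    have "emeasure \<nu> {..<a} = (\<integral>\<^sup>+x. ennreal (M * d) * (ennreal (x powr (d - 1)) * indicator {0<..<max 0 a} x) \<partial>lborel)"
      unfolding \<nu>_def by (subst emeasure_density) (auto intro!: nn_integral_cong simp: indicator_def)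
    also have "\<dots> = ennreal (M * d) * ennreal (max 0 a powr d / d)"
      by (subst nn_integral_cmult) (use dpos in \<open>auto simp: nn_integral_powr_Icc\<close>)
    also have "\<dots> = ennreal (M * max 0 a powr d)"
      using dpos M by (simp add: ennreal_mult[symmetric])
    finally show ?thesis .
  qed
  have "\<mu> = \<nu>"
  proof (rule measure_eqI_generator_eq[where E="range lessThan" and A="\<lambda>i::nat. {..<real i}" and \<Omega>=UNIV])
    show "Int_stable (range lessThan :: real set set)"
    proof (clarsimp simp: Int_stable_def)
      fix a b :: real
      have "{..<a} \<inter> {..<b} = {..<min a b}" by auto
      then show "{..<a} \<inter> {..<b} \<in> range lessThan" by blast
    qed
    show "sets \<mu> = sigma_sets UNIV (range lessThan)" "sets \<nu> = sigma_sets UNIV (range lessThan)"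
      unfolding \<mu>_def \<nu>_def by (simp_all add: borel_Iio)
    show "(\<Union>i. {..<real i}) = UNIV"
      using reals_Archimedean2 by auto
  qed (auto simp: eq eq2)
  then have "(\<integral>\<^sup>+x. \<phi> x \<partial>\<mu>) = (\<integral>\<^sup>+x. \<phi> x \<partial>\<nu>)" by simp
  moreover have "(\<integral>\<^sup>+x. \<phi> x \<partial>\<mu>) = (\<integral>\<^sup>+z. ennreal (G z) * \<phi> ((norm z)\<^sup>2) \<partial>lborel)"
    unfolding \<mu>_def by (subst nn_integral_distr) (auto simp: nn_integral_density)
  moreover have "(\<integral>\<^sup>+x. \<phi> x \<partial>\<nu>) = ennreal (M * d) * (\<integral>\<^sup>+x. ennreal (x powr (d - 1)) * \<phi> x * indicator {0<..} x \<partial>lborel)"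
    unfolding \<nu>_def by (subst nn_integral_density) (auto simp: nn_integral_cmult[symmetric] ac_simps intro!: nn_integral_cong)
  ultimately show ?thesis by simp
qed

section \<open>Fourier coefficients on the unit circle\<close>

text \<open>The period is normalised to 1, so that a circle mean is an integral over
  \<open>{0..1}\<close> and Fourier coefficients carry no factor \<open>2 * pi\<close>.\<close>

definition circ :: "real \<Rightarrow> complex" where "circ t = cis (2 * pi * t)"

lemma norm_circ [simp]: "norm (circ t) = 1"
  by (simp add: circ_def)

lemma circ_nonzero [simp]: "circ t \<noteq> 0"
  by (simp add: circ_def)

lemma circ_0 [simp]: "circ 0 = 1" and circ_1 [simp]: "circ 1 = 1"
  by (simp_all add: circ_def)

lemma continuous_on_circ [continuous_intros]:
  "continuous_on S f \<Longrightarrow> continuous_on S (\<lambda>x. circ (f x))"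
  unfolding circ_def by (intro continuous_intros)

lemma circ_measurable [measurable]: "circ \<in> borel_measurable borel"
  by (intro borel_measurable_continuous_onI continuous_intros)

lemma circ_powi: "circ t powi a = cis (2 * pi * of_int a * t)"
  by (simp add: circ_def cis_power_int mult_ac)

lemma norm_circ_powi [simp]: "norm (circ t powi a) = 1"
  by (simp add: circ_powi)

lemma circ_has_vector_derivative:
  "(circ has_vector_derivative (2 * pi * \<i> * circ t)) (at t within S)"
proof -
  have "((\<lambda>z. exp (\<i> * (2 * of_real pi * z))) has_field_derivative
      (exp (\<i> * (2 * of_real pi * of_real t)) * (\<i> * (2 * of_real pi)))) (at (of_real t))"
    by (auto intro!: derivative_eq_intros)
  then have "((\<lambda>t. exp (\<i> * (2 * of_real pi * of_real t))) has_vector_derivative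
      (exp (\<i> * (2 * of_real pi * of_real t)) * (\<i> * (2 * of_real pi)))) (at t within S)"
    by (rule has_vector_derivative_real_field)
  then show ?thesis
    by (simp add: circ_def[abs_def] cis_conv_exp mult_ac)
qed

lemma sphere_circ:
  assumes "norm z = 1" obtains t where "t \<in> {0..1}" "z = circ t"
proof -
  define s where "s = Arg2pi z"
  have "z = cis s" "0 \<le> s" "s < 2 * pi"
    using assms Arg2pi[of z] by (simp_all add: s_def cis_conv_exp is_Arg_def)
  note s = this
  show ?thesis
    by (rule that[of "s / (2 * pi)"]) (use s in \<open>auto simp: circ_def field_simps\<close>)
qed

lemma integral_circ_powi: "integral {0..1} (\<lambda>t. circ t powi a) = (if a = 0 then 1 else 0)"
proof (cases "a = 0")
  case False
  have "((\<lambda>t. cis (2 * pi * of_int a * t) / (2 * pi * of_int a * \<i>)) has_vector_derivative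
      cis (2 * pi * of_int a * t)) (at t within {0..1})" for t
  proof -
    have "((\<lambda>z. exp (\<i> * (2 * of_real pi * of_int a * z)) / (2 * pi * of_int a * \<i>)) has_field_derivative
      exp (\<i> * (2 * of_real pi * of_int a * of_real t))) (at (of_real t))"
      using False by (auto intro!: derivative_eq_intros simp: field_simps)
    then have "((\<lambda>t. exp (\<i> * (2 * of_real pi * of_int a * of_real t)) / (2 * pi * of_int a * \<i>)) has_vector_derivative
      exp (\<i> * (2 * of_real pi * of_int a * of_real t))) (at t within {0..1})"
      by (rule has_vector_derivative_real_field)
    then show ?thesis by (simp add: cis_conv_exp)
  qed
  then have "((\<lambda>t. cis (2 * pi * of_int a * t)) has_integral
      (cis (2 * pi * of_int a * 1) / (2 * pi * of_int a * \<i>) - cis (2 * pi * of_int a * 0) / (2 * pi * of_int a * \<i>))) {0..1}"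
    by (intro fundamental_theorem_of_calculus) auto
  moreover have "cis (2 * pi * of_int a * 1) = 1"
    using cis_multiple_2pi[of "of_int a"] by simp
  ultimately show ?thesis
    using False by (simp add: circ_powi integral_unique)
qed simp

definition fourier_coeff :: "(complex \<Rightarrow> complex) \<Rightarrow> int \<Rightarrow> complex" where
  "fourier_coeff u a = integral {0..1} (\<lambda>t. u (circ t) * circ t powi (- a))"

lemma continuous_on_compose_circ:
  assumes "continuous_on (sphere 0 1) u" shows "continuous_on S (\<lambda>t. u (circ t))"
  by (rule continuous_on_compose2[OF assms]) (auto intro!: continuous_intros)

lemma fourier_integrable:
  assumes "continuous_on (sphere 0 1) u" shows "(\<lambda>t. u (circ t) * circ t powi a) integrable_on {0..1}"
  by (intro integrable_continuous_real continuous_intros continuous_on_compose_circ assms) auto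

lemma fourier_coeff_add:
  assumes "continuous_on (sphere 0 1) u" "continuous_on (sphere 0 1) v"
  shows "fourier_coeff (\<lambda>z. u z + v z) a = fourier_coeff u a + fourier_coeff v a"
  unfolding fourier_coeff_def
  by (simp add: distrib_right integral_add fourier_integrable assms)

lemma fourier_coeff_cmult: "fourier_coeff (\<lambda>z. c * u z) a = c * fourier_coeff u a"
  unfolding fourier_coeff_def by (simp add: mult.assoc)

lemma fourier_coeff_shift: "fourier_coeff (\<lambda>z. z powi b * u z) a = fourier_coeff u (a - b)"
proof -
  have "circ t powi b * u (circ t) * circ t powi (- a) = u (circ t) * circ t powi (- (a - b))" for t
    using power_int_add[of "circ t" b "- a"] by (simp add: mult_ac)
  then show ?thesis by (simp only: fourier_coeff_def)
qed

text \<open>On the unit circle a real linear form equals \<open>c * z + d / z\<close>, so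
  multiplying by it merely shifts Fourier coefficients, and vanishing coefficients stay zero. The
  induction varies \<open>u\<close>, so that a product is handled by applying one factor after the
  other.\<close>

lemma polynomial_fourier_coeff_zero:
  assumes p: "real_polynomial_function p" and u: "continuous_on (sphere 0 1) u" "\<And>a. fourier_coeff u a = 0"
  shows "continuous_on (sphere 0 1) (\<lambda>z. of_real (p z) * u z)"
    and "fourier_coeff (\<lambda>z. of_real (p z) * u z) a = 0"
proof -
  have "continuous_on (sphere 0 1) (\<lambda>z. of_real (p z) * u z) \<and> (\<forall>a. fourier_coeff (\<lambda>z. of_real (p z) * u z) a = 0)"
    using p u
  proof (induction arbitrary: u)
    case (linear f)
    define c where "c = (of_real (f 1) - \<i> * of_real (f \<i>)) / 2"
    define d where "d = (of_real (f 1) + \<i> * of_real (f \<i>)) / 2"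
    have f: "of_real (f z) * u z = c * (z powi 1 * u z) + d * (z powi (-1) * u z)" if "norm z = 1" for z
    proof -
      interpret bounded_linear f by fact
      have "f z = f (Re z *\<^sub>R 1 + Im z *\<^sub>R \<i>)"
        by (rule arg_cong[where f=f]) (simp add: complex_eq_iff)
      also have "\<dots> = Re z * f 1 + Im z * f \<i>"
        by (simp only: add scaleR real_scaleR_def)
      finally have fz: "f z = Re z * f 1 + Im z * f \<i>" .
      have "inverse z = cnj z"
        using that by (simp add: inverse_complex_def complex_eq_iff cmod_def)
      then have zc: "z powi (-1) = cnj z" by (simp add: power_int_minus)
      have "of_real (f z) = c * z + d * cnj z"
        unfolding c_def d_def fz by (simp add: complex_eq_iff field_simps)
      then show ?thesis unfolding zc by (simp only: distrib_right mult.assoc power_int_1_right)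
    qed
    have c1: "continuous_on (sphere 0 1) (\<lambda>z. z powi b * u z)" for b
      using linear by (intro continuous_intros) auto
    have "continuous_on (sphere 0 1) (\<lambda>z. c * (z powi 1 * u z) + d * (z powi (-1) * u z))"
      by (intro continuous_intros c1)
    then have "continuous_on (sphere 0 1) (\<lambda>z. of_real (f z) * u z)"
      by (rule continuous_on_eq) (auto simp: f)
    moreover have "fourier_coeff (\<lambda>z. of_real (f z) * u z) a = 0" for a
    proof -
      have "fourier_coeff (\<lambda>z. of_real (f z) * u z) a =
        fourier_coeff (\<lambda>z. c * (z powi 1 * u z) + d * (z powi (-1) * u z)) a"
        unfolding fourier_coeff_def by (simp add: f)
      also have "\<dots> = 0"
        by (subst fourier_coeff_add)
           (auto intro!: continuous_on_mult c1 simp: fourier_coeff_cmult fourier_coeff_shift linear simp del: power_int_minus1_right power_int_1_right)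
      finally show ?thesis .
    qed
    ultimately show ?case by blast
  next
    case (const c)
    then show ?case by (auto simp: fourier_coeff_cmult intro!: continuous_intros)
  next
    case (add f g)
    then show ?case
      by (auto simp: distrib_right fourier_coeff_add intro!: continuous_on_add)
  next
    case (mult f g)
    have "continuous_on (sphere 0 1) (\<lambda>z. of_real (f z) * (of_real (g z) * u z)) \<and>
      (\<forall>a. fourier_coeff (\<lambda>z. of_real (f z) * (of_real (g z) * u z)) a = 0)"
      using mult by blast
    then show ?case by (simp add: mult.assoc)
  qed
  then show "continuous_on (sphere 0 1) (\<lambda>z. of_real (p z) * u z)"
    and "fourier_coeff (\<lambda>z. of_real (p z) * u z) a = 0" by auto
qed

text \<open>If all coefficients of \<open>u\<close> vanish, then \<open>u\<close> is orthogonal to every polynomial in the real and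
  imaginary parts, and these approximate \<open>cnj u\<close> uniformly by Stone--Weierstrass.\<close>

lemma fourier_unique:
  assumes u: "continuous_on (sphere 0 1) u" and z: "\<And>a. fourier_coeff u a = 0" and "norm x = 1"
  shows "u x = 0"
proof -
  have cu: "continuous_on {0..1} (\<lambda>t. u (circ t))" by (rule continuous_on_compose_circ[OF u])
  define I where "I = integral {0..1} (\<lambda>t. norm (u (circ t)) ^ 2)"
  define J where "J = integral {0..1} (\<lambda>t. norm (u (circ t)))"
  have J0: "J \<ge> 0" unfolding J_def by (intro integral_nonneg integrable_continuous_real continuous_intros cu) auto
  have I0: "I \<ge> 0" unfolding I_def by (intro integral_nonneg integrable_continuous_real continuous_intros cu) auto
  have est: "I \<le> \<epsilon> * J" if "\<epsilon> > 0" for \<epsilon>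
  proof -
    have "continuous_on (sphere 0 1) (\<lambda>z. cnj (u z))" by (intro continuous_intros u)
    then have "\<exists>g. polynomial_function g \<and> (\<forall>z\<in>sphere 0 1. norm (cnj (u z) - g z) < \<epsilon>)"
      by (rule Stone_Weierstrass_polynomial_function[OF compact_sphere _ \<open>\<epsilon> > 0\<close>])
    then obtain g where g: "polynomial_function g" "\<forall>z\<in>sphere 0 1. norm (cnj (u z) - g z) < \<epsilon>"
      by (elim exE conjE)
    have R: "real_polynomial_function (\<lambda>z. Re (g z))" "real_polynomial_function (\<lambda>z. Im (g z))"
      using g(1) bounded_linear_Re bounded_linear_Im unfolding polynomial_function_def o_def by blast+
    have cg: "continuous_on (sphere 0 1) g" using continuous_on_polymonial_function[OF g(1)] .
    have "fourier_coeff (\<lambda>z. of_real (Re (g z)) * u z + \<i> * (of_real (Im (g z)) * u z)) 0 = 0"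
      by (subst fourier_coeff_add)
         (auto simp: fourier_coeff_cmult polynomial_fourier_coeff_zero[OF R(1) u z] polynomial_fourier_coeff_zero[OF R(2) u z]
            intro!: continuous_intros cg u)
    moreover have "of_real (Re (g z)) * u z + \<i> * (of_real (Im (g z)) * u z) = g z * u z" for z
      by (simp add: algebra_simps complex_eq_iff)
    ultimately have gu: "integral {0..1} (\<lambda>t. g (circ t) * u (circ t)) = 0"
      by (simp add: fourier_coeff_def)
    have "complex_of_real I = integral {0..1} (\<lambda>t. u (circ t) * cnj (u (circ t)))"
      unfolding I_def complex_norm_square[symmetric]
      by (rule integral_linear[OF _ bounded_linear_of_real, unfolded o_def, symmetric])
         (intro integrable_continuous_real continuous_intros cu)
    also have "\<dots> = integral {0..1} (\<lambda>t. (cnj (u (circ t)) - g (circ t)) * u (circ t))"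
      unfolding left_diff_distrib
      by (subst integral_diff)
         (auto simp: gu mult.commute intro!: integrable_continuous_real continuous_intros cu continuous_on_compose_circ cg u)
    also have "norm \<dots> \<le> integral {0..1} (\<lambda>t. \<epsilon> * norm (u (circ t)))"
    proof (rule integral_norm_bound_integral)
      fix t
      have "norm (cnj (u (circ t)) - g (circ t)) \<le> \<epsilon>"
        using g(2) by (simp add: less_imp_le)
      then show "norm ((cnj (u (circ t)) - g (circ t)) * u (circ t)) \<le> \<epsilon> * norm (u (circ t))"
        by (simp add: norm_mult mult_right_mono)
    qed (auto intro!: integrable_continuous_real continuous_intros cu continuous_on_compose_circ cg u)
    finally show ?thesis using I0 by (simp add: J_def)
  qed
  have "I \<le> 0"
  proof (rule field_le_epsilon)
    fix e :: real assume "e > 0"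
    have "I \<le> e / (J + 1) * J" using est[of "e / (J + 1)"] J0 \<open>e > 0\<close> by simp
    also have "\<dots> \<le> 0 + e" using J0 \<open>e > 0\<close> by (simp add: field_simps)
    finally show "I \<le> 0 + e" .
  qed
  then have "I = 0" using I0 by simp
  then have "\<forall>t\<in>{0..1}. norm (u (circ t)) ^ 2 = 0"
    unfolding I_def by (subst (asm) integral_eq_0_iff) (auto intro!: continuous_intros cu)
  then show ?thesis using sphere_circ[OF \<open>norm x = 1\<close>] by (metis norm_eq_zero zero_eq_power2)
qed

text \<open>The absolutely convergent series defines a continuous function \<open>v\<close>;
  integrating it termwise gives back the coefficients of \<open>u\<close>, so \<open>v = u\<close>
  by uniqueness. At the point 1 the series is just the sum of the coefficients.\<close>

lemma fourier_series_at_1: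
  assumes u: "continuous_on (sphere 0 1) u" and s: "(\<lambda>a. norm (fourier_coeff u a)) summable_on UNIV"
  shows "((fourier_coeff u) has_sum u 1) UNIV"
proof -
  define v where "v z = (\<Sum>\<^sub>\<infinity>a\<in>UNIV. fourier_coeff u a * z powi a)" for z
  have lim: "uniform_limit (sphere 0 1) (\<lambda>X z. \<Sum>a\<in>X. fourier_coeff u a * z powi a) v (finite_subsets_at_top UNIV)"
    unfolding v_def by (rule Weierstrass_m_test_general[OF _ s]) (auto simp: norm_mult norm_power_int)
  have cv: "continuous_on (sphere 0 1) v"
    by (rule uniform_limit_theorem[OF _ lim]) (auto intro!: always_eventually continuous_intros)
  have cf: "fourier_coeff v b = fourier_coeff u b" for b
  proof -
    have "uniform_limit {0..1} (\<lambda>X t. (\<Sum>a\<in>X. fourier_coeff u a * circ t powi a)) (\<lambda>t. v (circ t)) (finite_subsets_at_top UNIV)"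
      using lim unfolding uniform_limit_iff by (auto elim!: eventually_mono)
    then have "uniform_limit {0..1} (\<lambda>X t. (\<Sum>a\<in>X. fourier_coeff u a * circ t powi a) * circ t powi (-b)) (\<lambda>t. v (circ t) * circ t powi (-b)) (finite_subsets_at_top UNIV)"
      by (rule uniform_lim_mult[OF _ uniform_limit_const])
         (auto intro!: compact_imp_bounded compact_continuous_image continuous_intros continuous_on_compose_circ cv)
    then obtain I J where I: "\<And>X. ((\<lambda>t. (\<Sum>a\<in>X. fourier_coeff u a * circ t powi a) * circ t powi (-b)) has_integral I X) {0..1}"
      and J: "((\<lambda>t. v (circ t) * circ t powi (-b)) has_integral J) {0..1}"
      and IJ: "(I \<longlongrightarrow> J) (finite_subsets_at_top UNIV)"
      by (rule uniform_limit_integral) (auto intro!: continuous_intros)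
    have "I X = fourier_coeff u b" if "finite X" "b \<in> X" for X
    proof -
      have "I X = integral {0..1} (\<lambda>t. (\<Sum>a\<in>X. fourier_coeff u a * circ t powi (a - b)))"
      proof -
        have "circ t powi a * circ t powi (- b) = circ t powi (a - b)" for a t
          using power_int_add[of "circ t" a "- b"] by simp
        then have "(\<Sum>a\<in>X. fourier_coeff u a * circ t powi a) * circ t powi (- b) =
            (\<Sum>a\<in>X. fourier_coeff u a * circ t powi (a - b))" for t
          by (simp only: sum_distrib_right mult.assoc)
        then show ?thesis using integral_unique[OF I[of X]] by simp
      qed
      also have "\<dots> = (\<Sum>a\<in>X. fourier_coeff u a * (if a = b then 1 else 0))"
        by (subst integral_sum) (auto simp: that integral_circ_powi intro!: integrable_continuous_real continuous_intros)
      finally show ?thesis using that by (simp add: if_distrib[of "\<lambda>x. _ * x"] cong: if_cong)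
    qed
    then have "eventually (\<lambda>X. I X = fourier_coeff u b) (finite_subsets_at_top UNIV)"
      unfolding eventually_finite_subsets_at_top by (intro exI[of _ "{b}"]) auto
    then have "(I \<longlongrightarrow> fourier_coeff u b) (finite_subsets_at_top UNIV)"
      by (rule tendsto_eventually)
    then have "J = fourier_coeff u b" using IJ tendsto_unique finite_subsets_at_top_neq_bot by blast
    then show ?thesis using integral_unique[OF J] by (simp add: fourier_coeff_def)
  qed
  have "v 1 - u 1 = 0"
  proof (rule fourier_unique[where u="\<lambda>z. v z - u z"])
    show "continuous_on (sphere 0 1) (\<lambda>z. v z - u z)" by (intro continuous_intros cv u)
    show "fourier_coeff (\<lambda>z. v z - u z) a = 0" for a
      using fourier_coeff_add[OF cv, of "\<lambda>z. (-1) * u z" a] u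
      by (simp add: fourier_coeff_cmult[of "-1", simplified] cf continuous_intros)
  qed simp
  moreover have "(fourier_coeff u has_sum v 1) UNIV"
    unfolding v_def using s by (simp add: abs_summable_summable)
  ultimately show ?thesis by simp
qed

text \<open>Differentiating the mean in \<open>z\<close> under the integral gives the mean of
  \<open>deriv g (z * circ t) * circ t\<close>. Up to a constant this is the
  \<open>t\<close>-derivative of \<open>g (z * circ t)\<close>, and it integrates to zero over a
  full period. The statement serves both annuli and the whole plane, where it becomes the mean value
  property.\<close>

lemma circle_mean_constant:
  assumes A: "open A" "connected A" and rot: "\<And>z t. z \<in> A \<Longrightarrow> z * circ t \<in> A"
    and g: "g holomorphic_on A" and "x \<in> A" "y \<in> A"
  shows "integral {0..1} (\<lambda>t. g (x * circ t)) = integral {0..1} (\<lambda>t. g (y * circ t))"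
proof -
  define m where "m z = integral {0..1} (\<lambda>t. g (z * circ t))" for z
  have dg: "(g has_field_derivative deriv g z) (at z)" if "z \<in> A" for z
    using holomorphic_derivI[OF g A(1) that] .
  have cg: "continuous_on A g" using g holomorphic_on_imp_continuous_on by blast
  have cdg: "continuous_on A (deriv g)" using holomorphic_deriv[OF g A(1)] holomorphic_on_imp_continuous_on by blast
  have dm: "(m has_field_derivative 0) (at z)" if z: "z \<in> A" for z
  proof -
    obtain e where e: "e > 0" "ball z e \<subseteq> A" using A z open_contains_ball by blast
    have "((\<lambda>w. integral (cbox 0 1) (\<lambda>t. g (w * circ t))) has_field_derivative
        integral (cbox 0 1) (\<lambda>t. deriv g (z * circ t) * circ t)) (at z within ball z e)"
    proof (rule leibniz_rule_field_derivative)
      show "((\<lambda>w. g (w * circ t)) has_field_derivative deriv g (w * circ t) * circ t) (at w within ball z e)"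
        if "w \<in> ball z e" for w and t :: real
        using dg[OF rot[of w t]] that e
        by (auto intro!: derivative_eq_intros DERIV_chain2[of g _ "\<lambda>w. w * circ t"])
      show "(\<lambda>t. g (w * circ t)) integrable_on cbox 0 1" if "w \<in> ball z e" for w
        by (intro integrable_continuous continuous_on_compose2[OF cg] continuous_intros) (use rot that e in auto)
      show "continuous_on (ball z e \<times> cbox 0 1) (\<lambda>(w, t). deriv g (w * circ t) * circ t)"
        unfolding split_beta
        by (intro continuous_intros continuous_on_compose2[OF cdg]) (use rot e in auto)
    qed (use e in auto)
    then have 1: "(m has_field_derivative integral {0..1} (\<lambda>t. deriv g (z * circ t) * circ t)) (at z)"
      using e by (simp add: m_def[abs_def] at_within_open[of z "ball z e"])
    have "integral {0..1} (\<lambda>t. deriv g (z * circ t) * circ t) = 0"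
    proof (cases "z = 0")
      \<comment> \<open>At the origin the constant cannot be divided out, but there
        \<open>deriv g\<close> is constant along the orbit and \<open>circ\<close> has mean
        zero.\<close>
      case True
      then show ?thesis using integral_circ_powi[of 1] by simp
    next
      case False
      have "((\<lambda>t. g (z * circ t)) has_vector_derivative (z * (2 * pi * \<i> * circ t)) * deriv g (z * circ t)) (at t within {0..1})" for t
        using field_vector_diff_chain_within[OF has_vector_derivative_mult_right[OF circ_has_vector_derivative]
            has_field_derivative_at_within[OF dg[OF rot[OF z]]]]
        by (simp add: o_def)
      then have "((\<lambda>t. (z * (2 * pi * \<i> * circ t)) * deriv g (z * circ t)) has_integral (g (z * circ 1) - g (z * circ 0))) {0..1}"
        by (intro fundamental_theorem_of_calculus) auto
      from has_integral_mult_right[OF this, of "inverse (z * (2 * pi * \<i>))"]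
      have "((\<lambda>t. deriv g (z * circ t) * circ t) has_integral 0) {0..1}"
        using False by (simp add: field_simps)
      then show ?thesis by (rule integral_unique)
    qed
    with 1 show ?thesis by simp
  qed
  have "m x = m y"
  proof (rule DERIV_zero_connected_constant[OF A(2,1), of "{}" m, THEN exE])
    show "continuous_on A m"
      using dm by (meson DERIV_isCont continuous_at_imp_continuous_on)
  qed (use dm \<open>x \<in> A\<close> \<open>y \<in> A\<close> in auto)
  then show ?thesis by (simp add: m_def)
qed

text \<open>Both sides are the Laurent coefficient of \<open>h\<close>, computed on two circles: the
  circle mean of \<open>h z * z powi (- a)\<close> is independent of the radius. The bound
  \<open>0 \<le> r1\<close> keeps the origin out of the annulus, so the negative powers are
  holomorphic.\<close>

lemma fourier_coeff_annulus:
  assumes r: "0 \<le> r1" and h: "h holomorphic_on {z. r1 < norm z \<and> norm z < r2}"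
    and x: "r1 < norm x" "norm x < r2" and y: "r1 < norm y" "norm y < r2"
  shows "fourier_coeff (\<lambda>u. h (x * u)) a * x powi (- a) = fourier_coeff (\<lambda>u. h (y * u)) a * y powi (- a)"
proof -
  let ?A = "{z::complex. r1 < norm z \<and> norm z < r2}"
  have o: "open ?A" by (intro open_Collect_conj open_Collect_less continuous_intros)
  have c: "connected ?A" using connected_annulus(1)[of r1 "0::complex" r2] by simp
  have g: "(\<lambda>z. h z * z powi (- a)) holomorphic_on ?A"
    using r by (intro holomorphic_intros h) auto
  have "integral {0..1} (\<lambda>t. h (x * circ t) * (x * circ t) powi (- a)) =
      integral {0..1} (\<lambda>t. h (y * circ t) * (y * circ t) powi (- a))"
    by (rule circle_mean_constant[OF o c _ g]) (use x y in \<open>auto simp: norm_mult\<close>)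
  moreover have "integral {0..1} (\<lambda>t. h (x * circ t) * (x * circ t) powi (- a))
    = fourier_coeff (\<lambda>u. h (x * u)) a * x powi (- a)" for x
    unfolding fourier_coeff_def power_int_mult_distrib
    by (subst integral_mult_left[symmetric]) (simp add: mult_ac)
  ultimately show ?thesis by metis
qed

section \<open>Averaging over a circle action\<close>

text \<open>Lebesgue measure of \<open>{0..1}\<close> as a density on the whole line, so that its
  measurable sets are those of \<open>borel\<close> and no restriction appears in Fubini
  arguments.\<close>

definition unit_meas :: "real measure" where
  "unit_meas = density lborel (\<lambda>t. ennreal (indicator {0..1} t))"

lemma sets_unit_meas [simp, measurable_cong]: "sets unit_meas = sets borel"
  by (simp add: unit_meas_def)

lemma space_unit_meas [simp]: "space unit_meas = UNIV"
  by (simp add: unit_meas_def)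

lemma emeasure_unit_meas [simp]: "emeasure unit_meas UNIV = 1"
  by (simp add: unit_meas_def emeasure_density ennreal_indicator)

lemma measure_unit_meas [simp]: "measure unit_meas UNIV = 1"
  by (simp add: measure_def)

interpretation unit_meas: finite_measure unit_meas
  by standard simp

lemma
  fixes f :: "real \<Rightarrow> 'b::euclidean_space"
  assumes c: "continuous_on {0..1} f" and [measurable]: "f \<in> borel_measurable borel"
  shows integrable_unit_meas: "integrable unit_meas f"
    and integral_unit_meas: "(\<integral>t. f t \<partial>unit_meas) = integral {0..1} f"
proof -
  have 1: "set_integrable lborel {0..1} f"
    by (rule borel_integrable_atLeastAtMost'[OF c])
  show "integrable unit_meas f"
    using 1 unfolding unit_meas_def set_integrable_def
    by (subst integrable_density) auto
  show "(\<integral>t. f t \<partial>unit_meas) = integral {0..1} f"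
    using set_borel_integral_eq_integral(2)[OF 1] unfolding unit_meas_def set_lebesgue_integral_def
    by (subst integral_density) auto
qed

locale circle_average = sigma_finite_measure M for M :: "'a measure" +
  fixes rot :: "real \<Rightarrow> 'a \<Rightarrow> 'a"
  assumes rot [measurable]: "(\<lambda>(t, x). rot t x) \<in> borel \<Otimes>\<^sub>M M \<rightarrow>\<^sub>M M"
    and rot_invariant: "\<And>t. distr M M (rot t) = M"
begin

sublocale P: pair_sigma_finite unit_meas M ..

lemma rot_measurable [measurable]: "rot t \<in> M \<rightarrow>\<^sub>M M"
  using measurable_compose[OF measurable_Pair1'[of t borel M] rot] by simp

lemma nn_integral_rot: "f \<in> borel_measurable M \<Longrightarrow> (\<integral>\<^sup>+x. f (rot t x) \<partial>M) = (\<integral>\<^sup>+x. f x \<partial>M)"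
  by (subst (2) rot_invariant[of t, symmetric]) (simp add: nn_integral_distr)

lemma integral_rot:
  fixes f :: "'a \<Rightarrow> 'b::{banach, second_countable_topology}"
  shows "f \<in> borel_measurable M \<Longrightarrow> (\<integral>x. f (rot t x) \<partial>M) = (\<integral>x. f x \<partial>M)"
  by (subst (2) rot_invariant[of t, symmetric]) (simp add: integral_distr)

lemma pair_measurable [measurable]:
  assumes [measurable]: "f \<in> borel_measurable M"
  shows "(\<lambda>(t, x). f (rot t x)) \<in> borel_measurable (unit_meas \<Otimes>\<^sub>M M)"
proof -
  have "sets (unit_meas \<Otimes>\<^sub>M M) = sets (borel \<Otimes>\<^sub>M M)"
    by (intro sets_pair_measure_cong) auto
  then have "(\<lambda>(t, x). rot t x) \<in> unit_meas \<Otimes>\<^sub>M M \<rightarrow>\<^sub>M M"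
    using rot by (metis measurable_cong_sets)
  from measurable_compose[OF this assms] show ?thesis
    by (simp add: case_prod_unfold)
qed

text \<open>Each rotated copy of \<open>f\<close> has the same integral, also in absolute value;
  this makes the function of two variables integrable, and Fubini exchanges the two
  integrals.\<close>

lemma
  fixes f :: "'a \<Rightarrow> complex"
  assumes f: "integrable M f"
  shows integrable_average: "integrable M (\<lambda>x. \<integral>t. f (rot t x) \<partial>unit_meas)"
    and integral_average: "(\<integral>x. (\<integral>t. f (rot t x) \<partial>unit_meas) \<partial>M) = (\<integral>x. f x \<partial>M)"
proof -
  have fm[measurable]: "f \<in> borel_measurable M" using f by simp
  have "(\<integral>\<^sup>+t. (\<integral>\<^sup>+x. norm (f (rot t x)) \<partial>M) \<partial>unit_meas) = (\<integral>\<^sup>+x. norm (f x) \<partial>M)"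
    by (subst nn_integral_rot[where f="\<lambda>x. norm (f x)"]) auto
  also have "\<dots> < \<infinity>" using f by (simp add: integrable_iff_bounded)
  finally have i: "integrable (unit_meas \<Otimes>\<^sub>M M) (\<lambda>(t, x). f (rot t x))"
    by (subst integrable_iff_bounded) (auto simp: nn_integral_fst[symmetric] split_beta')
  show "integrable M (\<lambda>x. \<integral>t. f (rot t x) \<partial>unit_meas)"
    using P.integrable_snd[OF i] by simp
  have "(\<integral>x. (\<integral>t. f (rot t x) \<partial>unit_meas) \<partial>M) = (\<integral>t. (\<integral>x. f (rot t x) \<partial>M) \<partial>unit_meas)"
    by (rule P.Fubini_integral[OF i])
  also have "\<dots> = (\<integral>x. f x \<partial>M)"
    by (simp add: integral_rot fm)
  finally show "(\<integral>x. (\<integral>t. f (rot t x) \<partial>unit_meas) \<partial>M) = (\<integral>x. f x \<partial>M)" .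
qed

text \<open>Cauchy-Schwarz on the probability measure \<open>unit_meas\<close> bounds the squared
  mean by the mean of the squares, and Tonelli with invariance removes the rotation. Orbits along
  which \<open>f\<close> is not integrable are harmless, since the Bochner integral is 0
  there.\<close>

lemma nn_integral_average_sq_le:
  fixes f :: "'a \<Rightarrow> complex" and c :: "real \<Rightarrow> complex"
  assumes [measurable]: "f \<in> borel_measurable M" "c \<in> borel_measurable borel" and c: "\<And>t. norm (c t) = 1"
  shows "(\<integral>\<^sup>+x. ennreal ((norm (\<integral>t. f (rot t x) * c t \<partial>unit_meas))\<^sup>2) \<partial>M) \<le> (\<integral>\<^sup>+x. ennreal ((norm (f x))\<^sup>2) \<partial>M)"
proof -
  have 1: "ennreal ((norm (\<integral>t. f (rot t x) * c t \<partial>unit_meas))\<^sup>2) \<le> (\<integral>\<^sup>+t. ennreal ((norm (f (rot t x)))\<^sup>2) \<partial>unit_meas)"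
    if x: "x \<in> space M" for x
  proof -
    have [measurable]: "(\<lambda>t. f (rot t x)) \<in> borel_measurable unit_meas"
      using measurable_compose[OF measurable_Pair2'[OF x, of unit_meas] pair_measurable[OF assms(1)]] by simp
    show ?thesis
    proof (cases "integrable unit_meas (\<lambda>t. f (rot t x) * c t)")
      case True
      have "ennreal (norm (\<integral>t. f (rot t x) * c t \<partial>unit_meas)) \<le> (\<integral>\<^sup>+t. ennreal (norm (f (rot t x))) * 1 \<partial>unit_meas)"
        using integral_norm_bound_ennreal[OF True] by (simp add: norm_mult c)
      then have "ennreal (norm (\<integral>t. f (rot t x) * c t \<partial>unit_meas)) ^ 2 \<le> (\<integral>\<^sup>+t. ennreal (norm (f (rot t x))) * 1 \<partial>unit_meas) ^ 2"
        by (rule power_mono) simp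
      also have "\<dots> \<le> (\<integral>\<^sup>+t. ennreal (norm (f (rot t x))) ^ 2 \<partial>unit_meas) * (\<integral>\<^sup>+t. 1 ^ 2 \<partial>unit_meas)"
        by (rule Cauchy_Schwarz_nn_integral) auto
      finally show ?thesis by (simp add: ennreal_power)
    qed (simp add: not_integrable_integral_eq)
  qed
  have "(\<integral>\<^sup>+x. ennreal ((norm (\<integral>t. f (rot t x) * c t \<partial>unit_meas))\<^sup>2) \<partial>M)
      \<le> (\<integral>\<^sup>+x. (\<integral>\<^sup>+t. ennreal ((norm (f (rot t x)))\<^sup>2) \<partial>unit_meas) \<partial>M)"
    by (intro nn_integral_mono 1)
  also have "\<dots> = (\<integral>\<^sup>+t. (\<integral>\<^sup>+x. ennreal ((norm (f (rot t x)))\<^sup>2) \<partial>M) \<partial>unit_meas)"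
    by (rule P.Fubini') measurable
  also have "\<dots> = (\<integral>\<^sup>+x. ennreal ((norm (f x))\<^sup>2) \<partial>M)"
    by (subst nn_integral_rot[where f="\<lambda>x. ennreal ((norm (f x))\<^sup>2)"]) auto
  finally show ?thesis .
qed

end

section \<open>A reproducing formula for homogeneous holomorphic functions on the ball\<close>

definition hprod :: "complex ^ 'n \<Rightarrow> complex ^ 'n \<Rightarrow> complex" where
  "hprod z y = (\<Sum>i\<in>UNIV. z $ i * cnj (y $ i))"

lemma hprod_add_left: "hprod (x + y) z = hprod x z + hprod y z"
  by (simp add: hprod_def distrib_right sum.distrib)

lemma hprod_add_right: "hprod z (x + y) = hprod z x + hprod z y"
  by (simp add: hprod_def distrib_left sum.distrib)

lemma hprod_scale_left: "hprod (c *s x) y = c * hprod x y"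
  by (simp add: hprod_def sum_distrib_left mult.assoc)

lemma hprod_scale_right: "hprod x (c *s y) = cnj c * hprod x y"
  by (simp add: hprod_def sum_distrib_left mult_ac)

lemma cnj_hprod: "cnj (hprod x y) = hprod y x"
  by (simp add: hprod_def mult.commute)

lemma hprod_self: "hprod x x = of_real ((norm x)\<^sup>2)"
  by (simp add: hprod_def norm_vec_def L2_set_def sum_nonneg complex_norm_square[symmetric] del: of_real_power)

lemma hprod_0 [simp]: "hprod 0 y = 0" "hprod y 0 = 0"
  by (simp_all add: hprod_def)

lemma norm_hprod_le: "norm (hprod x y) \<le> norm x * norm y"
proof -
  have "norm (hprod x y) \<le> (\<Sum>i\<in>UNIV. \<bar>norm (x $ i)\<bar> * \<bar>norm (y $ i)\<bar>)"
    unfolding hprod_def by (rule order_trans[OF norm_sum]) (simp add: norm_mult)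
  also have "\<dots> \<le> L2_set (\<lambda>i. norm (x $ i)) UNIV * L2_set (\<lambda>i. norm (y $ i)) UNIV"
    by (rule L2_set_mult_ineq)
  finally show ?thesis by (simp add: norm_vec_def)
qed

lemma norm_vector_smult [simp]: "norm ((c::complex) *s x) = norm c * norm x"
  by (simp add: norm_vec_def norm_mult L2_set_right_distrib)

lemma scaleR_eq_smult: "r *\<^sub>R (x :: complex ^ 'n) = of_real r *s x"
  by (simp add: vec_eq_iff scaleR_conv_of_real[symmetric])

lemma continuous_on_smult [continuous_intros]:
  "continuous_on S f \<Longrightarrow> continuous_on S g \<Longrightarrow> continuous_on S (\<lambda>x. (f x :: complex) *s g x)"
  unfolding vector_scalar_mult_def by (intro continuous_intros)

lemma continuous_on_hprod [continuous_intros]: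
  "continuous_on S f \<Longrightarrow> continuous_on S g \<Longrightarrow> continuous_on S (\<lambda>x. hprod (f x) (g x))"
  unfolding hprod_def by (intro continuous_intros)

lemma linear_smult: "linear ((*s) (c::complex))"
  by (intro linearI) (simp_all add: vec_eq_iff algebra_simps)

lemma circle_average_smult: "circle_average lborel (\<lambda>t x. circ t *s (x :: complex ^ 'n))"
proof
  show "(\<lambda>(t, x). circ t *s (x :: complex ^ 'n)) \<in> borel \<Otimes>\<^sub>M lborel \<rightarrow>\<^sub>M lborel"
  proof -
    have "(\<lambda>p. circ (fst p) *s (snd p :: complex ^ 'n)) \<in> borel_measurable borel"
      by (intro borel_measurable_continuous_onI continuous_intros)
    then show ?thesis
      by (simp add: case_prod_unfold borel_prod[symmetric] cong: measurable_cong_sets)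
  qed
  show "distr lborel lborel ((*s) (circ t)) = (lborel :: (complex ^ 'n) measure)" for t
    using lborel_distr_linear_isometry[OF linear_smult, of "circ t"]
    by (simp cong: distr_cong)
qed

interpretation smult_avg: circle_average lborel "\<lambda>t x. circ t *s (x :: complex ^ 'n)"
  by (rule circle_average_smult)

lemma volume_unit_ball: "emeasure lborel (ball (0 :: complex ^ 'n) 1) = ennreal (pi ^ CARD('n) / fact CARD('n))"
  using emeasure_ball[of 1 "0 :: complex ^ 'n"] unit_ball_vol_even[of "CARD('n)"] by (simp add: mult.commute)

lemma nn_integral_gaussian:
  "(\<integral>\<^sup>+z. ennreal (exp (- (norm (z :: complex ^ 'n))\<^sup>2)) \<partial>lborel) = ennreal (pi ^ CARD('n))"
proof -
  let ?n = "CARD('n)"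
  have "(\<integral>\<^sup>+z. ennreal 1 * (ennreal (exp (- (norm (z :: complex ^ 'n))\<^sup>2))) \<partial>lborel)
     = ennreal (pi ^ ?n / fact ?n * real ?n) *
       (\<integral>\<^sup>+x. ennreal (x powr (real ?n - 1)) * ennreal (exp (- x)) * indicator {0<..} x \<partial>lborel)"
    by (rule nn_integral_homogeneous_radial[where k=0]) (simp_all add: volume_unit_ball)
  also have "(\<integral>\<^sup>+x. ennreal (x powr (real ?n - 1)) * ennreal (exp (- x)) * indicator {0<..} x \<partial>lborel)
     = (\<integral>\<^sup>+x. ennreal (indicator {0..} x * x powr (real ?n - 1) / exp x) \<partial>lborel)"
    by (intro nn_integral_cong) (auto simp: indicator_def ennreal_mult[symmetric] exp_minus field_simps)
  also have "\<dots> = ennreal (Gamma (real ?n))"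
    by (rule Gamma_conv_nn_integral_real[symmetric]) simp
  also have "Gamma (real ?n) = fact (?n - 1)"
    using Gamma_fact[of "?n - 1"] by (simp add: of_nat_diff)
  also have "ennreal (pi ^ ?n / fact ?n * real ?n) * ennreal (fact (?n - 1)) = ennreal (pi ^ ?n / fact ?n * real ?n * fact (?n - 1))"
    by (rule ennreal_mult[symmetric]) auto
  also have "pi ^ ?n / fact ?n * real ?n * fact (?n - 1) = pi ^ ?n"
    using fact_reduce[of ?n, where 'a=real] by simp
  finally show ?thesis by simp
qed

lemma integrable_gaussian: "integrable lborel (\<lambda>z :: complex ^ 'n. exp (- (norm z)\<^sup>2))"
  by (rule integrableI_nonneg) (auto simp: nn_integral_gaussian)

lemma integral_gaussian: "(\<integral>z. exp (- (norm (z :: complex ^ 'n))\<^sup>2) \<partial>lborel) = pi ^ CARD('n)"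
  using nn_integral_gaussian by (intro integral_eq_nn_integral[THEN trans]) auto

text \<open>The polynomial factor is at most \<open>fact k * exp (b + norm z)\<close>, and
  completing the square absorbs all linear exponents into part of the quadratic one. What remains is
  dominated by a Gaussian at half the scale.\<close>

lemma integrable_gaussian_growth:
  fixes H :: "complex ^ 'n \<Rightarrow> complex"
  assumes H: "continuous_on UNIV H" and b: "\<And>z. norm (H z) \<le> C * (exp (a * norm z) * (b + norm z) ^ k)" and C: "C \<ge> 0" "b \<ge> 0"
  shows "integrable lborel (\<lambda>z. H z * of_real (exp (- (norm z)\<^sup>2)))"
proof -
  have [measurable]: "H \<in> borel_measurable borel" using H by (rule borel_measurable_continuous_onI)
  \<comment> \<open>The constant dominates the two linear exponents at once: \<open>a\<close> from
    the hypothesis and 1 from the exponential bound of the polynomial.\<close>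
  define c where "c = \<bar>a\<bar> + 1"
  define D where "D = C * fact k * exp b * exp (c\<^sup>2)"
  have bound: "norm (H z) * exp (- (norm z)\<^sup>2) \<le> D * exp (- (norm ((1/2) *\<^sub>R z))\<^sup>2)" for z
  proof -
    let ?x = "norm z"
    have x: "b + ?x \<ge> 0" using C by simp
    have "sum (\<lambda>n. (b + ?x) ^ n /\<^sub>R fact n) {k} \<le> exp (b + ?x)"
      unfolding exp_def by (rule sum_le_suminf[OF summable_exp_generic]) (use x in auto)
    then have 1: "(b + ?x) ^ k \<le> fact k * exp (b + ?x)" by (simp add: field_simps)
    have "0 \<le> (c - ?x / 2)\<^sup>2" by simp
    then have "c * ?x \<le> c\<^sup>2 + ?x\<^sup>2 / 4" by (simp add: power2_eq_square algebra_simps)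
    moreover have "a * ?x + ?x \<le> c * ?x"
      using mult_right_mono[OF abs_ge_self[of a], of ?x] by (simp add: c_def algebra_simps)
    moreover have "0 \<le> ?x\<^sup>2" by simp
    moreover have "(?x / 2)\<^sup>2 = ?x\<^sup>2 / 4" by (simp add: power_divide)
    ultimately have 2: "a * ?x + (b + ?x) + - ?x\<^sup>2 \<le> b + c\<^sup>2 + - (?x / 2)\<^sup>2"
      by linarith
    have "norm (H z) * exp (- ?x\<^sup>2) \<le> C * (exp (a * ?x) * (b + ?x) ^ k) * exp (- ?x\<^sup>2)"
      by (intro mult_right_mono H b) simp
    also have "\<dots> \<le> C * (exp (a * ?x) * (fact k * exp (b + ?x))) * exp (- ?x\<^sup>2)"
      by (intro mult_right_mono mult_left_mono 1 C) auto
    also have "\<dots> = C * fact k * exp (a * ?x + (b + ?x) + - ?x\<^sup>2)"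
      by (simp only: exp_add mult_ac)
    also have "\<dots> \<le> C * fact k * exp (b + c\<^sup>2 + - (?x / 2)\<^sup>2)"
      using 2 C by (intro mult_left_mono) auto
    also have "\<dots> = D * exp (- (norm ((1/2) *\<^sub>R z))\<^sup>2)"
      unfolding D_def exp_add by simp
    finally show ?thesis .
  qed
  have "integrable lborel (\<lambda>z :: complex ^ 'n. exp (- (norm ((1/2) *\<^sub>R z))\<^sup>2))"
    using integrable_lborel_affine_iff[of "\<lambda>z :: complex ^ 'n. exp (- (norm z)\<^sup>2)" "1/2" 0] integrable_gaussian by simp
  then have "integrable lborel (\<lambda>z :: complex ^ 'n. D * exp (- (norm ((1/2) *\<^sub>R z))\<^sup>2))" by simp
  then show ?thesis
  proof (rule Bochner_Integration.integrable_bound)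
    show "AE z in lborel. norm (H z * of_real (exp (- (norm z)\<^sup>2))) \<le> norm (D * exp (- (norm ((1/2) *\<^sub>R z))\<^sup>2))"
      using order_trans[OF bound abs_ge_self] by (intro AE_I2) (simp add: norm_mult)
  qed measurable
qed

text \<open>The Gaussian weight is constant on the circles \<open>circ t *s z\<close>, and on the
  complex line through \<open>z\<close> the mean of the holomorphic \<open>H\<close> over such a
  circle is \<open>H 0\<close>. Averaging therefore replaces \<open>H z\<close> by
  \<open>H 0\<close> under the integral.\<close>

lemma gaussian_mean_value:
  fixes H :: "complex ^ 'n \<Rightarrow> complex"
  assumes H: "continuous_on UNIV H" and hol: "\<And>z. (\<lambda>c. H (c *s z)) holomorphic_on UNIV"
    and int: "integrable lborel (\<lambda>z. H z * of_real (exp (- (norm z)\<^sup>2)))"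
  shows "(\<integral>z. H z * of_real (exp (- (norm z)\<^sup>2)) \<partial>lborel) = pi ^ CARD('n) * H 0"
proof -
  have [measurable]: "H \<in> borel_measurable borel" using H by (rule borel_measurable_continuous_onI)
  have "(\<integral>z. H z * of_real (exp (- (norm z)\<^sup>2)) \<partial>lborel)
      = (\<integral>z. (\<integral>t. H (circ t *s z) * of_real (exp (- (norm (circ t *s z))\<^sup>2)) \<partial>unit_meas) \<partial>lborel)"
    by (rule smult_avg.integral_average[OF int, symmetric])
  also have "\<dots> = (\<integral>z. H 0 * of_real (exp (- (norm (z :: complex ^ 'n))\<^sup>2)) \<partial>lborel)"
  proof (rule Bochner_Integration.integral_cong[OF refl])
    fix z :: "complex ^ 'n"
    have "(\<integral>t. H (circ t *s z) \<partial>unit_meas) = integral {0..1} (\<lambda>t. H ((1 * circ t) *s z))"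
      by (subst integral_unit_meas)
         (auto intro!: continuous_on_compose2[OF H] continuous_intros borel_measurable_continuous_onI)
    also have "\<dots> = integral {0..1} (\<lambda>t. H ((0 * circ t) *s z))"
      by (rule circle_mean_constant[OF _ _ _ hol]) auto
    finally have "(\<integral>t. H (circ t *s z) \<partial>unit_meas) = H 0" by simp
    then show "(\<integral>t. H (circ t *s z) * of_real (exp (- (norm (circ t *s z))\<^sup>2)) \<partial>unit_meas) = H 0 * of_real (exp (- (norm z)\<^sup>2))"
      by simp
  qed
  also have "\<dots> = H 0 * of_real (\<integral>z. exp (- (norm (z :: complex ^ 'n))\<^sup>2) \<partial>lborel)"
    by (simp only: integral_mult_right_zero integral_complex_of_real)
  finally show ?thesis by (simp add: integral_gaussian)
qed

text \<open>A substitute for homogeneous polynomials of degree \<open>k\<close> that avoids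
  coordinates and multi-indices. It asks exactly for what the components of a holomorphic function
  are later shown to satisfy.\<close>

definition hom_holo :: "(complex ^ 'n \<Rightarrow> complex) \<Rightarrow> nat \<Rightarrow> bool" where
  "hom_holo p k \<longleftrightarrow> continuous_on UNIV p \<and> (\<forall>z v. (\<lambda>c. p (z + c *s v)) holomorphic_on UNIV) \<and>
     (\<forall>c z. c \<noteq> 0 \<longrightarrow> p (c *s z) = c ^ k * p z)"

lemma hom_holo_bound:
  assumes "hom_holo p k" obtains M where "M \<ge> 0" "\<And>z. norm (p z) \<le> M * norm z ^ k"
proof -
  have cp: "continuous_on UNIV p" and hp: "\<And>c z. c \<noteq> 0 \<Longrightarrow> p (c *s z) = c ^ k * p z"
    using assms by (auto simp: hom_holo_def)
  have "compact (p ` cball 0 1)"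
    by (intro compact_continuous_image continuous_on_subset[OF cp]) auto
  then obtain M where M: "M > 0" "\<And>z. z \<in> cball 0 1 \<Longrightarrow> norm (p z) \<le> M"
    using compact_imp_bounded bounded_pos by (metis imageI)
  have "norm (p z) \<le> M * norm z ^ k" if "z \<noteq> 0" for z
  proof -
    have "p z = p (of_real (norm z) *s (of_real (1 / norm z) *s z))"
      using that by simp
    also have "\<dots> = of_real (norm z) ^ k * p (of_real (1 / norm z) *s z)"
      using that by (intro hp) auto
    also have "norm \<dots> \<le> norm z ^ k * M"
      unfolding norm_mult by (intro mult_mono M) (use that in \<open>auto simp: norm_power norm_divide\<close>)
    finally show ?thesis by (simp add: mult.commute)
  qed
  \<comment> \<open>The origin is not reached by scaling from the unit ball. For positive degree,
    homogeneity with factor 2 forces \<open>p 0 = 0\<close>.\<close>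
  moreover have "norm (p 0) \<le> M * norm (0 :: complex ^ 'a) ^ k"
  proof (cases "k = 0")
    case False
    have "p 0 = 2 ^ k * p 0" using hp[of 2 0] by simp
    moreover have "(2::complex) ^ k \<noteq> 1"
      using False by (metis norm_one norm_power norm_numeral one_less_numeral_iff one_less_power semiring_norm(76) less_irrefl bot_nat_0.not_eq_extremum)
    ultimately have "p 0 = 0" by auto
    then show ?thesis using M by simp
  qed (use M in auto)
  ultimately show ?thesis using that M by (metis less_imp_le)
qed

text \<open>The reproducing formula of the Fock space. After the translation
  \<open>z \<mapsto> y + z\<close> the exponent \<open>hprod y (y + z) - (norm (y + z))^2\<close>
  collapses to \<open>- hprod z y - (norm z)^2\<close>, so the integrand is a Gaussian times a
  function holomorphic in \<open>z\<close>, and the mean value property evaluates it at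
  \<open>z = 0\<close>.\<close>

lemma fock_reproducing:
  fixes p :: "complex ^ 'n \<Rightarrow> complex"
  assumes p: "hom_holo p k"
  shows "integrable lborel (\<lambda>z. p z * exp (hprod y z) * of_real (exp (- (norm z)\<^sup>2)))"
    and "(\<integral>z. p z * exp (hprod y z) * of_real (exp (- (norm z)\<^sup>2)) \<partial>lborel) = pi ^ CARD('n) * p y"
proof -
  have cp[continuous_intros]: "continuous_on UNIV p" using p by (simp add: hom_holo_def)
  obtain M where M: "M \<ge> 0" "\<And>z. norm (p z) \<le> M * norm z ^ k" using hom_holo_bound[OF p] by blast
  have nexp: "norm (exp (hprod x z)) \<le> exp (norm x * norm z)" for x z :: "complex ^ 'n"
    using norm_hprod_le[of x z] complex_Re_le_cmod[of "hprod x z"] by (simp add: norm_exp_eq_Re)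
  have nexp': "norm (exp (- hprod z y)) \<le> exp (norm y * norm z)" for z :: "complex ^ 'n"
    using norm_hprod_le[of z y] complex_Re_le_cmod[of "- hprod z y"] by (simp add: norm_exp_eq_Re mult.commute)
  show i: "integrable lborel (\<lambda>z. p z * exp (hprod y z) * of_real (exp (- (norm z)\<^sup>2)))"
  proof (rule integrable_gaussian_growth[where C=M and a="norm y" and b=0 and k=k])
    show "norm (p z * exp (hprod y z)) \<le> M * (exp (norm y * norm z) * (0 + norm z) ^ k)" for z
      using mult_mono[OF M(2)[of z] nexp[of y z]] M(1) by (simp add: norm_mult mult_ac)
  qed (auto intro!: continuous_intros continuous_on_compose2[OF cp] M)
  let ?H = "\<lambda>z. p (y + z) * exp (- hprod z y)"
  have iH: "integrable lborel (\<lambda>z. ?H z * of_real (exp (- (norm z)\<^sup>2)))"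
  proof (rule integrable_gaussian_growth[where C=M and a="norm y" and b="norm y" and k=k])
    fix z
    have "norm (p (y + z)) \<le> M * (norm y + norm z) ^ k"
      by (rule order_trans[OF M(2)]) (intro mult_left_mono power_mono norm_triangle_ineq M, auto)
    from mult_mono[OF this nexp'[of z]]
    show "norm (?H z) \<le> M * (exp (norm y * norm z) * (norm y + norm z) ^ k)"
      using M(1) by (simp add: norm_mult mult_ac)
  qed (auto intro!: continuous_intros continuous_on_compose2[OF cp] M)
  have "(\<integral>z. p z * exp (hprod y z) * of_real (exp (- (norm z)\<^sup>2)) \<partial>lborel)
      = (\<integral>z. p (y + z) * exp (hprod y (y + z)) * of_real (exp (- (norm (y + z))\<^sup>2)) \<partial>lborel)"
    by (subst integral_lborel_affine[where t=y and c=1])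
       (auto intro!: borel_measurable_continuous_onI continuous_intros continuous_on_compose2[OF cp])
  also have "\<dots> = (\<integral>z. ?H z * of_real (exp (- (norm z)\<^sup>2)) \<partial>lborel)"
  proof (rule Bochner_Integration.integral_cong[OF refl])
    fix z
    have "hprod y (y + z) - of_real ((norm (y + z))\<^sup>2) = - hprod z y - of_real ((norm z)\<^sup>2)"
      unfolding hprod_self[symmetric] by (simp add: hprod_add_left hprod_add_right)
    then have "exp (hprod y (y + z)) * of_real (exp (- (norm (y + z))\<^sup>2)) = exp (- hprod z y) * of_real (exp (- (norm z)\<^sup>2))"
      unfolding exp_of_real[symmetric] exp_add[symmetric] by simp
    then show "p (y + z) * exp (hprod y (y + z)) * of_real (exp (- (norm (y + z))\<^sup>2)) = ?H z * of_real (exp (- (norm z)\<^sup>2))"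
      by (simp add: mult.assoc)
  qed
  also have "\<dots> = pi ^ CARD('n) * ?H 0"
  proof (rule gaussian_mean_value[OF _ _ iH])
    show "(\<lambda>c. ?H (c *s z)) holomorphic_on UNIV" for z
      using p unfolding hprod_scale_left hom_holo_def by (auto intro!: holomorphic_intros)
  qed (auto intro!: continuous_intros continuous_on_compose2[OF cp])
  finally show "(\<integral>z. p z * exp (hprod y z) * of_real (exp (- (norm z)\<^sup>2)) \<partial>lborel) = pi ^ CARD('n) * p y"
    by simp
qed


text \<open>In the exponential series only the term of index \<open>k\<close> has rotation weight
  opposite to \<open>circ t ^ k\<close>; all others integrate to zero.\<close>

lemma integral_circ_exp:
  "(\<integral>t. circ t ^ k * exp (cnj (circ t) * c) \<partial>unit_meas) = c ^ k / fact k"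
proof -
  define f where "f i t = circ t ^ k * ((cnj (circ t) * c) ^ i /\<^sub>R fact i)" for i t
  have f: "f i t = (c ^ i / fact i) * circ t powi (int k - int i)" for i t
  proof -
    have "circ t * cnj (circ t) = 1"
      by (simp add: complex_norm_square[symmetric] flip: complex_norm_square)
    then have ci: "cnj (circ t) = inverse (circ t)" by (simp add: field_simps)
    show ?thesis
      unfolding f_def ci power_mult_distrib power_inverse
      by (simp add: power_int_diff scaleR_conv_of_real field_simps)
  qed
  have int: "integrable unit_meas (f i)" for i
    unfolding f by (intro integrable_unit_meas continuous_intros borel_measurable_continuous_onI) auto
  have fi: "(\<integral>t. f i t \<partial>unit_meas) = (if i = k then c ^ k / fact k else 0)" for i
  proof -
    have "(\<integral>t. f i t \<partial>unit_meas) = integral {0..1} (f i)"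
      unfolding f by (intro integral_unit_meas continuous_intros borel_measurable_continuous_onI) auto
    also have "\<dots> = (c ^ i / fact i) * (if int k - int i = 0 then 1 else 0)"
      unfolding f integral_circ_powi[symmetric] by (rule Henstock_Kurzweil_Integration.integral_mult_right)
    finally show ?thesis by auto
  qed
  have nf: "norm (f i t) = norm c ^ i /\<^sub>R fact i" for i t
    by (simp add: f norm_mult norm_power norm_divide norm_inverse divide_inverse mult.commute)
  have s: "summable (\<lambda>i. norm c ^ i /\<^sub>R fact i)" by (rule summable_exp_generic)
  have "circ t ^ k * exp (cnj (circ t) * c) = (\<Sum>i. f i t)" for t
    unfolding f_def exp_def by (rule suminf_mult[symmetric, OF summable_exp_generic])
  then have "(\<integral>t. circ t ^ k * exp (cnj (circ t) * c) \<partial>unit_meas) = (\<integral>t. (\<Sum>i. f i t) \<partial>unit_meas)"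
    by simp
  also have "\<dots> = (\<Sum>i. \<integral>t. f i t \<partial>unit_meas)"
    by (rule integral_suminf[OF int]) (use s in \<open>auto simp: nf\<close>)
  also have "\<dots> = c ^ k / fact k"
    unfolding fi by (rule sums_unique[symmetric, OF sums_single])
  finally show ?thesis .
qed

text \<open>Since \<open>p\<close> is homogeneous, averaging the Fock formula over rotations of
  \<open>z\<close> retains only the degree \<open>k\<close> part of \<open>exp (hprod y z)\<close>,
  namely \<open>hprod y z ^ k / fact k\<close>.\<close>

lemma fock_reproducing_power:
  fixes p :: "complex ^ 'n \<Rightarrow> complex"
  assumes p: "hom_holo p k"
  shows "integrable lborel (\<lambda>z. p z * hprod y z ^ k * of_real (exp (- (norm z)\<^sup>2)))"
    and "(\<integral>z. p z * hprod y z ^ k * of_real (exp (- (norm z)\<^sup>2)) \<partial>lborel) = pi ^ CARD('n) * fact k * p y"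
proof -
  have cp: "continuous_on UNIV p" and hp: "\<And>c z. c \<noteq> 0 \<Longrightarrow> p (c *s z) = c ^ k * p z"
    using p by (auto simp: hom_holo_def)
  have avg: "(\<integral>t. p (circ t *s z) * exp (hprod y (circ t *s z)) * of_real (exp (- (norm (circ t *s z))\<^sup>2)) \<partial>unit_meas)
    = inverse (fact k) * (p z * hprod y z ^ k * of_real (exp (- (norm z)\<^sup>2)))" for z
  proof -
    have "p (circ t *s z) * exp (hprod y (circ t *s z)) * of_real (exp (- (norm (circ t *s z))\<^sup>2))
      = (p z * of_real (exp (- (norm z)\<^sup>2))) * (circ t ^ k * exp (cnj (circ t) * hprod y z))" for t
      by (simp add: hp hprod_scale_right)
    then have "(\<integral>t. p (circ t *s z) * exp (hprod y (circ t *s z)) * of_real (exp (- (norm (circ t *s z))\<^sup>2)) \<partial>unit_meas)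
      = (p z * of_real (exp (- (norm z)\<^sup>2))) * (\<integral>t. circ t ^ k * exp (cnj (circ t) * hprod y z) \<partial>unit_meas)"
      by (simp only: integral_mult_right_zero)
    then show ?thesis by (simp add: integral_circ_exp field_simps)
  qed
  note F = fock_reproducing[OF p, of y]
  show "integrable lborel (\<lambda>z. p z * hprod y z ^ k * of_real (exp (- (norm z)\<^sup>2)))"
    using integrable_mult_right[OF smult_avg.integrable_average[OF F(1), unfolded avg], of "fact k"]
    by (simp add: mult.assoc[symmetric])
  have "inverse (fact k) * (\<integral>z. p z * hprod y z ^ k * of_real (exp (- (norm z)\<^sup>2)) \<partial>lborel) = pi ^ CARD('n) * p y"
    using smult_avg.integral_average[OF F(1)] F(2) unfolding avg by simp
  then show "(\<integral>z. p z * hprod y z ^ k * of_real (exp (- (norm z)\<^sup>2)) \<partial>lborel) = pi ^ CARD('n) * fact k * p y"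
    by (simp add: field_simps)
qed

lemma integral_homogeneous_ball:
  fixes G :: "complex ^ 'n \<Rightarrow> complex"
  assumes G [measurable]: "G \<in> borel_measurable borel" and hom: "\<And>r z. r > 0 \<Longrightarrow> G (r *\<^sub>R z) = of_real (r ^ (2 * k)) * G z"
    and R: "R > 0"
  shows "(\<integral>z. indicator (ball 0 R) z *\<^sub>R G z \<partial>lborel) = (R\<^sup>2) ^ (k + CARD('n)) * (\<integral>z. indicator (ball 0 1) z *\<^sub>R G z \<partial>lborel)"
proof -
  have [measurable]: "ball (0 :: complex ^ 'n) R \<in> sets borel" by simp
  have "(\<integral>z. indicator (ball 0 R) z *\<^sub>R G z \<partial>lborel)
      = R ^ DIM(complex ^ 'n) *\<^sub>R (\<integral>z. indicator (ball 0 R) (0 + R *\<^sub>R z) *\<^sub>R G (0 + R *\<^sub>R z) \<partial>lborel)"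
    using R by (subst integral_lborel_affine[where c=R and t=0]) auto
  also have "(\<integral>z. indicator (ball 0 R) (0 + R *\<^sub>R z) *\<^sub>R G (0 + R *\<^sub>R z) \<partial>lborel)
      = (\<integral>z. of_real (R ^ (2 * k)) * (indicator (ball 0 1) z *\<^sub>R G z) \<partial>lborel)"
    using R by (intro Bochner_Integration.integral_cong) (auto simp: hom indicator_def)
  also have "\<dots> = of_real (R ^ (2 * k)) * (\<integral>z. indicator (ball 0 1) z *\<^sub>R G z \<partial>lborel)"
    by (rule integral_mult_right_zero)
  finally show ?thesis
    by (simp add: scaleR_conv_of_real power_add power_mult[symmetric] mult_ac)
qed

text \<open>By the layer-cake formula \<open>exp (- norm\<^sup>2) = \<integral> 1{norm\<^sup>2 < x} exp (- x) dx\<close>.\<close>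

lemma gaussian_homogeneous_integral:
  fixes G :: "complex ^ 'n \<Rightarrow> complex"
  assumes G [measurable]: "G \<in> borel_measurable borel" and hom: "\<And>r z. r > 0 \<Longrightarrow> G (r *\<^sub>R z) = of_real (r ^ (2 * k)) * G z"
    and int: "integrable lborel (\<lambda>z. G z * of_real (exp (- (norm z)\<^sup>2)))"
  shows "(\<integral>z. G z * of_real (exp (- (norm z)\<^sup>2)) \<partial>lborel) = fact (k + CARD('n)) * (\<integral>z. indicator (ball 0 1) z *\<^sub>R G z \<partial>lborel)"
proof -
  let ?d = "k + CARD('n)"
  define F where "F x z = (if (norm z)\<^sup>2 < x then exp (- x) else 0) *\<^sub>R G z" for x :: real and z :: "complex ^ 'n"
  have e: "(\<integral>\<^sup>+x. ennreal (exp (- x)) * indicator {a<..} x \<partial>lborel) = ennreal (exp (- a))" for a :: real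
  proof -
    have "(\<integral>\<^sup>+x. ennreal (exp (- x)) * indicator {a..} x \<partial>lborel) = ennreal (0 - (- exp (- a)))"
    proof (rule nn_integral_FTC_atLeast)
      show "((\<lambda>x::real. - exp (- x)) \<longlongrightarrow> 0) at_top"
      proof -
        have "((\<lambda>x::real. exp (- x)) \<longlongrightarrow> 0) at_top"
          by (rule filterlim_compose[OF exp_at_bot filterlim_uminus_at_bot_at_top])
        from tendsto_minus[OF this] show ?thesis by simp
      qed
    qed (auto intro!: derivative_eq_intros)
    moreover have "(\<integral>\<^sup>+x. ennreal (exp (- x)) * indicator {a<..} x \<partial>lborel) = (\<integral>\<^sup>+x. ennreal (exp (- x)) * indicator {a..} x \<partial>lborel)"
    proof (rule nn_integral_cong_AE)
      show "AE x in lborel. ennreal (exp (- x)) * indicator {a<..} x = ennreal (exp (- x)) * indicator {a..} x"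
        using AE_lborel_singleton[of a] by eventually_elim (auto simp: indicator_def)
    qed
    ultimately show ?thesis by simp
  qed
  have [measurable]: "G \<in> borel_measurable lborel" by simp
  have [measurable]: "case_prod F \<in> borel_measurable (lborel \<Otimes>\<^sub>M lborel)"
    unfolding F_def by measurable
  have nF: "ennreal (norm (F x z)) = ennreal (norm (G z)) * (ennreal (exp (- x)) * indicator {(norm z)\<^sup>2<..} x)" for x z
    by (auto simp: F_def indicator_def ennreal_mult mult.commute)
  have "(\<integral>\<^sup>+z. (\<integral>\<^sup>+x. norm (F x z) \<partial>lborel) \<partial>lborel) = (\<integral>\<^sup>+z. norm (G z * of_real (exp (- (norm z)\<^sup>2))) \<partial>lborel)"
    unfolding nF by (subst nn_integral_cmult) (auto simp: e norm_mult ennreal_mult)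
  also have "\<dots> < \<infinity>" using int by (simp add: integrable_iff_bounded)
  finally have iF: "integrable (lborel \<Otimes>\<^sub>M lborel) (case_prod F)"
    by (subst integrable_iff_bounded) (auto simp: lborel_pair.nn_integral_snd[symmetric] split_beta')
  have F1: "(\<integral>x. F x z \<partial>lborel) = G z * of_real (exp (- (norm z)\<^sup>2))" for z
  proof -
    have "(\<integral>\<^sup>+x. ennreal (if (norm z)\<^sup>2 < x then exp (- x) else 0) \<partial>lborel)
        = (\<integral>\<^sup>+x. ennreal (exp (- x)) * indicator {(norm z)\<^sup>2<..} x \<partial>lborel)"
      by (intro nn_integral_cong) (auto simp: indicator_def)
    then have "(\<integral>x. (if (norm z)\<^sup>2 < x then exp (- x) else 0) \<partial>lborel) = exp (- (norm z)\<^sup>2)"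
      using e[of "(norm z)\<^sup>2"]
      by (intro integral_eq_nn_integral[THEN trans]) auto
    then show ?thesis by (simp add: F_def scaleR_conv_of_real mult.commute)
  qed
  \<comment> \<open>For \<open>x > 0\<close> the integrand is \<open>exp (- x)\<close> times
    \<open>G\<close> on the ball of radius \<open>sqrt x\<close>, and homogeneity gives the factor
    \<open>x ^ ?d\<close>. The exponent is written as \<open>Suc ?d - 1\<close> so that the
    remaining integral is \<open>Gamma (Suc ?d) = fact ?d\<close>.\<close>
  have F2: "(\<integral>z. F x z \<partial>lborel) = (indicator {0..} x * x powr (real (Suc ?d) - 1) / exp x) *\<^sub>R (\<integral>z. indicator (ball 0 1) z *\<^sub>R G z \<partial>lborel)" for x
  proof (cases "x > 0")
    case True
    have "F x z = exp (- x) *\<^sub>R (indicator (ball 0 (sqrt x)) z *\<^sub>R G z)" for z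
      using True real_sqrt_less_iff[of "(norm z)\<^sup>2" x] by (auto simp: F_def indicator_def)
    then have "(\<integral>z. F x z \<partial>lborel) = exp (- x) *\<^sub>R (\<integral>z. indicator (ball 0 (sqrt x)) z *\<^sub>R G z \<partial>lborel)"
      by (simp only: Bochner_Integration.integral_scaleR_right)
    also have "(\<integral>z. indicator (ball 0 (sqrt x)) z *\<^sub>R G z \<partial>lborel) = x ^ ?d * (\<integral>z. indicator (ball 0 1) z *\<^sub>R G z \<partial>lborel)"
      using True integral_homogeneous_ball[OF G hom, of "sqrt x"] by (simp flip: of_real_power)
    finally have "(\<integral>z. F x z \<partial>lborel) = exp (- x) *\<^sub>R (x ^ ?d * (\<integral>z. indicator (ball 0 1) z *\<^sub>R G z \<partial>lborel))" .
    then show ?thesis using True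
      by (simp add: powr_realpow[symmetric] scaleR_conv_of_real exp_minus field_simps)
  next
    case False
    then have "F x z = 0" for z
    proof -
      have "\<not> (norm z)\<^sup>2 < x" using False zero_le_power2[of "norm z"] by linarith
      then show ?thesis by (simp add: F_def)
    qed
    then show ?thesis using False by (cases "x = 0") auto
  qed
  have "(\<integral>z. G z * of_real (exp (- (norm z)\<^sup>2)) \<partial>lborel) = (\<integral>z. (\<integral>x. F x z \<partial>lborel) \<partial>lborel)"
    by (simp add: F1)
  also have "\<dots> = (\<integral>x. (\<integral>z. F x z \<partial>lborel) \<partial>lborel)"
    by (rule lborel_pair.Fubini_integral[OF iF])
  also have "\<dots> = (\<integral>x. indicator {0..} x * x powr (real (Suc ?d) - 1) / exp x \<partial>lborel) *\<^sub>R (\<integral>z. indicator (ball 0 1) z *\<^sub>R G z \<partial>lborel)"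
    unfolding F2
  proof (rule Bochner_Integration.integral_scaleR_left)
    show "integrable lborel (\<lambda>x. indicator {0..} x * x powr (real (Suc ?d) - 1) / exp x)"
      by (rule integrableI_nonneg) (use Gamma_conv_nn_integral_real[of "real (Suc ?d)", symmetric] in auto)
  qed
  also have "(\<integral>x. indicator {0..} x * x powr (real (Suc ?d) - 1) / exp x \<partial>lborel) = Gamma (real (Suc ?d))"
    by (subst integral_eq_nn_integral)
       (use Gamma_conv_nn_integral_real[of "real (Suc ?d)", symmetric] in auto)
  also have "Gamma (real (Suc ?d)) = fact ?d"
    using Gamma_fact[of ?d] by simp
  finally show ?thesis by (simp add: scaleR_conv_of_real)
qed

text \<open>\<open>p z * hprod y z ^ k\<close> scales like \<open>r ^ (2 * k)\<close> under real
  dilations, so the passage from the Gaussian to the unit ball divides by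
  \<open>fact (k + n)\<close>, and a dilation then reaches radius \<open>R\<close>. The constant is
  the one inverted in \<open>cc\<close>.\<close>

lemma ball_reproducing:
  fixes p :: "complex ^ 'n \<Rightarrow> complex"
  assumes p: "hom_holo p k" and R: "R > 0"
  shows "(\<integral>z. indicator (ball 0 R) z *\<^sub>R (p z * hprod y z ^ k) \<partial>lborel)
    = (R\<^sup>2) ^ (k + CARD('n)) * (pi ^ CARD('n) * fact k / fact (k + CARD('n))) * p y"
proof -
  have cp: "continuous_on UNIV p" and hp: "\<And>c z. c \<noteq> 0 \<Longrightarrow> p (c *s z) = c ^ k * p z"
    using p by (auto simp: hom_holo_def)
  let ?G = "\<lambda>z. p z * hprod y z ^ k"
  have G: "?G \<in> borel_measurable borel"
    by (intro borel_measurable_continuous_onI continuous_intros cp)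
  have hG: "?G (r *\<^sub>R z) = of_real (r ^ (2 * k)) * ?G z" if "r > 0" for r z
    using that by (simp add: scaleR_eq_smult hp hprod_scale_right power_mult_distrib power2_eq_square power_mult)
  have "fact (k + CARD('n)) * (\<integral>z. indicator (ball 0 1) z *\<^sub>R ?G z \<partial>lborel) = pi ^ CARD('n) * fact k * p y"
    using gaussian_homogeneous_integral[OF G hG fock_reproducing_power(1)[OF p]] fock_reproducing_power(2)[OF p] by simp
  then have "(\<integral>z. indicator (ball 0 1) z *\<^sub>R ?G z \<partial>lborel) = (pi ^ CARD('n) * fact k / fact (k + CARD('n))) * p y"
    by (simp add: field_simps)
  then show ?thesis
    using integral_homogeneous_ball[OF G hG R] by (simp add: mult.assoc)
qed

lemma hom_holo_hprod: "hom_holo (\<lambda>z. hprod z y ^ k) k"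
  unfolding hom_holo_def hprod_add_left hprod_scale_left power_mult_distrib
  by (auto intro!: continuous_intros holomorphic_intros)

text \<open>The reproducing formula on the unit ball, applied to \<open>p z = hprod z y ^ k\<close>
  and evaluated at \<open>y\<close> itself.\<close>

lemma nn_integral_ball_hprod:
  fixes y :: "complex ^ 'n"
  shows "(\<integral>\<^sup>+z. ennreal (norm (hprod z y) ^ (2 * k)) * indicator (ball 0 1) z \<partial>lborel)
    = ennreal (pi ^ CARD('n) * fact k / fact (k + CARD('n)) * norm y ^ (2 * k))"
proof -
  let ?c = "pi ^ CARD('n) * fact k / fact (k + CARD('n)) :: real"
  have eq: "hprod z y ^ k * hprod y z ^ k = of_real (norm (hprod z y) ^ (2 * k))" for z
    unfolding cnj_hprod[of z y, symmetric] power_mult_distrib[symmetric] complex_norm_square[symmetric] power_mult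
    by (rule of_real_power[symmetric])
  have "complex_of_real (\<integral>z. indicator (ball 0 1) z * norm (hprod z y) ^ (2 * k) \<partial>lborel)
     = (\<integral>z. indicator (ball 0 1) z *\<^sub>R (hprod z y ^ k * hprod y z ^ k) \<partial>lborel)"
    unfolding eq by (subst integral_complex_of_real[symmetric]) (simp add: scaleR_conv_of_real)
  also have "\<dots> = of_real (?c * norm y ^ (2 * k))"
    using ball_reproducing[OF hom_holo_hprod, of 1 y k y] by (simp add: hprod_self power_mult)
  finally have I: "(\<integral>z. indicator (ball 0 1) z * norm (hprod z y) ^ (2 * k) \<partial>lborel) = ?c * norm y ^ (2 * k)"
    using of_real_eq_iff by blast
  have "(\<integral>\<^sup>+z. ennreal (norm (hprod z y) ^ (2 * k)) * indicator (ball 0 1) z \<partial>lborel)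
     = (\<integral>\<^sup>+z. ennreal (indicator (ball 0 1) z * norm (hprod z y) ^ (2 * k)) \<partial>lborel)"
    by (intro nn_integral_cong) (auto simp: indicator_def)
  also have "\<dots> = ennreal (\<integral>z. indicator (ball 0 1) z * norm (hprod z y) ^ (2 * k) \<partial>lborel)"
  proof (rule nn_integral_eq_integral)
    have "set_integrable lborel (cball 0 1) (\<lambda>z. norm (hprod z y) ^ (2 * k))"
      unfolding set_integrable_def by (intro borel_integrable_compact continuous_intros) auto
    then have "set_integrable lborel (ball 0 1) (\<lambda>z. norm (hprod z y) ^ (2 * k))"
      by (rule set_integrable_subset) auto
    then show "integrable lborel (\<lambda>z. indicator (ball 0 1) z * norm (hprod z y) ^ (2 * k))"
      by (simp add: set_integrable_def)
  qed auto
  finally show ?thesis unfolding I .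
qed

section \<open>Averages of holomorphic functions on the generalized Hartogs triangle\<close>

lemma deriv_circle_formula:
  assumes h: "h holomorphic_on ball c R" and r: "0 < r" "r < R"
  shows "deriv h c = (1 / of_real r) * integral {0..1} (\<lambda>s. h (c + of_real r * circ s) * circ s powi (- 1))"
proof -
  have "(h has_field_derivative 1 / (2 * of_real pi * \<i>) * contour_integral (circlepath c r) (\<lambda>u. h u / (u - c)^2)) (at c)"
  proof (rule Cauchy_derivative_integral_circlepath(2)[where w=c])
    show "continuous_on (cball c r) h"
      by (rule continuous_on_subset[OF holomorphic_on_imp_continuous_on[OF h]]) (use r in auto)
    show "h holomorphic_on ball c r"
      by (rule holomorphic_on_subset[OF h]) (use r in auto)
  qed (use r in auto)
  then have "deriv h c = 1 / (2 * of_real pi * \<i>) * contour_integral (circlepath c r) (\<lambda>u. h u / (u - c)^2)"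
    by (rule DERIV_imp_deriv)
  also have "contour_integral (circlepath c r) (\<lambda>u. h u / (u - c)^2)
      = integral {0..1} (\<lambda>s. (2 * of_real pi * \<i> / of_real r) * (h (c + of_real r * circ s) * circ s powi (- 1)))"
    unfolding contour_integral_integral
  proof (rule Henstock_Kurzweil_Integration.integral_cong)
    fix s :: real
    have e: "exp (2 * of_real pi * \<i> * of_real s) = circ s"
      by (simp add: circ_def cis_conv_exp mult_ac)
    have v: "vector_derivative (circlepath c r) (at s) = 2 * pi * \<i> * r * circ s"
      unfolding vector_derivative_circlepath e ..
    have p: "circlepath c r s = c + of_real r * circ s"
      unfolding circlepath e ..
    show "h (circlepath c r s) / (circlepath c r s - c)^2 * vector_derivative (circlepath c r) (at s)
      = (2 * of_real pi * \<i> / of_real r) * (h (c + of_real r * circ s) * circ s powi (- 1))"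
      unfolding v p using r by (simp add: power_int_minus field_simps power2_eq_square)
  qed
  also have "\<dots> = (2 * of_real pi * \<i> / of_real r) * integral {0..1} (\<lambda>s. h (c + of_real r * circ s) * circ s powi (- 1))"
    by (rule Henstock_Kurzweil_Integration.integral_mult_right)
  finally show ?thesis using r by (simp add: field_simps)
qed

text \<open>Only joint continuity of \<open>g\<close> is assumed, not of its derivative. Cauchy's
  formula expresses the derivative as a circle integral of \<open>g\<close>, which is again jointly
  continuous, and so the Leibniz rule applies.\<close>

lemma holomorphic_parametric_integral:
  fixes g :: "complex \<Rightarrow> real \<Rightarrow> complex"
  assumes U: "open U" and c: "continuous_on (U \<times> {0..1}) (\<lambda>(z, t). g z t)"
    and h: "\<And>t. t \<in> {0..1} \<Longrightarrow> (\<lambda>z. g z t) holomorphic_on U"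
  shows "(\<lambda>z. integral {0..1} (g z)) holomorphic_on U"
  unfolding holomorphic_on_open[OF U]
proof
  fix z0 assume "z0 \<in> U"
  then obtain e where e: "e > 0" "ball z0 e \<subseteq> U" using U open_contains_ball by blast
  \<comment> \<open>Centres range over the ball of radius \<open>e / 2\<close>; as
    \<open>1/2 + 1/3 < 1\<close>, circles of radius \<open>e / 3\<close> around them stay in
    \<open>U\<close>, and \<open>e / 3 < e / 2\<close> fits the disc on which Cauchy's formula is
    used.\<close>
  define r where "r = e / 3"
  have r: "r > 0" using e by (simp add: r_def)
  have in_U: "z + of_real r * circ s \<in> U" if "z \<in> ball z0 (e / 2)" for z s
  proof -
    have "dist z0 (z + of_real r * circ s) \<le> dist z0 z + r"
      using dist_triangle[of z0 "z + of_real r * circ s" z] r by (simp add: dist_norm norm_mult)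
    then have "z + of_real r * circ s \<in> ball z0 e" using that e by (simp add: r_def)
    then show ?thesis using e by blast
  qed
  have sub: "ball z (e / 2) \<subseteq> U" if "z \<in> ball z0 (e / 2)" for z
  proof
    fix x assume "x \<in> ball z (e / 2)"
    then have "dist z0 x < e" using that dist_triangle[of z0 x z] by simp
    then show "x \<in> U" using e by auto
  qed
  have "(\<lambda>z. integral (cbox 0 1) (g z)) holomorphic_on ball z0 (e / 2)"
  proof (rule leibniz_rule_holomorphic[where fx="\<lambda>z t. (1 / of_real r) * integral (cbox 0 1) (\<lambda>s. g (z + of_real r * circ s) t * circ s powi (- 1))"])
    fix z t assume z: "z \<in> ball z0 (e / 2)" and t: "t \<in> cbox 0 (1::real)"
    have "deriv (\<lambda>z. g z t) z = (1 / of_real r) * integral (cbox 0 1) (\<lambda>s. g (z + of_real r * circ s) t * circ s powi (- 1))"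
      using deriv_circle_formula[OF holomorphic_on_subset[OF h sub[OF z]], of t r] t e by (simp add: r_def)
    moreover have "z \<in> U" using sub[OF z] e by auto
    moreover have "((\<lambda>z. g z t) has_field_derivative deriv (\<lambda>z. g z t) z) (at z)"
      using t by (intro holomorphic_derivI[OF h U \<open>z \<in> U\<close>]) auto
    ultimately show "((\<lambda>z. g z t) has_field_derivative (1 / of_real r) * integral (cbox 0 1) (\<lambda>s. g (z + of_real r * circ s) t * circ s powi (- 1))) (at z within ball z0 (e / 2))"
      by (simp add: has_field_derivative_at_within)
  next
    fix z assume z: "z \<in> ball z0 (e / 2)"
    then have "z \<in> U" using sub[OF z] e by auto
    then show "g z integrable_on cbox 0 1"
      by (intro integrable_continuous continuous_on_compose2[OF c, of _ "\<lambda>t. (z, t)", simplified] continuous_intros) auto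
  next
    have "continuous_on ((ball z0 (e / 2) \<times> cbox 0 1) \<times> cbox 0 1) (\<lambda>(p, s). g (fst p + of_real r * circ s) (snd p) * circ s powi (- 1))"
      unfolding split_beta
      by (intro continuous_intros continuous_on_compose2[OF c, of _ "\<lambda>q. (fst (fst q) + of_real r * circ (snd q), snd (fst q))", simplified])
         (auto intro!: in_U)
    then have "continuous_on (ball z0 (e / 2) \<times> cbox 0 1) (\<lambda>p. integral (cbox 0 1) (\<lambda>s. g (fst p + of_real r * circ s) (snd p) * circ s powi (- 1)))"
      by (rule integral_continuous_on_param)
    then show "continuous_on (ball z0 (e / 2) \<times> cbox 0 1) (\<lambda>(z, t). (1 / of_real r) * integral (cbox 0 1) (\<lambda>s. g (z + of_real r * circ s) t * circ s powi (- 1)))"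
      unfolding split_beta by (intro continuous_intros)
  qed simp
  then show "\<exists>f'. ((\<lambda>z. integral {0..1} (g z)) has_field_derivative f') (at z0)"
    using e by (auto simp: holomorphic_on_open)
qed

lemma cscale_simps [simp]: "fst (cscale c v) = c *s fst v" "snd (cscale c v) = c * snd v"
  by (simp_all add: cscale_def)

lemma continuous_on_cscale [continuous_intros]:
  "continuous_on S g \<Longrightarrow> continuous_on S (\<lambda>c. cscale (g c) v)"
  unfolding cscale_def by (intro continuous_intros)

lemma smult_0_left [simp]: "0 *s (v :: complex ^ 'n) = 0"
  by (simp add: vec_eq_iff)

lemma cscale_simps2 [simp]: "cscale 0 v = 0" "cscale 1 v = v"
  by (auto simp: cscale_def prod_eq_iff)

lemma holomorphic_several_on_line:
  assumes "holomorphic_several f S" "open S"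
  shows "(\<lambda>c. f (x + cscale c v)) holomorphic_on {c. x + cscale c v \<in> S}"
proof -
  have ln: "((\<lambda>c. x + cscale c v) has_derivative (\<lambda>h. cscale h v)) (at c)" for c
  proof -
    have "bounded_linear (\<lambda>h. cscale h v)"
      unfolding linear_conv_bounded_linear[symmetric]
      by (intro linearI) (auto simp: prod_eq_iff vec_eq_iff algebra_simps)
    then show ?thesis
      by (auto intro!: derivative_eq_intros bounded_linear_imp_has_derivative)
  qed
  have "((\<lambda>c. f (x + cscale c v)) has_field_derivative D v) (at c)"
    if D: "(f has_derivative D) (at (x + cscale c v))" "\<And>c v. D (cscale c v) = c * D v" for c D
  proof -
    have "((\<lambda>c. f (x + cscale c v)) has_derivative (\<lambda>h. D (cscale h v))) (at c)"
      by (rule has_derivative_compose[OF ln D(1)])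
    then show ?thesis unfolding has_field_derivative_def by (simp add: D(2) mult_commute_abs)
  qed
  then show ?thesis
    using assms(1) unfolding holomorphic_several_def holomorphic_on_def field_differentiable_def
    by (blast intro: has_field_derivative_at_within)
qed

lemma holomorphic_several_continuous_on:
  "holomorphic_several f S \<Longrightarrow> continuous_on S f"
  unfolding holomorphic_several_def
  by (meson continuous_at_imp_continuous_on has_derivative_continuous)

text \<open>The parameter \<open>T\<close> carries the index type \<open>'n\<close>, which makes the
  dimension \<open>CARD('n)\<close> part of the locale.\<close>

locale hartogs =
  fixes m l :: nat and T :: "'n::finite itself"
  assumes m: "m > 0" and l: "l > 0"
begin

abbreviation \<Omega> :: "((complex ^ 'n) \<times> complex) set" where "\<Omega> \<equiv> hartogs_triangle m l"

text \<open>The radius of the ball formed by all \<open>z\<close> with \<open>(z, w)\<close> in the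
  domain.\<close>

definition rad :: "complex \<Rightarrow> real" where "rad w = norm w powr (real l / real m)"

lemma rad_pow: "w \<noteq> 0 \<Longrightarrow> rad w ^ m = norm w ^ l"
  using m by (simp add: rad_def powr_realpow[symmetric] powr_powr)

lemma in_Omega_iff: "(z, w) \<in> \<Omega> \<longleftrightarrow> w \<noteq> 0 \<and> norm w < 1 \<and> norm z < rad w"
proof (cases "w = 0")
  case True
  then show ?thesis using l by (simp add: hartogs_triangle_def zero_power not_less)
next
  case False
  have "norm z ^ m < norm w ^ l \<longleftrightarrow> norm z < rad w"
  proof -
    have "rad w ^ m \<le> norm z ^ m \<longleftrightarrow> rad w \<le> norm z"
      by (rule power_mono_iff) (use m in \<open>auto simp: rad_def\<close>)
    then show ?thesis unfolding rad_pow[OF False, symmetric] by (metis not_le)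
  qed
  moreover have "norm w ^ l < 1 \<longleftrightarrow> norm w < 1"
    using l by (simp add: power_less_one_iff)
  ultimately show ?thesis using False by (auto simp: hartogs_triangle_def)
qed

lemma rad_pos: "w \<noteq> 0 \<Longrightarrow> rad w > 0"
  by (simp add: rad_def)

lemma open_Omega: "open \<Omega>"
  unfolding hartogs_triangle_def case_prod_unfold
  by (intro open_Collect_conj open_Collect_less continuous_intros)

lemma Omega_borel [measurable]: "\<Omega> \<in> sets borel"
  using open_Omega by auto

definition act1 :: "complex \<Rightarrow> (complex ^ 'n) \<times> complex \<Rightarrow> (complex ^ 'n) \<times> complex" where
  "act1 u x = (u *s fst x, snd x)"

definition act2 :: "complex \<Rightarrow> (complex ^ 'n) \<times> complex \<Rightarrow> (complex ^ 'n) \<times> complex" where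
  "act2 u x = (fst x, u * snd x)"

text \<open>Holomorphy restricted to complex lines. Unlike Frechet differentiability it passes
  through circle averages by a one-variable argument, and together with continuity it suffices for
  Laurent coefficients.\<close>

definition line_holo :: "((complex ^ 'n) \<times> complex \<Rightarrow> complex) \<Rightarrow> bool" where
  "line_holo f \<longleftrightarrow> (\<forall>x v. (\<lambda>c. f (x + cscale c v)) holomorphic_on {c. x + cscale c v \<in> \<Omega>})"

definition avg :: "(complex \<Rightarrow> (complex ^ 'n) \<times> complex \<Rightarrow> (complex ^ 'n) \<times> complex) \<Rightarrow> int \<Rightarrow>
    ((complex ^ 'n) \<times> complex \<Rightarrow> complex) \<Rightarrow> (complex ^ 'n) \<times> complex \<Rightarrow> complex" where
  "avg \<sigma> a f x = fourier_coeff (\<lambda>u. f (\<sigma> u x)) a"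

text \<open>Collects the properties shared by the rotations of \<open>z\<close> and of
  \<open>w\<close>, so that every fact about averages is proved once for both.\<close>

definition circle_act :: "(complex \<Rightarrow> (complex ^ 'n) \<times> complex \<Rightarrow> (complex ^ 'n) \<times> complex) \<Rightarrow> bool" where
  "circle_act \<sigma> \<longleftrightarrow> continuous_on UNIV (\<lambda>p. \<sigma> (fst p) (snd p)) \<and> (\<forall>t x. \<sigma> (circ t) x \<in> \<Omega> \<longleftrightarrow> x \<in> \<Omega>) \<and>
     (\<forall>u x c v. \<sigma> u (x + cscale c v) = \<sigma> u x + cscale c (\<sigma> u v)) \<and>
     (\<forall>t. linear (\<sigma> (circ t))) \<and> (\<forall>t x. norm (\<sigma> (circ t) x) = norm x)"

lemma circle_act_act1: "circle_act act1" and circle_act_act2: "circle_act act2"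
proof -
  have "rad (circ t * w) = rad w" for t w by (simp add: rad_def norm_mult)
  then show "circle_act act1" "circle_act act2"
    unfolding circle_act_def act1_def act2_def
    by (auto simp: in_Omega_iff prod_eq_iff vec_eq_iff algebra_simps norm_Pair norm_mult
        intro!: continuous_intros linearI)
qed

context
  fixes \<sigma> assumes s: "circle_act \<sigma>"
begin

lemma act_continuous [continuous_intros]:
  "continuous_on S f \<Longrightarrow> continuous_on S g \<Longrightarrow> continuous_on S (\<lambda>x. \<sigma> (f x) (g x))"
  using s unfolding circle_act_def
  by (auto intro!: continuous_on_compose2[of UNIV "\<lambda>p. \<sigma> (fst p) (snd p)" S "\<lambda>x. (f x, g x)", simplified] continuous_intros)

lemma act_in_Omega [simp]: "\<sigma> (circ t) x \<in> \<Omega> \<longleftrightarrow> x \<in> \<Omega>"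
  using s unfolding circle_act_def by blast

lemma circle_average_act: "circle_average lborel (\<lambda>t. \<sigma> (circ t))"
proof
  show "(\<lambda>(t, x). \<sigma> (circ t) x) \<in> borel \<Otimes>\<^sub>M lborel \<rightarrow>\<^sub>M lborel"
  proof -
    have "(\<lambda>p. \<sigma> (circ (fst p)) (snd p)) \<in> borel_measurable borel"
      by (intro borel_measurable_continuous_onI continuous_intros)
    then show ?thesis
      by (simp add: case_prod_unfold borel_prod[symmetric] cong: measurable_cong_sets)
  qed
  show "distr lborel lborel (\<sigma> (circ t)) = lborel" for t
  proof -
    have "linear (\<sigma> (circ t))" "\<And>x. norm (\<sigma> (circ t) x) = norm x"
      using s unfolding circle_act_def by blast+
    from lborel_distr_linear_isometry[OF this] show ?thesis by (simp cong: distr_cong)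
  qed
qed

interpretation A: circle_average lborel "\<lambda>t. \<sigma> (circ t)"
  by (rule circle_average_act)

lemma orbit_continuous:
  assumes f: "continuous_on \<Omega> f" and x: "x \<in> \<Omega>"
  shows "continuous_on S (\<lambda>t. f (\<sigma> (circ t) x))"
  by (rule continuous_on_compose2[OF f]) (auto intro!: continuous_intros x)

lemma avg_eq: "avg \<sigma> a f x = integral {0..1} (\<lambda>t. f (\<sigma> (circ t) x) * circ t powi (- a))"
  by (simp add: avg_def fourier_coeff_def)

lemma avg_eq_unit_meas:
  assumes f: "continuous_on \<Omega> f" and x: "x \<in> \<Omega>"
  shows "avg \<sigma> a f x = (\<integral>t. f (\<sigma> (circ t) x) * circ t powi (- a) \<partial>unit_meas)"
  unfolding avg_eq by (rule integral_unit_meas[symmetric])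
     (auto intro!: borel_measurable_continuous_onI continuous_intros orbit_continuous f x)

lemma continuous_on_avg:
  assumes f: "continuous_on \<Omega> f" shows "continuous_on \<Omega> (avg \<sigma> a f)"
proof -
  have "continuous_on \<Omega> (\<lambda>x. integral (cbox 0 1) (\<lambda>t. f (\<sigma> (circ t) x) * circ t powi (- a)))"
    by (intro integral_continuous_on_param)
       (auto simp: split_beta intro!: continuous_intros continuous_on_compose2[OF f])
  then show ?thesis by (simp add: avg_eq[abs_def])
qed

lemma line_holo_avg:
  assumes f: "continuous_on \<Omega> f" and h: "line_holo f"
  shows "line_holo (avg \<sigma> a f)"
  unfolding line_holo_def avg_eq
proof (intro allI holomorphic_parametric_integral)
  fix x v :: "(complex ^ 'n) \<times> complex"
  have "{c. x + cscale c v \<in> \<Omega>} = (\<lambda>c. x + cscale c v) -` \<Omega>" by auto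
  then show "open {c. x + cscale c v \<in> \<Omega>}"
    using open_vimage[OF open_Omega continuous_on_add[OF continuous_on_const continuous_on_cscale[OF continuous_on_id]]] by simp
  show "continuous_on ({c. x + cscale c v \<in> \<Omega>} \<times> {0..1}) (\<lambda>(z, t). f (\<sigma> (circ t) (x + cscale z v)) * circ t powi - a)"
    unfolding split_beta
    by (intro continuous_intros continuous_on_compose2[OF f]) auto
  fix t
  have e: "\<sigma> (circ t) (x + cscale c v) = \<sigma> (circ t) x + cscale c (\<sigma> (circ t) v)" for c
    using s unfolding circle_act_def by blast
  have "(\<lambda>c. f (\<sigma> (circ t) x + cscale c (\<sigma> (circ t) v))) holomorphic_on {c. \<sigma> (circ t) x + cscale c (\<sigma> (circ t) v) \<in> \<Omega>}"
    using h unfolding line_holo_def by blast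
  then show "(\<lambda>z. f (\<sigma> (circ t) (x + cscale z v)) * circ t powi - a) holomorphic_on {c. x + cscale c v \<in> \<Omega>}"
    unfolding e[symmetric] act_in_Omega by (intro holomorphic_intros)
qed

text \<open>If \<open>v\<close> has rotation weight \<open>a\<close>, then averaging the invariant
  integral of \<open>f * cnj v\<close> along the orbits replaces \<open>f\<close> by its component
  of weight \<open>a\<close>: the phase of \<open>cnj v\<close> becomes the phase in the Fourier
  coefficient.\<close>

lemma
  assumes f: "continuous_on \<Omega> f" and v: "continuous_on \<Omega> v"
    and hv: "\<And>x t. x \<in> \<Omega> \<Longrightarrow> v (\<sigma> (circ t) x) = circ t powi a * v x"
    and int: "integrable lborel (\<lambda>x. indicator \<Omega> x *\<^sub>R (f x * cnj (v x)))"
  shows integrable_avg_mult: "integrable lborel (\<lambda>x. indicator \<Omega> x *\<^sub>R (avg \<sigma> a f x * cnj (v x)))"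
    and integral_avg_mult: "(\<integral>x. indicator \<Omega> x *\<^sub>R (avg \<sigma> a f x * cnj (v x)) \<partial>lborel)
      = (\<integral>x. indicator \<Omega> x *\<^sub>R (f x * cnj (v x)) \<partial>lborel)"
proof -
  have eq: "(\<integral>t. indicator \<Omega> (\<sigma> (circ t) x) *\<^sub>R (f (\<sigma> (circ t) x) * cnj (v (\<sigma> (circ t) x))) \<partial>unit_meas)
      = indicator \<Omega> x *\<^sub>R (avg \<sigma> a f x * cnj (v x))" for x
  proof (cases "x \<in> \<Omega>")
    case True
    have "cnj (circ t powi a) = circ t powi (- a)" for t
      by (simp add: circ_powi cis_cnj)
    then have k: "f (\<sigma> (circ t) x) * cnj (v (\<sigma> (circ t) x)) = (f (\<sigma> (circ t) x) * circ t powi (- a)) * cnj (v x)" for t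
      by (simp add: hv[OF True] mult.assoc)
    have "(\<integral>t. f (\<sigma> (circ t) x) * cnj (v (\<sigma> (circ t) x)) \<partial>unit_meas) = avg \<sigma> a f x * cnj (v x)"
      by (simp only: k avg_eq_unit_meas[OF f True] integral_mult_left_zero)
    then show ?thesis using True by simp
  qed (simp add: indicator_def)
  show "integrable lborel (\<lambda>x. indicator \<Omega> x *\<^sub>R (avg \<sigma> a f x * cnj (v x)))"
    using A.integrable_average[OF int] unfolding eq .
  show "(\<integral>x. indicator \<Omega> x *\<^sub>R (avg \<sigma> a f x * cnj (v x)) \<partial>lborel)
      = (\<integral>x. indicator \<Omega> x *\<^sub>R (f x * cnj (v x)) \<partial>lborel)"
    using A.integral_average[OF int] unfolding eq .
qed

lemma nn_integral_avg_sq_le: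
  assumes f: "continuous_on \<Omega> f"
  shows "(\<integral>\<^sup>+x. ennreal ((norm (avg \<sigma> a f x))\<^sup>2) * indicator \<Omega> x \<partial>lborel)
    \<le> (\<integral>\<^sup>+x. ennreal ((norm (f x))\<^sup>2) * indicator \<Omega> x \<partial>lborel)"
proof -
  let ?f = "\<lambda>x. indicator \<Omega> x *\<^sub>R f x"
  have fm: "?f \<in> borel_measurable lborel"
    using borel_measurable_continuous_on_indicator[OF _ f] open_Omega by simp
  have cm: "(\<lambda>t. circ t powi (- a)) \<in> borel_measurable borel"
    by (intro borel_measurable_continuous_onI continuous_intros) auto
  have "(\<integral>\<^sup>+x. ennreal ((norm (avg \<sigma> a f x))\<^sup>2) * indicator \<Omega> x \<partial>lborel)
      = (\<integral>\<^sup>+x. ennreal ((norm (\<integral>t. ?f (\<sigma> (circ t) x) * circ t powi (- a) \<partial>unit_meas))\<^sup>2) \<partial>lborel)"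
    by (intro nn_integral_cong) (auto simp: indicator_def avg_eq_unit_meas[OF f])
  also have "\<dots> \<le> (\<integral>\<^sup>+x. ennreal ((norm (?f x))\<^sup>2) \<partial>lborel)"
    by (rule A.nn_integral_average_sq_le[OF fm cm]) (simp del: power_int_minus)
  also have "\<dots> = (\<integral>\<^sup>+x. ennreal ((norm (f x))\<^sup>2) * indicator \<Omega> x \<partial>lborel)"
    by (intro nn_integral_cong) (auto simp: indicator_def)
  finally show ?thesis .
qed

end

end

lemma nn_integral_powr_eq_infinity:
  fixes b :: real
  assumes b: "b \<le> - 1"
  shows "(\<integral>\<^sup>+y. ennreal (y powr b) * indicator {0<..<1} y \<partial>lborel) = \<infinity>"
proof (rule ccontr)
  let ?I = "\<integral>\<^sup>+y. ennreal (y powr b) * indicator {0<..<1} y \<partial>lborel"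
  assume "?I \<noteq> \<infinity>"
  then obtain r where r: "r \<ge> 0" "?I = ennreal r" by (metis ennreal_cases infinity_ennreal_def)
  \<comment> \<open>The cutoff makes the integral of \<open>1 / y\<close> over \<open>{e..1}\<close>
    equal to \<open>r + 1\<close>, more than the assumed value \<open>r\<close>.\<close>
  define e where "e = exp (- (r + 1))"
  have e: "0 < e" "e < 1" using r by (auto simp: e_def)
  have "(\<integral>\<^sup>+y. ennreal (1 / y) * indicator {e..1} y \<partial>lborel) = ennreal (ln 1 - ln e)"
    by (rule nn_integral_FTC_Icc) (use e in \<open>auto intro!: derivative_eq_intros simp: has_real_derivative_iff_has_vector_derivative[symmetric]\<close>)
  moreover have "(\<integral>\<^sup>+y. ennreal (1 / y) * indicator {e..1} y \<partial>lborel) \<le> ?I"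
  proof (rule nn_integral_mono_AE)
    show "AE y in lborel. ennreal (1 / y) * indicator {e..1} y \<le> ennreal (y powr b) * indicator {0<..<1} y"
      using AE_lborel_singleton[of 1]
    proof eventually_elim
      case (elim y)
      have "1 / y \<le> y powr b" if "0 < y" "y < 1"
        using powr_mono'[OF b, of y] that by (simp add: powr_minus_divide)
      then show ?case using elim e by (auto simp: indicator_def intro!: ennreal_leI)
    qed
  qed
  ultimately have "ennreal (r + 1) \<le> ennreal r" by (simp add: r(2) e_def add.commute)
  then show False using r by simp
qed

section \<open>Bihomogeneous components of a holomorphic function on the domain\<close>

context hartogs
begin

text \<open>The Laurent component of degree \<open>k\<close> in \<open>z\<close> and exponent
  \<open>j\<close> in \<open>w\<close>. The index \<open>k\<close> ranges over all integers at
  first; negative degrees are shown to vanish.\<close>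

definition comp :: "((complex ^ 'n) \<times> complex \<Rightarrow> complex) \<Rightarrow> int \<Rightarrow> int \<Rightarrow> (complex ^ 'n) \<times> complex \<Rightarrow> complex" where
  "comp f k j = avg act2 j (avg act1 k f)"

text \<open>On the complex line \<open>u \<mapsto> (u *s z, w)\<close> the average is a Laurent
  coefficient of a function on a punctured disc. Its independence of the radius extends homogeneity
  from unimodular factors to all \<open>c\<close> that stay in the domain.\<close>

lemma avg1_hom:
  assumes h: "line_holo f" and x: "x \<in> \<Omega>" and c: "c \<noteq> 0" "act1 c x \<in> \<Omega>"
  shows "avg act1 k f (act1 c x) = c powi k * avg act1 k f x"
proof (cases "fst x = 0")
  \<comment> \<open>The rotation fixes a point with \<open>z = 0\<close>, so its coefficient is zero
    unless \<open>k = 0\<close>, in which case \<open>c powi k = 1\<close>.\<close>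
  case True
  then have "act1 u x = x" for u by (simp add: act1_def prod_eq_iff vec_eq_iff)
  moreover have "fourier_coeff (\<lambda>u. f x) k = f x * (if - k = 0 then 1 else 0)"
    unfolding fourier_coeff_def integral_circ_powi[symmetric] by (rule Henstock_Kurzweil_Integration.integral_mult_right)
  ultimately show ?thesis by (simp add: avg_def)
next
  case False
  obtain z w where xzw: "x = (z, w)" by force
  have z: "norm z > 0" using False xzw by simp
  have w: "w \<noteq> 0" "norm w < 1" "norm z < rad w" using x by (auto simp: xzw in_Omega_iff)
  have cz: "norm c * norm z < rad w" using c by (auto simp: xzw in_Omega_iff act1_def)
  have "(\<lambda>u. f ((0, w) + cscale u (z, 0))) holomorphic_on {u. (0, w) + cscale u (z, 0) \<in> \<Omega>}"
    using h unfolding line_holo_def by blast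
  moreover have "(0, w) + cscale u (z, 0) = act1 u x" for u
    by (simp add: act1_def xzw prod_eq_iff)
  ultimately have "(\<lambda>u. f (act1 u x)) holomorphic_on {u. act1 u x \<in> \<Omega>}" by simp
  then have "(\<lambda>u. f (act1 u x)) holomorphic_on {u. 0 < norm u \<and> norm u < rad w / norm z}"
    by (rule holomorphic_on_subset) (use z w in \<open>auto simp: act1_def xzw in_Omega_iff field_simps\<close>)
  from fourier_coeff_annulus[OF order_refl this, of 1 c k]
  have "fourier_coeff (\<lambda>u. f (act1 u x)) k = fourier_coeff (\<lambda>u. f (act1 (c * u) x)) k * c powi (- k)"
    using c z w cz by (simp add: field_simps)
  moreover have "act1 (c * u) x = act1 u (act1 c x)" for u
    by (simp add: act1_def vec_eq_iff mult_ac)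
  ultimately show ?thesis using c by (simp add: avg_def power_int_minus field_simps)
qed

text \<open>For fixed \<open>z\<close> the admissible \<open>w\<close> form the annulus between
  \<open>root l (norm z ^ m)\<close> and 1, and the Laurent coefficient there does not depend on the
  base point.\<close>

lemma avg2_hom:
  assumes h: "line_holo f" and x: "(z, w) \<in> \<Omega>" "(z, w') \<in> \<Omega>"
  shows "avg act2 j f (z, w') * w' powi (- j) = avg act2 j f (z, w) * w powi (- j)"
proof -
  define r where "r = root l (norm z ^ m)"
  have r: "norm z ^ m < norm u ^ l \<longleftrightarrow> r < norm u" for u :: complex
  proof -
    have "r < norm u \<longleftrightarrow> root l (norm z ^ m) < root l (norm u ^ l)"
      using l by (simp add: r_def real_root_power_cancel)
    then show ?thesis using l by simp
  qed
  have "(\<lambda>u. f ((z, 0) + cscale u (0, 1))) holomorphic_on {u. (z, 0) + cscale u (0, 1) \<in> \<Omega>}"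
    using h unfolding line_holo_def by blast
  moreover have "(z, 0) + cscale u (0, 1) = (z, u)" for u
    by (simp add: prod_eq_iff vec_eq_iff)
  ultimately have "(\<lambda>u. f (z, u)) holomorphic_on {u. (z, u) \<in> \<Omega>}" by simp
  then have "(\<lambda>u. f (z, u)) holomorphic_on {u. r < norm u \<and> norm u < 1}"
    by (rule holomorphic_on_subset) (use l in \<open>auto simp: hartogs_triangle_def r power_less_one_iff\<close>)
  moreover have "r < norm w" "r < norm w'" "norm w < 1" "norm w' < 1"
    using x l by (auto simp: hartogs_triangle_def r power_less_one_iff)
  moreover have "0 \<le> r" using l by (simp add: r_def real_root_ge_zero)
  ultimately have "fourier_coeff (\<lambda>u. f (z, w' * u)) j * w' powi (- j) = fourier_coeff (\<lambda>u. f (z, w * u)) j * w powi (- j)"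
    by (intro fourier_coeff_annulus[where ?r1.0=r and ?r2.0=1])
  then show ?thesis by (simp add: avg_def act2_def mult.commute)
qed

lemma comp_continuous: "continuous_on \<Omega> f \<Longrightarrow> continuous_on \<Omega> (comp f k j)"
  unfolding comp_def by (intro continuous_on_avg circle_act_act1 circle_act_act2)

lemma comp_line_holo: "continuous_on \<Omega> f \<Longrightarrow> line_holo f \<Longrightarrow> line_holo (comp f k j)"
  unfolding comp_def by (intro continuous_on_avg line_holo_avg circle_act_act1 circle_act_act2)

lemma comp_hom1:
  assumes h: "line_holo f" and x: "x \<in> \<Omega>" and c: "c \<noteq> 0" "act1 c x \<in> \<Omega>"
  shows "comp f k j (act1 c x) = c powi k * comp f k j x"
proof -
  have "avg act1 k f (act2 (circ t) (act1 c x)) = c powi k * avg act1 k f (act2 (circ t) x)" for t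
  proof -
    have "act2 (circ t) (act1 c x) = act1 c (act2 (circ t) x)" by (simp add: act1_def act2_def)
    moreover have "act2 (circ t) x \<in> \<Omega>" using x by (simp add: act_in_Omega circle_act_act2)
    moreover have "act1 c (act2 (circ t) x) \<in> \<Omega>"
      using c act_in_Omega[OF circle_act_act2, of t "act1 c x"] by (simp add: calculation)
    ultimately show ?thesis using avg1_hom[OF h _ c(1)] by simp
  qed
  then show ?thesis
    by (simp add: comp_def avg_def[of act2] fourier_coeff_def mult.assoc)
qed

lemma comp_hom2:
  assumes "continuous_on \<Omega> f" "line_holo f" "(z, w) \<in> \<Omega>" "(z, w') \<in> \<Omega>"
  shows "comp f k j (z, w') * w' powi (- j) = comp f k j (z, w) * w powi (- j)"
  unfolding comp_def using assms by (intro avg2_hom line_holo_avg circle_act_act1)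

text \<open>The point \<open>(0, w)\<close> belongs to the domain. Shrinking \<open>z\<close>
  towards 0 keeps the component bounded by continuity, while a negative degree makes it grow unless
  it is zero.\<close>

lemma comp_negative:
  assumes f: "continuous_on \<Omega> f" "line_holo f" and k: "k < 0" and x: "x \<in> \<Omega>"
  shows "comp f k j x = 0"
proof -
  obtain z w where xzw: "x = (z, w)" by force
  have w: "w \<noteq> 0" "norm w < 1" "norm z < rad w" using x by (auto simp: xzw in_Omega_iff)
  define c :: "nat \<Rightarrow> complex" where "c i = inverse (of_nat (Suc i))" for i
  have nc: "norm (c i) \<le> 1" "c i \<noteq> 0" for i
    by (simp_all add: c_def norm_inverse inverse_le_1_iff del: of_nat_Suc)
  have in0: "(c i *s z, w) \<in> \<Omega>" for i
    using w mult_right_mono[OF nc(1)[of i], of "norm z"] by (auto simp: in_Omega_iff)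
  have c0: "c \<longlonglongrightarrow> 0"
    unfolding c_def using LIMSEQ_inverse_real_of_nat
    by (simp add: tendsto_of_real_iff[symmetric, where 'a=complex] del: of_nat_Suc tendsto_of_real_iff) 
  have eq: "comp f k j x = c i ^ nat (- k) * comp f k j (c i *s z, w)" for i
    using comp_hom1[OF f(2) x nc(2)[of i], of k j] in0[of i] k nc(2)[of i]
    by (simp add: act1_def xzw power_int_def field_simps)
  have "(\<lambda>i. (c i *s z, w)) \<longlonglongrightarrow> (0 *s z, w)"
    unfolding vector_scalar_mult_def by (intro tendsto_intros tendsto_vec_lambda c0)
  then have "(\<lambda>i. comp f k j (c i *s z, w)) \<longlonglongrightarrow> comp f k j (0 *s z, w)"
    using in0 w by (intro continuous_on_tendsto_compose[OF comp_continuous[OF f(1)]]) (auto simp: in_Omega_iff rad_pos)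
  then have "(\<lambda>i. c i ^ nat (- k) * comp f k j (c i *s z, w)) \<longlonglongrightarrow> 0 ^ nat (- k) * comp f k j (0 *s z, w)"
    by (intro tendsto_intros c0)
  then have "(\<lambda>i. comp f k j x) \<longlonglongrightarrow> 0" using k by (simp add: eq[symmetric] power_0_left)
  then show ?thesis by (simp add: LIMSEQ_const_iff)
qed

text \<open>The factor \<open>p\<close> is read off on the slice over one fixed \<open>w0\<close>,
  where \<open>z\<close> only ranges over a ball, and is extended to all \<open>z\<close> by
  homogeneity. The \<open>w\<close>-dependence follows from \<open>comp_hom2\<close>.\<close>

lemma comp_form:
  assumes f: "continuous_on \<Omega> f" "line_holo f"
  obtains p where "hom_holo p k" "\<And>z w. (z, w) \<in> \<Omega> \<Longrightarrow> comp f (int k) j (z, w) = p z * w powi j"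
proof -
  define F where "F = comp f (int k) j"
  define w0 :: complex where "w0 = 1 / 2"
  define r0 where "r0 = rad w0"
  have w0: "w0 \<noteq> 0" "norm w0 < 1" by (simp_all add: w0_def)
  have r0: "r0 > 0" using w0 rad_pos by (simp add: r0_def)
  have inw0: "(z, w0) \<in> \<Omega> \<longleftrightarrow> norm z < r0" for z using w0 by (simp add: in_Omega_iff r0_def)
  \<comment> \<open>A continuous scale that moves \<open>z\<close> into the slice over
    \<open>w0\<close>. By homogeneity every other sufficiently large scale \<open>M\<close> yields
    the same value of \<open>p\<close>.\<close>
  define N where "N z = (norm z + 1) / r0" for z :: "complex ^ 'n"
  have N: "N z > 0" "norm z / N z < r0" for z :: "complex ^ 'n"
    using r0 norm_ge_zero[of z] by (auto simp: N_def field_simps add_pos_nonneg)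
  have F1: "F (c *s z, w) = c ^ k * F (z, w)" if "(z, w) \<in> \<Omega>" "(c *s z, w) \<in> \<Omega>" "c \<noteq> 0" for c z w
    using comp_hom1[OF f(2) that(1,3)] that by (simp add: F_def act1_def)
  define p where "p z = of_real (N z) ^ k * F (of_real (1 / N z) *s z, w0) * w0 powi (- j)" for z
  have p: "p z = of_real M ^ k * F (of_real (1 / M) *s z, w0) * w0 powi (- j)" if M: "M > 0" "norm z < r0 * M" for M z
  proof -
    have "of_real (1 / M) *s z = of_real (N z / M) *s (of_real (1 / N z) *s z)"
      using N[of z] by (simp add: vec_eq_iff)
    then have "F (of_real (1 / M) *s z, w0) = of_real (N z / M) ^ k * F (of_real (1 / N z) *s z, w0)"
      using F1[of "of_real (1 / N z) *s z" w0 "of_real (N z / M)"] N[of z] M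
      by (simp add: inw0 norm_divide field_simps)
    then show ?thesis using M by (simp add: p_def power_divide)
  qed
  have cF: "continuous_on \<Omega> F" unfolding F_def by (rule comp_continuous[OF f(1)])
  have "continuous_on UNIV p"
    unfolding p_def
  proof (intro continuous_intros continuous_on_compose2[OF cF])
    show "(\<lambda>z. (complex_of_real (1 / N z) *s z, w0)) ` UNIV \<subseteq> \<Omega>"
      using N by (auto simp: inw0 norm_divide less_imp_le) 
  qed (use N in \<open>auto simp: N_def less_imp_neq[symmetric] r0 add_nonneg_eq_0_iff intro!: continuous_intros\<close>)
  moreover have "(\<lambda>c. p (z + c *s v)) holomorphic_on UNIV" for z v
    unfolding holomorphic_on_open[OF open_UNIV]
  proof
    fix c0 :: complex
    \<comment> \<open>The scale \<open>N\<close> depends on the norm and is not holomorphic in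
      \<open>c\<close>. One constant scale that works for all \<open>c\<close> in
      \<open>ball c0 1\<close> replaces it, and then \<open>p\<close> is a constant multiple of
      \<open>F\<close> along a line.\<close>
    define M where "M = (norm z + (norm c0 + 1) * norm v + 1) / r0"
    have M: "M > 0" using r0 by (auto simp: M_def intro!: divide_pos_pos add_nonneg_pos)
    have b: "norm (z + c *s v) < r0 * M" if "c \<in> ball c0 1" for c
    proof -
      have "norm c \<le> norm c0 + 1" using that norm_triangle_sub[of c c0] by (simp add: dist_norm norm_minus_commute)
      then have "norm c * norm v \<le> (norm c0 + 1) * norm v" by (intro mult_right_mono) auto
      then have "norm (z + c *s v) \<le> norm z + (norm c0 + 1) * norm v"
        using norm_triangle_ineq[of z "c *s v"] by simp
      also have "\<dots> < r0 * M" using r0 by (simp add: M_def)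
      finally show ?thesis .
    qed
    have "(\<lambda>c. F ((of_real (1 / M) *s z, w0) + cscale c (of_real (1 / M) *s v, 0))) holomorphic_on
        {c. (of_real (1 / M) *s z, w0) + cscale c (of_real (1 / M) *s v, 0) \<in> \<Omega>}"
      using comp_line_holo[OF f] unfolding F_def line_holo_def by blast
    moreover have e: "(of_real (1 / M) *s z, w0) + cscale c (of_real (1 / M) *s v, 0) = (of_real (1 / M) *s (z + c *s v), w0)" for c
      by (simp add: cscale_def vec_eq_iff algebra_simps)
    ultimately have "(\<lambda>c. F (of_real (1 / M) *s (z + c *s v), w0)) holomorphic_on {c. (of_real (1 / M) *s (z + c *s v), w0) \<in> \<Omega>}"
      by (simp only: e)
    then have "(\<lambda>c. F (of_real (1 / M) *s (z + c *s v), w0)) holomorphic_on ball c0 1"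
    proof (rule holomorphic_on_subset)
      show "ball c0 1 \<subseteq> {c. (complex_of_real (1 / M) *s (z + c *s v), w0) \<in> \<Omega>}"
      proof
        fix c assume "c \<in> ball c0 1"
        from b[OF this] have "norm (complex_of_real (1 / M) *s (z + c *s v)) < r0"
          unfolding norm_vector_smult using M by (simp add: norm_divide field_simps)
        then show "c \<in> {c. (complex_of_real (1 / M) *s (z + c *s v), w0) \<in> \<Omega>}" by (simp add: inw0)
      qed
    qed
    then have "(\<lambda>c. of_real M ^ k * F (of_real (1 / M) *s (z + c *s v), w0) * w0 powi (- j)) holomorphic_on ball c0 1"
      by (intro holomorphic_intros)
    then have "(\<lambda>c. p (z + c *s v)) holomorphic_on ball c0 1"
      by (rule holomorphic_transform) (use p[OF M b] in auto)
    then show "\<exists>f'. ((\<lambda>c. p (z + c *s v)) has_field_derivative f') (at c0)"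
      by (auto simp: holomorphic_on_open)
  qed
  moreover have "p (c *s z) = c ^ k * p z" if c: "c \<noteq> 0" for c z
  proof -
    define M where "M = (norm z + norm c * norm z + 1) / r0"
    have rM: "r0 * M = norm z + norm c * norm z + 1" using r0 by (simp add: M_def)
    have nn: "0 \<le> norm c * norm z" "0 \<le> norm z" by simp_all
    have M: "M > 0" "norm z < r0 * M" "norm (c *s z) < r0 * M"
      unfolding rM norm_vector_smult using nn r0
      by (auto simp only: M_def intro!: divide_pos_pos)
    have "of_real (1 / M) *s (c *s z) = c *s (of_real (1 / M) *s z)" by (simp add: vec_eq_iff)
    then have "F (of_real (1 / M) *s (c *s z), w0) = c ^ k * F (of_real (1 / M) *s z, w0)"
      using M c by (subst F1[symmetric]) (auto simp: inw0 norm_divide norm_mult field_simps)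
    then show ?thesis using p[OF M(1,2)] p[OF M(1,3)] by simp
  qed
  ultimately have "hom_holo p k" by (auto simp: hom_holo_def)
  moreover have "F (z, w) = p z * w powi j" if x: "(z, w) \<in> \<Omega>" for z w
  proof -
    have w: "w \<noteq> 0" "norm w < 1" "norm z < rad w" using x by (auto simp: in_Omega_iff)
    \<comment> \<open>Being at least 1, the scale keeps \<open>z / M\<close> in the fibre over
      \<open>w\<close>; being large, it also brings \<open>z / M\<close> into the fibre over
      \<open>w0\<close>, so the two slices can be compared.\<close>
    define M where "M = 1 + (norm z + 1) / r0"
    have M: "M > 0" "M \<ge> 1" "norm z < r0 * M" using r0 by (auto simp: M_def field_simps intro!: add_nonneg_pos add_pos_nonneg)
    have "norm z / M \<le> norm z" using M divide_left_mono[of 1 M "norm z"] by simp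
    then have 1: "(of_real (1 / M) *s z, w) \<in> \<Omega>" "(of_real (1 / M) *s z, w0) \<in> \<Omega>"
    proof -
      have e: "norm (complex_of_real (1 / M) *s z) = norm z / M"
        unfolding norm_vector_smult using M by (simp add: norm_divide)
      have "norm z / M < r0" using M by (simp add: field_simps)
      then show "(of_real (1 / M) *s z, w0) \<in> \<Omega>" by (simp only: inw0 e)
      show "(of_real (1 / M) *s z, w) \<in> \<Omega>"
        using w \<open>norm z / M \<le> norm z\<close> by (simp only: in_Omega_iff e) simp
    qed
    have "F (of_real (1 / M) *s z, w) * w powi (- j) = F (of_real (1 / M) *s z, w0) * w0 powi (- j)"
      unfolding F_def using comp_hom2[OF f 1(2,1)] .
    then have "F (of_real (1 / M) *s z, w) = F (of_real (1 / M) *s z, w0) * w0 powi (- j) * w powi j"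
      using w by (simp add: power_int_minus field_simps)
    moreover have "F (z, w) = of_real M ^ k * F (of_real (1 / M) *s z, w)"
      using F1[of "of_real (1 / M) *s z" w "of_real M"] 1 x M by simp
    ultimately show ?thesis using p[OF M(1,3)] by simp
  qed
  ultimately show ?thesis using that unfolding F_def by blast
qed


section \<open>Moments in the coordinates \<open>Xc\<close> and \<open>Yc\<close>\<close>

definition Xc :: "(complex ^ 'n) \<times> complex \<Rightarrow> real" where "Xc x = (norm (fst x) / rad (snd x))\<^sup>2"
definition Yc :: "(complex ^ 'n) \<times> complex \<Rightarrow> real" where "Yc x = (norm (snd x))\<^sup>2"
text \<open>A term of degree \<open>k\<close> in \<open>z\<close> and exponent \<open>j\<close> in
  \<open>w\<close>, squared and integrated over the fibre ball of radius \<open>rad w\<close>,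
  contributes \<open>Yc powr (\<beta> k j - 1)\<close> to the remaining integral over
  \<open>{0<..<1}\<close>. Hence a nonzero term is square integrable exactly when
  \<open>\<beta> k j > 0\<close>.\<close>

definition \<beta> :: "nat \<Rightarrow> int \<Rightarrow> real" where "\<beta> k j = of_int j + real l / real m * real (k + CARD('n)) + 1"

lemma Xc_Yc_in_Omega:
  assumes "x \<in> \<Omega>" shows "0 \<le> Xc x" "Xc x < 1" "0 < Yc x" "Yc x < 1"
proof -
  obtain z w where x: "x = (z, w)" by force
  have w: "w \<noteq> 0" "norm w < 1" "norm z < rad w" using assms by (auto simp: x in_Omega_iff)
  show "0 \<le> Xc x" "0 < Yc x" using w by (simp_all add: Xc_def Yc_def x)
  show "Yc x < 1" using w by (simp add: Yc_def x power_less_one_iff)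
  show "Xc x < 1" using w rad_pos[of w] by (simp add: Xc_def x power_less_one_iff)
qed

lemma rad_measurable [measurable]: "rad \<in> borel_measurable borel"
  unfolding rad_def by measurable

lemma fst_measurable_borel [measurable]: "fst \<in> borel_measurable (borel :: ('a::second_countable_topology \<times> 'b::second_countable_topology) measure)"
  and snd_measurable_borel [measurable]: "snd \<in> borel_measurable (borel :: ('a::second_countable_topology \<times> 'b::second_countable_topology) measure)"
  by (auto intro!: borel_measurable_continuous_onI continuous_intros)

lemma Xc_measurable [measurable]: "Xc \<in> borel_measurable borel"
  and Yc_measurable [measurable]: "Yc \<in> borel_measurable borel"
  unfolding Xc_def Yc_def by measurable

lemma powi_measurable [measurable]: "(\<lambda>w::complex. w powi j) \<in> borel_measurable borel"
  unfolding power_int_def by (cases "j \<ge> 0") auto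

lemma weight_eq:
  assumes "w \<noteq> 0"
  shows "(norm (w powi j))\<^sup>2 * ((rad w)\<^sup>2) ^ (k + CARD('n)) = ((norm w)\<^sup>2) powr (\<beta> k j - 1)"
proof -
  have w: "norm w > 0" using assms by simp
  have "(norm (w powi j))\<^sup>2 = norm w powr (2 * of_int j)"
    using w by (simp add: norm_power_int powr_real_of_int'[symmetric] power2_eq_square powr_add[symmetric])
  moreover have "((rad w)\<^sup>2) ^ (k + CARD('n)) = norm w powr (2 * (real l / real m * real (k + CARD('n))))"
    using w by (simp add: rad_def powr_realpow[symmetric] powr_powr power_mult[symmetric] mult_ac)
  moreover have "((norm w)\<^sup>2) powr (\<beta> k j - 1) = norm w powr (2 * (\<beta> k j - 1))"
    using w powr_powr[of "norm w" 2 "\<beta> k j - 1"] by simp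
  ultimately show ?thesis
    by (simp only: powr_add[symmetric]) (simp add: \<beta>_def algebra_simps)
qed

lemma nn_integral_radial_complex:
  assumes [measurable]: "\<phi> \<in> borel_measurable borel"
  shows "(\<integral>\<^sup>+w. \<phi> ((norm (w::complex))\<^sup>2) \<partial>lborel) = ennreal pi * (\<integral>\<^sup>+y. \<phi> y * indicator {0<..} y \<partial>lborel)"
proof -
  have "emeasure lborel (ball (0::complex) 1) = ennreal pi"
    using emeasure_ball[of 1 "0::complex"] by (simp add: unit_ball_vol_2)
  then have "(\<integral>\<^sup>+w. ennreal 1 * \<phi> ((norm (w::complex))\<^sup>2) \<partial>lborel)
     = ennreal (pi * 1) * (\<integral>\<^sup>+y. ennreal (y powr (1 - 1)) * \<phi> y * indicator {0<..} y \<partial>lborel)"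
    by (intro nn_integral_homogeneous_radial[where k=0]) simp_all
  also have "(\<integral>\<^sup>+y. ennreal (y powr (1 - 1)) * \<phi> y * indicator {0<..} y \<partial>lborel) = (\<integral>\<^sup>+y. \<phi> y * indicator {0<..} y \<partial>lborel)"
    by (intro nn_integral_cong) (auto simp: indicator_def)
  finally show ?thesis by simp
qed

text \<open>For fixed \<open>w\<close>, dilating \<open>z\<close> by \<open>rad w\<close> turns the
  fibre into the unit ball and releases the factor \<open>rad w ^ (2 * (k + n))\<close>, which
  combines with the power of \<open>w\<close>. What is left is a product of two radial integrals,
  one in each coordinate.\<close>

lemma nn_integral_moment:
  fixes G :: "complex ^ 'n \<Rightarrow> real"
  assumes [measurable]: "G \<in> borel_measurable borel" "\<phi>1 \<in> borel_measurable borel" "\<phi>2 \<in> borel_measurable borel"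
    and G0: "\<And>z. G z \<ge> 0" and hom: "\<And>r z. r > 0 \<Longrightarrow> G (r *\<^sub>R z) = r ^ (2 * k) * G z"
    and M: "(\<integral>\<^sup>+z. ennreal (G z) * indicator (ball 0 1) z \<partial>lborel) = ennreal M" "M \<ge> 0"
  shows "(\<integral>\<^sup>+x. ennreal (G (fst x) * (norm (snd x powi j))\<^sup>2) * \<phi>1 (Xc x) * \<phi>2 (Yc x) * indicator \<Omega> x \<partial>lborel)
    = (ennreal (M * real (k + CARD('n))) * (\<integral>\<^sup>+x. ennreal (x powr (real (k + CARD('n)) - 1)) * \<phi>1 x * indicator {0<..<1} x \<partial>lborel))
    * (ennreal pi * (\<integral>\<^sup>+y. ennreal (y powr (\<beta> k j - 1)) * \<phi>2 y * indicator {0<..<1} y \<partial>lborel))"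
proof -
  define A where "A = ennreal (M * real (k + CARD('n))) * (\<integral>\<^sup>+x. ennreal (x powr (real (k + CARD('n)) - 1)) * \<phi>1 x * indicator {0<..<1} x \<partial>lborel)"
  let ?h = "\<lambda>x. ennreal (G (fst x) * (norm (snd x powi j))\<^sup>2) * \<phi>1 (Xc x) * \<phi>2 (Yc x) * indicator \<Omega> x"
  have A: "(\<integral>\<^sup>+z. ennreal (G z) * (\<phi>1 ((norm z)\<^sup>2) * indicator {..<1} ((norm z)\<^sup>2)) \<partial>lborel) = A"
  proof -
    have "(\<integral>\<^sup>+z. ennreal (G z) * (\<phi>1 ((norm z)\<^sup>2) * indicator {..<1} ((norm z)\<^sup>2)) \<partial>lborel)
      = ennreal (M * real (k + CARD('n))) * (\<integral>\<^sup>+x. ennreal (x powr (real (k + CARD('n)) - 1)) * (\<phi>1 x * indicator {..<1} x) * indicator {0<..} x \<partial>lborel)"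
      by (rule nn_integral_homogeneous_radial[OF _ _ G0 hom _ M]) auto
    also have "(\<lambda>x. ennreal (x powr (real (k + CARD('n)) - 1)) * (\<phi>1 x * indicator {..<1} x) * indicator {0<..} x)
        = (\<lambda>x. ennreal (x powr (real (k + CARD('n)) - 1)) * \<phi>1 x * indicator {0<..<1} x)"
      by (auto simp: indicator_def fun_eq_iff)
    also have "ennreal (M * real (k + CARD('n))) * (\<integral>\<^sup>+x. ennreal (x powr (real (k + CARD('n)) - 1)) * \<phi>1 x * indicator {0<..<1} x \<partial>lborel) = A"
      unfolding A_def ..
    finally show ?thesis .
  qed
  have inner: "(\<integral>\<^sup>+z. ?h (z, w) \<partial>lborel) = A * (ennreal (((norm w)\<^sup>2) powr (\<beta> k j - 1)) * \<phi>2 ((norm w)\<^sup>2) * indicator {0<..<1} ((norm w)\<^sup>2))" for w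
  proof (cases "w \<noteq> 0 \<and> norm w < 1")
    case False
    then have "(norm w)\<^sup>2 \<notin> {0<..<1}" by (auto simp: power_less_one_iff)
    then show ?thesis using False by (auto simp: in_Omega_iff indicator_def)
  next
    case True
    then have R: "rad w > 0" by (simp add: rad_pos)
    let ?c = "ennreal ((norm (w powi j))\<^sup>2) * \<phi>2 ((norm w)\<^sup>2)"
    have "(\<integral>\<^sup>+z. ?h (z, w) \<partial>lborel) = (\<integral>\<^sup>+z. ?c * (ennreal (G z) * \<phi>1 ((norm z / rad w)\<^sup>2) * indicator {..<rad w} (norm z)) \<partial>lborel)"
      using True by (intro nn_integral_cong) (auto simp: in_Omega_iff indicator_def Xc_def Yc_def ennreal_mult G0 mult_ac)
    also have "\<dots> = ?c * (\<integral>\<^sup>+z. ennreal (G z) * \<phi>1 ((norm z / rad w)\<^sup>2) * indicator {..<rad w} (norm z) \<partial>lborel)"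
      by (rule nn_integral_cmult) measurable
    also have "(\<integral>\<^sup>+z. ennreal (G z) * \<phi>1 ((norm z / rad w)\<^sup>2) * indicator {..<rad w} (norm z) \<partial>lborel)
      = ennreal (rad w ^ (2 * CARD('n))) * (\<integral>\<^sup>+z. ennreal (G (rad w *\<^sub>R z)) * \<phi>1 ((norm (rad w *\<^sub>R z) / rad w)\<^sup>2) * indicator {..<rad w} (norm (rad w *\<^sub>R z)) \<partial>lborel)"
      by (subst nn_integral_lborel_affine[where t=0 and c="rad w"]) (use R in \<open>auto simp: mult.commute[of 2]\<close>)
    also have "(\<integral>\<^sup>+z. ennreal (G (rad w *\<^sub>R z)) * \<phi>1 ((norm (rad w *\<^sub>R z) / rad w)\<^sup>2) * indicator {..<rad w} (norm (rad w *\<^sub>R z)) \<partial>lborel)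
      = (\<integral>\<^sup>+z. ennreal (rad w ^ (2 * k)) * (ennreal (G z) * (\<phi>1 ((norm z)\<^sup>2) * indicator {..<1} ((norm z)\<^sup>2))) \<partial>lborel)"
      using R by (intro nn_integral_cong) (auto simp: hom ennreal_mult G0 indicator_def power_less_one_iff mult_ac)
    also have "\<dots> = ennreal (rad w ^ (2 * k)) * A"
      unfolding A[symmetric] by (rule nn_integral_cmult) measurable
    finally have "(\<integral>\<^sup>+z. ?h (z, w) \<partial>lborel) = A * ((ennreal ((norm (w powi j))\<^sup>2) * (ennreal (rad w ^ (2 * CARD('n))) * ennreal (rad w ^ (2 * k)))) * \<phi>2 ((norm w)\<^sup>2))"
      by (simp only: mult_ac)
    also have "ennreal ((norm (w powi j))\<^sup>2) * (ennreal (rad w ^ (2 * CARD('n))) * ennreal (rad w ^ (2 * k)))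
        = ennreal (((norm w)\<^sup>2) powr (\<beta> k j - 1))"
      using R True by (subst weight_eq[of w j k, symmetric]) (auto simp: ennreal_mult[symmetric] power_add power_mult[symmetric] mult_ac)
    finally show ?thesis using True by (simp add: indicator_def power_less_one_iff)
  qed
  have hm: "?h \<in> borel_measurable (borel \<Otimes>\<^sub>M borel)"
    unfolding borel_prod by measurable
  have "(\<integral>\<^sup>+x. ?h x \<partial>lborel) = (\<integral>\<^sup>+w. (\<integral>\<^sup>+z. ?h (z, w) \<partial>lborel) \<partial>lborel)"
    unfolding lborel_prod[symmetric] using hm by (intro lborel_pair.nn_integral_snd[symmetric]) (simp cong: measurable_cong_sets)
  also have "\<dots> = A * (\<integral>\<^sup>+w. ennreal (((norm (w::complex))\<^sup>2) powr (\<beta> k j - 1)) * \<phi>2 ((norm w)\<^sup>2) * indicator {0<..<1} ((norm w)\<^sup>2) \<partial>lborel)"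
    unfolding inner by (rule nn_integral_cmult) measurable
  also have "(\<integral>\<^sup>+w. ennreal (((norm (w::complex))\<^sup>2) powr (\<beta> k j - 1)) * \<phi>2 ((norm w)\<^sup>2) * indicator {0<..<1} ((norm w)\<^sup>2) \<partial>lborel)
      = ennreal pi * (\<integral>\<^sup>+y. ennreal (y powr (\<beta> k j - 1)) * \<phi>2 y * indicator {0<..<1} y * indicator {0<..} y \<partial>lborel)"
    by (rule nn_integral_radial_complex) measurable
  also have "(\<integral>\<^sup>+y. ennreal (y powr (\<beta> k j - 1)) * \<phi>2 y * indicator {0<..<1} y * indicator {0<..} y \<partial>lborel)
      = (\<integral>\<^sup>+y. ennreal (y powr (\<beta> k j - 1)) * \<phi>2 y * indicator {0<..<1} y \<partial>lborel)"
    by (intro nn_integral_cong) (auto simp: indicator_def)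
  finally show ?thesis unfolding A_def .
qed


text \<open>The reciprocal of the reproducing constant on the fibre ball times
  \<open>pi / \<beta> k j\<close> from the integral over \<open>w\<close>; this normalisation makes
  \<open>uu k j\<close> reproduce its component.\<close>

definition cc :: "nat \<Rightarrow> int \<Rightarrow> real" where
  "cc k j = fact (k + CARD('n)) / (fact k * pi ^ (CARD('n) + 1)) * \<beta> k j"

definition uu :: "nat \<Rightarrow> int \<Rightarrow> (complex ^ 'n) \<times> complex \<Rightarrow> (complex ^ 'n) \<times> complex \<Rightarrow> complex" where
  "uu k j y x = of_real (cc k j) * hprod (fst x) (fst y) ^ k * (snd x * cnj (snd y)) powi j"

text \<open>The fibre volume and the line element in \<open>Yc\<close> enter the integrated exponent
  \<open>\<beta>\<close> but not the pointwise size of a term, which is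
  \<open>Yc powr (\<beta> k j - \<nu>)\<close>.\<close>

definition \<nu> :: real where "\<nu> = real (m + CARD('n) * l) / real m"

lemma diag_weight:
  assumes y: "y \<in> \<Omega>"
  shows "norm (fst y) ^ (2 * k) * (norm (snd y powi j))\<^sup>2 = Xc y ^ k * Yc y powr (\<beta> k j - \<nu>)"
proof -
  obtain z w where yzw: "y = (z, w)" by force
  have w: "w \<noteq> 0" using y by (auto simp: yzw in_Omega_iff)
  have r: "rad w > 0" using w by (rule rad_pos)
  have "norm z ^ (2 * k) = Xc y ^ k * ((rad w)\<^sup>2) ^ k"
    using r by (simp add: Xc_def yzw power_mult power_divide)
  moreover have "(norm (w powi j))\<^sup>2 * ((rad w)\<^sup>2) ^ k = Yc y powr (\<beta> k j - \<nu>)"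
  proof -
    have 0: "((rad w)\<^sup>2) ^ CARD('n) = Yc y powr (\<nu> - 1)"
      using weight_eq[OF w, of 0 0] m by (simp add: \<beta>_def Yc_def yzw \<nu>_def add_divide_distrib mult.commute)
    have "((norm (w powi j))\<^sup>2 * ((rad w)\<^sup>2) ^ k) * ((rad w)\<^sup>2) ^ CARD('n) = Yc y powr (\<beta> k j - 1)"
      using weight_eq[OF w, of j k] by (simp add: Yc_def yzw power_add mult.assoc)
    also have "\<dots> = Yc y powr (\<beta> k j - \<nu>) * Yc y powr (\<nu> - 1)"
      by (simp add: powr_add[symmetric])
    finally show ?thesis using w by (simp add: 0 Yc_def yzw)
  qed
  ultimately show ?thesis by (simp add: yzw mult_ac)
qed

lemma cc_pos: "\<beta> k j > 0 \<Longrightarrow> cc k j > 0"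
  by (simp add: cc_def)

lemma norm_uu_sq:
  "(norm (uu k j y x))\<^sup>2 = (cc k j)\<^sup>2 * (norm (snd y powi j))\<^sup>2 * (norm (hprod (fst x) (fst y)) ^ (2 * k) * (norm (snd x powi j))\<^sup>2)"
  by (simp add: uu_def norm_mult norm_power norm_power_int power_mult_distrib power_int_mult_distrib power_mult[symmetric] mult_ac)

lemma uu_moment:
  assumes [measurable]: "\<phi>1 \<in> borel_measurable borel" "\<phi>2 \<in> borel_measurable borel" and b: "\<beta> k j > 0"
  shows "(\<integral>\<^sup>+x. ennreal ((norm (uu k j y x))\<^sup>2) * \<phi>1 (Xc x) * \<phi>2 (Yc x) * indicator \<Omega> x \<partial>lborel)
    = ennreal (cc k j * \<beta> k j * real (k + CARD('n)) * (norm (fst y) ^ (2 * k) * (norm (snd y powi j))\<^sup>2))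
      * (\<integral>\<^sup>+x. ennreal (x powr (real (k + CARD('n)) - 1)) * \<phi>1 x * indicator {0<..<1} x \<partial>lborel)
      * (\<integral>\<^sup>+y. ennreal (y powr (\<beta> k j - 1)) * \<phi>2 y * indicator {0<..<1} y \<partial>lborel)"
proof -
  let ?M = "pi ^ CARD('n) * fact k / fact (k + CARD('n)) * norm (fst y) ^ (2 * k)"
  let ?c = "(cc k j)\<^sup>2 * (norm (snd y powi j))\<^sup>2"
  let ?I1 = "\<integral>\<^sup>+x. ennreal (x powr (real (k + CARD('n)) - 1)) * \<phi>1 x * indicator {0<..<1} x \<partial>lborel"
  let ?I2 = "\<integral>\<^sup>+y. ennreal (y powr (\<beta> k j - 1)) * \<phi>2 y * indicator {0<..<1} y \<partial>lborel"
  have hm[measurable]: "(\<lambda>z. hprod z (fst y)) \<in> borel_measurable borel"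
    by (intro borel_measurable_continuous_onI continuous_intros)
  have "(\<integral>\<^sup>+x. ennreal ((norm (uu k j y x))\<^sup>2) * \<phi>1 (Xc x) * \<phi>2 (Yc x) * indicator \<Omega> x \<partial>lborel)
      = (\<integral>\<^sup>+x. ennreal ?c * (ennreal (norm (hprod (fst x) (fst y)) ^ (2 * k) * (norm (snd x powi j))\<^sup>2) * \<phi>1 (Xc x) * \<phi>2 (Yc x) * indicator \<Omega> x) \<partial>lborel)"
    by (intro nn_integral_cong) (simp add: norm_uu_sq ennreal_mult mult_ac)
  also have "\<dots> = ennreal ?c * (\<integral>\<^sup>+x. ennreal (norm (hprod (fst x) (fst y)) ^ (2 * k) * (norm (snd x powi j))\<^sup>2) * \<phi>1 (Xc x) * \<phi>2 (Yc x) * indicator \<Omega> x \<partial>lborel)"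
    by (rule nn_integral_cmult) measurable
  also have "(\<integral>\<^sup>+x. ennreal (norm (hprod (fst x) (fst y)) ^ (2 * k) * (norm (snd x powi j))\<^sup>2) * \<phi>1 (Xc x) * \<phi>2 (Yc x) * indicator \<Omega> x \<partial>lborel)
      = (ennreal (?M * real (k + CARD('n))) * ?I1) * (ennreal pi * ?I2)"
    by (rule nn_integral_moment)
       (auto simp: nn_integral_ball_hprod scaleR_eq_smult hprod_scale_left norm_mult power_mult_distrib)
  also have "ennreal ?c * ((ennreal (?M * real (k + CARD('n))) * ?I1) * (ennreal pi * ?I2)) = ennreal ?c * (ennreal (?M * real (k + CARD('n))) * ennreal pi) * ?I1 * ?I2"
    by (simp only: mult_ac)
  also have "ennreal ?c * (ennreal (?M * real (k + CARD('n))) * ennreal pi) = ennreal (?c * (?M * real (k + CARD('n)) * pi))"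
    by (simp add: ennreal_mult[symmetric])
  also have "?c * (?M * real (k + CARD('n)) * pi) = cc k j * \<beta> k j * real (k + CARD('n)) * (norm (fst y) ^ (2 * k) * (norm (snd y powi j))\<^sup>2)"
    by (simp add: cc_def power2_eq_square field_simps)
  finally show ?thesis .
qed

lemma nn_integral_powr_01:
  fixes d :: real
  shows "d > 0 \<Longrightarrow> (\<integral>\<^sup>+x. ennreal (x powr (d - 1)) * 1 * indicator {0<..<1} x \<partial>lborel) = ennreal (1 / d)"
  using nn_integral_powr_Icc[of d 1] by simp

lemma uu_norm_sq:
  assumes b: "\<beta> k j > 0"
  shows "(\<integral>\<^sup>+x. ennreal ((norm (uu k j y x))\<^sup>2) * indicator \<Omega> x \<partial>lborel)
    = ennreal (cc k j * (norm (fst y) ^ (2 * k) * (norm (snd y powi j))\<^sup>2))"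
proof -
  have "0 < real (k + CARD('n))" by (simp add: add_nonneg_pos)
  then show ?thesis
    using uu_moment[of "\<lambda>_. 1" "\<lambda>_. 1" k j y] b cc_pos[OF b]
    by (simp add: nn_integral_powr_01[simplified] ennreal_mult[symmetric] del: of_nat_add)
qed

text \<open>The form in which membership in the Bergman space is used: continuity, holomorphy on
  lines, and square integrability with respect to Borel-Lebesgue measure.\<close>

definition A2 :: "((complex ^ 'n) \<times> complex \<Rightarrow> complex) \<Rightarrow> bool" where
  "A2 f \<longleftrightarrow> continuous_on \<Omega> f \<and> line_holo f \<and> (\<integral>\<^sup>+x. ennreal ((norm (f x))\<^sup>2) * indicator \<Omega> x \<partial>lborel) < \<infinity>"

lemma nn_integral_lebesgue_on_Omega:
  "(\<integral>\<^sup>+x. f x \<partial>lebesgue_on \<Omega>) = (\<integral>\<^sup>+x. f x * indicator \<Omega> x \<partial>lborel)"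
  using Omega_borel by (subst nn_integral_restrict_space) (auto simp: nn_integral_completion)

lemma bergman_space_A2:
  assumes "f \<in> bergman_space \<Omega>" shows "A2 f"
proof -
  have f: "integrable (lebesgue_on \<Omega>) (\<lambda>x. norm (f x) powr 2)" "holomorphic_several f \<Omega>"
    using assms by (auto simp: bergman_space_def Lp_space_def)
  have "(\<integral>\<^sup>+x. ennreal ((norm (f x))\<^sup>2) \<partial>lebesgue_on \<Omega>) < \<infinity>"
    using f(1) by (simp add: integrable_iff_bounded)
  then show ?thesis
    unfolding A2_def line_holo_def
    using f(2) holomorphic_several_continuous_on holomorphic_several_on_line[OF f(2) open_Omega]
    by (auto simp: nn_integral_lebesgue_on_Omega)
qed

lemma integrable_L2_mult:
  fixes f v :: "(complex ^ 'n) \<times> complex \<Rightarrow> complex"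
  assumes f: "(\<lambda>x. indicator \<Omega> x *\<^sub>R f x) \<in> borel_measurable lborel" and v: "(\<lambda>x. indicator \<Omega> x *\<^sub>R v x) \<in> borel_measurable lborel"
    and fi: "(\<integral>\<^sup>+x. ennreal ((norm (f x))\<^sup>2) * indicator \<Omega> x \<partial>lborel) < \<infinity>"
    and vi: "(\<integral>\<^sup>+x. ennreal ((norm (v x))\<^sup>2) * indicator \<Omega> x \<partial>lborel) < \<infinity>"
  shows "integrable lborel (\<lambda>x. indicator \<Omega> x *\<^sub>R (f x * cnj (v x)))"
proof -
  have eq: "indicator \<Omega> x *\<^sub>R (f x * cnj (v x)) = (indicator \<Omega> x *\<^sub>R f x) * cnj (indicator \<Omega> x *\<^sub>R v x)" for x
    by (simp add: indicator_def)
  have sq: "integrable lborel (\<lambda>x. (norm (indicator \<Omega> x *\<^sub>R g x))\<^sup>2)"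
    if "(\<lambda>x. indicator \<Omega> x *\<^sub>R g x) \<in> borel_measurable lborel"
       "(\<integral>\<^sup>+x. ennreal ((norm (g x))\<^sup>2) * indicator \<Omega> x \<partial>lborel) < \<infinity>" for g :: "(complex ^ 'n) \<times> complex \<Rightarrow> complex"
  proof (rule integrableI_nonneg)
    have "(\<integral>\<^sup>+x. ennreal ((norm (indicator \<Omega> x *\<^sub>R g x))\<^sup>2) \<partial>lborel) = (\<integral>\<^sup>+x. ennreal ((norm (g x))\<^sup>2) * indicator \<Omega> x \<partial>lborel)"
      by (intro nn_integral_cong) (auto simp: indicator_def)
    then show "(\<integral>\<^sup>+x. ennreal ((norm (indicator \<Omega> x *\<^sub>R g x))\<^sup>2) \<partial>lborel) < \<infinity>" using that by simp
    show "(\<lambda>x. (norm (indicator \<Omega> x *\<^sub>R g x))\<^sup>2) \<in> borel_measurable lborel"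
      using measurable_compose[OF that(1), of "\<lambda>z. (norm z)\<^sup>2" borel] by simp
  qed simp
  show ?thesis unfolding eq
  proof (rule Bochner_Integration.integrable_bound[OF Bochner_Integration.integrable_add[OF sq[OF f fi] sq[OF v vi]]])
    have "norm (a * cnj b) \<le> norm ((norm a)\<^sup>2 + (norm b)\<^sup>2)" for a b :: complex
    proof -
      have "0 \<le> (norm a - norm b)\<^sup>2" "0 \<le> norm a * norm b" by simp_all
      then have "norm a * norm b \<le> (norm a)\<^sup>2 + (norm b)\<^sup>2" unfolding power2_eq_square by (simp only: algebra_simps)
      then show ?thesis by (simp add: norm_mult)
    qed
    then show "AE x in lborel. norm ((indicator \<Omega> x *\<^sub>R f x) * cnj (indicator \<Omega> x *\<^sub>R v x))
        \<le> norm ((norm (indicator \<Omega> x *\<^sub>R f x))\<^sup>2 + (norm (indicator \<Omega> x *\<^sub>R v x))\<^sup>2)" by blast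
    have "cnj \<in> borel_measurable borel" by (intro borel_measurable_continuous_onI continuous_intros)
    then show "(\<lambda>x. (indicator \<Omega> x *\<^sub>R f x) * cnj (indicator \<Omega> x *\<^sub>R v x)) \<in> borel_measurable lborel"
      by (intro borel_measurable_times f measurable_compose[OF v])
  qed
qed

lemma continuous_on_uu: "continuous_on \<Omega> (uu k j y)" if "y \<in> \<Omega>"
proof -
  have "snd y \<noteq> 0" "x \<in> \<Omega> \<Longrightarrow> snd x \<noteq> 0" for x
    using that by (metis in_Omega_iff prod.collapse)+
  then show ?thesis unfolding uu_def by (intro continuous_intros) auto
qed

lemma measurable_on_Omega:
  fixes f :: "(complex ^ 'n) \<times> complex \<Rightarrow> complex"
  shows "continuous_on \<Omega> f \<Longrightarrow> (\<lambda>x. indicator \<Omega> x *\<^sub>R f x) \<in> borel_measurable lborel"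
  using borel_measurable_continuous_on_indicator[OF Omega_borel] by simp

text \<open>In each fibre the reproducing formula on the ball of radius \<open>rad w\<close>
  evaluates \<open>p\<close> at the same point; the powers of \<open>rad w\<close> and
  \<open>w\<close> then factor out and integrate to \<open>pi / \<beta> k j\<close>.\<close>

lemma inner_hom_holo:
  assumes p: "hom_holo p k" and b: "\<beta> k j > 0"
    and int: "integrable lborel (\<lambda>x. indicator \<Omega> x *\<^sub>R (p (fst x) * snd x powi j * cnj (hprod (fst x) \<zeta> ^ k * snd x powi j)))"
  shows "(\<integral>x. indicator \<Omega> x *\<^sub>R (p (fst x) * snd x powi j * cnj (hprod (fst x) \<zeta> ^ k * snd x powi j)) \<partial>lborel)
     = of_real (1 / cc k j) * p \<zeta>"
proof -
  let ?F = "\<lambda>x. indicator \<Omega> x *\<^sub>R (p (fst x) * snd x powi j * cnj (hprod (fst x) \<zeta> ^ k * snd x powi j))"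
  let ?K = "pi ^ CARD('n) * fact k / fact (k + CARD('n)) :: real"
  let ?g = "\<lambda>w::complex. ((norm w)\<^sup>2) powr (\<beta> k j - 1) * indicator {0<..<1} ((norm w)\<^sup>2)"
  have inner: "(\<integral>z. ?F (z, w) \<partial>lborel) = of_real (?g w) * (of_real ?K * p \<zeta>)" for w
  proof (cases "w \<noteq> 0 \<and> norm w < 1")
    case False
    then have "(norm w)\<^sup>2 \<notin> {0<..<1}" by (auto simp: power_less_one_iff)
    then show ?thesis using False by (auto simp: in_Omega_iff indicator_def)
  next
    case True
    then have R: "rad w > 0" by (simp add: rad_pos)
    have "?F (z, w) = of_real ((norm (w powi j))\<^sup>2) * (indicator (ball 0 (rad w)) z *\<^sub>R (p z * hprod \<zeta> z ^ k))" for z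
      using True unfolding complex_norm_square cnj_hprod[of z \<zeta>, symmetric]
      by (auto simp: indicator_def in_Omega_iff)
    then have "(\<integral>z. ?F (z, w) \<partial>lborel) = of_real ((norm (w powi j))\<^sup>2) * (\<integral>z. indicator (ball 0 (rad w)) z *\<^sub>R (p z * hprod \<zeta> z ^ k) \<partial>lborel)"
      by (simp only: integral_mult_right_zero)
    also have "\<dots> = of_real ((norm (w powi j))\<^sup>2 * ((rad w)\<^sup>2) ^ (k + CARD('n))) * (of_real ?K * p \<zeta>)"
      unfolding ball_reproducing[OF p R] by simp
    also have "(norm (w powi j))\<^sup>2 * ((rad w)\<^sup>2) ^ (k + CARD('n)) = ?g w"
      using True by (subst weight_eq) (auto simp: indicator_def power_less_one_iff)
    finally show ?thesis .
  qed
  have g: "(\<integral>w. ?g w \<partial>lborel) = pi / \<beta> k j"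
  proof -
    have "(\<integral>\<^sup>+w. ennreal (?g w) \<partial>lborel) = (\<integral>\<^sup>+w. ennreal (((norm (w::complex))\<^sup>2) powr (\<beta> k j - 1)) * indicator {0<..<1} ((norm w)\<^sup>2) \<partial>lborel)"
      by (intro nn_integral_cong) (auto simp: indicator_def)
    also have "\<dots> = ennreal pi * (\<integral>\<^sup>+y. ennreal (y powr (\<beta> k j - 1)) * indicator {0<..<1} y * indicator {0<..} y \<partial>lborel)"
      by (rule nn_integral_radial_complex) measurable
    also have "(\<integral>\<^sup>+y. ennreal (y powr (\<beta> k j - 1)) * indicator {0<..<1} y * indicator {0<..} y \<partial>lborel)
        = (\<integral>\<^sup>+y. ennreal (y powr (\<beta> k j - 1)) * 1 * indicator {0<..<1} y \<partial>lborel)"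
      by (intro nn_integral_cong) (auto simp: indicator_def)
    also have "\<dots> = ennreal (1 / \<beta> k j)" by (rule nn_integral_powr_01[OF b])
    finally have "(\<integral>\<^sup>+w. ennreal (?g w) \<partial>lborel) = ennreal (pi / \<beta> k j)"
      using b by (simp add: ennreal_mult[symmetric])
    then show ?thesis using b by (intro integral_eq_nn_integral[THEN trans]) auto
  qed
  have "(\<integral>x. ?F x \<partial>lborel) = (\<integral>w. (\<integral>z. ?F (z, w) \<partial>lborel) \<partial>lborel)"
    using int unfolding lborel_prod[symmetric] by (subst lborel_pair.integral_snd) (auto simp: case_prod_unfold)
  also have "\<dots> = of_real (\<integral>w. ?g w \<partial>lborel) * (of_real ?K * p \<zeta>)"
    unfolding inner by (simp only: integral_mult_left_zero integral_complex_of_real)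
  also have "\<dots> = of_real (1 / cc k j) * p \<zeta>"
    using b unfolding g by (simp add: cc_def field_simps)
  finally show ?thesis .
qed

text \<open>Averages do not increase the square norm, so the component is square integrable. Its
  norm factors into the mass \<open>M\<close> of \<open>p\<close> on the unit ball and a divergent
  integral in \<open>Yc\<close>, hence \<open>M = 0\<close>. Then \<open>p\<close> vanishes almost
  everywhere on the ball, and the reproducing formula turns this into vanishing everywhere.\<close>

lemma comp_vanish:
  assumes f: "A2 f" and b: "\<beta> k j \<le> 0" and x: "x \<in> \<Omega>"
  shows "comp f (int k) j x = 0"
proof -
  have cf: "continuous_on \<Omega> f" "line_holo f" using f by (auto simp: A2_def)
  obtain p where p: "hom_holo p k" "\<And>z w. (z, w) \<in> \<Omega> \<Longrightarrow> comp f (int k) j (z, w) = p z * w powi j"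
    using comp_form[OF cf] by blast
  have cp: "continuous_on UNIV p" and hp: "\<And>c z. c \<noteq> 0 \<Longrightarrow> p (c *s z) = c ^ k * p z"
    using p(1) by (auto simp: hom_holo_def)
  have [measurable]: "p \<in> borel_measurable borel" using cp by (rule borel_measurable_continuous_onI)
  let ?G = "\<lambda>z. (norm (p z))\<^sup>2"
  have "(\<integral>\<^sup>+x. ennreal ((norm (comp f (int k) j x))\<^sup>2) * indicator \<Omega> x \<partial>lborel) \<le> (\<integral>\<^sup>+x. ennreal ((norm (f x))\<^sup>2) * indicator \<Omega> x \<partial>lborel)"
    unfolding comp_def
    by (rule order_trans[OF nn_integral_avg_sq_le[OF circle_act_act2 continuous_on_avg[OF circle_act_act1 cf(1)]] nn_integral_avg_sq_le[OF circle_act_act1 cf(1)]])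
  also have "\<dots> < \<infinity>" using f by (simp add: A2_def)
  finally have fin: "(\<integral>\<^sup>+x. ennreal ((norm (comp f (int k) j x))\<^sup>2) * indicator \<Omega> x \<partial>lborel) < \<infinity>" .
  obtain M0 where M0: "M0 \<ge> 0" "\<And>z. norm (p z) \<le> M0 * norm z ^ k" using hom_holo_bound[OF p(1)] by blast
  have "(\<integral>\<^sup>+z. ennreal (?G z) * indicator (ball 0 1) z \<partial>lborel) \<le> (\<integral>\<^sup>+z. ennreal (M0\<^sup>2) * indicator (ball 0 1) z \<partial>(lborel :: (complex ^ 'n) measure))"
  proof (intro nn_integral_mono)
    fix z :: "complex ^ 'n"
    have "norm (p z) \<le> M0" if "norm z < 1"
      using M0(2)[of z] mult_left_mono[OF power_le_one[of "norm z" k] M0(1)] that by simp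
    then show "ennreal (?G z) * indicator (ball 0 1) z \<le> ennreal (M0\<^sup>2) * indicator (ball 0 1) z"
      by (auto simp: indicator_def intro!: ennreal_leI power_mono)
  qed
  also have "\<dots> < \<infinity>"
    by (simp add: nn_integral_cmult_indicator volume_unit_ball ennreal_mult_less_top)
  finally obtain M where M: "(\<integral>\<^sup>+z. ennreal (?G z) * indicator (ball 0 1) z \<partial>lborel) = ennreal M" "M \<ge> 0"
    by (cases "\<integral>\<^sup>+z. ennreal (?G z) * indicator (ball 0 1) z \<partial>lborel") auto
  have "(\<integral>\<^sup>+x. ennreal ((norm (comp f (int k) j x))\<^sup>2) * indicator \<Omega> x \<partial>lborel)
      = (\<integral>\<^sup>+x. ennreal (?G (fst x) * (norm (snd x powi j))\<^sup>2) * 1 * 1 * indicator \<Omega> x \<partial>lborel)"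
    using p(2) by (intro nn_integral_cong) (auto simp: indicator_def norm_mult power_mult_distrib)
  also have "\<dots> = (ennreal (M * real (k + CARD('n))) * (\<integral>\<^sup>+x. ennreal (x powr (real (k + CARD('n)) - 1)) * 1 * indicator {0<..<1} x \<partial>lborel))
    * (ennreal pi * (\<integral>\<^sup>+y. ennreal (y powr (\<beta> k j - 1)) * 1 * indicator {0<..<1} y \<partial>lborel))"
    by (rule nn_integral_moment[where ?\<phi>1.0="\<lambda>_. 1" and ?\<phi>2.0="\<lambda>_. 1"])
       (use M in \<open>auto simp: scaleR_eq_smult hp norm_mult norm_power power_mult_distrib power_mult[symmetric] mult.commute[of k]\<close>)
  also have "(\<integral>\<^sup>+y. ennreal (y powr (\<beta> k j - 1)) * 1 * indicator {0<..<1} y \<partial>lborel) = \<infinity>"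
    using nn_integral_powr_eq_infinity[of "\<beta> k j - 1"] b by simp
  also have "(\<integral>\<^sup>+x. ennreal (x powr (real (k + CARD('n)) - 1)) * 1 * indicator {0<..<1} x \<partial>lborel) = ennreal (1 / real (k + CARD('n)))"
    by (rule nn_integral_powr_01) (simp add: add_nonneg_pos)
  finally have "ennreal (M * real (k + CARD('n))) * ennreal (1 / real (k + CARD('n))) * (ennreal pi * \<infinity>) < \<infinity>"
    using fin by simp
  then have "M = 0"
    using M(2) by (auto simp: ennreal_mult_less_top ennreal_mult_top ennreal_mult[symmetric] add_nonneg_eq_0_iff split: if_splits)
  then have i0: "(\<integral>\<^sup>+z. ennreal (?G z) * indicator (ball 0 1) z \<partial>lborel) = 0"
    using M(1) by simp
  have [measurable]: "ball (0 :: complex ^ 'n) 1 \<in> sets borel" by simp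
  have ae: "AE z in lborel. ennreal (?G z) * indicator (ball 0 1) z = 0"
    by (rule nn_integral_0_iff_AE[THEN iffD1, OF _ i0]) measurable
  have "p \<zeta> = 0" for \<zeta>
  proof -
    have "(\<integral>z. indicator (ball 0 1) z *\<^sub>R (p z * hprod \<zeta> z ^ k) \<partial>lborel) = 0"
      by (rule integral_eq_zero_AE) (use ae in eventually_elim, auto simp: indicator_def)
    then show ?thesis using ball_reproducing[OF p(1), of 1 \<zeta>] by simp
  qed
  then show ?thesis using p(2) x by (metis mult_zero_left prod.collapse)
qed

text \<open>Up to a constant, \<open>uu k j y\<close> has rotation weights \<open>k\<close> and
  \<open>j\<close>, so pairing it with \<open>f\<close> is the same as pairing it with the component
  of \<open>f\<close>, which has the explicit form handled by \<open>inner_hom_holo\<close>.\<close>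

lemma comp_inner:
  assumes f: "A2 f" and b: "\<beta> k j > 0" and y: "y \<in> \<Omega>"
  shows "comp f (int k) j y = (\<integral>x. indicator \<Omega> x *\<^sub>R (f x * cnj (uu k j y x)) \<partial>lborel)"
proof -
  have cf: "continuous_on \<Omega> f" "line_holo f" using f by (auto simp: A2_def)
  obtain p where p: "hom_holo p k" "\<And>z w. (z, w) \<in> \<Omega> \<Longrightarrow> comp f (int k) j (z, w) = p z * w powi j"
    using comp_form[OF cf] by blast
  obtain \<zeta> \<omega> where y': "y = (\<zeta>, \<omega>)" by force
  have w: "\<omega> \<noteq> 0" using y by (simp add: y' in_Omega_iff)
  have snz: "snd x \<noteq> 0" if "x \<in> \<Omega>" for x using that by (metis in_Omega_iff prod.collapse)
  define v where "v x = hprod (fst x) \<zeta> ^ k * snd x powi j" for x :: "(complex ^ 'n) \<times> complex"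
  define d where "d = of_real (cc k j) * (cnj \<omega>) powi j"
  have d: "d \<noteq> 0" using cc_pos[OF b] w by (simp add: d_def)
  have uv: "uu k j y x = d * v x" for x
    by (simp add: uu_def v_def d_def y' power_int_mult_distrib)
  have cv: "continuous_on \<Omega> v" unfolding v_def using snz by (intro continuous_intros) auto
  have "(\<integral>\<^sup>+x. ennreal ((norm (uu k j y x))\<^sup>2) * indicator \<Omega> x \<partial>lborel) < \<infinity>"
    by (simp add: uu_norm_sq[OF b])
  then have intu: "integrable lborel (\<lambda>x. indicator \<Omega> x *\<^sub>R (f x * cnj (uu k j y x)))"
    using f unfolding A2_def by (intro integrable_L2_mult measurable_on_Omega continuous_on_uu y) auto
  have int: "integrable lborel (\<lambda>x. indicator \<Omega> x *\<^sub>R (f x * cnj (v x)))"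
  proof -
    have "indicator \<Omega> x *\<^sub>R (f x * cnj (v x)) = (1 / cnj d) * (indicator \<Omega> x *\<^sub>R (f x * cnj (uu k j y x)))" for x
      using d by (simp add: uv field_simps)
    then show ?thesis using integrable_mult_right[OF intu, of "1 / cnj d"] by (simp only:)
  qed
  have v1: "v (act1 (circ t) x) = circ t powi int k * v x" for t x
    by (simp add: v_def act1_def hprod_scale_left power_mult_distrib mult.assoc)
  have v2: "v (act2 (circ t) x) = circ t powi j * v x" for t x
    by (simp add: v_def act2_def power_int_mult_distrib)
  note i1 = integrable_avg_mult[OF circle_act_act1 cf(1) cv v1 int]
  note c1 = continuous_on_avg[OF circle_act_act1 cf(1), of "int k"]
  have i2: "integrable lborel (\<lambda>x. indicator \<Omega> x *\<^sub>R (comp f (int k) j x * cnj (v x)))"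
    unfolding comp_def by (rule integrable_avg_mult[OF circle_act_act2 c1 cv v2 i1])
  have "(\<integral>x. indicator \<Omega> x *\<^sub>R (f x * cnj (v x)) \<partial>lborel) = (\<integral>x. indicator \<Omega> x *\<^sub>R (comp f (int k) j x * cnj (v x)) \<partial>lborel)"
    unfolding comp_def
    by (simp only: integral_avg_mult[OF circle_act_act2 c1 cv v2 i1] integral_avg_mult[OF circle_act_act1 cf(1) cv v1 int])
  also have eq: "(\<lambda>x. indicator \<Omega> x *\<^sub>R (comp f (int k) j x * cnj (v x)))
      = (\<lambda>x. indicator \<Omega> x *\<^sub>R (p (fst x) * snd x powi j * cnj (hprod (fst x) \<zeta> ^ k * snd x powi j)))"
    using p(2) by (auto simp: indicator_def v_def fun_eq_iff)
  also have "(\<integral>x. indicator \<Omega> x *\<^sub>R (p (fst x) * snd x powi j * cnj (hprod (fst x) \<zeta> ^ k * snd x powi j)) \<partial>lborel) = of_real (1 / cc k j) * p \<zeta>"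
    by (rule inner_hom_holo[OF p(1) b]) (use i2 eq in simp)
  finally have V: "(\<integral>x. indicator \<Omega> x *\<^sub>R (f x * cnj (v x)) \<partial>lborel) = of_real (1 / cc k j) * p \<zeta>" .
  have "(\<integral>x. indicator \<Omega> x *\<^sub>R (f x * cnj (uu k j y x)) \<partial>lborel) = (\<integral>x. cnj d * (indicator \<Omega> x *\<^sub>R (f x * cnj (v x))) \<partial>lborel)"
    by (simp add: uv mult_ac)
  also have "\<dots> = cnj d * (of_real (1 / cc k j) * p \<zeta>)"
    by (simp only: integral_mult_right_zero V)
  also have "\<dots> = p \<zeta> * \<omega> powi j"
  proof -
    have "cnj (cnj \<omega> powi j) = \<omega> powi j" by (simp add: power_int_def)
    then show ?thesis using cc_pos[OF b] by (simp add: d_def)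
  qed
  finally show ?thesis using p(2) y by (simp add: y')
qed

end

section \<open>The Bergman kernel\<close>

lemma summable_poly_geometric:
  fixes x :: real
  assumes "\<bar>x\<bar> < 1" shows "summable (\<lambda>q. real q ^ N * x ^ q)"
  using assms
proof (induction N arbitrary: x)
  case 0
  then show ?case by (simp add: summable_geometric)
next
  case (Suc N)
  have "summable (\<lambda>q. diffs (\<lambda>q. real q ^ N) q * x ^ q)"
    by (rule termdiff_converges[where K=1]) (use Suc in auto)
  then have "summable (\<lambda>q. x * (diffs (\<lambda>q. real q ^ N) q * x ^ q))" by (rule summable_mult)
  then have "summable (\<lambda>q. real (Suc q) ^ Suc N * x ^ Suc q)"
    by (simp add: diffs_def mult_ac del: of_nat_Suc)
  then show ?case by (subst (asm) summable_Suc_iff)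
qed

lemma summable_poly_geometric_Suc:
  fixes x :: real
  assumes "\<bar>x\<bar> < 1" shows "summable (\<lambda>q. real (Suc q) ^ N * x ^ q)"
proof (rule summable_comparison_test)
  have "summable (\<lambda>q. 2 ^ N * (1 * \<bar>x\<bar> ^ q + real q ^ N * \<bar>x\<bar> ^ q))"
    using assms by (intro summable_mult summable_add summable_poly_geometric) (auto intro: summable_geometric)
  then show "summable (\<lambda>q. 2 ^ N * (1 + real q ^ N) * \<bar>x\<bar> ^ q)" by (simp add: algebra_simps)
  have "real (Suc q) ^ N \<le> 2 ^ N * (1 + real q ^ N)" for q
  proof (cases q)
    case (Suc r)
    have "real (Suc q) ^ N \<le> (2 * real q) ^ N" by (intro power_mono) (auto simp: Suc)
    also have "\<dots> \<le> 2 ^ N * (1 + real q ^ N)" by (simp add: power_mult_distrib)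
    finally show ?thesis .
  next
    case 0
    have "(1::real) \<le> 2 ^ N" by simp
    then show ?thesis unfolding 0 by (cases "N = 0") (auto simp: power_0_left)
  qed
  then show "\<exists>M. \<forall>q\<ge>M. norm (real (Suc q) ^ N * x ^ q) \<le> 2 ^ N * (1 + real q ^ N) * \<bar>x\<bar> ^ q"
    by (auto simp: abs_mult power_abs simp del: of_nat_Suc intro!: exI[of _ 0] mult_right_mono)
qed

lemma summable_on_nat_nonneg:
  fixes f :: "nat \<Rightarrow> real"
  assumes "summable f" "\<And>i. f i \<ge> 0" shows "f summable_on UNIV"
  using norm_summable_imp_summable_on[of f] assms by simp

lemma
  fixes f g :: "nat \<Rightarrow> 'a::{real_normed_field, banach}"
  assumes f: "summable (\<lambda>i. norm (f i))" and g: "summable (\<lambda>i. norm (g i))"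
  shows abs_summable_on_product: "(\<lambda>(i, j). norm (f i * g j)) summable_on UNIV"
    and has_sum_product: "((\<lambda>(i, j). f i * g j) has_sum (suminf f * suminf g)) UNIV"
proof -
  have sf: "(f has_sum suminf f) UNIV" by (rule norm_summable_imp_has_sum[OF f summable_sums[OF summable_norm_cancel[OF f]]])
  have sg: "(g has_sum suminf g) UNIV" by (rule norm_summable_imp_has_sum[OF g summable_sums[OF summable_norm_cancel[OF g]]])
  have nf: "(\<lambda>i. norm (f i)) summable_on UNIV" by (rule summable_on_nat_nonneg[OF f]) simp
  have ng: "(\<lambda>i. norm (g i)) summable_on UNIV" by (rule summable_on_nat_nonneg[OF g]) simp
  have 0: "(\<lambda>p. norm (f (fst p) * g (snd p))) summable_on Sigma UNIV (\<lambda>_. UNIV)"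
  proof (rule Infinite_Sum.abs_summable_on_Sigma_iff[THEN iffD2], intro conjI ballI)
    show "(\<lambda>y. norm (f (fst (x, y)) * g (snd (x, y)))) summable_on UNIV" for x
      using summable_on_cmult_right[OF ng, of "norm (f x)"] by (simp add: norm_mult)
    have "(\<Sum>\<^sub>\<infinity>j. norm (f i * g j)) = norm (f i) * (\<Sum>\<^sub>\<infinity>j. norm (g j))" for i
      by (simp add: norm_mult infsum_cmult_right')
    then show "(\<lambda>x. norm (\<Sum>\<^sub>\<infinity>y. norm (f (fst (x, y)) * g (snd (x, y))))) summable_on UNIV"
      using summable_on_cmult_left[OF nf, of "\<Sum>\<^sub>\<infinity>j. norm (g j)"] by (simp add: abs_mult infsum_nonneg)
  qed
  then show "(\<lambda>(i, j). norm (f i * g j)) summable_on UNIV"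
    by (simp add: case_prod_unfold)
  have 2: "(\<lambda>p. f (fst p) * g (snd p)) summable_on Sigma UNIV (\<lambda>_. UNIV)"
    by (rule Infinite_Sum.abs_summable_summable[OF 0])
  have "infsum (\<lambda>p. f (fst p) * g (snd p)) (Sigma UNIV (\<lambda>_. UNIV)) = suminf f * suminf g"
    unfolding infsum_Sigma_banach[OF 2, symmetric]
    using sf sg by (simp add: infsum_cmult_right' infsum_cmult_left' infsumI)
  with has_sum_infsum[OF 2] show "((\<lambda>(i, j). f i * g j) has_sum (suminf f * suminf g)) UNIV"
    by (simp add: case_prod_unfold)
qed

lemma fact_le_pow: "fact (k + N) \<le> fact k * (real (k + N)) ^ N"
proof (induction N)
  case (Suc N)
  have "fact (k + Suc N) = real (k + Suc N) * fact (k + N)" by simp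
  also have "\<dots> \<le> real (k + Suc N) * (fact k * (real (k + N)) ^ N)"
    by (intro mult_left_mono Suc) simp
  also have "\<dots> \<le> real (k + Suc N) * (fact k * (real (k + Suc N)) ^ N)"
    by (intro mult_left_mono power_mono) auto
  finally show ?case by (simp add: mult_ac)
qed simp

lemma sums_prod_decode:
  fixes f :: "nat \<times> nat \<Rightarrow> 'a::{topological_comm_monoid_add, t2_space}"
  assumes "(f has_sum S) UNIV" shows "(\<lambda>N. f (prod_decode N)) sums S"
  using assms has_sum_reindex_bij_betw[OF bij_prod_decode, of f S] by (simp add: has_sum_imp_sums)

lemma summable_prod_decode:
  fixes f :: "nat \<times> nat \<Rightarrow> real"
  assumes "f summable_on UNIV" shows "summable (\<lambda>N. f (prod_decode N))"
  using sums_prod_decode[OF has_sum_infsum[OF assms]] by (rule sums_summable)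

lemma cnj_power_int: "cnj (z powi a) = cnj z powi a"
  by (simp add: power_int_def)

section \<open>Arithmetic of the admissible exponents\<close>

context hartogs
begin

text \<open>Integer \<open>div\<close> rounds towards minus infinity, so this is the least
  \<open>j\<close> with \<open>\<beta> k j > 0\<close>.\<close>

definition j0 :: "nat \<Rightarrow> int" where "j0 k = (- int (l * (k + CARD('n)))) div int m"
definition bb :: "nat \<Rightarrow> real" where "bb k = \<beta> k (j0 k)"
definition Cn :: "nat \<Rightarrow> real" where "Cn k = fact (k + CARD('n)) / (fact k * pi ^ (CARD('n) + 1))"

lemma bb_eq: "bb k = (real m - real_of_int ((- int (l * (k + CARD('n)))) mod int m)) / real m"
proof -
  let ?L = "- int (l * (k + CARD('n)))"
  have "real_of_int ?L = real m * real_of_int (j0 k) + real_of_int (?L mod int m)"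
    unfolding j0_def using mult_div_mod_eq[of "int m" ?L]
    by (metis of_int_add of_int_mult of_int_of_nat_eq)
  then show ?thesis using m by (simp add: bb_def \<beta>_def field_simps)
qed

lemma bb_bounds: "1 / real m \<le> bb k" "bb k \<le> 1" "0 < bb k"
proof -
  let ?r = "(- int (l * (k + CARD('n)))) mod int m"
  have r: "0 \<le> ?r" "?r < int m" using m by simp_all
  then have "?r + 1 \<le> int m" by simp
  then have "real_of_int ?r + 1 \<le> real m" by linarith
  then show 1: "1 / real m \<le> bb k" using m by (simp add: bb_eq field_simps)
  show "bb k \<le> 1" using m r by (simp add: bb_eq field_simps)
  have "0 < 1 / real m" using m by simp
  then show "0 < bb k" using 1 by linarith
qed

lemma beta_j0: "\<beta> k (j0 k + int i) = bb k + real i"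
  by (simp add: bb_def \<beta>_def)

lemma beta_pos_iff: "\<beta> k j > 0 \<longleftrightarrow> j \<ge> j0 k"
proof
  assume "j \<ge> j0 k"
  then have "\<beta> k j \<ge> bb k" by (simp add: bb_def \<beta>_def)
  then show "\<beta> k j > 0" using bb_bounds(3)[of k] by linarith
next
  assume b: "\<beta> k j > 0"
  show "j \<ge> j0 k"
  proof (rule ccontr)
    assume "\<not> ?thesis"
    then have "of_int j \<le> of_int (j0 k) - (1::real)" by linarith
    then have "\<beta> k j \<le> bb k - 1" by (simp add: bb_def \<beta>_def)
    then show False using bb_bounds(2)[of k] b by linarith
  qed
qed

text \<open>Raising the degree in \<open>z\<close> by \<open>m\<close> lowers the least exponent of
  \<open>w\<close> by exactly \<open>l\<close>. Consequently \<open>bb\<close> has period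
  \<open>m\<close>, which is what allows all series to be split into residue classes.\<close>

lemma j0_add_m: "j0 (k + m) = j0 k - int l"
proof -
  have "- int (l * (k + m + CARD('n))) = - int (l * (k + CARD('n))) + (- int l) * int m"
    by (simp add: algebra_simps)
  then show ?thesis using m unfolding j0_def by (simp only: div_mult_self1)
qed

lemma bb_add_m: "bb (k + m) = bb k"
  using m by (simp add: bb_def \<beta>_def j0_add_m field_simps)

lemma j0_add_mult: "j0 (m * q + r) = j0 r - int (l * q)" and bb_add_mult: "bb (m * q + r) = bb r"
proof (induction q)
  case (Suc q)
  { case 1 show ?case using j0_add_m[of "m * q + r"] Suc(1) by (simp add: algebra_simps) }
  { case 2 show ?case using bb_add_m[of "m * q + r"] Suc(2) by (simp add: algebra_simps) }
qed simp_all

lemma cc_j0: "cc k (j0 k + int i) = Cn k * (bb k + real i)"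
  by (simp add: cc_def Cn_def beta_j0)

lemma Cn_pos: "Cn k > 0" by (simp add: Cn_def)

lemma Cn_le: "Cn k \<le> real (k + CARD('n)) ^ CARD('n)"
proof -
  have "(1::real) \<le> pi ^ (CARD('n) + 1)" using pi_ge_two by (intro one_le_power) linarith
  then have "Cn k \<le> fact (k + CARD('n)) / (fact k * 1)"
    unfolding Cn_def by (intro divide_left_mono mult_left_mono) auto
  also have "\<dots> \<le> real (k + CARD('n)) ^ CARD('n)"
    using fact_le_pow[of k "CARD('n)"] by (simp add: field_simps)
  finally show ?thesis .
qed

lemma Cn_le_Suc: "Cn k \<le> real CARD('n) ^ CARD('n) * real (Suc k) ^ CARD('n)"
proof -
  have "real (k + CARD('n)) \<le> real CARD('n) * real (Suc k)"
  proof -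
    have "1 \<le> CARD('n)" by (simp add: Suc_leI)
    then have "k + CARD('n) \<le> CARD('n) * Suc k" by (metis add.commute add_le_cancel_left mult_Suc_right mult_le_mono1 mult_1)
    then show ?thesis by (metis of_nat_le_iff of_nat_mult)
  qed
  then have "real (k + CARD('n)) ^ CARD('n) \<le> (real CARD('n) * real (Suc k)) ^ CARD('n)" by (rule power_mono) simp
  then show ?thesis using Cn_le[of k] by (simp add: power_mult_distrib)
qed

text \<open>The block \<open>un k i\<close> on the diagonal, written in \<open>Xc\<close> and
  \<open>Yc\<close>; it is also the squared norm of \<open>un k i y\<close>.\<close>

definition dg :: "(complex ^ 'n) \<times> complex \<Rightarrow> nat \<Rightarrow> nat \<Rightarrow> real" where
  "dg y k i = Cn k * (bb k + real i) * (Xc y ^ k * Yc y powr (bb k + real i - \<nu>))"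

lemma dg_eq:
  assumes "y \<in> \<Omega>"
  shows "dg y k i = cc k (j0 k + int i) * (norm (fst y) ^ (2 * k) * (norm (snd y powi (j0 k + int i)))\<^sup>2)"
  unfolding diag_weight[OF assms] cc_j0 beta_j0 dg_def by simp

lemma dg_nonneg: "dg y k i \<ge> 0"
proof -
  have "0 \<le> Xc y" by (simp add: Xc_def)
  then show ?thesis unfolding dg_def using Cn_pos[of k] bb_bounds(3)[of k] by (intro mult_nonneg_nonneg) auto
qed

lemma dg_le:
  assumes y: "y \<in> \<Omega>"
  shows "dg y k i \<le> Yc y powr (- \<nu>) * ((Cn k * Xc y ^ k) * (real (Suc i) * Yc y ^ i))"
proof -
  note Y = Xc_Yc_in_Omega[OF y]
  have "Yc y powr (bb k + real i - \<nu>) = Yc y powr (bb k) * Yc y ^ i * Yc y powr (- \<nu>)"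
    using Y by (simp add: powr_add[symmetric] powr_realpow[symmetric])
  also have "\<dots> \<le> 1 * Yc y ^ i * Yc y powr (- \<nu>)"
    using Y bb_bounds(3)[of k] powr_mono'[of 0 "bb k" "Yc y"] by (intro mult_right_mono) auto
  finally have "Yc y powr (bb k + real i - \<nu>) \<le> Yc y ^ i * Yc y powr (- \<nu>)" by simp
  then have "dg y k i \<le> Cn k * real (Suc i) * (Xc y ^ k * (Yc y ^ i * Yc y powr (- \<nu>)))"
    unfolding dg_def using Cn_pos[of k] bb_bounds[of k] Y
    by (intro mult_mono mult_nonneg_nonneg) auto
  then show ?thesis by (simp add: mult_ac)
qed

text \<open>The square root appears because Cauchy-Schwarz bounds the pairing of a square integrable
  function with a block by the norm of that block, which is \<open>sqrt (dg y k i)\<close>.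
  Polynomial growth against \<open>sqrt (Xc y) ^ k\<close> and \<open>sqrt (Yc y) ^ i\<close> is
  still summable.\<close>

lemma summable_sqrt_dg:
  assumes y: "y \<in> \<Omega>"
  shows "(\<lambda>(k, i). sqrt (dg y k i)) summable_on UNIV"
proof -
  note Y = Xc_Yc_in_Omega[OF y]
  define f where "f k = real CARD('n) ^ CARD('n) * (real (Suc k) ^ CARD('n) * sqrt (Xc y) ^ k)" for k
  define g where "g i = real (Suc i) ^ 1 * sqrt (Yc y) ^ i" for i
  have f: "summable (\<lambda>k. norm (f k))"
    unfolding f_def using Y by (simp add: norm_mult) (intro summable_mult summable_poly_geometric_Suc[unfolded of_nat_Suc], simp)
  have g: "summable (\<lambda>i. norm (g i))"
    unfolding g_def using Y summable_poly_geometric_Suc[of "sqrt (Yc y)" 1] by (simp add: norm_mult)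
  have s: "(\<lambda>p. sqrt (Yc y powr (- \<nu>)) * (case p of (k, i) \<Rightarrow> norm (f k * g i))) summable_on UNIV"
    by (intro summable_on_cmult_right abs_summable_on_product f g)
  have sq1: "sqrt t \<le> t" if "t \<ge> 1" for t :: real
    using that real_sqrt_le_mono[of t "t\<^sup>2"] by (simp add: power2_eq_square)
  have "sqrt (dg y k i) \<le> sqrt (Yc y powr (- \<nu>)) * norm (f k * g i)" for k i
  proof -
    have "sqrt (dg y k i) \<le> sqrt (Yc y powr (- \<nu>) * (((real CARD('n) ^ CARD('n) * real (Suc k) ^ CARD('n)) * Xc y ^ k) * (real (Suc i) * Yc y ^ i)))"
    proof (rule real_sqrt_le_mono[OF order_trans[OF dg_le[OF y]]])
      show "Yc y powr (- \<nu>) * ((Cn k * Xc y ^ k) * (real (Suc i) * Yc y ^ i))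
        \<le> Yc y powr (- \<nu>) * (((real CARD('n) ^ CARD('n) * real (Suc k) ^ CARD('n)) * Xc y ^ k) * (real (Suc i) * Yc y ^ i))"
        using Y by (intro mult_left_mono mult_right_mono Cn_le_Suc) auto
    qed
    also have "\<dots> = sqrt (Yc y powr (- \<nu>)) * ((sqrt (real CARD('n) ^ CARD('n) * real (Suc k) ^ CARD('n)) * sqrt (Xc y) ^ k) * (sqrt (real (Suc i)) * sqrt (Yc y) ^ i))"
      by (simp only: real_sqrt_mult real_sqrt_power)
    also have "\<dots> \<le> sqrt (Yc y powr (- \<nu>)) * (((real CARD('n) ^ CARD('n) * real (Suc k) ^ CARD('n)) * sqrt (Xc y) ^ k) * (real (Suc i) * sqrt (Yc y) ^ i))"
    proof -
      have "1 \<le> real CARD('n) ^ CARD('n)" by (intro one_le_power) (simp add: Suc_leI)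
      moreover have "1 \<le> real (Suc k) ^ CARD('n)" by (intro one_le_power) simp
      ultimately have "1 \<le> real CARD('n) ^ CARD('n) * real (Suc k) ^ CARD('n)"
        using mult_mono[of 1 _ 1] by fastforce
      then show ?thesis using Y
        by (intro mult_left_mono mult_mono mult_right_mono sq1) auto
    qed
    also have "\<dots> = sqrt (Yc y powr (- \<nu>)) * norm (f k * g i)"
      using Y by (simp add: f_def g_def norm_mult mult_ac abs_mult)
    finally show ?thesis .
  qed
  then show ?thesis
    by (intro summable_on_comparison_test[OF s]) (auto simp: dg_nonneg)
qed

lemma summable_dg:
  assumes y: "y \<in> \<Omega>"
  shows "(\<lambda>(k, i). dg y k i) summable_on UNIV"
proof -
  note Y = Xc_Yc_in_Omega[OF y]
  have f: "summable (\<lambda>k. norm (Cn k * Xc y ^ k))"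
  proof (rule summable_comparison_test)
    show "summable (\<lambda>k. real CARD('n) ^ CARD('n) * (real (Suc k) ^ CARD('n) * Xc y ^ k))"
      using Y by (intro summable_mult summable_poly_geometric_Suc) auto
    show "\<exists>N. \<forall>k\<ge>N. norm (norm (Cn k * Xc y ^ k)) \<le> real CARD('n) ^ CARD('n) * (real (Suc k) ^ CARD('n) * Xc y ^ k)"
      using Y Cn_pos less_imp_le mult_right_mono[OF Cn_le_Suc]
      by (auto simp: norm_mult abs_mult mult.assoc[symmetric] abs_of_pos intro!: exI[of _ 0] simp del: of_nat_Suc)
  qed
  have g: "summable (\<lambda>i. norm (real (Suc i) * Yc y ^ i))"
    using Y summable_poly_geometric_Suc[of "Yc y" 1] by (simp add: norm_mult)
  have s: "(\<lambda>p. Yc y powr (- \<nu>) * (case p of (k, i) \<Rightarrow> norm ((Cn k * Xc y ^ k) * (real (Suc i) * Yc y ^ i)))) summable_on UNIV"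
    by (intro summable_on_cmult_right abs_summable_on_product f g)
  have "dg y k i \<le> Yc y powr (- \<nu>) * norm ((Cn k * Xc y ^ k) * (real (Suc i) * Yc y ^ i))" for k i
    using dg_le[OF y, of k i] mult_left_mono[OF abs_ge_self, of "Yc y powr (- \<nu>)"] by (simp del: of_nat_Suc) (meson order_trans powr_ge_zero)
  then show ?thesis
    by (intro summable_on_comparison_test[OF s]) (auto simp: dg_nonneg)
qed

definition un :: "nat \<Rightarrow> nat \<Rightarrow> (complex ^ 'n) \<times> complex \<Rightarrow> (complex ^ 'n) \<times> complex \<Rightarrow> complex" where
  "un k i y = uu k (j0 k + int i) y"

text \<open>Cauchy-Schwarz for \<open>hprod\<close> splits the block into a product of its sizes at
  \<open>x\<close> and at \<open>y\<close>, and \<open>a * b \<le> a^2 + b^2\<close> reduces it to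
  diagonal values.\<close>

lemma norm_un_le:
  assumes "x \<in> \<Omega>" "y \<in> \<Omega>" shows "norm (un k i y x) \<le> dg x k i + dg y k i"
proof -
  let ?j = "j0 k + int i"
  let ?a = "norm (fst x) ^ k * norm (snd x powi ?j)"
  let ?b = "norm (fst y) ^ k * norm (snd y powi ?j)"
  have c: "cc k ?j > 0" by (rule cc_pos) (use bb_bounds(3)[of k] in \<open>simp add: beta_j0\<close>)
  have "norm (un k i y x) = cc k ?j * (norm (hprod (fst x) (fst y)) ^ k * (norm (snd x powi ?j) * norm (snd y powi ?j)))"
    using c by (simp add: un_def uu_def norm_mult norm_power norm_power_int power_int_mult_distrib)
  also have "\<dots> \<le> cc k ?j * ((norm (fst x) * norm (fst y)) ^ k * (norm (snd x powi ?j) * norm (snd y powi ?j)))"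
    using c by (intro mult_left_mono mult_right_mono power_mono norm_hprod_le) auto
  also have "\<dots> = cc k ?j * (?a * ?b)" by (simp add: power_mult_distrib mult_ac)
  also have "\<dots> \<le> cc k ?j * (?a\<^sup>2 + ?b\<^sup>2)"
  proof (intro mult_left_mono)
    have "0 \<le> (?a - ?b)\<^sup>2" "0 \<le> ?a * ?b" by simp_all
    then show "?a * ?b \<le> ?a\<^sup>2 + ?b\<^sup>2" unfolding power2_eq_square by (simp only: algebra_simps)
  qed (use c in simp)
  also have "\<dots> = dg x k i + dg y k i"
    by (simp add: dg_eq assms power_mult_distrib power_mult[symmetric] algebra_simps)
  finally show ?thesis .
qed

lemma un_abs_summable:
  assumes "x \<in> \<Omega>" "y \<in> \<Omega>" shows "(\<lambda>(k, i). norm (un k i y x)) summable_on UNIV"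
proof -
  have "(\<lambda>p. (case p of (k, i) \<Rightarrow> dg x k i) + (case p of (k, i) \<Rightarrow> dg y k i)) summable_on UNIV"
    by (intro summable_on_add summable_dg assms)
  then show ?thesis
    by (rule summable_on_comparison_test) (auto simp: norm_un_le[OF assms])
qed

text \<open>The value 0 outside the domain follows the normalisation in
  \<open>is_bergman_kernel\<close>.\<close>

definition KK :: "(complex ^ 'n) \<times> complex \<Rightarrow> (complex ^ 'n) \<times> complex \<Rightarrow> complex" where
  "KK x y = (if x \<in> \<Omega> \<and> y \<in> \<Omega> then \<Sum>\<^sub>\<infinity>(k, i). un k i y x else 0)"

lemma KK_has_sum:
  assumes "x \<in> \<Omega>" "y \<in> \<Omega>" shows "((\<lambda>(k, i). un k i y x) has_sum KK x y) UNIV"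
proof -
  have "(\<lambda>(k, i). un k i y x) summable_on UNIV"
    by (rule Infinite_Sum.abs_summable_summable) (use un_abs_summable[OF assms] in \<open>simp add: case_prod_unfold\<close>)
  then show ?thesis using assms by (simp add: KK_def has_sum_infsum)
qed

definition Kd :: "(complex ^ 'n) \<times> complex \<Rightarrow> real" where
  "Kd y = (\<Sum>\<^sub>\<infinity>(k, i). dg y k i)"

lemma un_diag: assumes "y \<in> \<Omega>" shows "un k i y y = of_real (dg y k i)"
proof -
  have "(snd y * cnj (snd y)) powi j = of_real ((norm (snd y powi j))\<^sup>2)" for j
    unfolding complex_norm_square[of "snd y powi j"] by (simp add: power_int_mult_distrib cnj_power_int)
  then show ?thesis
    by (simp add: un_def uu_def dg_eq[OF assms] hprod_self power_mult)
qed

lemma KK_diag: assumes "y \<in> \<Omega>" shows "KK y y = of_real (Kd y)"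
proof -
  have "((\<lambda>p. complex_of_real (case p of (k, i) \<Rightarrow> dg y k i)) has_sum of_real (Kd y)) UNIV"
    unfolding Kd_def by (intro has_sum_of_real has_sum_infsum summable_dg assms)
  then have "((\<lambda>(k, i). un k i y y) has_sum of_real (Kd y)) UNIV"
    by (simp add: un_diag[OF assms] case_prod_unfold)
  then show ?thesis using KK_has_sum[OF assms assms] infsumI by metis
qed

lemma KK_sums:
  assumes "x \<in> \<Omega>" "y \<in> \<Omega>"
  shows "(\<lambda>N. un (fst (prod_decode N)) (snd (prod_decode N)) y x) sums KK x y"
  using sums_prod_decode[OF KK_has_sum[OF assms]] by (simp add: case_prod_unfold)

lemma uu_measurable [measurable]:
  "(\<lambda>(x, y). uu k j y x) \<in> borel_measurable (borel \<Otimes>\<^sub>M borel)"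
proof -
  have [measurable]: "(\<lambda>p. hprod (fst (fst p)) (fst (snd p))) \<in> borel_measurable (borel :: ((((complex ^ 'n) \<times> complex) \<times> ((complex ^ 'n) \<times> complex))) measure)"
    "(\<lambda>p. snd (fst p) * cnj (snd (snd p))) \<in> borel_measurable (borel :: ((((complex ^ 'n) \<times> complex) \<times> ((complex ^ 'n) \<times> complex))) measure)"
    by (auto intro!: borel_measurable_continuous_onI continuous_intros)
  have "(\<lambda>p. (snd (fst p) * cnj (snd (snd p))) powi j) \<in> borel_measurable (borel :: ((((complex ^ 'n) \<times> complex) \<times> ((complex ^ 'n) \<times> complex))) measure)"
    by (rule measurable_compose[OF _ powi_measurable]) measurable
  then show ?thesis unfolding uu_def borel_prod case_prod_unfold by measurable
qed

lemma KK_measurable: "(\<lambda>(x, y). KK x y) \<in> borel_measurable (borel \<Otimes>\<^sub>M borel)"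
proof -
  have eq: "(\<lambda>(x, y). KK x y) = (\<lambda>p. if fst p \<in> \<Omega> \<and> snd p \<in> \<Omega> then (\<Sum>N. (\<lambda>(x, y). uu (fst (prod_decode N)) (j0 (fst (prod_decode N)) + int (snd (prod_decode N))) y x) p) else 0)"
    using sums_unique[OF KK_sums] by (auto simp: fun_eq_iff un_def KK_def)
  have "Measurable.pred (borel \<Otimes>\<^sub>M borel) (\<lambda>p :: ((complex ^ 'n) \<times> complex) \<times> ((complex ^ 'n) \<times> complex). fst p \<in> \<Omega> \<and> snd p \<in> \<Omega>)"
    using Omega_borel by measurable
  then show ?thesis unfolding eq
    by (intro measurable_If borel_measurable_suminf uu_measurable) auto
qed

lemma KK_measurable1: "(\<lambda>x. KK x y) \<in> borel_measurable borel"
  and KK_measurable2: "(\<lambda>y. KK x y) \<in> borel_measurable borel"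
  using measurable_compose[OF measurable_Pair2'[of y borel borel] KK_measurable]
    measurable_compose[OF measurable_Pair1'[of x borel borel] KK_measurable] by simp_all

text \<open>Terms with different exponents are orthogonal for every weight that is invariant under both
  circle actions: one suitable rotation changes the sign of the integral.\<close>

lemma un_orthogonal:
  assumes w: "\<And>x t. \<omega> (act1 (circ t) x) = \<omega> x" "\<And>x t. \<omega> (act2 (circ t) x) = \<omega> x"
    and wm [measurable]: "(\<omega> :: (complex ^ 'n) \<times> complex \<Rightarrow> real) \<in> borel_measurable borel" and ne: "(k, i) \<noteq> (k', i')"
  shows "(\<integral>x. (\<omega> x * indicator \<Omega> x) *\<^sub>R (un k i y x * cnj (un k' i' y x)) \<partial>lborel) = 0"
proof -
  have [measurable]: "(\<lambda>x. uu k j y x) \<in> borel_measurable borel" for k j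
    using measurable_compose[OF measurable_Pair2'[of y borel borel] uu_measurable] by simp
  have [measurable]: "cnj \<in> borel_measurable borel" by (intro borel_measurable_continuous_onI continuous_intros)
  define h where "h x = (\<omega> x * indicator \<Omega> x) *\<^sub>R (un k i y x * cnj (un k' i' y x))" for x
  have hm: "h \<in> borel_measurable lborel" unfolding h_def un_def by measurable
  have zero: "(\<integral>x. h x \<partial>lborel) = 0"
    if s: "circle_act \<sigma>" and hs: "\<And>x t. h (\<sigma> (circ t) x) = circ t powi a * h x" and a: "a \<noteq> 0" for \<sigma> a
  proof -
    interpret A: circle_average lborel "\<lambda>t. \<sigma> (circ t)" by (rule circle_average_act[OF s])
    define t where "t = 1 / (2 * of_int a :: real)"
    have eq: "2 * pi * of_int a * t = pi" using a by (simp add: t_def)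
    have ct: "circ t powi a = -1" by (simp only: circ_powi eq cis_pi)
    have "(\<integral>x. h x \<partial>lborel) = (\<integral>x. h (\<sigma> (circ t) x) \<partial>lborel)" by (rule A.integral_rot[OF hm, symmetric])
    also have "\<dots> = - (\<integral>x. h x \<partial>lborel)" by (simp add: hs ct)
    finally show ?thesis by simp
  qed
  have cc1: "circ t * cnj (circ t) = 1" for t by (simp add: complex_norm_square[symmetric])
  then have cci: "cnj (circ t) = inverse (circ t)" for t by (simp add: field_simps)
  show ?thesis
  proof (cases "k = k'")
    case False
    have "h (act1 (circ t) x) = circ t powi (int k - int k') * h x" for x t
      using act_in_Omega[OF circle_act_act1, of t x] w(1)[of t x]
      by (simp add: h_def un_def uu_def act1_def hprod_scale_left power_mult_distrib indicator_def cci
          power_int_diff power_inverse divide_inverse scaleR_conv_of_real mult_ac)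
    from zero[OF circle_act_act1 this] False show ?thesis by (simp add: h_def)
  next
    case True
    have "h (act2 (circ t) x) = circ t powi (int i - int i') * h x" for x t
    proof -
      have "un k i y (act2 (circ t) x) = circ t powi (j0 k + int i) * un k i y x"
        "un k i' y (act2 (circ t) x) = circ t powi (j0 k + int i') * un k i' y x"
        by (simp_all add: un_def uu_def act2_def power_int_mult_distrib mult_ac)
      moreover have "circ t powi (j0 k + int i) * cnj (circ t powi (j0 k + int i')) = circ t powi (int i - int i')"
        unfolding circ_powi cis_cnj cis_mult by (rule arg_cong[where f=cis]) (simp add: algebra_simps)
      ultimately show ?thesis
        using act_in_Omega[OF circle_act_act2, of t x] w(2)[of t x] True
        by (simp add: h_def indicator_def scaleR_conv_of_real)
    qed
    from zero[OF circle_act_act2 this] True ne show ?thesis by (simp add: h_def)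
  qed
qed

text \<open>The weight is invariant under both rotations, so distinct blocks are orthogonal and
  every finite partial sum has squared norm at most the sum of the \<open>\<mu>\<close>. Fatou's
  lemma passes this to the pointwise limit \<open>KK\<close>, without convergence in the weighted
  space.\<close>

lemma KK_weighted_norm_le:
  assumes w: "\<And>x t. \<omega> (act1 (circ t) x) = \<omega> x" "\<And>x t. \<omega> (act2 (circ t) x) = \<omega> x" "\<And>x. \<omega> x \<ge> 0"
    and wm [measurable]: "\<omega> \<in> borel_measurable borel" and y: "y \<in> \<Omega>"
    and mu: "\<And>k i. (\<integral>\<^sup>+x. ennreal ((norm (un k i y x))\<^sup>2 * \<omega> x) * indicator \<Omega> x \<partial>lborel) \<le> ennreal (\<mu> (k, i))"
    and mu0: "\<And>p. \<mu> p \<ge> 0" and s: "(\<mu> has_sum S) UNIV"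
  shows "(\<integral>\<^sup>+x. ennreal ((norm (KK x y))\<^sup>2 * \<omega> x) * indicator \<Omega> x \<partial>lborel) \<le> ennreal S"
proof -
  have [measurable]: "(\<lambda>x. uu k j y x) \<in> borel_measurable borel" for k j
    using measurable_compose[OF measurable_Pair2'[of y borel borel] uu_measurable] by simp
  have [measurable]: "cnj \<in> borel_measurable borel" by (intro borel_measurable_continuous_onI continuous_intros)
  define v where "v N = un (fst (prod_decode N)) (snd (prod_decode N)) y" for N
  have [measurable]: "v N \<in> borel_measurable borel" for N unfolding v_def un_def by measurable
  define P where "P N x = (\<Sum>i<N. v i x)" for N x
  have [measurable]: "P N \<in> borel_measurable borel" for N unfolding P_def by measurable
  have sq: "integrable lborel (\<lambda>x. (\<omega> x * indicator \<Omega> x) * (norm (v N x))\<^sup>2)"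
    and sqle: "(\<integral>x. (\<omega> x * indicator \<Omega> x) * (norm (v N x))\<^sup>2 \<partial>lborel) \<le> \<mu> (prod_decode N)" for N
  proof -
    have e: "(\<integral>\<^sup>+x. ennreal ((\<omega> x * indicator \<Omega> x) * (norm (v N x))\<^sup>2) \<partial>lborel) \<le> ennreal (\<mu> (prod_decode N))"
      using mu[of "fst (prod_decode N)" "snd (prod_decode N)"]
      by (simp add: v_def indicator_def if_distrib mult_ac cong: if_cong)
         (auto elim!: order_trans[rotated] intro!: nn_integral_mono)
    show i: "integrable lborel (\<lambda>x. (\<omega> x * indicator \<Omega> x) * (norm (v N x))\<^sup>2)"
    proof (rule integrableI_nonneg)
      show "(\<integral>\<^sup>+x. ennreal ((\<omega> x * indicator \<Omega> x) * (norm (v N x))\<^sup>2) \<partial>lborel) < \<infinity>"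
        using e by (rule le_less_trans) simp
      show "AE x in lborel. 0 \<le> (\<omega> x * indicator \<Omega> x) * (norm (v N x))\<^sup>2"
        by (intro AE_I2 mult_nonneg_nonneg w(3)) auto
    qed measurable
    have "ennreal (\<integral>x. (\<omega> x * indicator \<Omega> x) * (norm (v N x))\<^sup>2 \<partial>lborel) \<le> ennreal (\<mu> (prod_decode N))"
      using e by (subst nn_integral_eq_integral[OF i, symmetric]) (auto simp: w(3))
    then show "(\<integral>x. (\<omega> x * indicator \<Omega> x) * (norm (v N x))\<^sup>2 \<partial>lborel) \<le> \<mu> (prod_decode N)"
      using mu0 by simp
  qed
  have int2: "integrable lborel (\<lambda>x. (\<omega> x * indicator \<Omega> x) *\<^sub>R (v i x * cnj (v j x)))" for i j
  proof (rule Bochner_Integration.integrable_bound[OF Bochner_Integration.integrable_add[OF sq[of i] sq[of j]]])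
    have ab: "a * b \<le> a\<^sup>2 + b\<^sup>2" if "a \<ge> 0" "b \<ge> 0" for a b :: real
    proof -
      have "0 \<le> (a - b)\<^sup>2" "0 \<le> a * b" using that by simp_all
      then show ?thesis unfolding power2_eq_square by (simp only: algebra_simps)
    qed
    show "AE x in lborel. norm ((\<omega> x * indicator \<Omega> x) *\<^sub>R (v i x * cnj (v j x)))
      \<le> norm ((\<omega> x * indicator \<Omega> x) * (norm (v i x))\<^sup>2 + (\<omega> x * indicator \<Omega> x) * (norm (v j x))\<^sup>2)"
    proof (intro AE_I2)
      fix x
      have "(\<omega> x * indicator \<Omega> x) * (norm (v i x) * norm (v j x)) \<le> (\<omega> x * indicator \<Omega> x) * ((norm (v i x))\<^sup>2 + (norm (v j x))\<^sup>2)"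
        using w(3) by (intro mult_left_mono ab) auto
      then show "norm ((\<omega> x * indicator \<Omega> x) *\<^sub>R (v i x * cnj (v j x)))
        \<le> norm ((\<omega> x * indicator \<Omega> x) * (norm (v i x))\<^sup>2 + (\<omega> x * indicator \<Omega> x) * (norm (v j x))\<^sup>2)"
        using w(3) by (auto simp: norm_mult abs_mult algebra_simps indicator_def)
    qed
  qed measurable
  have orth: "(\<integral>x. (\<omega> x * indicator \<Omega> x) *\<^sub>R (v i x * cnj (v j x)) \<partial>lborel) = 0" if "i \<noteq> j" for i j
  proof -
    have "(fst (prod_decode i), snd (prod_decode i)) \<noteq> (fst (prod_decode j), snd (prod_decode j))"
      using that inj_prod_decode by (simp add: inj_eq)
    then show ?thesis unfolding v_def by (intro un_orthogonal w wm)
  qed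
  have fin: "(\<integral>\<^sup>+x. ennreal ((norm (P N x))\<^sup>2 * \<omega> x) * indicator \<Omega> x \<partial>lborel) \<le> ennreal S" for N
  proof -
    have expand: "complex_of_real ((\<omega> x * indicator \<Omega> x) * (norm (P N x))\<^sup>2) = (\<Sum>i<N. \<Sum>j<N. (\<omega> x * indicator \<Omega> x) *\<^sub>R (v i x * cnj (v j x)))" for x
    proof -
      have "complex_of_real ((norm (P N x))\<^sup>2) = (\<Sum>i<N. \<Sum>j<N. v i x * cnj (v j x))"
        unfolding complex_norm_square P_def cnj_sum sum_product ..
      then show ?thesis by (simp only: of_real_mult scaleR_conv_of_real sum_distrib_left)
    qed
    have iP: "complex_integrable lborel (\<lambda>x. complex_of_real ((\<omega> x * indicator \<Omega> x) * (norm (P N x))\<^sup>2))"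
      unfolding expand by (intro Bochner_Integration.integrable_sum int2)
    then have iPr: "integrable lborel (\<lambda>x. (\<omega> x * indicator \<Omega> x) * (norm (P N x))\<^sup>2)"
      by (subst (asm) complex_of_real_integrable_eq)
    have "complex_of_real (\<integral>x. (\<omega> x * indicator \<Omega> x) * (norm (P N x))\<^sup>2 \<partial>lborel) = (\<Sum>i<N. \<Sum>j<N. \<integral>x. (\<omega> x * indicator \<Omega> x) *\<^sub>R (v i x * cnj (v j x)) \<partial>lborel)"
      unfolding integral_complex_of_real[symmetric] expand
      by (simp only: Bochner_Integration.integral_sum int2 Bochner_Integration.integrable_sum)
    also have "\<dots> = (\<Sum>i<N. \<integral>x. (\<omega> x * indicator \<Omega> x) *\<^sub>R (v i x * cnj (v i x)) \<partial>lborel)"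
    proof (intro sum.cong refl)
      fix i assume "i \<in> {..<N}"
      then have "(\<Sum>j<N. \<integral>x. (\<omega> x * indicator \<Omega> x) *\<^sub>R (v i x * cnj (v j x)) \<partial>lborel)
        = (\<Sum>j<N. if j = i then \<integral>x. (\<omega> x * indicator \<Omega> x) *\<^sub>R (v i x * cnj (v i x)) \<partial>lborel else 0)"
        by (intro sum.cong) (auto simp: orth)
      also have "\<dots> = (\<integral>x. (\<omega> x * indicator \<Omega> x) *\<^sub>R (v i x * cnj (v i x)) \<partial>lborel)"
        using \<open>i \<in> {..<N}\<close> by (simp add: sum.delta)
      finally show "(\<Sum>j<N. \<integral>x. (\<omega> x * indicator \<Omega> x) *\<^sub>R (v i x * cnj (v j x)) \<partial>lborel) = \<dots>" .
    qed
    also have "\<dots> = of_real (\<Sum>i<N. \<integral>x. (\<omega> x * indicator \<Omega> x) * (norm (v i x))\<^sup>2 \<partial>lborel)"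
      unfolding of_real_sum integral_complex_of_real[symmetric] of_real_mult complex_norm_square
      by (simp add: scaleR_conv_of_real)
    finally have "(\<integral>x. (\<omega> x * indicator \<Omega> x) * (norm (P N x))\<^sup>2 \<partial>lborel) = (\<Sum>i<N. \<integral>x. (\<omega> x * indicator \<Omega> x) * (norm (v i x))\<^sup>2 \<partial>lborel)"
      using of_real_eq_iff by blast
    also have "\<dots> \<le> (\<Sum>i<N. \<mu> (prod_decode i))" by (intro sum_mono sqle)
    also have "\<dots> \<le> S"
      using sums_prod_decode[OF s] mu0 by (metis sum_le_suminf sums_unique sums_summable finite_lessThan)
    finally have le: "(\<integral>x. (\<omega> x * indicator \<Omega> x) * (norm (P N x))\<^sup>2 \<partial>lborel) \<le> S" .
    have "(\<integral>\<^sup>+x. ennreal ((norm (P N x))\<^sup>2 * \<omega> x) * indicator \<Omega> x \<partial>lborel) = (\<integral>\<^sup>+x. ennreal ((\<omega> x * indicator \<Omega> x) * (norm (P N x))\<^sup>2) \<partial>lborel)"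
      by (intro nn_integral_cong) (auto simp: indicator_def mult_ac)
    also have "\<dots> = ennreal (\<integral>x. (\<omega> x * indicator \<Omega> x) * (norm (P N x))\<^sup>2 \<partial>lborel)"
      by (rule nn_integral_eq_integral[OF iPr]) (use w(3) in auto)
    finally show ?thesis using le by (simp add: ennreal_leI)
  qed
  have "(\<integral>\<^sup>+x. ennreal ((norm (KK x y))\<^sup>2 * \<omega> x) * indicator \<Omega> x \<partial>lborel)
      = (\<integral>\<^sup>+x. liminf (\<lambda>N. ennreal ((norm (P N x))\<^sup>2 * \<omega> x) * indicator \<Omega> x) \<partial>lborel)"
  proof (intro nn_integral_cong)
    fix x
    show "ennreal ((norm (KK x y))\<^sup>2 * \<omega> x) * indicator \<Omega> x = liminf (\<lambda>N. ennreal ((norm (P N x))\<^sup>2 * \<omega> x) * indicator \<Omega> x)"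
    proof (cases "x \<in> \<Omega>")
      case True
      have "(\<lambda>N. P N x) \<longlonglongrightarrow> KK x y"
        using KK_sums[OF True y] unfolding sums_def P_def v_def .
      then have "(\<lambda>N. ennreal ((norm (P N x))\<^sup>2 * \<omega> x)) \<longlonglongrightarrow> ennreal ((norm (KK x y))\<^sup>2 * \<omega> x)"
        by (intro tendsto_intros tendsto_ennrealI)
      then show ?thesis using True by (simp add: lim_imp_Liminf)
    qed (simp add: Liminf_const)
  qed
  also have "\<dots> \<le> liminf (\<lambda>N. \<integral>\<^sup>+x. ennreal ((norm (P N x))\<^sup>2 * \<omega> x) * indicator \<Omega> x \<partial>lborel)"
    by (rule nn_integral_liminf) measurable
  also have "\<dots> \<le> liminf (\<lambda>N. ennreal S)"
    by (intro Liminf_mono always_eventually allI fin)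
  finally show ?thesis by (simp add: Liminf_const)
qed

end

section \<open>Calculus of complex differentiability in several variables\<close>

definition cdiff :: "((complex ^ 'n) \<times> complex \<Rightarrow> complex) \<Rightarrow> (complex ^ 'n) \<times> complex \<Rightarrow> bool" where
  "cdiff f x \<longleftrightarrow> (\<exists>D. (f has_derivative D) (at x) \<and> (\<forall>c v. D (cscale c v) = c * D v))"

lemma cdiff_const: "cdiff (\<lambda>_. a) x"
  unfolding cdiff_def by (intro exI[of _ "\<lambda>_. 0"]) auto

lemma cdiff_add: "cdiff f x \<Longrightarrow> cdiff g x \<Longrightarrow> cdiff (\<lambda>x. f x + g x) x"
  unfolding cdiff_def
proof (elim exE conjE)
  fix D E assume D: "(f has_derivative D) (at x)" "\<forall>c v. D (cscale c v) = c * D v"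
    and E: "(g has_derivative E) (at x)" "\<forall>c v. E (cscale c v) = c * E v"
  show "\<exists>D. ((\<lambda>x. f x + g x) has_derivative D) (at x) \<and> (\<forall>c v. D (cscale c v) = c * D v)"
    by (rule exI[of _ "\<lambda>v. D v + E v"]) (simp add: D E distrib_left has_derivative_add)
qed

lemma cdiff_mult: "cdiff f x \<Longrightarrow> cdiff g x \<Longrightarrow> cdiff (\<lambda>x. f x * g x) x"
  unfolding cdiff_def
proof (elim exE conjE)
  fix D E assume D: "(f has_derivative D) (at x)" "\<forall>c v. D (cscale c v) = c * D v"
    and E: "(g has_derivative E) (at x)" "\<forall>c v. E (cscale c v) = c * E v"
  show "\<exists>D. ((\<lambda>x. f x * g x) has_derivative D) (at x) \<and> (\<forall>c v. D (cscale c v) = c * D v)"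
  proof (intro exI conjI)
    show "((\<lambda>x. f x * g x) has_derivative (\<lambda>v. f x * E v + D v * g x)) (at x)"
      by (rule has_derivative_mult[OF D(1) E(1)])
  qed (simp add: D E algebra_simps)
qed

lemma cdiff_sum: "(\<And>i. i \<in> I \<Longrightarrow> cdiff (f i) x) \<Longrightarrow> cdiff (\<lambda>x. \<Sum>i\<in>I. f i x) x"
  by (induction I rule: infinite_finite_induct) (auto intro!: cdiff_const cdiff_add)

lemma cdiff_compose:
  assumes g: "cdiff g x" and p: "p field_differentiable (at (g x))"
  shows "cdiff (\<lambda>x. p (g x)) x"
proof -
  obtain D where D: "(g has_derivative D) (at x)" "\<forall>c v. D (cscale c v) = c * D v"
    using g by (auto simp: cdiff_def)
  obtain d where "(p has_field_derivative d) (at (g x))" using p by (auto simp: field_differentiable_def)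
  then have d: "(p has_derivative (\<lambda>h. d * h)) (at (g x))" by (simp add: has_field_derivative_def)
  have "((\<lambda>x. p (g x)) has_derivative (\<lambda>v. d * D v)) (at x)"
    by (rule has_derivative_compose[OF D(1) d])
  then show ?thesis unfolding cdiff_def by (intro exI[of _ "\<lambda>v. d * D v"]) (simp add: D(2))
qed

lemma cdiff_linear:
  assumes "linear f" "\<And>c v. f (cscale c v) = c * f v"
  shows "cdiff f x"
  unfolding cdiff_def using assms
  by (intro exI[of _ f]) (simp add: linear_imp_has_derivative)

lemma cdiff_hprod: "cdiff (\<lambda>x. hprod (fst x) z) x"
  by (intro cdiff_linear linearI) (auto simp: hprod_add_left hprod_scale_left scaleR_eq_smult scaleR_conv_of_real)

lemma cdiff_snd: "cdiff (\<lambda>x. snd x * c) x"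
  by (intro cdiff_linear linearI) (auto simp: algebra_simps)

lemma powi_field_differentiable: "z \<noteq> 0 \<Longrightarrow> (\<lambda>z. z powi j) field_differentiable (at (z::complex))"
proof -
  assume "z \<noteq> 0"
  have "(\<lambda>z::complex. z powi j) holomorphic_on (- {0})" by (intro holomorphic_intros) auto
  then show ?thesis using \<open>z \<noteq> 0\<close> by (intro holomorphic_on_imp_differentiable_at) auto
qed

lemma power_series_field_differentiable:
  fixes c :: "nat \<Rightarrow> real"
  assumes s: "\<And>x::real. 0 \<le> x \<Longrightarrow> x < 1 \<Longrightarrow> summable (\<lambda>q. \<bar>c q\<bar> * x ^ q)" and z: "norm (z::complex) < 1"
  shows "(\<lambda>u. \<Sum>q. of_real (c q) * u ^ q) field_differentiable (at z)"
proof -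
  define r where "r = (1 + norm z) / 2"
  have r: "norm z < r" "r < 1" "0 \<le> r" using z by (auto simp: r_def)
  have "summable (\<lambda>q. norm (complex_of_real (c q) * of_real r ^ q))"
    using s[OF r(3,2)] r by (simp add: norm_mult norm_power)
  then have "summable (\<lambda>q. complex_of_real (c q) * of_real r ^ q)" by (rule summable_norm_cancel)
  from termdiffs_strong[OF this, of z] r show ?thesis by (auto simp: field_differentiable_def)
qed

section \<open>The reproducing property\<close>

context hartogs
begin

lemma un_L2:
  assumes y: "y \<in> \<Omega>"
  shows "(\<integral>\<^sup>+x. ennreal ((norm (un k i y x))\<^sup>2) * indicator \<Omega> x \<partial>lborel) = ennreal (dg y k i)"
proof -
  have "\<beta> k (j0 k + int i) > 0" using bb_bounds(3)[of k] by (simp add: beta_j0)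
  then show ?thesis unfolding un_def by (simp add: uu_norm_sq dg_eq[OF y])
qed

lemma continuous_on_un: "y \<in> \<Omega> \<Longrightarrow> continuous_on \<Omega> (un k i y)"
  unfolding un_def by (rule continuous_on_uu)

text \<open>By Cauchy-Schwarz the integral of \<open>g\<close> times block \<open>(k, i)\<close> is,
  in absolute value, at most the norm of \<open>g\<close> times \<open>sqrt (dg y k i)\<close>.
  Summability of these bounds allows the series for \<open>KK\<close> to be integrated termwise
  against any square integrable \<open>g\<close>.\<close>

lemma
  assumes y: "y \<in> \<Omega>" and gm: "(\<lambda>x. indicator \<Omega> x *\<^sub>R g x) \<in> borel_measurable lborel"
    and gi: "(\<integral>\<^sup>+x. ennreal ((norm (g x))\<^sup>2) * indicator \<Omega> x \<partial>lborel) < \<infinity>"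
  shows un_inner_summable: "(\<lambda>(k, i). norm (\<integral>x. indicator \<Omega> x *\<^sub>R (g x * cnj (un k i y x)) \<partial>lborel)) summable_on UNIV"
    and KK_inner_has_sum: "((\<lambda>(k, i). \<integral>x. indicator \<Omega> x *\<^sub>R (g x * cnj (un k i y x)) \<partial>lborel) has_sum
      (\<integral>x. indicator \<Omega> x *\<^sub>R (g x * cnj (KK x y)) \<partial>lborel)) UNIV"
proof -
  define F where "F p x = indicator \<Omega> x *\<^sub>R (g x * cnj (un (fst p) (snd p) y x))" for p x
  have um: "(\<lambda>x. indicator \<Omega> x *\<^sub>R un k i y x) \<in> borel_measurable lborel" for k i
    by (rule measurable_on_Omega[OF continuous_on_un[OF y]])
  have int: "integrable lborel (F p)" for p
    unfolding F_def by (rule integrable_L2_mult[OF gm um gi]) (simp add: un_L2[OF y])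
  obtain Q where Q: "Q \<ge> 0" "(\<integral>\<^sup>+x. ennreal ((norm (g x))\<^sup>2) * indicator \<Omega> x \<partial>lborel) = ennreal Q"
    using gi by (cases "\<integral>\<^sup>+x. ennreal ((norm (g x))\<^sup>2) * indicator \<Omega> x \<partial>lborel") auto
  have le: "(\<integral>x. norm (F p x) \<partial>lborel) \<le> sqrt Q * sqrt (dg y (fst p) (snd p))" for p
  proof -
    let ?a = "\<lambda>x. ennreal (norm (indicator \<Omega> x *\<^sub>R g x))"
    let ?b = "\<lambda>x. ennreal (norm (indicator \<Omega> x *\<^sub>R un (fst p) (snd p) y x))"
    have am: "?a \<in> borel_measurable lborel" using measurable_compose[OF gm, of "\<lambda>z. ennreal (norm z)" borel] by simp
    have bm: "?b \<in> borel_measurable lborel" using measurable_compose[OF um, of "\<lambda>z. ennreal (norm z)" borel] by simp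
    have "ennreal (\<integral>x. norm (F p x) \<partial>lborel) = (\<integral>\<^sup>+x. ?a x * ?b x \<partial>lborel)"
      unfolding nn_integral_eq_integral[OF integrable_norm[OF int], of p, simplified, symmetric]
      by (intro nn_integral_cong) (auto simp: F_def indicator_def norm_mult ennreal_mult)
    then have "ennreal (\<integral>x. norm (F p x) \<partial>lborel) ^ 2 \<le> (\<integral>\<^sup>+x. ?a x ^ 2 \<partial>lborel) * (\<integral>\<^sup>+x. ?b x ^ 2 \<partial>lborel)"
      using Cauchy_Schwarz_nn_integral[OF am bm] by simp
    also have "(\<integral>\<^sup>+x. ?a x ^ 2 \<partial>lborel) = ennreal Q"
      unfolding Q(2)[symmetric] by (intro nn_integral_cong) (auto simp: indicator_def ennreal_power)
    also have "(\<integral>\<^sup>+x. ?b x ^ 2 \<partial>lborel) = ennreal (dg y (fst p) (snd p))"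
      unfolding un_L2[OF y, symmetric] by (intro nn_integral_cong) (auto simp: indicator_def ennreal_power)
    finally have "ennreal ((\<integral>x. norm (F p x) \<partial>lborel)\<^sup>2) \<le> ennreal (Q * dg y (fst p) (snd p))"
      using Q(1) dg_nonneg by (simp add: ennreal_power ennreal_mult)
    then have "(\<integral>x. norm (F p x) \<partial>lborel)\<^sup>2 \<le> Q * dg y (fst p) (snd p)"
      using Q(1) dg_nonneg by (simp add: ennreal_le_iff)
    then have "(\<integral>x. norm (F p x) \<partial>lborel) \<le> sqrt (Q * dg y (fst p) (snd p))" by (rule real_le_rsqrt)
    then show ?thesis by (simp add: real_sqrt_mult)
  qed
  have sq: "(\<lambda>p. sqrt Q * (case p of (k, i) \<Rightarrow> sqrt (dg y k i))) summable_on UNIV"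
    by (intro summable_on_cmult_right summable_sqrt_dg y)
  have "(\<lambda>p. norm (\<integral>x. F p x \<partial>lborel)) summable_on UNIV"
    by (rule summable_on_comparison_test[OF sq])
       (auto simp: case_prod_unfold intro!: order_trans[OF integral_norm_bound le])
  then show "(\<lambda>(k, i). norm (\<integral>x. indicator \<Omega> x *\<^sub>R (g x * cnj (un k i y x)) \<partial>lborel)) summable_on UNIV"
    by (simp add: F_def case_prod_unfold)
  have s1: "(\<lambda>p. \<integral>x. norm (F p x) \<partial>lborel) summable_on UNIV"
    by (rule summable_on_comparison_test[OF sq])
       (auto simp: case_prod_unfold intro!: le)
  have s2: "summable (\<lambda>N. norm (F (prod_decode N) x))" for x
  proof (cases "x \<in> \<Omega>")
    case True
    have "summable (\<lambda>N. norm (g x) * norm (un (fst (prod_decode N)) (snd (prod_decode N)) y x))"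
      using summable_prod_decode[OF un_abs_summable[OF True y]] by (intro summable_mult) (simp add: case_prod_unfold)
    then show ?thesis using True by (simp add: F_def norm_mult)
  qed (simp add: F_def)
  have lim: "(\<Sum>N. F (prod_decode N) x) = indicator \<Omega> x *\<^sub>R (g x * cnj (KK x y))" for x
  proof (cases "x \<in> \<Omega>")
    case True
    have "(\<lambda>N. g x * cnj (un (fst (prod_decode N)) (snd (prod_decode N)) y x)) sums (g x * cnj (KK x y))"
      by (intro sums_mult sums_cnj[THEN iffD2] KK_sums True y)
    then show ?thesis using True by (simp add: F_def sums_iff)
  qed (simp add: F_def)
  have "(\<lambda>N. \<integral>x. F (prod_decode N) x \<partial>lborel) sums (\<integral>x. (\<Sum>N. F (prod_decode N) x) \<partial>lborel)"
    by (rule sums_integral[OF int]) (use s2 summable_prod_decode[OF s1] in auto)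
  then have "(\<lambda>N. \<integral>x. F (prod_decode N) x \<partial>lborel) sums (\<integral>x. indicator \<Omega> x *\<^sub>R (g x * cnj (KK x y)) \<partial>lborel)"
    unfolding lim .
  moreover have "summable (\<lambda>N. norm (\<integral>x. F (prod_decode N) x \<partial>lborel))"
    by (rule summable_comparison_test'[OF summable_prod_decode[OF s1], of 0]) (simp add: integral_norm_bound)
  ultimately have "((\<lambda>N. \<integral>x. F (prod_decode N) x \<partial>lborel) has_sum (\<integral>x. indicator \<Omega> x *\<^sub>R (g x * cnj (KK x y)) \<partial>lborel)) UNIV"
    by (intro norm_summable_imp_has_sum)
  then have "((\<lambda>p. \<integral>x. F p x \<partial>lborel) has_sum (\<integral>x. indicator \<Omega> x *\<^sub>R (g x * cnj (KK x y)) \<partial>lborel)) UNIV"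
    using has_sum_reindex_bij_betw[OF bij_prod_decode, of "\<lambda>p. \<integral>x. F p x \<partial>lborel"] by simp
  then show "((\<lambda>(k, i). \<integral>x. indicator \<Omega> x *\<^sub>R (g x * cnj (un k i y x)) \<partial>lborel) has_sum
      (\<integral>x. indicator \<Omega> x *\<^sub>R (g x * cnj (KK x y)) \<partial>lborel)) UNIV"
    by (simp add: F_def case_prod_unfold)
qed

lemma fourier_series_act:
  assumes s: "circle_act \<sigma>" and one: "\<sigma> 1 y = y" and f: "continuous_on \<Omega> f" and y: "y \<in> \<Omega>"
    and sm: "(\<lambda>a. norm (avg \<sigma> a f y)) summable_on UNIV"
  shows "((\<lambda>a. avg \<sigma> a f y) has_sum f y) UNIV"
proof -
  have "continuous_on (sphere 0 1) (\<lambda>z. f (\<sigma> z y))"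
  proof (rule continuous_on_compose2[OF f])
    show "continuous_on (sphere 0 1) (\<lambda>z. \<sigma> z y)" by (intro act_continuous[OF s] continuous_intros)
    show "(\<lambda>z. \<sigma> z y) ` sphere 0 1 \<subseteq> \<Omega>"
    proof (rule image_subsetI)
      fix z :: complex assume "z \<in> sphere 0 1"
      then obtain t where "z = circ t" by (metis sphere_circ mem_sphere_0)
      then show "\<sigma> z y \<in> \<Omega>" using act_in_Omega[OF s] y by simp
    qed
  qed
  from fourier_series_at_1[OF this] sm show ?thesis
    by (simp add: avg_def[abs_def] one)
qed

text \<open>The pairing of \<open>f\<close> with \<open>KK\<close> is an absolutely convergent
  double series whose terms are the components of \<open>f\<close> at \<open>y\<close>. Absolute
  convergence licenses the Fourier series, first over the rotation of \<open>w\<close> and then over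
  that of \<open>z\<close>, and these sum the same terms to \<open>f y\<close>.\<close>

lemma reproducing:
  assumes f: "A2 f" and y: "y \<in> \<Omega>"
  shows "f y = (\<integral>x. indicator \<Omega> x *\<^sub>R (f x * cnj (KK x y)) \<partial>lborel)"
proof -
  have cf: "continuous_on \<Omega> f" "line_holo f" using f by (auto simp: A2_def)
  have fi: "(\<integral>\<^sup>+x. ennreal ((norm (f x))\<^sup>2) * indicator \<Omega> x \<partial>lborel) < \<infinity>" using f by (simp add: A2_def)
  define a where "a k i = comp f (int k) (j0 k + int i) y" for k i
  have a: "(\<integral>x. indicator \<Omega> x *\<^sub>R (f x * cnj (un k i y x)) \<partial>lborel) = a k i" for k i
    unfolding a_def un_def using bb_bounds(3)[of k] by (intro comp_inner[symmetric] f y) (simp add: beta_j0)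
  note I = un_inner_summable[OF y measurable_on_Omega[OF cf(1)] fi, unfolded a]
    KK_inner_has_sum[OF y measurable_on_Omega[OF cf(1)] fi, unfolded a]
  have aS: "(\<lambda>(k, i). norm (a k i)) summable_on Sigma UNIV (\<lambda>_. UNIV)" using I(1) by simp
  have ak: "(\<lambda>i. norm (a k i)) summable_on UNIV" for k
    using summable_on_Sigma_banach[OF aS] Infinite_Sum.abs_summable_on_Sigma_iff[of "\<lambda>(k, i). a k i" UNIV "\<lambda>_. UNIV"] aS
    by (auto simp: case_prod_unfold)
  have as: "(\<lambda>k. \<Sum>\<^sub>\<infinity>i. norm (a k i)) summable_on UNIV"
    by (rule summable_on_Sigma_banach[OF aS])
  have bij: "bij_betw (\<lambda>i. j0 k + int i) UNIV {j0 k..}" for k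
    by (rule bij_betwI[where g="\<lambda>j. nat (j - j0 k)"]) auto
  \<comment> \<open>Exponents below \<open>j0 k\<close> are absent from the kernel; square
    integrability makes the corresponding components of \<open>f\<close> vanish, so the two series
    run over the same indices.\<close>
  have van: "comp f (int k) j y = 0" if "j \<notin> {j0 k..}" for k j
    using that beta_pos_iff[of k j] by (intro comp_vanish[OF f _ y]) auto
  have inner: "((\<lambda>i. a k i) has_sum avg act1 (int k) f y) UNIV" for k
  proof -
    have "(\<lambda>j. norm (comp f (int k) j y)) summable_on {j0 k..}"
      using ak[of k] summable_on_reindex_bij_betw[OF bij, of "\<lambda>j. norm (comp f (int k) j y)"] by (simp add: a_def)
    then have "(\<lambda>j. norm (comp f (int k) j y)) summable_on UNIV"
      using van by (subst summable_on_cong_neutral[where T="{j0 k..}" and g="\<lambda>j. norm (comp f (int k) j y)"]) auto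
    then have "((\<lambda>j. comp f (int k) j y) has_sum avg act1 (int k) f y) UNIV"
      unfolding comp_def
      by (intro fourier_series_act circle_act_act2 continuous_on_avg circle_act_act1 cf y) (simp add: act2_def)
    then have "((\<lambda>j. comp f (int k) j y) has_sum avg act1 (int k) f y) {j0 k..}"
      using van by (subst (asm) has_sum_cong_neutral[where T="{j0 k..}" and g="\<lambda>j. comp f (int k) j y"]) auto
    then show ?thesis
      using has_sum_reindex_bij_betw[OF bij, of "\<lambda>j. comp f (int k) j y"] by (simp add: a_def)
  qed
  have neg: "avg act1 k f y = 0" if "k < 0" for k
  proof -
    have z: "avg act2 j (avg act1 k f) y = 0" for j
      using comp_negative[OF cf that y] by (simp add: comp_def)
    have "((\<lambda>j. avg act2 j (avg act1 k f) y) has_sum avg act1 k f y) UNIV"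
      by (intro fourier_series_act circle_act_act2 continuous_on_avg circle_act_act1 cf y) (simp_all add: act2_def z)
    then show ?thesis by (rule has_sum_unique) (rule has_sum_0, rule z)
  qed
  have bij0: "bij_betw int UNIV {0..}"
    by (rule bij_betwI[where g=nat]) auto
  have "(\<lambda>k. norm (avg act1 (int k) f y)) summable_on UNIV"
  proof (rule summable_on_comparison_test[OF as])
    show "norm (avg act1 (int k) f y) \<le> (\<Sum>\<^sub>\<infinity>i. norm (a k i))" for k
      using norm_infsum_bound[OF ak[of k]] infsumI[OF inner[of k]] by simp
  qed simp
  then have "(\<lambda>k. norm (avg act1 k f y)) summable_on {0..}"
    using summable_on_reindex_bij_betw[OF bij0, of "\<lambda>k. norm (avg act1 k f y)"] by simp
  then have "(\<lambda>k. norm (avg act1 k f y)) summable_on UNIV"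
    using neg by (subst summable_on_cong_neutral[where T="{0..}" and g="\<lambda>k. norm (avg act1 k f y)"]) auto
  then have "((\<lambda>k. avg act1 k f y) has_sum f y) UNIV"
    by (intro fourier_series_act circle_act_act1 cf y) (simp_all add: act1_def)
  then have "((\<lambda>k. avg act1 k f y) has_sum f y) {0..}"
    using neg by (subst (asm) has_sum_cong_neutral[where T="{0..}" and g="\<lambda>k. avg act1 k f y"]) auto
  then have 1: "((\<lambda>k. avg act1 (int k) f y) has_sum f y) UNIV"
    using has_sum_reindex_bij_betw[OF bij0, of "\<lambda>k. avg act1 k f y"] by simp
  have "((\<lambda>k. avg act1 (int k) f y) has_sum (\<integral>x. indicator \<Omega> x *\<^sub>R (f x * cnj (KK x y)) \<partial>lborel)) UNIV"
    by (rule has_sum_SigmaD[where f="\<lambda>(k, i). a k i" and A=UNIV and B="\<lambda>_. UNIV"]) (use I(2) inner in auto)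
  then show ?thesis using 1 has_sum_unique by blast
qed

lemma Cn_arith_le:
  assumes "r < m" shows "Cn (m * q + r) \<le> (real CARD('n) * real m) ^ CARD('n) * real (Suc q) ^ CARD('n)"
proof -
  have "Suc (m * q + r) \<le> m * Suc q" using assms by simp
  then have "real (Suc (m * q + r)) \<le> real m * real (Suc q)" by (metis of_nat_le_iff of_nat_mult)
  then have "real (Suc (m * q + r)) ^ CARD('n) \<le> (real m * real (Suc q)) ^ CARD('n)" by (rule power_mono) simp
  then have "real CARD('n) ^ CARD('n) * real (Suc (m * q + r)) ^ CARD('n) \<le> real CARD('n) ^ CARD('n) * (real m * real (Suc q)) ^ CARD('n)"
    by (rule mult_left_mono) simp
  with Cn_le_Suc[of "m * q + r"] show ?thesis
    unfolding power_mult_distrib mult.assoc by (rule order_trans)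
qed

lemma summable_Cn_arith:
  assumes "r < m" "0 \<le> x" "x < 1" shows "summable (\<lambda>q. \<bar>Cn (m * q + r)\<bar> * x ^ q)"
proof (rule summable_comparison_test'[of _ 0])
  show "summable (\<lambda>q. (real CARD('n) * real m) ^ CARD('n) * (real (Suc q) ^ CARD('n) * x ^ q))"
    using assms by (intro summable_mult summable_poly_geometric_Suc) auto
  show "norm (\<bar>Cn (m * q + r)\<bar> * x ^ q) \<le> (real CARD('n) * real m) ^ CARD('n) * (real (Suc q) ^ CARD('n) * x ^ q)" for q
    using mult_right_mono[OF Cn_arith_le[OF assms(1), of q], of "x ^ q"] assms Cn_pos[of "m * q + r"]
    by (simp add: abs_mult mult.assoc del: of_nat_Suc)
qed

lemma summable_bb:
  assumes "0 \<le> x" "x < (1::real)" shows "summable (\<lambda>i. \<bar>bb r + real i\<bar> * x ^ i)"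
proof (rule summable_comparison_test'[of _ 0])
  show "summable (\<lambda>q. real (Suc q) ^ 1 * x ^ q)"
    using assms by (intro summable_poly_geometric_Suc) auto
  show "norm (\<bar>bb r + real i\<bar> * x ^ i) \<le> real (Suc i) ^ 1 * x ^ i" for i
    using assms bb_bounds[of r] by (auto simp: abs_mult intro!: mult_right_mono)
qed

section \<open>Finite closed form and holomorphy of the kernel\<close>

definition \<Phi> :: "nat \<Rightarrow> complex \<Rightarrow> complex" where "\<Phi> r u = (\<Sum>q. of_real (Cn (m * q + r)) * u ^ q)"
definition \<Psi> :: "nat \<Rightarrow> complex \<Rightarrow> complex" where "\<Psi> r s = (\<Sum>i. of_real (bb r + real i) * s ^ i)"

lemma bij_arith: "bij_betw (\<lambda>(r, q, i). (m * q + r, i)) ({..<m} \<times> UNIV) (UNIV :: (nat \<times> nat) set)"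
proof (rule bij_betwI[where g="\<lambda>(k, i). (k mod m, k div m, i)"])
  show "(\<lambda>(k, i). (k mod m, k div m, i)) \<in> UNIV \<rightarrow> {..<m} \<times> UNIV" using m by auto
qed (use m in auto)

text \<open>With \<open>k = m * q + r\<close> the block depends on \<open>q\<close> only through
  powers of \<open>t ^ m * s powi (- int l)\<close> and on \<open>i\<close> only through powers of
  \<open>s\<close>. Each residue class is thus a product of two one-variable power series. Their
  arguments lie in the unit disc by Cauchy-Schwarz and the defining inequality of the domain at both
  points.\<close>

lemma KK_closed:
  assumes x: "x \<in> \<Omega>" and y: "y \<in> \<Omega>"
  defines "t \<equiv> hprod (fst x) (fst y)" and "s \<equiv> snd x * cnj (snd y)"
  shows "s \<noteq> 0" "norm s < 1" "norm (t ^ m * s powi (- int l)) < 1"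
    and "KK x y = (\<Sum>r<m. t ^ r * s powi (j0 r) * \<Phi> r (t ^ m * s powi (- int l)) * \<Psi> r s)"
proof -
  obtain z w where x': "x = (z, w)" by force
  obtain z' w' where y': "y = (z', w')" by force
  have wx: "w \<noteq> 0" "norm w < 1" "norm z < rad w" using x by (auto simp: x' in_Omega_iff)
  have wy: "w' \<noteq> 0" "norm w' < 1" "norm z' < rad w'" using y by (auto simp: y' in_Omega_iff)
  show s0: "s \<noteq> 0" using wx wy by (simp add: s_def x' y')
  show s1: "norm s < 1" using wx wy mult_strict_mono[of "norm w" 1 "norm w'" 1] by (simp add: s_def x' y' norm_mult)
  have "norm t ^ m \<le> (norm z * norm z') ^ m"
    unfolding t_def x' y' by (intro power_mono) (auto simp: norm_hprod_le)
  also have "\<dots> < (rad w * rad w') ^ m"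
    using wx wy m rad_pos by (intro power_strict_mono mult_strict_mono) auto
  also have "\<dots> = norm s ^ l"
    using wx wy by (simp add: power_mult_distrib rad_pow s_def x' y' norm_mult)
  finally have "norm t ^ m < norm s ^ l" .
  then show u1: "norm (t ^ m * s powi (- int l)) < 1"
    using s0 by (simp add: power_int_minus divide_inverse[symmetric] norm_divide norm_power)
  define u where "u = t ^ m * s powi (- int l)"
  have un_split: "un (m * q + r) i y x = t ^ r * s powi (j0 r) * ((of_real (Cn (m * q + r)) * u ^ q) * (of_real (bb r + real i) * s ^ i))" for r q i
  proof -
    have "s powi (j0 (m * q + r) + int i) = s powi (j0 r) * (s powi (- int l)) ^ q * s ^ i"
    proof -
      have "(s powi (- int l)) ^ q = s powi (- int (l * q))"
        by (simp add: power_int_power'[symmetric] power_int_minus power_mult power_inverse)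
      moreover have "j0 (m * q + r) + int i = j0 r + (- int (l * q)) + int i" by (simp add: j0_add_mult)
      ultimately show ?thesis using s0 by (simp only: power_int_add[OF disjI1[OF s0]] power_int_of_nat)
    qed
    then show ?thesis
      unfolding un_def uu_def cc_j0 t_def[symmetric] s_def[symmetric] u_def bb_add_mult
      by (simp add: power_add power_mult power_mult_distrib mult_ac)
  qed
  have inner: "((\<lambda>p. un (m * fst p + r) (snd p) y x) has_sum (t ^ r * s powi (j0 r) * (\<Phi> r u * \<Psi> r s))) UNIV" if r: "r < m" for r
  proof -
    have "((\<lambda>(q, i). (of_real (Cn (m * q + r)) * u ^ q) * (of_real (bb r + real i) * s ^ i)) has_sum (\<Phi> r u * \<Psi> r s)) UNIV"
      unfolding \<Phi>_def \<Psi>_def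
    proof (rule has_sum_product)
      show "summable (\<lambda>q. norm (complex_of_real (Cn (m * q + r)) * u ^ q))"
        using summable_Cn_arith[OF r, of "norm u"] u1 by (simp add: norm_mult norm_power u_def)
      show "summable (\<lambda>i. norm (complex_of_real (bb r + real i) * s ^ i))"
        using summable_bb[of "norm s" r] s1 by (simp add: norm_mult norm_power del: of_real_add)
    qed
    from has_sum_cmult_right[OF this, of "t ^ r * s powi (j0 r)"] show ?thesis
      by (simp add: un_split case_prod_unfold)
  qed
  have "((\<lambda>(r, q, i). un (m * q + r) i y x) has_sum KK x y) ({..<m} \<times> UNIV)"
    using KK_has_sum[OF x y] has_sum_reindex_bij_betw[OF bij_arith, of "\<lambda>(k, i). un k i y x"]
    by (simp add: case_prod_unfold)
  then have "((\<lambda>r. t ^ r * s powi (j0 r) * (\<Phi> r u * \<Psi> r s)) has_sum KK x y) {..<m}"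
    by (rule has_sum_SigmaD) (use inner in \<open>auto simp: case_prod_unfold\<close>)
  then have "KK x y = (\<Sum>r<m. t ^ r * s powi (j0 r) * (\<Phi> r u * \<Psi> r s))"
    using has_sum_finite[of "{..<m}" "\<lambda>r. t ^ r * s powi (j0 r) * (\<Phi> r u * \<Psi> r s)"] has_sum_unique by blast
  then show "KK x y = (\<Sum>r<m. t ^ r * s powi (j0 r) * \<Phi> r (t ^ m * s powi (- int l)) * \<Psi> r s)"
    by (simp add: u_def mult.assoc)
qed

lemma KK_holomorphic:
  assumes y: "y \<in> \<Omega>" shows "holomorphic_several (\<lambda>x. KK x y) \<Omega>"
  unfolding holomorphic_several_def
proof
  fix x assume x: "x \<in> \<Omega>"
  let ?t = "\<lambda>x. hprod (fst x) (fst y)" and ?s = "\<lambda>x. snd x * cnj (snd y)"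
  let ?G = "\<lambda>x. \<Sum>r<m. ?t x ^ r * ?s x powi (j0 r) * \<Phi> r (?t x ^ m * ?s x powi (- int l)) * \<Psi> r (?s x)"
  note K = KK_closed[OF x y]
  have pw: "(\<lambda>z. z ^ r) field_differentiable (at (z::complex))" for r z
    by (rule holomorphic_on_imp_differentiable_at[of _ UNIV]) (auto intro!: holomorphic_intros)
  have "cdiff ?G x"
  proof (intro cdiff_sum cdiff_mult)
    fix r assume r: "r \<in> {..<m}"
    show "cdiff (\<lambda>x. ?t x ^ r) x" by (rule cdiff_compose[OF cdiff_hprod pw])
    show "cdiff (\<lambda>x. ?s x powi (j0 r)) x" by (rule cdiff_compose[OF cdiff_snd powi_field_differentiable[OF K(1)]])
    show "cdiff (\<lambda>x. \<Psi> r (?s x)) x"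
      unfolding \<Psi>_def by (rule cdiff_compose[OF cdiff_snd power_series_field_differentiable[OF summable_bb K(2)]])
    have "cdiff (\<lambda>x. ?t x ^ m * ?s x powi (- int l)) x"
      by (intro cdiff_mult cdiff_compose[OF cdiff_hprod pw] cdiff_compose[OF cdiff_snd powi_field_differentiable[OF K(1)]])
    then show "cdiff (\<lambda>x. \<Phi> r (?t x ^ m * ?s x powi (- int l))) x"
      unfolding \<Phi>_def by (rule cdiff_compose) (intro power_series_field_differentiable summable_Cn_arith K(3), use r in auto)
  qed
  then obtain D where D: "(?G has_derivative D) (at x)" "\<forall>c v. D (cscale c v) = c * D v" unfolding cdiff_def by blast
  have "((\<lambda>x. KK x y) has_derivative D) (at x)"
    by (rule has_derivative_transform_within_open[OF D(1) open_Omega x]) (rule KK_closed(4)[OF _ y, symmetric])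
  then show "\<exists>D. ((\<lambda>x. KK x y) has_derivative D) (at x) \<and> (\<forall>c v. D (cscale c v) = c * D v)"
    using D(2) by blast
qed

lemma borel_measurable_lebesgue_on_Omega:
  "f \<in> borel_measurable borel \<Longrightarrow> f \<in> borel_measurable (lebesgue_on \<Omega>)"
  by (intro measurable_restrict_space1 measurable_completion) simp

lemma integral_lebesgue_on_Omega:
  fixes g :: "(complex ^ 'n) \<times> complex \<Rightarrow> complex"
  assumes "(\<lambda>x. indicator \<Omega> x *\<^sub>R g x) \<in> borel_measurable lborel"
  shows "(\<integral>x. g x \<partial>lebesgue_on \<Omega>) = (\<integral>x. indicator \<Omega> x *\<^sub>R g x \<partial>lborel)"
  using assms by (subst integral_restrict_space) (auto simp: integral_completion)

lemma KK_L2: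
  assumes y: "y \<in> \<Omega>"
  shows "(\<integral>\<^sup>+x. ennreal ((norm (KK x y))\<^sup>2) * indicator \<Omega> x \<partial>lborel) \<le> ennreal (Kd y)"
proof -
  have "(\<integral>\<^sup>+x. ennreal ((norm (KK x y))\<^sup>2 * 1) * indicator \<Omega> x \<partial>lborel) \<le> ennreal (Kd y)"
  proof (rule KK_weighted_norm_le[where \<omega>="\<lambda>_. 1" and \<mu>="\<lambda>(k, i). dg y k i"])
    show "((\<lambda>(k, i). dg y k i) has_sum Kd y) UNIV"
      unfolding Kd_def by (rule has_sum_infsum[OF summable_dg[OF y]])
  qed (auto simp: y un_L2 dg_nonneg)
  then show ?thesis by simp
qed

lemma is_bergman_kernel_KK: "is_bergman_kernel \<Omega> KK"
  unfolding is_bergman_kernel_def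
proof (intro conjI ballI allI impI)
  fix y assume y: "y \<in> \<Omega>"
  have m1: "(\<lambda>x. KK x y) \<in> borel_measurable (lebesgue_on \<Omega>)"
    by (rule borel_measurable_lebesgue_on_Omega[OF KK_measurable1])
  have "(\<integral>\<^sup>+x. ennreal ((norm (KK x y))\<^sup>2) \<partial>lebesgue_on \<Omega>) < \<infinity>"
    unfolding nn_integral_lebesgue_on_Omega using KK_L2[OF y] by (rule le_less_trans) simp
  then have "integrable (lebesgue_on \<Omega>) (\<lambda>x. (norm (KK x y))\<^sup>2)"
    using m1 by (intro integrableI_nonneg) auto
  then show "(\<lambda>x. KK x y) \<in> bergman_space \<Omega>"
    using KK_holomorphic[OF y] m1 by (simp add: bergman_space_def Lp_space_def)
  fix f assume f: "f \<in> bergman_space \<Omega>"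
  have A: "A2 f" by (rule bergman_space_A2[OF f])
  have "(\<lambda>x. indicator \<Omega> x *\<^sub>R (f x * cnj (KK x y))) \<in> borel_measurable lborel"
    using A KK_holomorphic[OF y] holomorphic_several_continuous_on
    by (intro measurable_on_Omega continuous_intros) (auto simp: A2_def)
  then show "f y = (\<integral>x. f x * cnj (KK x y) \<partial>lebesgue_on \<Omega>)"
    using reproducing[OF A y] by (simp add: integral_lebesgue_on_Omega)
qed (auto simp: KK_def)

lemma bergman_kernel_eq: "bergman_kernel \<Omega> = KK"
  unfolding bergman_kernel_def
  by (rule the_equality[where P="is_bergman_kernel \<Omega>", OF is_bergman_kernel_KK])
     (rule is_bergman_kernel_unique[OF _ is_bergman_kernel_KK])

end

section \<open>Estimates for the Schur test\<close>

text \<open>The integral is \<open>Beta a (N + 1) = fact N / pochhammer a (N + 1)\<close>, and every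
  factor of the Pochhammer symbol is at least \<open>a\<close>.\<close>

lemma nn_integral_Beta_le:
  fixes a :: real
  assumes a: "a > 0"
  shows "(\<integral>\<^sup>+x. ennreal (x powr (a - 1) * (1 - x) ^ N) * indicator {0<..<1} x \<partial>lborel) \<le> ennreal (fact N / a ^ Suc N)"
proof -
  have a': "a \<notin> \<int>\<^sub>\<le>\<^sub>0" using a nonpos_Ints_nonpos by force
  have G: "Gamma a > 0" using a by (rule Gamma_real_pos)
  have p0: "a ^ k \<le> pochhammer a k" for k
  proof (induction k)
    case (Suc k)
    have "a ^ Suc k \<le> pochhammer a k * (a + real k)"
      using mult_mono[OF Suc, of a "a + real k"] a pochhammer_pos[of a k] by (simp add: mult.commute)
    then show ?case by (simp add: pochhammer_Suc)
  qed simp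
  have "Beta a (real (Suc N)) = fact N / pochhammer a (Suc N)"
  proof -
    have "Gamma (a + real (Suc N)) = Gamma a * pochhammer a (Suc N)"
      using pochhammer_Gamma[OF a', of "Suc N"] G by simp
    moreover have "Gamma (real (Suc N)) = fact N" using Gamma_fact[of N, where 'a=real] by simp
    ultimately show ?thesis unfolding Beta_def using G by (simp only:) simp
  qed
  also have "\<dots> \<le> fact N / a ^ Suc N"
    using p0[of "Suc N"] a by (intro divide_left_mono) (auto intro!: mult_pos_pos pochhammer_pos zero_less_power)
  finally have B: "Beta a (real (Suc N)) \<le> fact N / a ^ Suc N" .
  have "((\<lambda>t. t powr (a - 1) * (1 - t) powr (real (Suc N) - 1)) has_integral Beta a (real (Suc N))) {0..1}"
    using a by (intro has_integral_Beta_real) auto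
  then have "((\<lambda>t. t powr (a - 1) * (1 - t) powr (real (Suc N) - 1)) has_integral Beta a (real (Suc N))) {0<..<1}"
    by (simp add: has_integral_Icc_iff_Ioo)
  then have "((\<lambda>t. t powr (a - 1) * (1 - t) ^ N) has_integral Beta a (real (Suc N))) {0<..<1}"
    by (rule has_integral_eq[rotated]) (simp add: powr_realpow)
  then have "((\<lambda>t. if t \<in> {0<..<1} then t powr (a - 1) * (1 - t) ^ N else 0) has_integral Beta a (real (Suc N))) UNIV"
    by (simp only: has_integral_restrict_UNIV)
  also have "(\<lambda>t. if t \<in> {0<..<1} then t powr (a - 1) * (1 - t) ^ N else 0) = (\<lambda>t. t powr (a - 1) * (1 - t) ^ N * indicator {0<..<1} t)"
    by (auto simp: indicator_def)
  finally have "(\<integral>\<^sup>+t. ennreal (t powr (a - 1) * (1 - t) ^ N * indicator {0<..<1} t) \<partial>lborel) = ennreal (Beta a (real (Suc N)))"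
    by (intro nn_integral_has_integral_lborel) (auto simp: indicator_def)
  moreover have "(\<integral>\<^sup>+x. ennreal (x powr (a - 1) * (1 - x) ^ N) * indicator {0<..<1} x \<partial>lborel)
     = (\<integral>\<^sup>+t. ennreal (t powr (a - 1) * (1 - t) ^ N * indicator {0<..<1} t) \<partial>lborel)"
    by (intro nn_integral_cong) (auto simp: indicator_def)
  ultimately show ?thesis using B by (simp add: ennreal_leI)
qed

text \<open>The interval is split at distance of order \<open>1 / (i + 1)\<close> from 1. Away from
  1 the singular factor is bounded by its value at the cut and the power of \<open>x\<close>
  integrates to about \<open>1 / (i + 1)\<close>; near 1 the power of \<open>x\<close> is at most 2
  and the singularity is integrable as \<open>B < 1\<close>. Both parts have order
  \<open>(i + 1) powr (B - 1)\<close>.\<close>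

lemma nn_integral_Beta_decay:
  fixes B e :: real
  assumes B: "0 < B" "B < 1" and e: "e > 0"
  obtains C where "C \<ge> 0" "\<And>i. (\<integral>\<^sup>+x. ennreal (x powr (real i + e - 1)) * ennreal ((1 - x) powr (- B)) * indicator {0<..<1} x \<partial>lborel)
      \<le> ennreal (C * real (Suc i) powr (B - 1))"
proof -
  \<comment> \<open>Converts \<open>1 / (real i + e)\<close> into a multiple of
    \<open>1 / (i + 1)\<close>; the factor \<open>1 / e\<close> is relevant for small
    \<open>e\<close>.\<close>
  define M where "M = max 1 (1 / e)"
  define C where "C = 2 * M + 2 / (1 - B)"
  have M: "M \<ge> 1" by (simp add: M_def)
  have "(\<integral>\<^sup>+x. ennreal (x powr (real i + e - 1)) * ennreal ((1 - x) powr (- B)) * indicator {0<..<1} x \<partial>lborel)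
      \<le> ennreal (C * real (Suc i) powr (B - 1))" for i
  proof -
    let ?s = "real (Suc i)"
    \<comment> \<open>The extra factor 2 keeps \<open>x > 1 / 2\<close> near the endpoint, so that
      \<open>x powr (- 1) \<le> 2\<close> there even for \<open>i = 0\<close>.\<close>
    define \<delta> where "\<delta> = 1 / (2 * ?s)"
    have d: "0 < \<delta>" "\<delta> \<le> 1 / 2" by (simp_all add: \<delta>_def field_simps)
    have ie: "real i + e > 0" using e by simp
    have pw: "ennreal (x powr (real i + e - 1)) * ennreal ((1 - x) powr (- B)) * indicator {0<..<1} x
      \<le> ennreal (\<delta> powr (- B)) * (ennreal (x powr (real i + e - 1)) * indicator {0<..<1} x)
        + 2 * (ennreal ((1 - x) powr (1 - B - 1)) * indicator {0<..<\<delta>} (1 - x))" for x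
    proof (cases "0 < x \<and> x < 1")
      case x: True
      show ?thesis
      proof (cases "\<delta> \<le> 1 - x")
        case True
        have "(1 - x) powr (- B) \<le> \<delta> powr (- B)" using True d B by (intro powr_mono2') auto
        then have "ennreal (x powr (real i + e - 1)) * ennreal ((1 - x) powr (- B)) \<le> ennreal (x powr (real i + e - 1)) * ennreal (\<delta> powr (- B))"
          by (intro mult_left_mono ennreal_leI) auto
        then show ?thesis using x by (auto simp: mult.commute intro: order_trans[OF _ add_increasing2[OF zero_le order_refl]])
      next
        case False
        have "x powr (real i + e - 1) \<le> x powr (- 1)" using x e by (intro powr_mono') auto
        also have "\<dots> = 1 / x" using x by (simp add: powr_minus_divide)
        also have "\<dots> \<le> 2" using False d x by (simp add: field_simps)
        finally have "ennreal (x powr (real i + e - 1)) \<le> 2"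
          by (metis ennreal_leI ennreal_numeral zero_le_numeral)
        then have "ennreal (x powr (real i + e - 1)) * ennreal ((1 - x) powr (- B)) \<le> 2 * ennreal ((1 - x) powr (- B))"
          by (rule mult_right_mono) simp
        then show ?thesis using x False by (auto intro: order_trans[OF _ add_increasing[OF zero_le order_refl]])
      qed
    qed auto
    have "(\<integral>\<^sup>+x. ennreal (x powr (real i + e - 1)) * ennreal ((1 - x) powr (- B)) * indicator {0<..<1} x \<partial>lborel)
      \<le> (\<integral>\<^sup>+x. ennreal (\<delta> powr (- B)) * (ennreal (x powr (real i + e - 1)) * indicator {0<..<1} x)
        + 2 * (ennreal ((1 - x) powr (1 - B - 1)) * indicator {0<..<\<delta>} (1 - x)) \<partial>lborel)"
      by (intro nn_integral_mono pw)
    also have "\<dots> = ennreal (\<delta> powr (- B)) * (\<integral>\<^sup>+x. ennreal (x powr (real i + e - 1)) * indicator {0<..<1} x \<partial>lborel)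
        + 2 * (\<integral>\<^sup>+x. ennreal ((1 - x) powr (1 - B - 1)) * indicator {0<..<\<delta>} (1 - x) \<partial>lborel)"
      by (subst nn_integral_add) (auto simp: nn_integral_cmult)
    also have "(\<integral>\<^sup>+x. ennreal ((1 - x) powr (1 - B - 1)) * indicator {0<..<\<delta>} (1 - x) \<partial>lborel)
        = (\<integral>\<^sup>+x. ennreal (x powr (1 - B - 1)) * indicator {0<..<\<delta>} x \<partial>lborel)"
      using nn_integral_lborel_affine[of "\<lambda>x. ennreal (x powr (1 - B - 1)) * indicator {0<..<\<delta>} x" "- 1" "1::real"] by simp
    also have "\<dots> = ennreal (\<delta> powr (1 - B) / (1 - B))"
      using B d by (intro nn_integral_powr_Icc) auto
    also have "(\<integral>\<^sup>+x. ennreal (x powr (real i + e - 1)) * indicator {0<..<1} x \<partial>lborel) = ennreal (1 / (real i + e))"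
      using nn_integral_powr_Icc[OF ie, of 1] by simp
    also have "ennreal (\<delta> powr (- B)) * ennreal (1 / (real i + e)) + 2 * ennreal (\<delta> powr (1 - B) / (1 - B))
        = ennreal (\<delta> powr (- B) * (1 / (real i + e)) + 2 * (\<delta> powr (1 - B) / (1 - B)))"
    proof -
      have "2 * ennreal (\<delta> powr (1 - B) / (1 - B)) = ennreal 2 * ennreal (\<delta> powr (1 - B) / (1 - B))"
        by simp
      also have "\<dots> = ennreal (2 * (\<delta> powr (1 - B) / (1 - B)))"
        by (rule ennreal_mult[symmetric]) (use B in auto)
      finally have "2 * ennreal (\<delta> powr (1 - B) / (1 - B)) = ennreal (2 * (\<delta> powr (1 - B) / (1 - B)))" .
      then show ?thesis using B ie by (simp add: ennreal_mult'[symmetric] ennreal_plus[symmetric] del: ennreal_plus)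
    qed
    also have "\<dots> \<le> ennreal (C * ?s powr (B - 1))"
    proof (rule ennreal_leI)
      have "\<delta> powr (- B) = (2 * ?s) powr B" by (simp add: \<delta>_def powr_minus powr_divide del: of_nat_Suc)
      also have "\<dots> \<le> 2 * ?s powr B"
        using B powr_mono[of B 1 2] by (simp add: powr_mult mult_right_mono del: of_nat_Suc)
      finally have 1: "\<delta> powr (- B) \<le> 2 * ?s powr B" .
      have "?s \<le> M * (real i + e)"
      proof (cases "e \<ge> 1")
        case True
        then show ?thesis using mult_mono[OF M, of "?s" "real i + e"] M by simp
      next
        case False
        then have "?s \<le> (real i + e) / e" using e by (simp add: field_simps mult_left_le_one_le)
        also have "\<dots> = (1 / e) * (real i + e)" by simp
        also have "\<dots> \<le> M * (real i + e)" using ie by (intro mult_right_mono) (auto simp: M_def)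
        finally show ?thesis .
      qed
      then have 2: "1 / (real i + e) \<le> M / ?s" using ie by (simp add: field_simps del: of_nat_Suc)
      have "\<delta> powr (- B) * (1 / (real i + e)) \<le> (2 * ?s powr B) * (M / ?s)"
        by (intro mult_mono 1 2) (use ie in auto)
      also have "\<dots> = 2 * M * ?s powr (B - 1)" by (simp add: powr_diff del: of_nat_Suc)
      finally have 3: "\<delta> powr (- B) * (1 / (real i + e)) \<le> 2 * M * ?s powr (B - 1)" .
      have "\<delta> powr (1 - B) \<le> (1 / ?s) powr (1 - B)" using B d by (intro powr_mono2) (auto simp: \<delta>_def field_simps)
      also have "\<dots> = ?s powr (B - 1)" by (simp add: powr_divide powr_minus_divide[symmetric] del: of_nat_Suc)
      finally have "\<delta> powr (1 - B) / (1 - B) \<le> ?s powr (B - 1) / (1 - B)" using B by (intro divide_right_mono) auto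
      then show "\<delta> powr (- B) * (1 / (real i + e)) + 2 * (\<delta> powr (1 - B) / (1 - B)) \<le> C * ?s powr (B - 1)"
        using 3 unfolding C_def by (simp add: algebra_simps del: of_nat_Suc)
    qed
    finally show ?thesis .
  qed
  moreover have "C \<ge> 0" using M B by (simp add: C_def)
  ultimately show ?thesis using that by blast
qed

text \<open>Summation by parts turns \<open>(1 - x) * S (Suc N)\<close> into a series with
  coefficients \<open>real (Suc q) ^ Suc N - real q ^ Suc N\<close>, which lie between
  \<open>real (Suc q) ^ N\<close> and \<open>real (Suc N)\<close> times it. Induction then gains one
  factor \<open>1 / (1 - x)\<close> per step.\<close>

lemma poly_geometric_bounds:
  fixes x :: real
  assumes x: "0 \<le> x" "x < 1"
  shows "1 / (1 - x) ^ Suc N \<le> (\<Sum>q. real (Suc q) ^ N * x ^ q)"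
    and "(\<Sum>q. real (Suc q) ^ N * x ^ q) \<le> fact N / (1 - x) ^ Suc N"
proof -
  define S where "S N = (\<Sum>q. real (Suc q) ^ N * x ^ q)" for N
  have sm: "summable (\<lambda>q. real (Suc q) ^ N * x ^ q)" for N
    using x by (intro summable_poly_geometric_Suc) auto
  have sm0: "summable (\<lambda>q. real q ^ N * x ^ q)" for N
    using x by (intro summable_poly_geometric) auto
  have step: "(1 - x) * S (Suc N) = (\<Sum>q. (real (Suc q) ^ Suc N - real q ^ Suc N) * x ^ q)" for N
  proof -
    have "(\<Sum>q. real q ^ Suc N * x ^ q) = (\<Sum>q. real (Suc q) ^ Suc N * x ^ Suc q)"
      using suminf_split_head[OF sm0[of "Suc N"]] by simp
    also have "\<dots> = x * S (Suc N)"
      unfolding S_def suminf_mult[OF sm, symmetric] by (simp add: mult_ac)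
    finally have "S (Suc N) - x * S (Suc N) = (\<Sum>q. real (Suc q) ^ Suc N * x ^ q) - (\<Sum>q. real q ^ Suc N * x ^ q)"
      by (simp add: S_def)
    also have "\<dots> = (\<Sum>q. (real (Suc q) ^ Suc N - real q ^ Suc N) * x ^ q)"
      by (subst suminf_diff[OF sm sm0]) (simp add: left_diff_distrib)
    finally show ?thesis by (simp add: algebra_simps)
  qed
  have smd: "summable (\<lambda>q. (real (Suc q) ^ Suc N - real q ^ Suc N) * x ^ q)" for N
    unfolding left_diff_distrib by (intro summable_diff sm sm0)
  have lo: "real (Suc q) ^ N \<le> real (Suc q) ^ Suc N - real q ^ Suc N" for q N
  proof -
    have "real q ^ N \<le> real (Suc q) ^ N" by (intro power_mono) auto
    then have "real q * real q ^ N \<le> real q * real (Suc q) ^ N" by (rule mult_left_mono) simp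
    then show ?thesis by (simp add: algebra_simps)
  qed
  have up: "real (Suc q) ^ Suc N - real q ^ Suc N \<le> real (Suc N) * real (Suc q) ^ N" for q N
  proof (induction N)
    case (Suc N)
    have "real (Suc q) ^ Suc (Suc N) - real q ^ Suc (Suc N) = real (Suc q) * (real (Suc q) ^ Suc N - real q ^ Suc N) + real q ^ Suc N"
      by (simp add: algebra_simps)
    also have "\<dots> \<le> real (Suc q) * (real (Suc N) * real (Suc q) ^ N) + real (Suc q) ^ Suc N"
      by (intro add_mono mult_left_mono Suc power_mono) auto
    also have "\<dots> = real (Suc (Suc N)) * real (Suc q) ^ Suc N" by (simp add: algebra_simps)
    finally show ?case .
  qed simp
  have 1: "S N \<le> (1 - x) * S (Suc N)" for N
    unfolding step unfolding S_def using x by (intro suminf_le sm smd mult_right_mono lo) auto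
  have 2: "(1 - x) * S (Suc N) \<le> real (Suc N) * S N" for N
    unfolding step unfolding S_def suminf_mult[OF sm, symmetric] mult.assoc[symmetric]
    using x up by (intro suminf_le smd mult_right_mono) (auto simp: mult.assoc simp del: of_nat_Suc intro!: summable_mult sm)
  have S0: "S 0 = 1 / (1 - x)" using x by (simp add: S_def suminf_geometric)
  have "1 / (1 - x) ^ Suc N \<le> S N \<and> S N \<le> fact N / (1 - x) ^ Suc N"
  proof (induction N)
    case (Suc N)
    have "1 / (1 - x) ^ Suc N \<le> (1 - x) * S (Suc N)" using Suc 1[of N] by linarith
    then have "(1 / (1 - x) ^ Suc N) / (1 - x) \<le> ((1 - x) * S (Suc N)) / (1 - x)"
      using x by (intro divide_right_mono) auto
    then have a: "1 / (1 - x) ^ Suc (Suc N) \<le> S (Suc N)" using x by (simp add: mult.commute)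
    have "(1 - x) * S (Suc N) \<le> real (Suc N) * (fact N / (1 - x) ^ Suc N)"
      using Suc 2[of N] mult_left_mono[of "S N" "fact N / (1 - x) ^ Suc N" "real (Suc N)"] by linarith
    then have "S (Suc N) \<le> (real (Suc N) * (fact N / (1 - x) ^ Suc N)) / (1 - x)"
      using x by (subst pos_le_divide_eq) (auto simp: mult.commute)
    then show ?case using a by (simp add: mult.commute)
  qed (simp add: S0)
  then show "1 / (1 - x) ^ Suc N \<le> (\<Sum>q. real (Suc q) ^ N * x ^ q)"
    "(\<Sum>q. real (Suc q) ^ N * x ^ q) \<le> fact N / (1 - x) ^ Suc N" by (auto simp: S_def)
qed

lemma fact_ge_pow: "real (Suc k) ^ N * fact k \<le> fact (k + N)"
proof (induction N)
  case (Suc N)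
  have "real (Suc k) ^ Suc N * fact k = real (Suc k) * (real (Suc k) ^ N * fact k)" by simp
  also have "\<dots> \<le> real (k + Suc N) * fact (k + N)" by (intro mult_mono Suc) auto
  finally show ?case by simp
qed simp

text \<open>At scale \<open>d\<close> the power satisfies
  \<open>(d * y) powr B \<le> max 1 (d * y)\<close>. This trades the fractional growth of the Schur
  integrals for linear growth, so that first moments of the diagonal series suffice.\<close>

lemma powr_le_linear:
  fixes B y d :: real
  assumes "0 < B" "B < 1" "y > 0" "d > 0"
  shows "y powr B \<le> d powr (- B) * (1 + d * y)"
proof -
  have "(d * y) powr B \<le> 1 + d * y"
  proof (cases "d * y \<le> 1")
    case True
    then have "(d * y) powr B \<le> 1" using assms powr_le1[of B "d * y"] by simp
    then show ?thesis using assms by (smt (verit) mult_pos_pos)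
  next
    case False
    then have "(d * y) powr B \<le> (d * y) powr 1" using assms by (intro powr_mono) auto
    then show ?thesis using assms by simp
  qed
  then have "d powr (- B) * (d * y) powr B \<le> d powr (- B) * (1 + d * y)" by (rule mult_left_mono) simp
  then show ?thesis using assms by (simp add: powr_mult powr_minus field_simps)
qed

lemma power_arith: "(x::real) ^ (M * q + r) = (x ^ M) ^ q * x ^ r"
  by (simp add: power_add power_mult)

section \<open>Two-sided bounds for the kernel on the diagonal\<close>

context hartogs
begin

text \<open>For double series whose terms factor on each residue class but not globally: the total
  is a finite sum of products of two simple series.\<close>

lemma has_sum_residues:
  fixes F :: "nat \<times> nat \<Rightarrow> real"
  assumes a: "\<And>r. r < m \<Longrightarrow> summable (\<alpha> r)" and g: "\<And>r. r < m \<Longrightarrow> summable (\<gamma> r)"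
    and nn: "\<And>r q. \<alpha> r q \<ge> 0" "\<And>r q. \<gamma> r q \<ge> 0"
    and F: "\<And>r q i. r < m \<Longrightarrow> F (m * q + r, i) = \<alpha> r q * \<gamma> r i"
  shows "(F has_sum (\<Sum>r<m. suminf (\<alpha> r) * suminf (\<gamma> r))) UNIV"
proof -
  let ?f = "\<lambda>(r, q, i). F (m * q + r, i)"
  have inner: "((\<lambda>p. ?f (r, p)) has_sum (suminf (\<alpha> r) * suminf (\<gamma> r))) UNIV" if "r \<in> {..<m}" for r
    using has_sum_product[of "\<alpha> r" "\<gamma> r"] a[of r] g[of r] that nn F[of r] by (simp add: case_prod_unfold)
  have nF: "norm (?f p) = ?f p" if "p \<in> {..<m} \<times> UNIV" for p
    using that nn F by (auto simp: abs_mult)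
  have "(\<lambda>p. norm (?f p)) summable_on Sigma {..<m} (\<lambda>_. UNIV)"
  proof (rule Infinite_Sum.abs_summable_on_Sigma_iff[THEN iffD2], intro conjI ballI)
    fix r assume r: "r \<in> {..<m}"
    then show "(\<lambda>y. norm (?f (r, y))) summable_on UNIV"
      using inner[OF r] nF by (subst summable_on_cong[of _ _ "\<lambda>y. ?f (r, y)"]) (auto simp: summable_on_def)
  qed (simp add: summable_on_finite)
  then have "?f summable_on Sigma {..<m} (\<lambda>_. UNIV)" by (rule Infinite_Sum.abs_summable_summable)
  from has_sum_SigmaI[OF inner has_sum_finite this]
  have "(?f has_sum (\<Sum>r<m. suminf (\<alpha> r) * suminf (\<gamma> r))) ({..<m} \<times> UNIV)" by simp
  then show ?thesis
    using has_sum_reindex_bij_betw[OF bij_arith, of F] by (simp add: case_prod_unfold)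
qed

text \<open>The singular factor common to all residue classes of \<open>Kd\<close>; what
  distinguishes the classes is \<open>Xc y ^ r * Yc y powr (bb r)\<close>.\<close>

definition EE :: "(complex ^ 'n) \<times> complex \<Rightarrow> real" where
  "EE y = Yc y powr (- \<nu>) / ((1 - Xc y) ^ Suc CARD('n) * (1 - Yc y)\<^sup>2)"

lemma EE_pos: "y \<in> \<Omega> \<Longrightarrow> EE y > 0"
  using Xc_Yc_in_Omega[of y] by (simp add: EE_def)

lemma Cn_arith_ge: "real (Suc q) ^ CARD('n) / pi ^ (CARD('n) + 1) \<le> Cn (m * q + r)"
proof -
  have mq: "q \<le> m * q + r" using m by (simp add: trans_le_add1)
  then have "real (Suc q) \<le> real (Suc (m * q + r))" by (simp only: of_nat_le_iff Suc_le_mono)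
  then have "real (Suc q) ^ CARD('n) \<le> real (Suc (m * q + r)) ^ CARD('n)" by (rule power_mono) simp
  also have "\<dots> \<le> fact (m * q + r + CARD('n)) / fact (m * q + r)"
    using fact_ge_pow[of "m * q + r" "CARD('n)"] by (simp add: pos_le_divide_eq del: of_nat_Suc)
  finally have "real (Suc q) ^ CARD('n) / pi ^ (CARD('n) + 1) \<le> (fact (m * q + r + CARD('n)) / fact (m * q + r)) / pi ^ (CARD('n) + 1)"
    by (intro divide_right_mono) auto
  then show ?thesis by (simp add: Cn_def)
qed

lemma powr_bb_split:
  assumes y: "y \<in> \<Omega>" shows "Yc y powr (bb r + real i - \<nu>) = Yc y powr (bb r - \<nu>) * Yc y ^ i"
  using Xc_Yc_in_Omega[OF y] by (simp add: powr_add[symmetric] powr_realpow[symmetric] algebra_simps)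

lemma one_minus_power_le:
  fixes X :: real
  assumes X: "0 \<le> X" "X < 1" shows "1 - X \<le> 1 - X ^ m" "1 - X ^ m \<le> real m * (1 - X)" "X ^ m < 1" "0 \<le> X ^ m"
proof -
  have "X ^ m \<le> X ^ 1" using X m by (intro power_decreasing) auto
  then show "1 - X \<le> 1 - X ^ m" by simp
  show "1 - X ^ m \<le> real m * (1 - X)"
    using Bernoulli_inequality[of "X - 1" m] X by (simp add: algebra_simps)
  show "X ^ m < 1" using X m by (simp add: power_less_one_iff)
qed (use X in simp)

lemma Kd_residues:
  assumes y: "y \<in> \<Omega>"
  shows "Kd y = (\<Sum>r<m. (\<Sum>q. Cn (m * q + r) * Xc y ^ (m * q + r)) * (\<Sum>i. (bb r + real i) * (Yc y powr (bb r - \<nu>) * Yc y ^ i)))"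
    and "\<And>r. r < m \<Longrightarrow> summable (\<lambda>q. Cn (m * q + r) * Xc y ^ (m * q + r))"
    and "\<And>r. summable (\<lambda>i. (bb r + real i) * (Yc y powr (bb r - \<nu>) * Yc y ^ i))"
proof -
  note Y = Xc_Yc_in_Omega[OF y]
  note X = one_minus_power_le[OF Y(1,2)]
  show s1: "summable (\<lambda>q. Cn (m * q + r) * Xc y ^ (m * q + r))" if "r < m" for r
  proof -
    have "Cn (m * q + r) * Xc y ^ (m * q + r) = Xc y ^ r * (\<bar>Cn (m * q + r)\<bar> * (Xc y ^ m) ^ q)" for q
      unfolding power_arith abs_of_pos[OF Cn_pos] by simp
    then show ?thesis by (simp only: summable_mult summable_Cn_arith[OF that X(4,3)])
  qed
  show s2: "summable (\<lambda>i. (bb r + real i) * (Yc y powr (bb r - \<nu>) * Yc y ^ i))" for r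
    using summable_mult[OF summable_bb[of "Yc y" r], of "Yc y powr (bb r - \<nu>)"] Y bb_bounds(3)[of r]
    by (simp add: mult_ac abs_of_pos add_pos_nonneg)
  have "((\<lambda>(k, i). dg y k i) has_sum (\<Sum>r<m. (\<Sum>q. Cn (m * q + r) * Xc y ^ (m * q + r)) * (\<Sum>i. (bb r + real i) * (Yc y powr (bb r - \<nu>) * Yc y ^ i)))) UNIV"
  proof (rule has_sum_residues)
    show "0 \<le> (bb r + real i) * (Yc y powr (bb r - \<nu>) * Yc y ^ i)" for r i
      using Y bb_bounds(3)[of r] by (intro mult_nonneg_nonneg) auto
    show "0 \<le> Cn (m * q + r) * Xc y ^ (m * q + r)" for q r
      using Y Cn_pos[of "m * q + r"] by (intro mult_nonneg_nonneg) auto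
  qed (use s1 s2 in \<open>auto simp: dg_def bb_add_mult powr_bb_split[OF y]\<close>)
  then show "Kd y = (\<Sum>r<m. (\<Sum>q. Cn (m * q + r) * Xc y ^ (m * q + r)) * (\<Sum>i. (bb r + real i) * (Yc y powr (bb r - \<nu>) * Yc y ^ i)))"
    unfolding Kd_def by (rule infsumI)
qed

text \<open>On the class of \<open>r\<close> the coefficients grow at least like
  \<open>real (Suc q) ^ n\<close> in \<open>q\<close> and linearly in \<open>i\<close>, so the lower
  bounds for such series produce the singularities of \<open>EE\<close>. The sum over
  \<open>r\<close> is kept because different \<open>bb r\<close> give incomparable behaviour as
  \<open>Yc\<close> tends to 0.\<close>

lemma Kd_lower:
  obtains c where "c > 0"
    "\<And>y. y \<in> \<Omega> \<Longrightarrow> c * (\<Sum>r<m. Xc y ^ r * Yc y powr (bb r)) * EE y \<le> Kd y"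
proof -
  \<comment> \<open>The power of \<open>pi\<close> comes from \<open>Cn\<close>,
    \<open>m ^ Suc n\<close> from \<open>1 - X ^ m \<le> m * (1 - X)\<close>, and the last
    \<open>m\<close> from \<open>bb r + i \<ge> (i + 1) / m\<close>.\<close>
  define c where "c = 1 / (pi ^ (CARD('n) + 1) * real m ^ Suc CARD('n) * real m)"
  have c: "c > 0" using m by (simp add: c_def)
  have "c * (\<Sum>r<m. Xc y ^ r * Yc y powr (bb r)) * EE y \<le> Kd y" if y: "y \<in> \<Omega>" for y
  proof -
    note Y = Xc_Yc_in_Omega[OF y]
    note X = one_minus_power_le[OF Y(1,2)]
    have A: "Xc y ^ r / (pi ^ (CARD('n) + 1) * real m ^ Suc CARD('n) * (1 - Xc y) ^ Suc CARD('n)) \<le> (\<Sum>q. Cn (m * q + r) * Xc y ^ (m * q + r))" if r: "r < m" for r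
    proof -
      have "1 / (real m ^ Suc CARD('n) * (1 - Xc y) ^ Suc CARD('n)) = 1 / (real m * (1 - Xc y)) ^ Suc CARD('n)"
        by (simp add: power_mult_distrib)
      also have "\<dots> \<le> 1 / (1 - Xc y ^ m) ^ Suc CARD('n)"
        using X Y m by (intro divide_left_mono power_mono mult_pos_pos zero_less_power) auto
      also have "\<dots> \<le> (\<Sum>q. real (Suc q) ^ CARD('n) * (Xc y ^ m) ^ q)" by (rule poly_geometric_bounds(1)[OF X(4,3)])
      finally have "Xc y ^ r / pi ^ (CARD('n) + 1) * (1 / (real m ^ Suc CARD('n) * (1 - Xc y) ^ Suc CARD('n)))
        \<le> Xc y ^ r / pi ^ (CARD('n) + 1) * (\<Sum>q. real (Suc q) ^ CARD('n) * (Xc y ^ m) ^ q)"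
        using Y by (intro mult_left_mono) auto
      also have "\<dots> = (\<Sum>q. Xc y ^ r / pi ^ (CARD('n) + 1) * (real (Suc q) ^ CARD('n) * (Xc y ^ m) ^ q))"
        using X by (intro suminf_mult[symmetric] summable_poly_geometric_Suc) auto
      also have "\<dots> \<le> (\<Sum>q. Cn (m * q + r) * Xc y ^ (m * q + r))"
      proof (intro suminf_le Kd_residues(2)[OF y r] summable_mult summable_poly_geometric_Suc)
        show "Xc y ^ r / pi ^ (CARD('n) + 1) * (real (Suc q) ^ CARD('n) * (Xc y ^ m) ^ q) \<le> Cn (m * q + r) * Xc y ^ (m * q + r)" for q
        proof -
          have "real (Suc q) ^ CARD('n) / pi ^ (CARD('n) + 1) * Xc y ^ (m * q + r) \<le> Cn (m * q + r) * Xc y ^ (m * q + r)"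
            using Y by (intro mult_right_mono Cn_arith_ge) auto
          moreover have "real (Suc q) ^ CARD('n) / pi ^ (CARD('n) + 1) * Xc y ^ (m * q + r)
              = Xc y ^ r / pi ^ (CARD('n) + 1) * (real (Suc q) ^ CARD('n) * (Xc y ^ m) ^ q)"
            unfolding power_arith by simp
          ultimately show ?thesis by (simp only:)
        qed
      qed (use X in auto)
      finally show ?thesis by (simp add: mult_ac)
    qed
    have B: "Yc y powr (bb r - \<nu>) / (real m * (1 - Yc y)\<^sup>2) \<le> (\<Sum>i. (bb r + real i) * (Yc y powr (bb r - \<nu>) * Yc y ^ i))" for r
    proof -
      let ?c = "Yc y powr (bb r - \<nu>) / real m"
      have s: "summable (\<lambda>i. real (Suc i) ^ 1 * Yc y ^ i)" using Y by (intro summable_poly_geometric_Suc) auto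
      have "?c * (1 / (1 - Yc y) ^ Suc 1) \<le> ?c * (\<Sum>i. real (Suc i) ^ 1 * Yc y ^ i)"
        using Y by (intro mult_left_mono poly_geometric_bounds(1)) auto
      also have "\<dots> = (\<Sum>i. ?c * (real (Suc i) ^ 1 * Yc y ^ i))" by (rule suminf_mult[OF s, symmetric])
      also have "\<dots> \<le> (\<Sum>i. (bb r + real i) * (Yc y powr (bb r - \<nu>) * Yc y ^ i))"
      proof (intro suminf_le Kd_residues(3)[OF y] summable_mult s)
        fix i
        have "real (Suc i) / real m \<le> bb r + real i"
        proof -
          have "real i / real m \<le> real i" using m divide_left_mono[of 1 "real m" "real i"] by simp
          then show ?thesis using bb_bounds(1)[of r] by (simp add: add_divide_distrib)
        qed
        then have "real (Suc i) / real m * (Yc y powr (bb r - \<nu>) * Yc y ^ i) \<le> (bb r + real i) * (Yc y powr (bb r - \<nu>) * Yc y ^ i)"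
          using Y by (intro mult_right_mono) auto
        then show "?c * (real (Suc i) ^ 1 * Yc y ^ i) \<le> (bb r + real i) * (Yc y powr (bb r - \<nu>) * Yc y ^ i)"
          by (simp add: mult_ac del: of_nat_Suc)
      qed
      finally show ?thesis by (simp add: power2_eq_square mult_ac)
    qed
    have "c * (\<Sum>r<m. Xc y ^ r * Yc y powr (bb r)) * EE y
        = (\<Sum>r<m. (Xc y ^ r / (pi ^ (CARD('n) + 1) * real m ^ Suc CARD('n) * (1 - Xc y) ^ Suc CARD('n))) * (Yc y powr (bb r - \<nu>) / (real m * (1 - Yc y)\<^sup>2)))"
      unfolding sum_distrib_left sum_distrib_right
      by (intro sum.cong refl) (simp add: c_def EE_def powr_diff powr_minus_divide field_simps)
    also have "\<dots> \<le> Kd y"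
      unfolding Kd_residues(1)[OF y] using Y
      by (intro sum_mono mult_mono A B suminf_nonneg Kd_residues(2)[OF y] mult_nonneg_nonneg divide_nonneg_nonneg)
         (auto intro!: less_imp_le[OF Cn_pos] mult_nonneg_nonneg)
    finally show ?thesis .
  qed
  then show ?thesis using that c by blast
qed

text \<open>An extra factor \<open>Suc k\<close> in the series costs one more
  \<open>1 / (1 - Xc y)\<close>, which the weight \<open>1 - Xc y\<close> compensates, and likewise
  for \<open>i\<close>. Hence the first moments have the same order as the series itself, class by
  class, and \<open>Kd_lower\<close> bounds them by \<open>Kd\<close>.\<close>

lemma Kd_weighted_upper:
  obtains D where "D \<ge> 0"
    "\<And>y. y \<in> \<Omega> \<Longrightarrow> \<exists>S. ((\<lambda>(k, i). dg y k i * ((1 + (1 - Xc y) * real (Suc k)) * (1 + (1 - Yc y) * real (Suc i)))) has_sum S) UNIV \<and> S \<le> D * Kd y"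
proof -
  obtain c where c: "c > 0" "\<And>y. y \<in> \<Omega> \<Longrightarrow> c * (\<Sum>r<m. Xc y ^ r * Yc y powr (bb r)) * EE y \<le> Kd y"
    using Kd_lower by blast
  let ?n = "CARD('n)"
  define c1 where "c1 = (real ?n * real m) ^ ?n"
  define c2 where "c2 = c1 * (fact ?n + real m * fact (Suc ?n))"
  have c1: "c1 \<ge> 0" by (simp add: c1_def)
  have c2: "c2 \<ge> 0" using c1 by (simp add: c2_def)
  have "\<exists>S. ((\<lambda>(k, i). dg y k i * ((1 + (1 - Xc y) * real (Suc k)) * (1 + (1 - Yc y) * real (Suc i)))) has_sum S) UNIV \<and> S \<le> (3 * c2 / c) * Kd y"
    if y: "y \<in> \<Omega>" for y
  proof -
    note Y = Xc_Yc_in_Omega[OF y]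
    note X = one_minus_power_le[OF Y(1,2)]
    let ?x = "Xc y ^ m"
    define \<alpha> where "\<alpha> r q = Cn (m * q + r) * Xc y ^ (m * q + r) * (1 + (1 - Xc y) * real (Suc (m * q + r)))" for r q
    define \<gamma> where "\<gamma> r i = (bb r + real i) * (Yc y powr (bb r - \<nu>) * Yc y ^ i) * (1 + (1 - Yc y) * real (Suc i))" for r i
    have a0: "\<alpha> r q \<ge> 0" for r q
      unfolding \<alpha>_def using Y Cn_pos[of "m * q + r"] by (intro mult_nonneg_nonneg add_nonneg_nonneg) auto
    have g0: "\<gamma> r i \<ge> 0" for r i
      unfolding \<gamma>_def using Y bb_bounds(3)[of r] by (intro mult_nonneg_nonneg add_nonneg_nonneg) auto
    define a' where "a' r q = c1 * Xc y ^ r * (real (Suc q) ^ ?n * ?x ^ q + (1 - Xc y) * real m * (real (Suc q) ^ Suc ?n * ?x ^ q))" for r q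
    have sn: "summable (\<lambda>q. real (Suc q) ^ N * ?x ^ q)" for N using X by (intro summable_poly_geometric_Suc) auto
    have sa': "summable (a' r)" for r
      unfolding a'_def by (intro summable_mult summable_add sn)
    have ale: "\<alpha> r q \<le> a' r q" if r: "r < m" for r q
    proof -
      have "Suc (m * q + r) \<le> m * Suc q" using r by simp
      then have "real (Suc (m * q + r)) \<le> real m * real (Suc q)" by (metis of_nat_le_iff of_nat_mult)
      then have "\<alpha> r q \<le> (c1 * real (Suc q) ^ ?n) * Xc y ^ (m * q + r) * (1 + (1 - Xc y) * (real m * real (Suc q)))"
        unfolding \<alpha>_def c1_def using Y Cn_pos[of "m * q + r"]
        by (intro mult_mono mult_right_mono Cn_arith_le r add_left_mono mult_left_mono mult_nonneg_nonneg add_nonneg_nonneg) auto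
      also have "\<dots> = a' r q" unfolding a'_def power_arith by (simp add: algebra_simps)
      finally show ?thesis .
    qed
    have sa: "summable (\<alpha> r)" if "r < m" for r
      by (rule summable_comparison_test'[OF sa'[of r], of 0]) (use ale[OF that] a0 in auto)
    have A: "suminf (\<alpha> r) \<le> c2 * Xc y ^ r / (1 - Xc y) ^ Suc ?n" if r: "r < m" for r
    proof -
      have "suminf (\<alpha> r) \<le> suminf (a' r)" by (intro suminf_le ale r sa sa')
      also have "\<dots> = c1 * Xc y ^ r * ((\<Sum>q. real (Suc q) ^ ?n * ?x ^ q) + (1 - Xc y) * real m * (\<Sum>q. real (Suc q) ^ Suc ?n * ?x ^ q))"
        unfolding a'_def by (simp only: suminf_mult suminf_add[symmetric] summable_mult summable_add sn)
      also have "\<dots> \<le> c1 * Xc y ^ r * (fact ?n / (1 - Xc y) ^ Suc ?n + (1 - Xc y) * real m * (fact (Suc ?n) / (1 - Xc y) ^ Suc (Suc ?n)))"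
      proof -
        have le: "(\<Sum>q. real (Suc q) ^ N * ?x ^ q) \<le> fact N / (1 - Xc y) ^ Suc N" for N
        proof (rule order_trans[OF poly_geometric_bounds(2)[OF X(4,3)]])
          show "fact N / (1 - ?x) ^ Suc N \<le> fact N / (1 - Xc y) ^ Suc N"
            using X Y by (intro divide_left_mono power_mono mult_pos_pos zero_less_power) auto
        qed
        show ?thesis using c1 Y by (intro mult_left_mono add_mono le) auto
      qed
      also have "\<dots> = c2 * Xc y ^ r / (1 - Xc y) ^ Suc ?n"
      proof -
        have "(1 - Xc y) * real m * (fact (Suc ?n) / (1 - Xc y) ^ Suc (Suc ?n)) = real m * fact (Suc ?n) / (1 - Xc y) ^ Suc ?n"
          using Y by simp
        then show ?thesis unfolding c2_def
          by (simp only: add_divide_distrib[symmetric] times_divide_eq_right times_divide_eq_left) (simp only: mult_ac)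
      qed
      finally show ?thesis .
    qed
    define g' where "g' r i = Yc y powr (bb r - \<nu>) * (real (Suc i) ^ 1 * Yc y ^ i + (1 - Yc y) * (real (Suc i) ^ 2 * Yc y ^ i))" for r i
    have sg: "summable (\<lambda>i. real (Suc i) ^ N * Yc y ^ i)" for N using Y by (intro summable_poly_geometric_Suc) auto
    have sg': "summable (g' r)" for r unfolding g'_def by (intro summable_mult summable_add sg)
    have gle: "\<gamma> r i \<le> g' r i" for r i
    proof -
      have "\<gamma> r i \<le> real (Suc i) * (Yc y powr (bb r - \<nu>) * Yc y ^ i) * (1 + (1 - Yc y) * real (Suc i))"
        unfolding \<gamma>_def using Y bb_bounds[of r] by (intro mult_right_mono mult_nonneg_nonneg add_nonneg_nonneg) auto
      also have "\<dots> = g' r i" by (simp add: g'_def power2_eq_square algebra_simps)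
      finally show ?thesis .
    qed
    have s\<gamma>: "summable (\<gamma> r)" for r
      by (rule summable_comparison_test'[OF sg'[of r], of 0]) (use gle g0 in auto)
    have G: "suminf (\<gamma> r) \<le> 3 * Yc y powr (bb r - \<nu>) / (1 - Yc y)\<^sup>2" for r
    proof -
      have "suminf (\<gamma> r) \<le> suminf (g' r)" by (intro suminf_le gle s\<gamma> sg')
      also have "\<dots> = Yc y powr (bb r - \<nu>) * ((\<Sum>i. real (Suc i) ^ 1 * Yc y ^ i) + (1 - Yc y) * (\<Sum>i. real (Suc i) ^ 2 * Yc y ^ i))"
        unfolding g'_def by (simp only: suminf_mult suminf_add[symmetric] summable_mult summable_add sg)
      also have "\<dots> \<le> Yc y powr (bb r - \<nu>) * (fact 1 / (1 - Yc y) ^ Suc 1 + (1 - Yc y) * (fact 2 / (1 - Yc y) ^ Suc 2))"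
        using Y by (intro mult_left_mono add_mono poly_geometric_bounds(2)) auto
      also have "\<dots> = 3 * Yc y powr (bb r - \<nu>) / (1 - Yc y)\<^sup>2"
      proof -
        have cancel: "d * (c / (d * E)) = c / E" if "d \<noteq> 0" for c d E :: real
          using that by simp
        have "(1 - Yc y) * (fact 2 / (1 - Yc y) ^ Suc 2) = 2 / (1 - Yc y)\<^sup>2"
          unfolding power_Suc fact_2 by (rule cancel) (use Y in simp)
        moreover have "fact 1 / (1 - Yc y) ^ Suc 1 = 1 / (1 - Yc y)\<^sup>2" by (simp add: power2_eq_square)
        ultimately show ?thesis by (simp only: add_divide_distrib[symmetric]) simp
      qed
      finally show ?thesis .
    qed
    have hs: "((\<lambda>(k, i). dg y k i * ((1 + (1 - Xc y) * real (Suc k)) * (1 + (1 - Yc y) * real (Suc i)))) has_sum (\<Sum>r<m. suminf (\<alpha> r) * suminf (\<gamma> r))) UNIV"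
      by (rule has_sum_residues[OF sa s\<gamma> a0 g0]) (simp_all add: \<alpha>_def \<gamma>_def dg_def bb_add_mult powr_bb_split[OF y])
    have "(\<Sum>r<m. suminf (\<alpha> r) * suminf (\<gamma> r)) \<le> (\<Sum>r<m. (c2 * Xc y ^ r / (1 - Xc y) ^ Suc ?n) * (3 * Yc y powr (bb r - \<nu>) / (1 - Yc y)\<^sup>2))"
      using Y c2 by (intro sum_mono mult_mono A G suminf_nonneg s\<gamma> g0 divide_nonneg_nonneg mult_nonneg_nonneg) auto
    also have "\<dots> = (3 * c2 / c) * (c * (\<Sum>r<m. Xc y ^ r * Yc y powr (bb r)) * EE y)"
      unfolding sum_distrib_left sum_distrib_right using c(1) Y
      by (intro sum.cong refl) (simp add: EE_def powr_diff powr_minus_divide field_simps)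
    also have "\<dots> \<le> (3 * c2 / c) * Kd y"
      using c(1) c2 by (intro mult_left_mono c(2) y) auto
    finally show ?thesis using hs by blast
  qed
  then show ?thesis using that[of "3 * c2 / c"] c c2 by simp
qed

end

section \<open>The two Schur integrals\<close>

context hartogs
begin

text \<open>The \<open>p\<close>-th power of the usual Schur weight; the conjugate exponent then
  produces \<open>GG powr (1 / (p - 1))\<close>. The exponent of \<open>Yc\<close> is the smallest
  one, \<open>1 / m - \<nu>\<close>, that can occur in a diagonal term.\<close>

definition GG :: "(complex ^ 'n) \<times> complex \<Rightarrow> real" where
  "GG y = Yc y powr (- (\<nu> - 1 / real m)) * ((1 - Yc y) powr (- 1) * (1 - Xc y) powr (- 1))"

lemma GG_pos: "y \<in> \<Omega> \<Longrightarrow> GG y > 0"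
  using Xc_Yc_in_Omega[of y] by (simp add: GG_def)

lemma GG_powr:
  "y \<in> \<Omega> \<Longrightarrow> GG y powr B = Yc y powr (- (B * (\<nu> - 1 / real m))) * ((1 - Yc y) powr (- B) * (1 - Xc y) powr (- B))"
proof -
  assume "y \<in> \<Omega>"
  note Y = Xc_Yc_in_Omega[OF this]
  have "GG y powr B = (Yc y powr (- (\<nu> - 1 / real m))) powr B * (((1 - Yc y) powr (- 1)) powr B * ((1 - Xc y) powr (- 1)) powr B)"
    unfolding GG_def by (simp only: powr_mult)
  also have "\<dots> = Yc y powr (- (\<nu> - 1 / real m) * B) * ((1 - Yc y) powr (- 1 * B) * (1 - Xc y) powr (- 1 * B))"
    by (simp only: powr_powr)
  finally have "GG y powr B = Yc y powr (- (\<nu> - 1 / real m) * B) * ((1 - Yc y) powr (- 1 * B) * (1 - Xc y) powr (- 1 * B))" .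
  moreover have "- (\<nu> - 1 / real m) * B = - (B * (\<nu> - 1 / real m))" "- 1 * B = - B" by (simp_all add: algebra_simps)
  ultimately show ?thesis by (simp only:)
qed

lemma nu_ge: "\<nu> - 1 / real m \<ge> 0"
proof -
  have "1 \<le> m + CARD('n) * l" using m by simp
  then have "1 \<le> real (m + CARD('n) * l)" by (metis of_nat_1 of_nat_le_iff)
  then show ?thesis using m by (simp add: \<nu>_def diff_divide_distrib[symmetric])
qed

lemma XY_rot [simp]: "Xc (act1 (circ t) x) = Xc x" "Xc (act2 (circ t) x) = Xc x"
  "Yc (act1 (circ t) x) = Yc x" "Yc (act2 (circ t) x) = Yc x"
  by (simp_all add: Xc_def Yc_def act1_def act2_def rad_def norm_mult)

lemma un_moment:
  assumes [measurable]: "\<phi>1 \<in> borel_measurable borel" "\<phi>2 \<in> borel_measurable borel" and y: "y \<in> \<Omega>"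
  shows "(\<integral>\<^sup>+x. ennreal ((norm (un k i y x))\<^sup>2) * \<phi>1 (Xc x) * \<phi>2 (Yc x) * indicator \<Omega> x \<partial>lborel)
    = ennreal (dg y k i * ((bb k + real i) * real (k + CARD('n))))
      * (\<integral>\<^sup>+x. ennreal (x powr (real (k + CARD('n)) - 1)) * \<phi>1 x * indicator {0<..<1} x \<partial>lborel)
      * (\<integral>\<^sup>+y. ennreal (y powr (bb k + real i - 1)) * \<phi>2 y * indicator {0<..<1} y \<partial>lborel)"
proof -
  have b: "\<beta> k (j0 k + int i) > 0" using bb_bounds(3)[of k] by (simp add: beta_j0)
  show ?thesis
    unfolding un_def uu_moment[OF assms(1,2) b] dg_eq[OF y] beta_j0 by (simp add: mult_ac)
qed

lemma KK_sym: "norm (KK x y) = norm (KK y x)"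
proof (cases "x \<in> \<Omega> \<and> y \<in> \<Omega>")
  case True
  then show ?thesis using is_bergman_kernel_cnj[OF is_bergman_kernel_KK is_bergman_kernel_KK, of x y] by simp
qed (auto simp: KK_def)

text \<open>Against the weight, block \<open>(k, i)\<close> gains a factor of at most the order
  \<open>(k + 1) powr B * (i + 1) powr B\<close> over \<open>dg y k i\<close>: the moment formula
  contributes one power of each index, the Beta integrals decay with exponent \<open>B - 1\<close>.
  Convergence at \<open>Yc = 0\<close> uses \<open>bb k \<ge> 1 / m\<close> and the third hypothesis
  on \<open>B\<close>.\<close>

lemma schur_first:
  assumes B: "0 < B" "B < 1" "B * (\<nu> - 1 / real m) < 1 / real m"
  obtains C where "C > 0" "\<And>y. y \<in> \<Omega> \<Longrightarrow>
    (\<integral>\<^sup>+x. ennreal ((norm (KK x y))\<^sup>2 * GG x powr B) * indicator \<Omega> x \<partial>lborel) \<le> ennreal (C * Kd y * GG y powr B)"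
proof -
  let ?n = "CARD('n)"
  define a0 where "a0 = B * (\<nu> - 1 / real m)"
  have a0: "a0 \<ge> 0" "1 / real m - a0 > 0" using B nu_ge by (auto simp: a0_def)
  obtain C1 where C1: "C1 \<ge> 0" "\<And>i. (\<integral>\<^sup>+x. ennreal (x powr (real i + (1 / real m - a0) - 1)) * ennreal ((1 - x) powr (- B)) * indicator {0<..<1} x \<partial>lborel)
      \<le> ennreal (C1 * real (Suc i) powr (B - 1))"
    using nn_integral_Beta_decay[OF B(1,2) a0(2)] by blast
  obtain C2 where C2: "C2 \<ge> 0" "\<And>i. (\<integral>\<^sup>+x. ennreal (x powr (real i + 1 - 1)) * ennreal ((1 - x) powr (- B)) * indicator {0<..<1} x \<partial>lborel)
      \<le> ennreal (C2 * real (Suc i) powr (B - 1))"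
    using nn_integral_Beta_decay[OF B(1,2) zero_less_one] by blast
  obtain D where D: "D \<ge> 0" "\<And>y. y \<in> \<Omega> \<Longrightarrow> \<exists>S. ((\<lambda>(k, i). dg y k i * ((1 + (1 - Xc y) * real (Suc k)) * (1 + (1 - Yc y) * real (Suc i)))) has_sum S) UNIV \<and> S \<le> D * Kd y"
    using Kd_weighted_upper by blast
  define E where "E = real ?n * C1 * C2"
  have E: "E \<ge> 0" using C1 C2 by (simp add: E_def)
  have Kd0: "Kd y \<ge> 0" for y unfolding Kd_def by (rule infsum_nonneg) (auto simp: dg_nonneg)
  \<comment> \<open>The \<open>+ 1\<close> keeps the constant positive even if \<open>E * D\<close>
    is zero; the Hoelder step of the Schur test takes the bound of this factor to be
    positive.\<close>
  have "(\<integral>\<^sup>+x. ennreal ((norm (KK x y))\<^sup>2 * GG x powr B) * indicator \<Omega> x \<partial>lborel) \<le> ennreal ((E * D + 1) * Kd y * GG y powr B)"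
    if y: "y \<in> \<Omega>" for y
  proof -
    note Y = Xc_Yc_in_Omega[OF y]
    define \<omega> where "\<omega> x = Yc x powr (- a0) * ((1 - Yc x) powr (- B) * (1 - Xc x) powr (- B))" for x
    have \<omega>m: "\<omega> \<in> borel_measurable borel" unfolding \<omega>_def by measurable
    obtain S where S: "((\<lambda>(k, i). dg y k i * ((1 + (1 - Xc y) * real (Suc k)) * (1 + (1 - Yc y) * real (Suc i)))) has_sum S) UNIV" "S \<le> D * Kd y"
      using D(2)[OF y] by blast
    define c where "c = E * ((1 - Xc y) powr (- B) * (1 - Yc y) powr (- B))"
    have c: "c \<ge> 0" using E by (simp add: c_def)
    define \<mu> where "\<mu> p = c * (case p of (k, i) \<Rightarrow> dg y k i * ((1 + (1 - Xc y) * real (Suc k)) * (1 + (1 - Yc y) * real (Suc i))))" for p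
    have "(\<integral>\<^sup>+x. ennreal ((norm (KK x y))\<^sup>2 * \<omega> x) * indicator \<Omega> x \<partial>lborel) \<le> ennreal (c * S)"
    proof (rule KK_weighted_norm_le[where \<mu>=\<mu>])
      show "(\<mu> has_sum c * S) UNIV" unfolding \<mu>_def by (rule has_sum_cmult_right[OF S(1)])
      show "\<mu> p \<ge> 0" for p
        unfolding \<mu>_def using c Y by (auto simp: case_prod_unfold intro!: mult_nonneg_nonneg dg_nonneg add_nonneg_nonneg)
      fix k i
      let ?I1 = "\<integral>\<^sup>+x. ennreal (x powr (real (k + ?n) - 1)) * ennreal ((1 - x) powr (- B)) * indicator {0<..<1} x \<partial>lborel"
      let ?I2 = "\<integral>\<^sup>+t. ennreal (t powr (bb k + real i - 1)) * ennreal (t powr (- a0) * (1 - t) powr (- B)) * indicator {0<..<1} t \<partial>lborel"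
      have "(\<integral>\<^sup>+x. ennreal ((norm (un k i y x))\<^sup>2 * \<omega> x) * indicator \<Omega> x \<partial>lborel)
        = (\<integral>\<^sup>+x. ennreal ((norm (un k i y x))\<^sup>2) * ennreal ((1 - Xc x) powr (- B)) * ennreal (Yc x powr (- a0) * (1 - Yc x) powr (- B)) * indicator \<Omega> x \<partial>lborel)"
        by (intro nn_integral_cong) (simp add: \<omega>_def ennreal_mult[symmetric] mult_ac)
      also have "\<dots> = ennreal (dg y k i * ((bb k + real i) * real (k + ?n))) * ?I1 * ?I2"
        by (rule un_moment[OF _ _ y]) measurable
      also have "\<dots> \<le> ennreal (dg y k i * ((bb k + real i) * real (k + ?n))) * ennreal (C2 * real (Suc k) powr (B - 1)) * ennreal (C1 * real (Suc i) powr (B - 1))"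
      proof (intro mult_mono)
        have n1: "1 \<le> real ?n" by (simp add: Suc_leI)
        show "?I1 \<le> ennreal (C2 * real (Suc k) powr (B - 1))"
        proof (rule order_trans[OF nn_integral_mono C2(2)])
          fix x :: real
          have "x powr (real (k + ?n) - 1) \<le> x powr (real k + 1 - 1)" if "0 < x" "x < 1"
            using that n1 by (intro powr_mono') auto
          then show "ennreal (x powr (real (k + ?n) - 1)) * ennreal ((1 - x) powr (- B)) * indicator {0<..<1} x
            \<le> ennreal (x powr (real k + 1 - 1)) * ennreal ((1 - x) powr (- B)) * indicator {0<..<1} x"
            by (cases "x \<in> {0<..<1}") (auto intro!: mult_right_mono ennreal_leI)
        qed
        show "?I2 \<le> ennreal (C1 * real (Suc i) powr (B - 1))"
        proof (rule order_trans[OF nn_integral_mono C1(2)])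
          fix t :: real
          have "t powr (bb k + real i - 1) * (t powr (- a0) * (1 - t) powr (- B)) \<le> t powr (real i + (1 / real m - a0) - 1) * (1 - t) powr (- B)" if t: "0 < t" "t < 1"
          proof -
            have "t powr (bb k + real i - 1) * t powr (- a0) \<le> t powr (real i + (1 / real m - a0) - 1)"
              unfolding powr_add[symmetric] using t bb_bounds(1)[of k] by (intro powr_mono') auto
            then show ?thesis unfolding mult.assoc[symmetric] by (rule mult_right_mono) simp
          qed
          then show "ennreal (t powr (bb k + real i - 1)) * ennreal (t powr (- a0) * (1 - t) powr (- B)) * indicator {0<..<1} t
            \<le> ennreal (t powr (real i + (1 / real m - a0) - 1)) * ennreal ((1 - t) powr (- B)) * indicator {0<..<1} t"
            by (cases "t \<in> {0<..<1}") (auto simp: ennreal_mult[symmetric] intro!: ennreal_leI)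
        qed
      qed auto
      also have "\<dots> = ennreal (dg y k i * ((bb k + real i) * real (k + ?n)) * (C2 * real (Suc k) powr (B - 1)) * (C1 * real (Suc i) powr (B - 1)))"
        using C1(1) C2(1) dg_nonneg[of y k i] bb_bounds(3)[of k] by (simp add: ennreal_mult)
      also have "\<dots> \<le> ennreal (\<mu> (k, i))"
      proof (rule ennreal_leI)
        have "k + ?n \<le> ?n * Suc k" using Suc_leI[of 0 ?n] by (cases ?n) auto
        then have kn: "real (k + ?n) \<le> real ?n * real (Suc k)" by (metis of_nat_le_iff of_nat_mult)
        have "(bb k + real i) * real (k + ?n) \<le> real (Suc i) * (real ?n * real (Suc k))"
          by (intro mult_mono kn) (use bb_bounds[of k] in auto)
        then have "dg y k i * ((bb k + real i) * real (k + ?n)) * (C2 * real (Suc k) powr (B - 1)) * (C1 * real (Suc i) powr (B - 1))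
          \<le> dg y k i * (real (Suc i) * (real ?n * real (Suc k))) * (C2 * real (Suc k) powr (B - 1)) * (C1 * real (Suc i) powr (B - 1))"
          using C1(1) C2(1) dg_nonneg[of y k i] by (intro mult_right_mono mult_left_mono) auto
        also have "\<dots> = E * dg y k i * (real (Suc k) powr B * real (Suc i) powr B)"
          by (simp add: E_def powr_diff del: of_nat_Suc)
        \<comment> \<open>Applied with scales \<open>1 - Xc y\<close> and \<open>1 - Yc y\<close>,
          which are exactly the weights in \<open>Kd_weighted_upper\<close> and leave the factors
          \<open>powr (- B)\<close> required by \<open>GG y powr B\<close>.\<close>
        also have "\<dots> \<le> E * dg y k i * (((1 - Xc y) powr (- B) * (1 + (1 - Xc y) * real (Suc k))) * ((1 - Yc y) powr (- B) * (1 + (1 - Yc y) * real (Suc i))))"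
          using E dg_nonneg[of y k i] Y B
          by (intro mult_left_mono mult_mono powr_le_linear) auto
        also have "\<dots> = \<mu> (k, i)" by (simp add: \<mu>_def c_def mult_ac del: of_nat_Suc)
        finally show "dg y k i * ((bb k + real i) * real (k + ?n)) * (C2 * real (Suc k) powr (B - 1)) * (C1 * real (Suc i) powr (B - 1)) \<le> \<mu> (k, i)" .
      qed
      finally show "(\<integral>\<^sup>+x. ennreal ((norm (un k i y x))\<^sup>2 * \<omega> x) * indicator \<Omega> x \<partial>lborel) \<le> ennreal (\<mu> (k, i))" .
    qed (auto simp: \<omega>_def y intro: \<omega>m[unfolded \<omega>_def])
    also have "(\<integral>\<^sup>+x. ennreal ((norm (KK x y))\<^sup>2 * \<omega> x) * indicator \<Omega> x \<partial>lborel) = (\<integral>\<^sup>+x. ennreal ((norm (KK x y))\<^sup>2 * GG x powr B) * indicator \<Omega> x \<partial>lborel)"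
      by (intro nn_integral_cong) (simp add: indicator_def GG_powr \<omega>_def a0_def)
    also have "ennreal (c * S) \<le> ennreal ((E * D + 1) * Kd y * GG y powr B)"
    proof (rule ennreal_leI)
      \<comment> \<open>The remaining factor \<open>Yc y powr (- a0)\<close> of
        \<open>GG y powr B\<close> is at least 1 and is given away.\<close>
      have g: "(1 - Xc y) powr (- B) * (1 - Yc y) powr (- B) \<le> GG y powr B"
      proof -
        have "1 \<le> Yc y powr (- a0)" using Y a0 powr_mono'[of "- a0" 0 "Yc y"] by simp
        then show ?thesis unfolding GG_powr[OF y] a0_def[symmetric]
          using mult_right_mono[of 1 "Yc y powr (- a0)" "(1 - Yc y) powr (- B) * (1 - Xc y) powr (- B)"] by (simp add: mult.commute)
      qed
      have "c * S \<le> c * (D * Kd y)" by (intro mult_left_mono S(2) c)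
      also have "\<dots> = (E * D) * Kd y * ((1 - Xc y) powr (- B) * (1 - Yc y) powr (- B))" by (simp add: c_def)
      also have "\<dots> \<le> (E * D + 1) * Kd y * GG y powr B"
        using E D(1) Kd0[of y] g by (intro mult_mono mult_nonneg_nonneg) auto
      finally show "c * S \<le> (E * D + 1) * Kd y * GG y powr B" .
    qed
    finally show ?thesis .
  qed
  moreover have "E * D + 1 > 0" using E D(1) by (simp add: add_nonneg_pos)
  ultimately show ?thesis using that by blast
qed

lemma Kd_pos:
  assumes y: "y \<in> \<Omega>" shows "Kd y > 0"
proof -
  obtain c where c: "c > 0" "\<And>y. y \<in> \<Omega> \<Longrightarrow> c * (\<Sum>r<m. Xc y ^ r * Yc y powr (bb r)) * EE y \<le> Kd y"
    using Kd_lower by blast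
  note Y = Xc_Yc_in_Omega[OF y]
  have "Xc y ^ 0 * Yc y powr (bb 0) \<le> (\<Sum>r<m. Xc y ^ r * Yc y powr (bb r))"
    using m Y by (intro member_le_sum) auto
  then have "0 < (\<Sum>r<m. Xc y ^ r * Yc y powr (bb r))" by (rule less_le_trans[rotated]) (use Y in simp)
  then have "0 < c * (\<Sum>r<m. Xc y ^ r * Yc y powr (bb r)) * EE y"
    using c(1) EE_pos[OF y] by (intro mult_pos_pos) auto
  then show ?thesis using c(2)[OF y] by linarith
qed

lemma Re_KK_measurable: "(\<lambda>x. Re (KK x x)) \<in> borel_measurable borel"
proof -
  have "(\<lambda>x. (x, x)) \<in> borel \<rightarrow>\<^sub>M (borel :: ((complex ^ 'n) \<times> complex) measure) \<Otimes>\<^sub>M borel" by measurable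
  from measurable_compose[OF this KK_measurable] show ?thesis by simp
qed

text \<open>For block \<open>(k, i)\<close> only the class of \<open>k\<close> in the lower bound of
  the diagonal is used. The weight then cancels \<open>bb k\<close> and leaves
  \<open>Yc powr (real i + 1 / m - 1)\<close>, integrable near 0. The two Beta integrals cancel the
  polynomial growth of the block completely, so the sum over blocks is a plain geometric series and
  reproduces \<open>GG y\<close>.\<close>

lemma schur_second:
  obtains C where "C \<ge> 0" "\<And>y. y \<in> \<Omega> \<Longrightarrow>
    (\<integral>\<^sup>+x. ennreal ((norm (KK x y))\<^sup>2 * (GG x / Kd x)) * indicator \<Omega> x \<partial>lborel) \<le> ennreal (C * GG y)"
proof -
  let ?n = "CARD('n)"
  obtain c where c: "c > 0" "\<And>y. y \<in> \<Omega> \<Longrightarrow> c * (\<Sum>r<m. Xc y ^ r * Yc y powr (bb r)) * EE y \<le> Kd y"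
    using Kd_lower by blast
  define C where "C = (1 / c) * (real ?n ^ ?n * real ?n * fact ?n * real m ^ Suc ?n * real m ^ 2)"
  have C: "C \<ge> 0" using c by (simp add: C_def)
  have "(\<integral>\<^sup>+x. ennreal ((norm (KK x y))\<^sup>2 * (GG x / Kd x)) * indicator \<Omega> x \<partial>lborel) \<le> ennreal (C * GG y)" if y: "y \<in> \<Omega>" for y
  proof -
    note Y = Xc_Yc_in_Omega[OF y]
    \<comment> \<open>\<open>Re (KK x x)\<close> equals \<open>Kd x\<close> on the domain and is
      Borel on the whole space; outside it is 0, and so is the quotient.\<close>
    define \<omega> where "\<omega> x = (Yc x powr (- (\<nu> - 1 / real m)) * ((1 - Yc x) powr (- 1) * (1 - Xc x) powr (- 1))) / Re (KK x x)" for x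
    have \<omega>m: "\<omega> \<in> borel_measurable borel" unfolding \<omega>_def using Re_KK_measurable by measurable
    have \<omega>K: "\<omega> x = GG x / Kd x" if "x \<in> \<Omega>" for x
      using that by (simp add: \<omega>_def GG_def KK_diag)
    have ReKK: "Re (KK x x) = (if x \<in> \<Omega> then Kd x else 0)" for x
      by (cases "x \<in> \<Omega>") (simp_all add: KK_diag, simp add: KK_def)
    have Kdrot: "Kd (act1 (circ t) x) = Kd x" "Kd (act2 (circ t) x) = Kd x" for t x
      by (simp_all add: Kd_def dg_def)
    define d where "d = C * Yc y powr (1 / real m - \<nu>)"
    define \<mu> where "\<mu> p = d * (case p of (k, i) \<Rightarrow> Xc y ^ k * Yc y ^ i)" for p
    have "(\<integral>\<^sup>+x. ennreal ((norm (KK x y))\<^sup>2 * \<omega> x) * indicator \<Omega> x \<partial>lborel) \<le> ennreal (d * ((\<Sum>k. Xc y ^ k) * (\<Sum>i. Yc y ^ i)))"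
    proof (rule KK_weighted_norm_le[where \<mu>=\<mu>])
      show "\<omega> x \<ge> 0" for x
      proof -
        have "0 \<le> Re (KK x x)" unfolding ReKK using Kd_pos[of x] by (simp add: less_imp_le)
        then show ?thesis unfolding \<omega>_def by (intro divide_nonneg_nonneg mult_nonneg_nonneg) auto
      qed
      show "\<omega> (act1 (circ t) x) = \<omega> x" "\<omega> (act2 (circ t) x) = \<omega> x" for x t
        unfolding \<omega>_def ReKK by (simp_all add: act_in_Omega circle_act_act1 circle_act_act2 Kdrot)
      show "(\<mu> has_sum d * ((\<Sum>k. Xc y ^ k) * (\<Sum>i. Yc y ^ i))) UNIV"
        unfolding \<mu>_def using Y by (intro has_sum_cmult_right has_sum_product) (auto simp: norm_power intro: summable_geometric)
      show "\<mu> p \<ge> 0" for p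
        unfolding \<mu>_def d_def using C Y by (auto simp: case_prod_unfold)
      fix k i
      \<comment> \<open>The residue selects the class of the block itself. Since
        \<open>r \<le> k\<close>, the factor \<open>1 / Xc ^ r\<close> from the lower bound is
        absorbed by the power of \<open>Xc\<close> in the block.\<close>
      define r where "r = k mod m"
      define q where "q = k div m"
      have k: "k = m * q + r" by (simp add: q_def r_def)
      have r: "r < m" "r \<le> k" using m by (simp_all add: r_def)
      have bk: "bb k = bb r" unfolding k by (rule bb_add_mult)
      let ?\<phi>1 = "\<lambda>x. ennreal ((1 - x) ^ ?n / x ^ r)"
      let ?\<phi>2 = "\<lambda>t. ennreal ((1 / c) * (t powr (1 / real m - bb r) * (1 - t)))"
      have pw: "(norm (un k i y x))\<^sup>2 * \<omega> x \<le> (norm (un k i y x))\<^sup>2 * ((1 - Xc x) ^ ?n / Xc x ^ r) * ((1 / c) * (Yc x powr (1 / real m - bb r) * (1 - Yc x)))"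
        if x: "x \<in> \<Omega>" for x
      proof (cases "Xc x = 0 \<and> r > 0")
        \<comment> \<open>The lower bound degenerates at \<open>Xc x = 0\<close> when
          \<open>r > 0\<close>, but then \<open>z = 0\<close> and the block has positive degree, so
          it vanishes there.\<close>
        case True
        then have "fst x = 0" using x in_Omega_iff[of "fst x" "snd x"] rad_pos[of "snd x"] by (auto simp: Xc_def)
        then have "un k i y x = 0" using True r by (simp add: un_def uu_def)
        then show ?thesis by simp
      next
        case False
        note Z = Xc_Yc_in_Omega[OF x]
        have Xr: "Xc x ^ r > 0" using False Z by (cases "r = 0") auto
        have "Xc x ^ r * Yc x powr (bb r) \<le> (\<Sum>r<m. Xc x ^ r * Yc x powr (bb r))"
          using r Z by (intro member_le_sum) auto
        then have "c * (Xc x ^ r * Yc x powr (bb r)) * EE x \<le> c * (\<Sum>r<m. Xc x ^ r * Yc x powr (bb r)) * EE x"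
          using c(1) EE_pos[OF x] by (intro mult_right_mono mult_left_mono) auto
        also have "\<dots> \<le> Kd x" by (rule c(2)[OF x])
        finally have lowb: "c * (Xc x ^ r * Yc x powr (bb r)) * EE x \<le> Kd x" .
        have lpos: "c * (Xc x ^ r * Yc x powr (bb r)) * EE x > 0"
          using c(1) Xr Z EE_pos[OF x] by (intro mult_pos_pos) auto
        have "\<omega> x \<le> GG x / (c * (Xc x ^ r * Yc x powr (bb r)) * EE x)"
          unfolding \<omega>K[OF x] using lowb lpos GG_pos[OF x] by (intro divide_left_mono mult_pos_pos[OF less_le_trans[OF lpos lowb] lpos]) auto
        also have "\<dots> = ((1 - Xc x) ^ ?n / Xc x ^ r) * ((1 / c) * (Yc x powr (1 / real m - bb r) * (1 - Yc x)))"
        proof -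
          define A where "A = Yc x powr (- \<nu>)"
          define D where "D = Yc x powr (bb r)"
          define F where "F = Yc x powr (1 / real m)"
          have AD: "A > 0" "D > 0" using Z by (auto simp: A_def D_def)
          have g: "GG x = (A * F) / ((1 - Yc x) * (1 - Xc x))"
          proof -
            have "Yc x powr (- (\<nu> - 1 / real m)) = A * F" by (simp add: A_def F_def powr_add[symmetric])
            then show ?thesis using Z by (simp add: GG_def powr_minus field_simps)
          qed
          have f: "Yc x powr (1 / real m - bb r) = F / D" by (simp add: F_def D_def powr_diff)
          define a where "a = 1 - Xc x"
          define b where "b = 1 - Yc x"
          have ab: "a > 0" "b > 0" using Z by (auto simp: a_def b_def)
          show ?thesis
            unfolding g f EE_def A_def[symmetric] D_def[symmetric] a_def[symmetric] b_def[symmetric]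
            using AD ab Xr c(1) by (simp add: field_simps power2_eq_square)
        qed
        finally have "(norm (un k i y x))\<^sup>2 * \<omega> x \<le> (norm (un k i y x))\<^sup>2 * (((1 - Xc x) ^ ?n / Xc x ^ r) * ((1 / c) * (Yc x powr (1 / real m - bb r) * (1 - Yc x))))"
          by (rule mult_left_mono) simp
        then show ?thesis by (simp only: mult.assoc)
      qed
      have "(\<integral>\<^sup>+x. ennreal ((norm (un k i y x))\<^sup>2 * \<omega> x) * indicator \<Omega> x \<partial>lborel)
        \<le> (\<integral>\<^sup>+x. ennreal ((norm (un k i y x))\<^sup>2) * ?\<phi>1 (Xc x) * ?\<phi>2 (Yc x) * indicator \<Omega> x \<partial>lborel)"
      proof (rule nn_integral_mono)
        fix x
        show "ennreal ((norm (un k i y x))\<^sup>2 * \<omega> x) * indicator \<Omega> x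
          \<le> ennreal ((norm (un k i y x))\<^sup>2) * ?\<phi>1 (Xc x) * ?\<phi>2 (Yc x) * indicator \<Omega> x"
        proof (cases "x \<in> \<Omega>")
          case True
          note Z = Xc_Yc_in_Omega[OF True]
          have "ennreal ((norm (un k i y x))\<^sup>2) * ?\<phi>1 (Xc x) * ?\<phi>2 (Yc x) = ennreal ((norm (un k i y x))\<^sup>2 * ((1 - Xc x) ^ ?n / Xc x ^ r) * ((1 / c) * (Yc x powr (1 / real m - bb r) * (1 - Yc x))))"
          proof -
            have n1: "0 \<le> (norm (un k i y x))\<^sup>2" by simp
            have n2: "0 \<le> (norm (un k i y x))\<^sup>2 * ((1 - Xc x) ^ ?n / Xc x ^ r)" using Z by simp
            show ?thesis by (simp only: ennreal_mult'[OF n1] ennreal_mult'[OF n2])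
          qed
          then show ?thesis using pw[OF True] True by (simp add: ennreal_leI)
        qed simp
      qed
      also have "\<dots> = ennreal (dg y k i * ((bb k + real i) * real (k + ?n)))
        * (\<integral>\<^sup>+x. ennreal (x powr (real (k + ?n) - 1)) * ?\<phi>1 x * indicator {0<..<1} x \<partial>lborel)
        * (\<integral>\<^sup>+t. ennreal (t powr (bb k + real i - 1)) * ?\<phi>2 t * indicator {0<..<1} t \<partial>lborel)"
        by (rule un_moment[OF _ _ y]) measurable
      also have "(\<integral>\<^sup>+x. ennreal (x powr (real (k + ?n) - 1)) * ?\<phi>1 x * indicator {0<..<1} x \<partial>lborel)
        = (\<integral>\<^sup>+x. ennreal (x powr ((real (k - r) + real ?n) - 1) * (1 - x) ^ ?n) * indicator {0<..<1} x \<partial>lborel)"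
      proof (rule nn_integral_cong)
        fix x :: real
        have "x powr (real (k + ?n) - 1) * ((1 - x) ^ ?n / x ^ r) = x powr ((real (k - r) + real ?n) - 1) * (1 - x) ^ ?n" if "0 < x"
        proof -
          have "x powr (real (k + ?n) - 1) = x powr ((real (k - r) + real ?n) - 1) * x ^ r"
            using that r by (simp add: powr_realpow[symmetric] powr_add[symmetric] of_nat_diff add_diff_eq)
          then show ?thesis using that by simp
        qed
        then show "ennreal (x powr (real (k + ?n) - 1)) * ?\<phi>1 x * indicator {0<..<1} x
            = ennreal (x powr ((real (k - r) + real ?n) - 1) * (1 - x) ^ ?n) * indicator {0<..<1} x"
          by (cases "x \<in> {0<..<1}") (auto simp: ennreal_mult'[symmetric])
      qed
      also have "(\<integral>\<^sup>+t. ennreal (t powr (bb k + real i - 1)) * ?\<phi>2 t * indicator {0<..<1} t \<partial>lborel)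
        = ennreal (1 / c) * (\<integral>\<^sup>+t. ennreal (t powr ((real i + 1 / real m) - 1) * (1 - t) ^ 1) * indicator {0<..<1} t \<partial>lborel)"
      proof (subst nn_integral_cmult[symmetric], measurable, rule nn_integral_cong)
        fix t :: real
        have "t powr (bb k + real i - 1) * ((1 / c) * (t powr (1 / real m - bb r) * (1 - t))) = (1 / c) * (t powr ((real i + 1 / real m) - 1) * (1 - t) ^ 1)"
        proof -
          have "t powr (bb k + real i - 1) * t powr (1 / real m - bb r) = t powr ((real i + 1 / real m) - 1)"
            by (simp add: powr_add[symmetric] bk algebra_simps)
          then show ?thesis by (simp add: mult_ac)
        qed
        then show "ennreal (t powr (bb k + real i - 1)) * ?\<phi>2 t * indicator {0<..<1} t
          = ennreal (1 / c) * (ennreal (t powr ((real i + 1 / real m) - 1) * (1 - t) ^ 1) * indicator {0<..<1} t)"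
          using c(1) by (cases "t \<in> {0<..<1}") (auto simp: ennreal_mult'[symmetric])
      qed
      also have "ennreal (dg y k i * ((bb k + real i) * real (k + ?n)))
        * (\<integral>\<^sup>+x. ennreal (x powr ((real (k - r) + real ?n) - 1) * (1 - x) ^ ?n) * indicator {0<..<1} x \<partial>lborel)
        * (ennreal (1 / c) * (\<integral>\<^sup>+t. ennreal (t powr ((real i + 1 / real m) - 1) * (1 - t) ^ 1) * indicator {0<..<1} t \<partial>lborel))
        \<le> ennreal (dg y k i * ((bb k + real i) * real (k + ?n))) * ennreal (fact ?n / (real (k - r) + real ?n) ^ Suc ?n)
        * (ennreal (1 / c) * ennreal (fact 1 / (real i + 1 / real m) ^ Suc 1))"
        using m by (intro mult_mono nn_integral_Beta_le) (auto intro!: add_nonneg_pos)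
      also have "\<dots> = ennreal ((dg y k i * ((bb k + real i) * real (k + ?n))) * (fact ?n / (real (k - r) + real ?n) ^ Suc ?n)
        * ((1 / c) * (fact 1 / (real i + 1 / real m) ^ Suc 1)))"
      proof -
        have n1: "0 \<le> dg y k i * ((bb k + real i) * real (k + ?n))" using dg_nonneg[of y k i] bb_bounds(3)[of k] by simp
        have n2: "0 \<le> dg y k i * ((bb k + real i) * real (k + ?n)) * (fact ?n / (real (k - r) + real ?n) ^ Suc ?n)"
          by (intro mult_nonneg_nonneg[OF n1]) simp
        have n3: "0 \<le> 1 / c" using c(1) by simp
        show ?thesis by (simp only: ennreal_mult'[OF n1] ennreal_mult'[OF n2] ennreal_mult'[OF n3])
      qed
      also have "\<dots> \<le> ennreal (\<mu> (k, i))"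
      proof (rule ennreal_leI)
        let ?K = "real (Suc k)" and ?I = "real (Suc i)"
        have n1: "1 \<le> ?n" by (simp add: Suc_leI)
        have "k + ?n \<le> ?n * Suc k" using n1 by (cases ?n) auto
        then have kn: "real (k + ?n) \<le> real ?n * ?K" by (metis of_nat_le_iff of_nat_mult)
        have bi: "0 \<le> bb k + real i" "bb k + real i \<le> ?I" using bb_bounds[of k] by auto
        \<comment> \<open>With \<open>k - r = m * q\<close> and \<open>r < m\<close> one has
          \<open>Suc k \<le> m * q + m\<close>. This undoes the loss of \<open>r\<close> in the
          exponent of the Beta integral at the price of a factor \<open>m\<close>.\<close>
        have "Suc k \<le> m * (k - r + ?n)"
        proof -
          have kr: "k - r = m * q" by (simp add: k)
          have "m * q \<le> m * (m * q)" using m by simp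
          moreover have "m \<le> m * ?n" using n1 by simp
          ultimately have "Suc k \<le> m * (m * q) + m * ?n" using k r(1) by linarith
          then show ?thesis by (simp only: kr distrib_left)
        qed
        then have "?K \<le> real m * (real (k - r) + real ?n)" by (metis of_nat_le_iff of_nat_mult of_nat_add)
        then have km: "?K / real m \<le> real (k - r) + real ?n" using m by (simp add: pos_divide_le_eq mult.commute)
        have a1: "fact ?n / (real (k - r) + real ?n) ^ Suc ?n \<le> fact ?n / (?K / real m) ^ Suc ?n"
          using km m n1 by (intro divide_left_mono power_mono mult_pos_pos zero_less_power) (auto intro: add_nonneg_pos)
        have im: "?I / real m \<le> real i + 1 / real m"
          using m divide_left_mono[of 1 "real m" "real i"] by (simp add: add_divide_distrib)
        have a2: "fact 1 / (real i + 1 / real m) ^ Suc 1 \<le> fact 1 / (?I / real m) ^ Suc 1"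
          using im m by (intro divide_left_mono power_mono mult_pos_pos zero_less_power) (auto intro!: add_nonneg_pos)
        have Yp: "Yc y powr (bb k + real i - \<nu>) \<le> Yc y powr (1 / real m - \<nu>) * Yc y ^ i"
        proof -
          have "Yc y powr (bb k + real i - \<nu>) \<le> Yc y powr (1 / real m - \<nu> + real i)"
            using Y bb_bounds(1)[of k] by (intro powr_mono') auto
          then show ?thesis using Y by (simp only: powr_add powr_realpow)
        qed
        have dgl: "dg y k i \<le> (real ?n ^ ?n * ?K ^ ?n) * ?I * (Xc y ^ k * (Yc y powr (1 / real m - \<nu>) * Yc y ^ i))"
          unfolding dg_def using Y bi by (intro mult_mono Cn_le_Suc Yp mult_left_mono mult_nonneg_nonneg) auto
        have "(dg y k i * ((bb k + real i) * real (k + ?n))) * (fact ?n / (real (k - r) + real ?n) ^ Suc ?n)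
          * ((1 / c) * (fact 1 / (real i + 1 / real m) ^ Suc 1))
          \<le> (((real ?n ^ ?n * ?K ^ ?n) * ?I * (Xc y ^ k * (Yc y powr (1 / real m - \<nu>) * Yc y ^ i))) * (?I * (real ?n * ?K))) * (fact ?n / (?K / real m) ^ Suc ?n)
          * ((1 / c) * (fact 1 / (?I / real m) ^ Suc 1))"
        proof (rule mult_mono[OF mult_mono[OF mult_mono[OF dgl mult_mono[OF bi(2) kn]] a1] mult_left_mono[OF a2]])
          show "0 \<le> (1 / c) * (fact 1 / (real i + 1 / real m) ^ Suc 1)" using c(1) by simp
          show "0 \<le> fact ?n / (real (k - r) + real ?n) ^ Suc ?n" by simp
          show "0 \<le> (bb k + real i) * real (k + ?n)" using bi by simp
          show "0 \<le> (real ?n ^ ?n * ?K ^ ?n) * ?I * (Xc y ^ k * (Yc y powr (1 / real m - \<nu>) * Yc y ^ i))"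
            using Y by (intro mult_nonneg_nonneg) auto
          then show "0 \<le> (((real ?n ^ ?n * ?K ^ ?n) * ?I * (Xc y ^ k * (Yc y powr (1 / real m - \<nu>) * Yc y ^ i))) * (?I * (real ?n * ?K)))"
            using Y by (intro mult_nonneg_nonneg) auto
          then show "0 \<le> (((real ?n ^ ?n * ?K ^ ?n) * ?I * (Xc y ^ k * (Yc y powr (1 / real m - \<nu>) * Yc y ^ i))) * (?I * (real ?n * ?K))) * (fact ?n / (?K / real m) ^ Suc ?n)"
            using Y by (intro mult_nonneg_nonneg) auto
        qed (use c(1) in auto)
        \<comment> \<open>Growth of order \<open>n + 1\<close> in \<open>Suc k\<close> and of order
          2 in \<open>Suc i\<close> is matched exactly by the two Beta bounds; only
          \<open>Xc y ^ k * Yc y ^ i\<close> remains.\<close>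
        also have "\<dots> = \<mu> (k, i)"
        proof -
          have "(K::real) ^ ?n * K * (fact ?n / (K / real m) ^ Suc ?n) = fact ?n * real m ^ Suc ?n" if "K > 0" for K
            using that by (simp add: power_divide)
          from this[of ?K] have 1: "?K ^ ?n * ?K * (fact ?n / (?K / real m) ^ Suc ?n) = fact ?n * real m ^ Suc ?n" by simp
          have "(I::real) * I * (fact 1 / (I / real m) ^ Suc 1) = real m ^ 2" if "I > 0" for I
            using that by (simp add: power2_eq_square)
          from this[of ?I] have 2: "?I * ?I * (fact 1 / (?I / real m) ^ Suc 1) = real m ^ 2" by simp
          have "(((real ?n ^ ?n * ?K ^ ?n) * ?I * (Xc y ^ k * (Yc y powr (1 / real m - \<nu>) * Yc y ^ i))) * (?I * (real ?n * ?K))) * (fact ?n / (?K / real m) ^ Suc ?n)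
            * ((1 / c) * (fact 1 / (?I / real m) ^ Suc 1))
            = (1 / c) * (real ?n ^ ?n * real ?n * (?K ^ ?n * ?K * (fact ?n / (?K / real m) ^ Suc ?n)) * (?I * ?I * (fact 1 / (?I / real m) ^ Suc 1)))
              * Yc y powr (1 / real m - \<nu>) * (Xc y ^ k * Yc y ^ i)"
            by (simp only: mult_ac)
          also have "\<dots> = \<mu> (k, i)" unfolding 1 2 by (simp add: \<mu>_def d_def C_def mult_ac)
          finally show ?thesis .
        qed
        finally show "(dg y k i * ((bb k + real i) * real (k + ?n))) * (fact ?n / (real (k - r) + real ?n) ^ Suc ?n)
          * ((1 / c) * (fact 1 / (real i + 1 / real m) ^ Suc 1)) \<le> \<mu> (k, i)" .
      qed
      finally show "(\<integral>\<^sup>+x. ennreal ((norm (un k i y x))\<^sup>2 * \<omega> x) * indicator \<Omega> x \<partial>lborel) \<le> ennreal (\<mu> (k, i))" .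
    qed (auto simp: y intro: \<omega>m)
    also have "(\<integral>\<^sup>+x. ennreal ((norm (KK x y))\<^sup>2 * \<omega> x) * indicator \<Omega> x \<partial>lborel)
        = (\<integral>\<^sup>+x. ennreal ((norm (KK x y))\<^sup>2 * (GG x / Kd x)) * indicator \<Omega> x \<partial>lborel)"
      by (intro nn_integral_cong) (auto simp: indicator_def \<omega>K)
    also have "d * ((\<Sum>k. Xc y ^ k) * (\<Sum>i. Yc y ^ i)) = C * GG y"
    proof -
      have "(\<Sum>k. Xc y ^ k) = (1 - Xc y) powr (- 1)" "(\<Sum>k. Yc y ^ k) = (1 - Yc y) powr (- 1)"
        using Y by (simp_all add: suminf_geometric powr_minus_divide)
      then show ?thesis by (simp add: d_def GG_def)
    qed
    finally show ?thesis .
  qed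
  then show ?thesis using that C by blast
qed

end

text \<open>Hoelder's inequality with \<open>c = 1 / p\<close> and the splitting weight
  \<open>g\<close>, obtained by integrating Young's inequality with a scaling parameter. The case
  \<open>A = 0\<close> is separate because the optimal parameter divides by \<open>A\<close>; there
  \<open>w * f\<close> vanishes almost everywhere.\<close>

lemma nn_integral_Hoelder_weighted:
  fixes w f g :: "'a \<Rightarrow> real" and a A c :: real
  assumes c: "0 < c" "c < 1"
    and [measurable]: "w \<in> borel_measurable M" "f \<in> borel_measurable M" "g \<in> borel_measurable M"
    and nn: "\<And>x. x \<in> space M \<Longrightarrow> 0 \<le> w x" "\<And>x. x \<in> space M \<Longrightarrow> 0 \<le> f x" "\<And>x. x \<in> space M \<Longrightarrow> 0 < g x"
    and a: "a > 0" "(\<integral>\<^sup>+x. ennreal (w x * g x powr (c / (1 - c))) \<partial>M) \<le> ennreal a"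
    and A: "A \<ge> 0" "(\<integral>\<^sup>+x. ennreal (w x * (f x powr (1 / c) / g x)) \<partial>M) \<le> ennreal A"
  shows "(\<integral>\<^sup>+x. ennreal (w x * f x) \<partial>M) \<le> ennreal (a powr (1 - c) * A powr c)"
proof (cases "A = 0")
  case True
  then have "(\<integral>\<^sup>+x. ennreal (w x * (f x powr (1 / c) / g x)) \<partial>M) = 0" using A by simp
  then have "AE x in M. ennreal (w x * (f x powr (1 / c) / g x)) = 0"
    by (subst nn_integral_0_iff_AE[symmetric]) simp_all
  then have "AE x in M. ennreal (w x * f x) = 0"
  proof (rule AE_mp, intro AE_I2 impI)
    fix x assume x: "x \<in> space M" and z: "ennreal (w x * (f x powr (1 / c) / g x)) = 0"
    then have z: "w x * (f x powr (1 / c) / g x) \<le> 0" by (simp only: ennreal_eq_0_iff)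
    have "\<not> (w x > 0 \<and> f x > 0)"
    proof
      assume "w x > 0 \<and> f x > 0"
      then have "w x * (f x powr (1 / c) / g x) > 0" using nn(3)[OF x] by simp
      then show False using z by simp
    qed
    then have "w x = 0 \<or> f x = 0" using nn(1,2)[OF x] by linarith
    then show "ennreal (w x * f x) = 0" by auto
  qed
  then have "(\<integral>\<^sup>+x. ennreal (w x * f x) \<partial>M) = (\<integral>\<^sup>+x. 0 \<partial>M)" by (rule nn_integral_cong_AE)
  then show ?thesis by simp
next
  case False
  then have Apos: "A > 0" using A by simp
  \<comment> \<open>This scale makes both terms of Young's inequality, stripped of their factors
    \<open>c\<close> and \<open>1 - c\<close>, integrate to at most
    \<open>a powr (1 - c) * A powr c\<close>.\<close>
  define s where "s = a / A"
  have s: "s > 0" using a Apos by (simp add: s_def)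
  define k1 k2 where "k1 = c * s powr (1 - c)" and "k2 = (1 - c) * s powr (- c)"
  have k: "k1 \<ge> 0" "k2 \<ge> 0" using c by (simp_all add: k1_def k2_def)
  have young: "f x \<le> k1 * (f x powr (1 / c) / g x) + k2 * g x powr (c / (1 - c))" if x: "x \<in> space M" for x
  proof (cases "f x = 0")
    case True
    then show ?thesis using k by simp
  next
    case False
    then have f: "f x > 0" using nn(2)[OF x] by simp
    define F G where "F = f x" and "G = g x"
    have FG: "F > 0" "G > 0" using f nn(3)[OF x] by (simp_all add: F_def G_def)
    have "(s powr (1 - c) * (F powr (1 / c) / G)) powr c * (s powr (- c) * G powr (c / (1 - c))) powr (1 - c)
      \<le> c * (s powr (1 - c) * (F powr (1 / c) / G)) + (1 - c) * (s powr (- c) * G powr (c / (1 - c)))"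
      using c s FG by (intro Youngs_inequality_0) auto
    also have "(s powr (1 - c) * (F powr (1 / c) / G)) powr c * (s powr (- c) * G powr (c / (1 - c))) powr (1 - c)
      = (s powr ((1 - c) * c) * (F powr (1 / c * c) / G powr c)) * (s powr (- c * (1 - c)) * G powr (c / (1 - c) * (1 - c)))"
      by (simp only: powr_mult powr_divide powr_powr)
    also have "\<dots> = (s powr ((1 - c) * c) * s powr (- c * (1 - c))) * F powr (1 / c * c)"
      using c FG by simp
    also have "\<dots> = F"
      using c FG s by (simp add: powr_add[symmetric] algebra_simps)
    finally show ?thesis by (simp add: k1_def k2_def F_def G_def mult_ac)
  qed
  have "(\<integral>\<^sup>+x. ennreal (w x * f x) \<partial>M)
    \<le> (\<integral>\<^sup>+x. ennreal k1 * ennreal (w x * (f x powr (1 / c) / g x)) + ennreal k2 * ennreal (w x * g x powr (c / (1 - c))) \<partial>M)"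
  proof (rule nn_integral_mono)
    fix x assume x: "x \<in> space M"
    have p: "0 \<le> w x * (f x powr (1 / c) / g x)" "0 \<le> w x * g x powr (c / (1 - c))"
      using nn[OF x] by simp_all
    have "w x * f x \<le> w x * (k1 * (f x powr (1 / c) / g x) + k2 * g x powr (c / (1 - c)))"
      by (rule mult_left_mono[OF young[OF x] nn(1)[OF x]])
    also have "\<dots> = k1 * (w x * (f x powr (1 / c) / g x)) + k2 * (w x * g x powr (c / (1 - c)))"
      by (simp only: distrib_left mult_ac)
    finally have "ennreal (w x * f x) \<le> ennreal (k1 * (w x * (f x powr (1 / c) / g x)) + k2 * (w x * g x powr (c / (1 - c))))"
      by (rule ennreal_leI)
    also have "\<dots> = ennreal (k1 * (w x * (f x powr (1 / c) / g x))) + ennreal (k2 * (w x * g x powr (c / (1 - c))))"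
      by (rule ennreal_plus[OF mult_nonneg_nonneg[OF k(1) p(1)] mult_nonneg_nonneg[OF k(2) p(2)]])
    finally show "ennreal (w x * f x) \<le> ennreal k1 * ennreal (w x * (f x powr (1 / c) / g x)) + ennreal k2 * ennreal (w x * g x powr (c / (1 - c)))"
      by (simp only: ennreal_mult'[OF k(1)] ennreal_mult'[OF k(2)])
  qed
  also have "\<dots> = ennreal k1 * (\<integral>\<^sup>+x. ennreal (w x * (f x powr (1 / c) / g x)) \<partial>M) + ennreal k2 * (\<integral>\<^sup>+x. ennreal (w x * g x powr (c / (1 - c))) \<partial>M)"
    by (simp add: nn_integral_add nn_integral_cmult)
  also have "\<dots> \<le> ennreal k1 * ennreal A + ennreal k2 * ennreal a"
    by (intro add_mono mult_left_mono A a) auto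
  also have "\<dots> = ennreal (k1 * A + k2 * a)"
    using k A a by (simp add: ennreal_mult ennreal_plus)
  also have "k1 * A + k2 * a = a powr (1 - c) * A powr c"
  proof -
    have A1: "A powr (1 - c) * A powr c = A" and a1: "a powr (- c) * a = a powr (1 - c)"
      using Apos a(1) by (simp_all add: powr_add[symmetric] powr_mult_base mult.commute)
    have "s powr (1 - c) * A = a powr (1 - c) / A powr (1 - c) * (A powr (1 - c) * A powr c)"
      unfolding A1 by (simp only: s_def powr_divide)
    also have "\<dots> = a powr (1 - c) * A powr c" using Apos by simp
    finally have 1: "s powr (1 - c) * A = a powr (1 - c) * A powr c" .
    have "s powr (- c) * a = (a powr (- c) * a) * A powr c"
      unfolding s_def powr_divide by (simp add: powr_minus field_simps)
    then have 2: "s powr (- c) * a = a powr (1 - c) * A powr c" by (simp only: a1)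
    have "k1 * A + k2 * a = c * (s powr (1 - c) * A) + (1 - c) * (s powr (- c) * a)"
      by (simp add: k1_def k2_def)
    then show ?thesis unfolding 1 2 by (simp add: algebra_simps)
  qed
  finally show ?thesis .
qed

lemma nn_integral_inverse_Ioo:
  assumes e: "0 < e" "e < (1::real)"
  shows "(\<integral>\<^sup>+y. ennreal (1 / y) * indicator {e<..<1} y \<partial>lborel) = ennreal (- ln e)"
proof -
  have "((\<lambda>y. 1 / y) has_integral (ln 1 - ln e)) {e..1}"
    using e by (intro fundamental_theorem_of_calculus)
      (auto intro!: derivative_eq_intros simp: has_real_derivative_iff_has_vector_derivative[symmetric])
  then have "((\<lambda>y. 1 / y) has_integral (- ln e)) {e<..<1}"
    by (simp add: has_integral_Icc_iff_Ioo)
  then have "((\<lambda>y. if y \<in> {e<..<1} then 1 / y else 0) has_integral (- ln e)) UNIV"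
    by (simp only: has_integral_restrict_UNIV)
  also have "(\<lambda>y. if y \<in> {e<..<1} then 1 / y else 0) = (\<lambda>y. 1 / y * indicator {e<..<1} y)"
    by (auto simp: indicator_def)
  finally have "(\<integral>\<^sup>+y. ennreal (1 / y * indicator {e<..<1} y) \<partial>lborel) = ennreal (- ln e)"
    using e by (intro nn_integral_has_integral_lborel) (auto simp: indicator_def)
  also have "(\<integral>\<^sup>+y. ennreal (1 / y * indicator {e<..<1} y) \<partial>lborel) = (\<integral>\<^sup>+y. ennreal (1 / y) * indicator {e<..<1} y \<partial>lborel)"
    by (intro nn_integral_cong) (auto simp: indicator_def)
  finally show ?thesis .
qed

section \<open>Boundedness above the threshold\<close>

context hartogs
begin

text \<open>The Berezin kernel as a real function. Writing the diagonal as
  \<open>Re (KK x x)\<close> keeps it Borel measurable on the whole space.\<close>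

definition bk :: "(complex ^ 'n) \<times> complex \<Rightarrow> (complex ^ 'n) \<times> complex \<Rightarrow> real" where
  "bk x y = (norm (KK x y))\<^sup>2 / Re (KK x x)"

lemma bk_eq: "x \<in> \<Omega> \<Longrightarrow> bk x y = (norm (KK x y))\<^sup>2 / Kd x"
  by (simp add: bk_def KK_diag)

lemma bk_nonneg: "bk x y \<ge> 0"
proof (cases "x \<in> \<Omega>")
  case True
  then show ?thesis using Kd_pos[OF True] by (simp add: bk_eq less_imp_le)
qed (simp add: bk_def KK_def)

lemma berezin_kernel_eq: "berezin_kernel \<Omega> x y = of_real (bk x y)"
proof (cases "x \<in> \<Omega>")
  case True
  then show ?thesis by (simp add: berezin_kernel_def bergman_kernel_eq KK_diag bk_eq)
qed (simp add: berezin_kernel_def bergman_kernel_eq bk_def KK_def)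

lemma finite_measure_Omega: "finite_measure (lebesgue_on \<Omega>)"
proof (rule finite_measure_lebesgue_on, rule lmeasurable_open[OF _ open_Omega], rule bounded_subset)
  show "bounded (ball (0 :: complex ^ 'n) 1 \<times> ball (0 :: complex) 1)" by (intro bounded_Times) auto
  show "\<Omega> \<subseteq> ball 0 1 \<times> ball 0 1"
  proof safe
    fix z :: "complex ^ 'n" and w assume "(z, w) \<in> \<Omega>"
    then have h: "norm z ^ m < norm w ^ l" "norm w ^ l < 1" by (auto simp: hartogs_triangle_def)
    then have "norm z ^ m < 1" by simp
    then show "z \<in> ball 0 1" "w \<in> ball 0 1"
      using h m l by (auto simp: power_less_one_iff)
  qed
qed

lemma measurable_id_Omega: "(\<lambda>x. x) \<in> lebesgue_on \<Omega> \<rightarrow>\<^sub>M (borel :: ((complex ^ 'n) \<times> complex) measure)"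
  by (rule borel_measurable_lebesgue_on_Omega) simp

lemma bk_measurable: "(\<lambda>p. bk (fst p) (snd p)) \<in> borel_measurable (lebesgue_on \<Omega> \<Otimes>\<^sub>M lebesgue_on \<Omega>)"
proof -
  have "(\<lambda>p. (fst p, snd p)) \<in> (lebesgue_on \<Omega> \<Otimes>\<^sub>M lebesgue_on \<Omega>) \<rightarrow>\<^sub>M (borel \<Otimes>\<^sub>M borel :: (((complex ^ 'n) \<times> complex) \<times> (complex ^ 'n) \<times> complex) measure)"
    by (intro measurable_Pair measurable_compose[OF measurable_fst measurable_id_Omega] measurable_compose[OF measurable_snd measurable_id_Omega])
  from measurable_compose[OF this KK_measurable]
  have [measurable]: "(\<lambda>p. KK (fst p) (snd p)) \<in> borel_measurable (lebesgue_on \<Omega> \<Otimes>\<^sub>M lebesgue_on \<Omega>)" by simp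
  have [measurable]: "(\<lambda>p. Re (KK (fst p) (fst p))) \<in> borel_measurable (lebesgue_on \<Omega> \<Otimes>\<^sub>M lebesgue_on \<Omega>)"
    by (rule measurable_compose[OF measurable_compose[OF measurable_fst measurable_id_Omega] Re_KK_measurable])
  show ?thesis unfolding bk_def by measurable
qed

lemma bk_measurable1: "(\<lambda>x. bk x y) \<in> borel_measurable borel"
  and bk_measurable2: "(\<lambda>y. bk x y) \<in> borel_measurable borel"
proof -
  note [measurable] = KK_measurable1[of y] KK_measurable2[of x] Re_KK_measurable
  show "(\<lambda>x. bk x y) \<in> borel_measurable borel" "(\<lambda>y. bk x y) \<in> borel_measurable borel"
    unfolding bk_def by measurable
qed

lemma GG_measurable: "GG \<in> borel_measurable borel"
  unfolding GG_def[abs_def] by measurable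

text \<open>Schur's test for a kernel that is not symmetric: \<open>1 / Kd\<close> belongs to the
  first variable. Integration in the second variable is controlled by \<open>schur_first\<close>
  after using \<open>KK_sym\<close>, integration in the first by
  \<open>schur_second\<close>.\<close>

lemma berezin_bounded:
  assumes p: "real (m + CARD('n) * l) < p"
  shows "berezin_bounded_on_Lp \<Omega> p"
proof -
  let ?L = "lebesgue_on \<Omega>"
  interpret L: finite_measure ?L by (rule finite_measure_Omega)
  interpret P: pair_sigma_finite ?L ?L by unfold_locales
  have "2 \<le> m + CARD('n) * l"
  proof -
    have "1 \<le> CARD('n) * l" using l by (simp add: Suc_leI)
    then show ?thesis using m by linarith
  qed
  then have N2: "2 \<le> real (m + CARD('n) * l)" by (metis of_nat_le_iff of_nat_numeral)
  then have p2: "p > 2" using p by linarith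
  define c where "c = 1 / p"
  have c: "0 < c" "c < 1" and pc: "1 / c = p" and cp: "c * p = 1" using p2 by (auto simp: c_def)
  \<comment> \<open>The quotient of the conjugate exponent by \<open>p\<close>: with Schur weight
    \<open>GG powr (1 / p)\<close>, the dual Hoelder factor carries
    \<open>GG powr B\<close>.\<close>
  define B where "B = c / (1 - c)"
  have B_eq: "B = 1 / (p - 1)" using p2 by (simp add: B_def c_def field_simps)
  have Bm: "B * (1 - c) = c" using c by (simp add: B_def)
  have B: "0 < B" "B < 1" using p2 by (simp_all add: B_eq)
  \<comment> \<open>This is where the threshold enters:
    \<open>\<nu> - 1 / m = (m + n l - 1) / m\<close>, so the condition becomes
    \<open>m + n l - 1 < p - 1\<close>.\<close>
  have B3: "B * (\<nu> - 1 / real m) < 1 / real m"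
  proof -
    have "\<nu> - 1 / real m = (real (m + CARD('n) * l) - 1) / real m" by (simp add: \<nu>_def diff_divide_distrib)
    also have "B * \<dots> = ((real (m + CARD('n) * l) - 1) / (p - 1)) / real m" by (simp add: B_eq)
    also have "\<dots> < 1 / real m" using p p2 m by (intro divide_strict_right_mono) (simp_all del: of_nat_add of_nat_mult)
    finally show ?thesis .
  qed
  obtain C1 where C1: "C1 > 0" "\<And>y. y \<in> \<Omega> \<Longrightarrow>
      (\<integral>\<^sup>+x. ennreal ((norm (KK x y))\<^sup>2 * GG x powr B) * indicator \<Omega> x \<partial>lborel) \<le> ennreal (C1 * Kd y * GG y powr B)"
    using schur_first[OF B B3] by blast
  obtain C2 where C2: "C2 \<ge> 0" "\<And>y. y \<in> \<Omega> \<Longrightarrow>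
      (\<integral>\<^sup>+x. ennreal ((norm (KK x y))\<^sup>2 * (GG x / Kd x)) * indicator \<Omega> x \<partial>lborel) \<le> ennreal (C2 * GG y)"
    using schur_second by blast
  have [measurable]: "GG \<in> borel_measurable ?L" by (rule borel_measurable_lebesgue_on_Omega[OF GG_measurable])
  have [measurable]: "(\<lambda>x. bk x y) \<in> borel_measurable ?L" "(\<lambda>y. bk x y) \<in> borel_measurable ?L" for x y
    by (rule borel_measurable_lebesgue_on_Omega[OF bk_measurable1], rule borel_measurable_lebesgue_on_Omega[OF bk_measurable2])
  note bkm [measurable] = bk_measurable
  have S1: "(\<integral>\<^sup>+y. ennreal (bk x y * GG y powr B) \<partial>?L) \<le> ennreal (C1 * GG x powr B)" if x: "x \<in> \<Omega>" for x
  proof -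
    have "(\<integral>\<^sup>+y. ennreal (bk x y * GG y powr B) \<partial>?L)
      = (\<integral>\<^sup>+y. ennreal (1 / Kd x) * (ennreal ((norm (KK y x))\<^sup>2 * GG y powr B) * indicator \<Omega> y) \<partial>lborel)"
      unfolding nn_integral_lebesgue_on_Omega using Kd_pos[OF x]
      by (intro nn_integral_cong) (simp add: bk_eq[OF x] KK_sym[of x] ennreal_mult'[symmetric] mult.assoc[symmetric])
    also have "\<dots> = ennreal (1 / Kd x) * (\<integral>\<^sup>+y. ennreal ((norm (KK y x))\<^sup>2 * GG y powr B) * indicator \<Omega> y \<partial>lborel)"
    proof -
      note [measurable] = KK_measurable1[of x] GG_measurable Omega_borel
      show ?thesis by (intro nn_integral_cmult) measurable
    qed
    also have "\<dots> \<le> ennreal (1 / Kd x) * ennreal (C1 * Kd x * GG x powr B)"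
      by (intro mult_left_mono C1(2)[OF x]) simp
    also have "\<dots> = ennreal (C1 * GG x powr B)"
      using Kd_pos[OF x] by (simp add: ennreal_mult'[symmetric])
    finally show ?thesis .
  qed
  have S2: "(\<integral>\<^sup>+x. ennreal (bk x y * GG x) \<partial>?L) \<le> ennreal (C2 * GG y)" if y: "y \<in> \<Omega>" for y
  proof -
    have "(\<integral>\<^sup>+x. ennreal (bk x y * GG x) \<partial>?L) = (\<integral>\<^sup>+x. ennreal ((norm (KK x y))\<^sup>2 * (GG x / Kd x)) * indicator \<Omega> x \<partial>lborel)"
      unfolding nn_integral_lebesgue_on_Omega by (intro nn_integral_cong) (auto simp: indicator_def bk_eq)
    then show ?thesis using C2(2)[OF y] by simp
  qed
  define D where "D = C1 powr ((1 - c) * p)"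
  have D: "D \<ge> 0" by (simp add: D_def)
  have main: "(AE x in ?L. integrable ?L (\<lambda>y. berezin_kernel \<Omega> x y * f y)) \<and>
        berezin_transform \<Omega> f \<in> Lp_space p ?L \<and>
        Lp_norm p ?L (berezin_transform \<Omega> f) \<le> (D * C2) powr (1 / p) * Lp_norm p ?L f"
    if f: "f \<in> Lp_space p ?L" for f
  proof -
    have fm [measurable]: "f \<in> borel_measurable ?L" and fi: "integrable ?L (\<lambda>x. norm (f x) powr p)"
      using f by (auto simp: Lp_space_def)
    define I where "I = (\<integral>x. norm (f x) powr p \<partial>?L)"
    have I: "I \<ge> 0" "(\<integral>\<^sup>+x. ennreal (norm (f x) powr p) \<partial>?L) = ennreal I"
      unfolding I_def by (simp, rule nn_integral_eq_integral[OF fi]) simp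
    define h where "h x y = bk x y * (norm (f y) powr p / GG y)" for x y
    have hm [measurable]: "(\<lambda>p. h (fst p) (snd p)) \<in> borel_measurable (?L \<Otimes>\<^sub>M ?L)"
      unfolding h_def by measurable
    define A where "A x = (\<integral>\<^sup>+y. ennreal (h x y) \<partial>?L)" for x
    have Am [measurable]: "A \<in> borel_measurable ?L"
      unfolding A_def[abs_def] by (rule L.borel_measurable_nn_integral) (simp add: case_prod_unfold)
    have hmx [measurable]: "h x \<in> borel_measurable ?L" for x
      unfolding h_def[abs_def] by measurable
    have "(\<integral>\<^sup>+x. ennreal (GG x) * A x \<partial>?L) = (\<integral>\<^sup>+x. (\<integral>\<^sup>+y. ennreal (GG x) * ennreal (h x y) \<partial>?L) \<partial>?L)"
      unfolding A_def by (intro nn_integral_cong nn_integral_cmult[symmetric]) measurable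
    also have "\<dots> = (\<integral>\<^sup>+y. (\<integral>\<^sup>+x. ennreal (GG x) * ennreal (h x y) \<partial>?L) \<partial>?L)"
      by (rule P.Fubini'[symmetric]) (simp add: case_prod_unfold)
    also have "\<dots> \<le> (\<integral>\<^sup>+y. ennreal C2 * ennreal (norm (f y) powr p) \<partial>?L)"
    proof (rule nn_integral_mono)
      fix y assume "y \<in> space ?L"
      then have y: "y \<in> \<Omega>" by simp
      have q: "0 \<le> norm (f y) powr p / GG y" using GG_pos[OF y] by simp
      have "(\<integral>\<^sup>+x. ennreal (GG x) * ennreal (h x y) \<partial>?L) = (\<integral>\<^sup>+x. ennreal (norm (f y) powr p / GG y) * ennreal (bk x y * GG x) \<partial>?L)"
      proof (rule nn_integral_cong)
        fix x assume "x \<in> space ?L"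
        then have G0: "0 \<le> GG x" using GG_pos[of x] by simp
        have "ennreal (GG x) * ennreal (h x y) = ennreal (GG x * h x y)" by (simp only: ennreal_mult'[OF G0])
        also have "\<dots> = ennreal (norm (f y) powr p / GG y * (bk x y * GG x))" by (simp only: h_def mult_ac)
        also have "\<dots> = ennreal (norm (f y) powr p / GG y) * ennreal (bk x y * GG x)" by (rule ennreal_mult'[OF q])
        finally show "ennreal (GG x) * ennreal (h x y) = ennreal (norm (f y) powr p / GG y) * ennreal (bk x y * GG x)" .
      qed
      also have "\<dots> = ennreal (norm (f y) powr p / GG y) * (\<integral>\<^sup>+x. ennreal (bk x y * GG x) \<partial>?L)"
        by (intro nn_integral_cmult) measurable
      also have "\<dots> \<le> ennreal (norm (f y) powr p / GG y) * ennreal (C2 * GG y)"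
        by (intro mult_left_mono S2[OF y]) simp
      also have "\<dots> = ennreal C2 * ennreal (norm (f y) powr p)"
        using GG_pos[OF y] C2(1) by (simp add: ennreal_mult'[OF q, symmetric] ennreal_mult'[OF C2(1), symmetric])
      finally show "(\<integral>\<^sup>+x. ennreal (GG x) * ennreal (h x y) \<partial>?L) \<le> ennreal C2 * ennreal (norm (f y) powr p)" .
    qed
    also have "\<dots> = ennreal C2 * ennreal I" by (subst nn_integral_cmult) (simp_all add: I)
    finally have tot: "(\<integral>\<^sup>+x. ennreal (GG x) * A x \<partial>?L) \<le> ennreal (C2 * I)" using C2(1) by (simp add: ennreal_mult')
    \<comment> \<open>\<open>A x\<close> may be infinite at some points. Its weighted integral is
      finite by Tonelli, hence it is finite almost everywhere as \<open>GG\<close> is positive; this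
      gives the absolute convergence of the transform almost everywhere.\<close>
    have "AE x in ?L. ennreal (GG x) * A x \<noteq> \<infinity>"
    proof (rule nn_integral_PInf_AE)
      show "(\<integral>\<^sup>+x. ennreal (GG x) * A x \<partial>?L) \<noteq> \<infinity>" using tot by (auto simp: top_unique)
    qed measurable
    then have good: "AE x in ?L. x \<in> \<Omega> \<and> ennreal (GG x) * A x \<noteq> \<infinity>" by (auto simp: AE_iff_measurable intro: AE_mp)
    have pointwise: "integrable ?L (\<lambda>y. berezin_kernel \<Omega> x y * f y) \<and>
        ennreal (norm (berezin_transform \<Omega> f x) powr p) \<le> ennreal D * (ennreal (GG x) * A x)"
      if x: "x \<in> \<Omega>" and fin: "ennreal (GG x) * A x \<noteq> \<infinity>" for x
    proof -
      note G = GG_pos[OF x]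
      have "A x \<noteq> \<infinity>" using fin G by (auto simp: ennreal_mult_eq_top_iff)
      then obtain a where a: "a \<ge> 0" "A x = ennreal a" by (cases "A x") auto
      define t where "t = (C1 * GG x powr B) powr (1 - c) * a powr c"
      have T: "(\<integral>\<^sup>+y. ennreal (bk x y * norm (f y)) \<partial>?L) \<le> ennreal t"
        unfolding t_def
      proof (rule nn_integral_Hoelder_weighted[OF c, where g=GG])
        show "(\<integral>\<^sup>+y. ennreal (bk x y * GG y powr (c / (1 - c))) \<partial>?L) \<le> ennreal (C1 * GG x powr B)"
          using S1[OF x] by (simp add: B_def)
        show "(\<integral>\<^sup>+y. ennreal (bk x y * (norm (f y) powr (1 / c) / GG y)) \<partial>?L) \<le> ennreal a"
          using a(2) by (simp add: A_def h_def pc)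
      qed (use G C1 a bk_nonneg GG_pos in auto)
      have nk: "norm (berezin_kernel \<Omega> x y * f y) = bk x y * norm (f y)" for y
        using bk_nonneg[of x y] by (simp add: berezin_kernel_eq norm_mult)
      have int: "integrable ?L (\<lambda>y. berezin_kernel \<Omega> x y * f y)"
      proof (rule integrableI_bounded)
        show "(\<lambda>y. berezin_kernel \<Omega> x y * f y) \<in> borel_measurable ?L"
          unfolding berezin_kernel_eq by measurable
        show "(\<integral>\<^sup>+y. ennreal (norm (berezin_kernel \<Omega> x y * f y)) \<partial>?L) < \<infinity>"
          unfolding nk using T by (auto intro: le_less_trans)
      qed
      have t0: "t \<ge> 0" by (simp add: t_def)
      have "ennreal (norm (berezin_transform \<Omega> f x)) \<le> (\<integral>\<^sup>+y. ennreal (norm (berezin_kernel \<Omega> x y * f y)) \<partial>?L)"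
        unfolding berezin_transform_def by (rule integral_norm_bound_ennreal[OF int])
      also have "\<dots> \<le> ennreal t" unfolding nk by (rule T)
      finally have "norm (berezin_transform \<Omega> f x) \<le> t" using t0 by (simp add: ennreal_le_iff)
      then have "norm (berezin_transform \<Omega> f x) powr p \<le> t powr p" using p2 by (intro powr_mono2) auto
      also have "t powr p = (C1 powr ((1 - c) * p) * GG x powr (B * ((1 - c) * p))) * a powr (c * p)"
        unfolding t_def by (simp only: powr_mult powr_powr mult.assoc)
      \<comment> \<open>The dual factor contributes exactly the first power of \<open>GG x\<close>,
        the weight under which \<open>A\<close> has been integrated.\<close>
      also have "B * ((1 - c) * p) = 1" by (simp only: mult.assoc[symmetric] Bm cp)
      also have "(C1 powr ((1 - c) * p) * GG x powr 1) * a powr (c * p) = D * (GG x * a)"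
        using G a(1) by (simp add: cp D_def)
      finally have "ennreal (norm (berezin_transform \<Omega> f x) powr p) \<le> ennreal (D * (GG x * a))" by (rule ennreal_leI)
      then show ?thesis using int G D a by (simp add: ennreal_mult')
    qed
    have bm: "berezin_transform \<Omega> f \<in> borel_measurable ?L"
      unfolding berezin_transform_def[abs_def] berezin_kernel_eq
    proof (rule L.borel_measurable_lebesgue_integral)
      have "(\<lambda>p. complex_of_real (bk (fst p) (snd p)) * f (snd p)) \<in> borel_measurable (?L \<Otimes>\<^sub>M ?L)" by measurable
      then show "(\<lambda>(x, y). complex_of_real (bk x y) * f y) \<in> borel_measurable (?L \<Otimes>\<^sub>M ?L)" by (simp add: case_prod_unfold)
    qed
    have "(\<integral>\<^sup>+x. ennreal (norm (berezin_transform \<Omega> f x) powr p) \<partial>?L) \<le> (\<integral>\<^sup>+x. ennreal D * (ennreal (GG x) * A x) \<partial>?L)"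
      by (rule nn_integral_mono_AE, rule AE_mp[OF good], rule AE_I2) (use pointwise in blast)
    also have "\<dots> = ennreal D * (\<integral>\<^sup>+x. ennreal (GG x) * A x \<partial>?L)" by (intro nn_integral_cmult) measurable
    also have "\<dots> \<le> ennreal D * ennreal (C2 * I)" by (intro mult_left_mono tot) simp
    also have "\<dots> = ennreal (D * C2 * I)" using D by (simp add: ennreal_mult'[symmetric] mult.assoc)
    finally have bnd: "(\<integral>\<^sup>+x. ennreal (norm (berezin_transform \<Omega> f x) powr p) \<partial>?L) \<le> ennreal (D * C2 * I)" .
    have bi: "integrable ?L (\<lambda>x. norm (berezin_transform \<Omega> f x) powr p)"
    proof (rule integrableI_bounded)
      show "(\<lambda>x. norm (berezin_transform \<Omega> f x) powr p) \<in> borel_measurable ?L" using bm by measurable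
      show "(\<integral>\<^sup>+x. ennreal (norm (norm (berezin_transform \<Omega> f x) powr p)) \<partial>?L) < \<infinity>"
        using bnd by (auto intro: le_less_trans)
    qed
    have "ennreal (\<integral>x. norm (berezin_transform \<Omega> f x) powr p \<partial>?L) \<le> ennreal (D * C2 * I)"
      using bnd nn_integral_eq_integral[OF bi] by simp
    then have "(\<integral>x. norm (berezin_transform \<Omega> f x) powr p \<partial>?L) \<le> D * C2 * I"
      using D C2(1) I(1) by (simp add: ennreal_le_iff)
    then have "(\<integral>x. norm (berezin_transform \<Omega> f x) powr p \<partial>?L) powr (1 / p) \<le> (D * C2 * I) powr (1 / p)"
      using p2 by (intro powr_mono2) auto
    then have "Lp_norm p ?L (berezin_transform \<Omega> f) \<le> (D * C2) powr (1 / p) * Lp_norm p ?L f"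
      by (simp only: Lp_norm_def I_def[symmetric] powr_mult)
    moreover have "AE x in ?L. integrable ?L (\<lambda>y. berezin_kernel \<Omega> x y * f y)"
      by (rule AE_mp[OF good], rule AE_I2) (use pointwise in blast)
    ultimately show ?thesis using bm bi by (simp add: Lp_space_def)
  qed
  show ?thesis unfolding berezin_bounded_on_Lp_def using main by blast
qed

text \<open>By Bezout some \<open>s \<ge> n\<close> is an inverse of \<open>l\<close> modulo
  \<open>m\<close>. With \<open>k + n = s\<close> the number \<open>- l * (k + n)\<close> has
  residue \<open>m - 1\<close>, the largest possible, and \<open>bb k\<close> takes its minimal
  value.\<close>

lemma bb_minimal:
  assumes "coprime m l"
  obtains k where "bb k = 1 / real m"
proof -
  obtain u v where "u * int l + v * int m = gcd (int l) (int m)" using bezout_int by blast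
  moreover have "gcd (int l) (int m) = 1" using assms by (simp add: coprime_iff_gcd_eq_1 gcd.commute)
  ultimately have uv: "u * int l + v * int m = 1" by simp
  \<comment> \<open>Adding this multiple of \<open>m\<close> to \<open>u\<close> changes nothing
    modulo \<open>m\<close> and makes \<open>s\<close> at least \<open>CARD('n)\<close>, so that
    \<open>k\<close> is a natural number.\<close>
  define t where "t = \<bar>u\<bar> + int CARD('n)"
  define s where "s = u + int m * t"
  have "t \<ge> 0" by (simp add: t_def)
  then have "1 * t \<le> int m * t" using m by (intro mult_right_mono) auto
  then have s: "s \<ge> int CARD('n)" by (simp add: s_def t_def)
  define k where "k = nat s - CARD('n)"
  have kn: "int (k + CARD('n)) = s" using s by (simp add: k_def)
  have "- int (l * (k + CARD('n))) = - (int l * s)" by (simp only: of_nat_mult kn)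
  also have "\<dots> = (int m - 1) + int m * (v - int l * t - 1)"
    using uv by (simp add: s_def algebra_simps)
  finally have "- int (l * (k + CARD('n))) mod int m = (int m - 1) mod int m" by simp
  also have "\<dots> = int m - 1" using m by (intro mod_pos_pos_trivial) auto
  finally have "bb k = 1 / real m" unfolding bb_eq using m by simp
  then show ?thesis by (rule that)
qed

section \<open>Test functions and failure at or below the threshold\<close>

definition test_fun :: "real \<Rightarrow> (complex ^ 'n) \<times> complex \<Rightarrow> real" where
  "test_fun e x = Yc x powr (- (1 / real m)) * indicator {e<..} (Yc x)"

lemma test_fun_measurable: "test_fun e \<in> borel_measurable borel"
  unfolding test_fun_def[abs_def] by measurable

lemma test_fun_nonneg: "test_fun e x \<ge> 0"
  by (simp add: test_fun_def)

lemma test_fun_le: "e > 0 \<Longrightarrow> test_fun e x \<le> e powr (- (1 / real m))"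
  by (auto simp: test_fun_def indicator_def intro!: powr_mono2')

lemma nn_integral_inverse_tail:
  assumes "0 < L"
  shows "(\<integral>\<^sup>+y. ennreal (1 / y) * indicator {exp (- L)<..} y * indicator {0<..<1} y \<partial>lborel) = ennreal L"
proof -
  have "(\<integral>\<^sup>+y. ennreal (1 / y) * indicator {exp (- L)<..} y * indicator {0<..<1} y \<partial>lborel)
    = (\<integral>\<^sup>+y. ennreal (1 / y) * indicator {exp (- L)<..<1} y \<partial>lborel)"
    using exp_gt_zero[of "- L"] by (intro nn_integral_cong) (auto simp: indicator_def simp del: exp_gt_zero intro: less_trans)
  also have "\<dots> = ennreal L" using assms by (subst nn_integral_inverse_Ioo) auto
  finally show ?thesis .
qed

text \<open>Over the domain, \<open>Yc\<close> is distributed with density proportional to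
  \<open>y powr (\<beta> 0 0 - 1)\<close>, where \<open>\<beta> 0 0 = (m + n l) / m\<close>. For
  \<open>p \<le> m + n l\<close> the \<open>p\<close>-th power of the test function times this
  density is at most \<open>1 / y\<close>, whose integral from \<open>exp (- L)\<close> to 1 is
  \<open>L\<close>.\<close>

lemma test_fun_Lp:
  assumes p: "0 < p" "p \<le> real (m + CARD('n) * l)" and L: "L > 0"
  shows "(\<integral>\<^sup>+x. ennreal (test_fun (exp (- L)) x powr p) \<partial>lebesgue_on \<Omega>) \<le> ennreal (pi ^ CARD('n) / fact CARD('n) * pi * L)"
proof -
  let ?n = "CARD('n)"
  let ?e = "exp (- L)"
  let ?M = "pi ^ ?n / fact ?n :: real"
  let ?\<phi> = "\<lambda>y. ennreal ((y powr (- (1 / real m))) powr p) * indicator {?e<..} y"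
  have "(\<integral>\<^sup>+y. ennreal (y powr (\<beta> 0 0 - 1)) * ?\<phi> y * indicator {0<..<1} y \<partial>lborel)
    \<le> (\<integral>\<^sup>+y. ennreal (1 / y) * indicator {?e<..} y * indicator {0<..<1} y \<partial>lborel)"
  proof (rule nn_integral_mono)
    fix y :: real
    have "y powr (\<beta> 0 0 - 1) * ((y powr (- (1 / real m))) powr p) \<le> 1 / y" if y: "0 < y" "y < 1"
    proof -
      have "p / real m \<le> real (m + ?n * l) / real m" using p(2) by (rule divide_right_mono) simp
      also have "real (m + ?n * l) / real m = \<beta> 0 0" using m by (simp add: \<beta>_def field_simps)
      finally have "- 1 \<le> \<beta> 0 0 - 1 + - (1 / real m) * p" by simp
      then have "y powr (\<beta> 0 0 - 1 + - (1 / real m) * p) \<le> y powr (- 1)" using y by (intro powr_mono') auto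
      also have "y powr (- 1) = 1 / y" using y by (simp add: powr_minus_divide)
      finally show ?thesis by (simp only: powr_powr powr_add)
    qed
    then show "ennreal (y powr (\<beta> 0 0 - 1)) * ?\<phi> y * indicator {0<..<1} y \<le> ennreal (1 / y) * indicator {?e<..} y * indicator {0<..<1} y"
      by (cases "y \<in> {0<..<1}") (auto simp: indicator_def ennreal_mult'[symmetric] intro!: ennreal_leI)
  qed
  also have "\<dots> = ennreal L" by (rule nn_integral_inverse_tail[OF L])
  finally have I2: "(\<integral>\<^sup>+y. ennreal (y powr (\<beta> 0 0 - 1)) * ?\<phi> y * indicator {0<..<1} y \<partial>lborel) \<le> ennreal L" .
  have "(\<integral>\<^sup>+x. ennreal (test_fun ?e x powr p) \<partial>lebesgue_on \<Omega>)
    = (\<integral>\<^sup>+x. ennreal ((\<lambda>_. 1) (fst x) * (norm (snd x powi 0))\<^sup>2) * (\<lambda>_. 1) (Xc x) * ?\<phi> (Yc x) * indicator \<Omega> x \<partial>lborel)"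
    unfolding nn_integral_lebesgue_on_Omega test_fun_def using p(1)
    by (intro nn_integral_cong) (auto simp: indicator_def)
  also have "\<dots> = (ennreal (?M * real (0 + ?n)) * (\<integral>\<^sup>+x. ennreal (x powr (real (0 + ?n) - 1)) * 1 * indicator {0<..<1} x \<partial>lborel))
    * (ennreal pi * (\<integral>\<^sup>+y. ennreal (y powr (\<beta> 0 0 - 1)) * ?\<phi> y * indicator {0<..<1} y \<partial>lborel))"
  proof (rule nn_integral_moment)
    show "(\<integral>\<^sup>+z. ennreal 1 * indicator (ball 0 1) z \<partial>(lborel :: (complex ^ 'n) measure)) = ennreal ?M"
      by (simp add: volume_unit_ball)
  qed (simp_all, measurable)
  also have "(\<integral>\<^sup>+x. ennreal (x powr (real (0 + ?n) - 1)) * 1 * indicator {0<..<1} x \<partial>lborel) = ennreal (1 / real (0 + ?n))"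
    by (rule nn_integral_powr_01) simp
  finally have "(\<integral>\<^sup>+x. ennreal (test_fun ?e x powr p) \<partial>lebesgue_on \<Omega>)
    \<le> (ennreal (?M * real (0 + ?n)) * ennreal (1 / real (0 + ?n))) * (ennreal pi * ennreal L)"
    using mult_left_mono[OF mult_left_mono[OF I2, of "ennreal pi"], of "ennreal (?M * real (0 + ?n)) * ennreal (1 / real (0 + ?n))"] by simp
  also have "\<dots> = ennreal (?M * pi * L)"
  proof -
    have 1: "0 \<le> ?M * real (0 + ?n)" "0 \<le> ?M * real (0 + ?n) * (1 / real (0 + ?n))" by simp_all
    have "?M * real (0 + ?n) * (1 / real (0 + ?n)) * (pi * L) = ?M * pi * L" by simp
    then show ?thesis by (simp only: ennreal_mult'[OF 1(1), symmetric] ennreal_mult'[OF 1(2), symmetric] ennreal_mult'[OF pi_ge_zero, symmetric])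
  qed
  finally show ?thesis .
qed

text \<open>Pairing \<open>KK (\<cdot>, x)\<close> with the extremal term \<open>un k 0 x\<close> against the weight isolates that
  single term by orthogonality, and \<open>2 |u K| \<le> |u|\<^sup>2 + |K|\<^sup>2\<close> turns this into a lower bound.\<close>

lemma KK_test_fun_ge:
  assumes k: "bb k = 1 / real m" and x: "x \<in> \<Omega>" and L: "L > 0"
  shows "ennreal (dg x k 0 / real m * L) \<le> (\<integral>\<^sup>+y. ennreal (test_fun (exp (- L)) y * (norm (KK y x))\<^sup>2) * indicator \<Omega> y \<partial>lborel)"
    and "(\<integral>\<^sup>+y. ennreal (test_fun (exp (- L)) y * (norm (KK y x))\<^sup>2) * indicator \<Omega> y \<partial>lborel) < \<infinity>"
proof -
  let ?n = "CARD('n)"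
  define e where "e = exp (- L)"
  have e: "e > 0" by (simp add: e_def)
  define E where "E = e powr (- (1 / real m))"
  define u where "u = un k 0 x"
  define w where "w = test_fun e"
  have w0: "w y \<ge> 0" and wE: "w y \<le> E" for y using test_fun_le[OF e] by (simp_all add: w_def E_def test_fun_nonneg)
  have wm [measurable]: "w \<in> borel_measurable borel" by (simp add: w_def test_fun_measurable)
  note [measurable] = KK_measurable1[of x] Omega_borel
  have um: "(\<lambda>y. indicator \<Omega> y *\<^sub>R u y) \<in> borel_measurable lborel"
    unfolding u_def by (rule measurable_on_Omega[OF continuous_on_un[OF x]])
  have u_m [measurable]: "u \<in> borel_measurable borel"
    unfolding u_def un_def using measurable_compose[OF measurable_Pair2'[of x borel borel] uu_measurable] by simp
  define m0 where "m0 = dg x k 0 / real m * L"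
  have m0: "m0 \<ge> 0" using L by (simp add: m0_def dg_nonneg)
  \<comment> \<open>Because \<open>bb k = 1 / m\<close>, the density
    \<open>y powr (bb k - 1)\<close> times the test function is exactly \<open>1 / y\<close>, so the
    truncated integral is exactly \<open>L\<close>.\<close>
  have U: "(\<integral>\<^sup>+y. ennreal (w y * (norm (u y))\<^sup>2) * indicator \<Omega> y \<partial>lborel) = ennreal m0"
  proof -
    let ?\<phi> = "\<lambda>t. ennreal (t powr (- (1 / real m))) * indicator {e<..} t"
    have "(\<integral>\<^sup>+y. ennreal (w y * (norm (u y))\<^sup>2) * indicator \<Omega> y \<partial>lborel)
      = (\<integral>\<^sup>+y. ennreal ((norm (un k 0 x y))\<^sup>2) * (\<lambda>_. 1) (Xc y) * ?\<phi> (Yc y) * indicator \<Omega> y \<partial>lborel)"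
      by (intro nn_integral_cong) (auto simp: w_def u_def test_fun_def indicator_def ennreal_mult'[symmetric] mult_ac)
    also have "\<dots> = ennreal (dg x k 0 * ((bb k + real 0) * real (k + ?n)))
        * (\<integral>\<^sup>+x. ennreal (x powr (real (k + ?n) - 1)) * 1 * indicator {0<..<1} x \<partial>lborel)
        * (\<integral>\<^sup>+y. ennreal (y powr (bb k + real 0 - 1)) * ?\<phi> y * indicator {0<..<1} y \<partial>lborel)"
      by (rule un_moment[OF _ _ x]) measurable
    also have "(\<integral>\<^sup>+x. ennreal (x powr (real (k + ?n) - 1)) * 1 * indicator {0<..<1} x \<partial>lborel) = ennreal (1 / real (k + ?n))"
      by (rule nn_integral_powr_01) (simp add: add_nonneg_pos)
    also have "(\<integral>\<^sup>+y. ennreal (y powr (bb k + real 0 - 1)) * ?\<phi> y * indicator {0<..<1} y \<partial>lborel)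
        = (\<integral>\<^sup>+y. ennreal (1 / y) * indicator {exp (- L)<..} y * indicator {0<..<1} y \<partial>lborel)"
    proof (rule nn_integral_cong)
      fix y :: real
      have "y powr (bb k + real 0 - 1) * y powr (- (1 / real m)) = 1 / y" if "0 < y"
      proof -
        have "bb k + real 0 - 1 + - (1 / real m) = - 1" by (simp add: k)
        then have "y powr (bb k + real 0 - 1) * y powr (- (1 / real m)) = y powr (- 1)" by (simp only: powr_add[symmetric])
        then show ?thesis using that by (simp add: powr_minus_divide)
      qed
      then show "ennreal (y powr (bb k + real 0 - 1)) * ?\<phi> y * indicator {0<..<1} y = ennreal (1 / y) * indicator {exp (- L)<..} y * indicator {0<..<1} y"
        by (cases "y \<in> {0<..<1}") (auto simp: indicator_def e_def ennreal_mult'[symmetric])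
    qed
    also have "\<dots> = ennreal L" by (rule nn_integral_inverse_tail[OF L])
    also have "ennreal (dg x k 0 * ((bb k + real 0) * real (k + ?n))) * ennreal (1 / real (k + ?n)) * ennreal L = ennreal m0"
    proof -
      have 1: "0 \<le> dg x k 0 * ((bb k + real 0) * real (k + ?n))" using dg_nonneg[of x k 0] bb_bounds(3)[of k] by simp
      have 2: "0 \<le> dg x k 0 * ((bb k + real 0) * real (k + ?n)) * (1 / real (k + ?n))" by (rule mult_nonneg_nonneg[OF 1]) simp
      have "real (k + ?n) > 0" by (simp add: add_nonneg_pos)
      then have "real (k + ?n) \<noteq> 0" by linarith
      then have "dg x k 0 * ((bb k + real 0) * real (k + ?n)) * (1 / real (k + ?n)) * L = m0" by (simp add: k m0_def)
      then show ?thesis by (simp only: ennreal_mult'[OF 1, symmetric] ennreal_mult'[OF 2, symmetric])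
    qed
    finally show ?thesis .
  qed
  define Q where "Q = (\<integral>\<^sup>+y. ennreal (w y * (norm (KK y x))\<^sup>2) * indicator \<Omega> y \<partial>lborel)"
  \<comment> \<open>The truncation bounds the weight by \<open>E\<close>, so \<open>Q\<close> is
    finite by the square norm of the kernel. Finiteness is needed to absorb half of the left side at
    the end.\<close>
  have "Q \<le> (\<integral>\<^sup>+y. ennreal E * (ennreal ((norm (KK y x))\<^sup>2) * indicator \<Omega> y) \<partial>lborel)"
    unfolding Q_def using wE w0
    by (intro nn_integral_mono) (auto simp: indicator_def ennreal_mult''[symmetric] intro!: ennreal_leI mult_right_mono)
  also have "\<dots> = ennreal E * (\<integral>\<^sup>+y. ennreal ((norm (KK y x))\<^sup>2) * indicator \<Omega> y \<partial>lborel)"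
    by (intro nn_integral_cmult) measurable
  also have "\<dots> \<le> ennreal E * ennreal (Kd x)" by (intro mult_left_mono KK_L2[OF x]) simp
  also have "\<dots> < \<infinity>" by (simp add: ennreal_mult_less_top)
  finally have Qfin: "Q < \<infinity>" .
  then obtain q where q: "q \<ge> 0" "Q = ennreal q" by (cases Q) auto
  \<comment> \<open>Moving the weight onto the block leaves an unweighted pairing with
    \<open>KK\<close>, to which the termwise integration \<open>KK_inner_has_sum\<close>
    applies.\<close>
  define g where "g y = of_real (w y) * u y" for y
  have gm: "(\<lambda>y. indicator \<Omega> y *\<^sub>R g y) \<in> borel_measurable lborel" unfolding g_def by measurable
  have gi: "(\<integral>\<^sup>+y. ennreal ((norm (g y))\<^sup>2) * indicator \<Omega> y \<partial>lborel) < \<infinity>"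
  proof -
    have "(\<integral>\<^sup>+y. ennreal ((norm (g y))\<^sup>2) * indicator \<Omega> y \<partial>lborel) \<le> (\<integral>\<^sup>+y. ennreal E * (ennreal (w y * (norm (u y))\<^sup>2) * indicator \<Omega> y) \<partial>lborel)"
    proof (rule nn_integral_mono)
      fix y
      have "(norm (g y))\<^sup>2 = w y * (w y * (norm (u y))\<^sup>2)" using w0[of y] by (simp add: g_def norm_mult power2_eq_square mult_ac)
      also have "\<dots> \<le> E * (w y * (norm (u y))\<^sup>2)" using w0[of y] wE[of y] by (intro mult_right_mono) auto
      finally have "ennreal ((norm (g y))\<^sup>2) \<le> ennreal E * ennreal (w y * (norm (u y))\<^sup>2)"
        using w0[of y] by (subst ennreal_mult''[symmetric]) (auto intro: ennreal_leI)
      then show "ennreal ((norm (g y))\<^sup>2) * indicator \<Omega> y \<le> ennreal E * (ennreal (w y * (norm (u y))\<^sup>2) * indicator \<Omega> y)"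
        by (auto simp: indicator_def)
    qed
    also have "\<dots> = ennreal E * ennreal m0" unfolding U[symmetric] by (intro nn_integral_cmult) measurable
    also have "\<dots> < \<infinity>" by (simp add: ennreal_mult_less_top)
    finally show ?thesis .
  qed
  define Z where "Z = (\<integral>y. indicator \<Omega> y *\<^sub>R (g y * cnj (KK y x)) \<partial>lborel)"
  have Z: "Z = of_real m0"
  proof -
    have hs: "((\<lambda>(k, i). \<integral>y. indicator \<Omega> y *\<^sub>R (g y * cnj (un k i x y)) \<partial>lborel) has_sum Z) UNIV"
      unfolding Z_def by (rule KK_inner_has_sum[OF x gm gi])
    have term0: "(\<integral>y. indicator \<Omega> y *\<^sub>R (g y * cnj (un k' i x y)) \<partial>lborel) = 0" if "(k, 0) \<noteq> (k', i)" for k' i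
    proof -
      have "indicator \<Omega> y *\<^sub>R (g y * cnj (un k' i x y)) = (w y * indicator \<Omega> y) *\<^sub>R (un k 0 x y * cnj (un k' i x y))" for y
        by (simp add: g_def u_def scaleR_conv_of_real mult_ac)
      moreover have "(\<integral>y. (w y * indicator \<Omega> y) *\<^sub>R (un k 0 x y * cnj (un k' i x y)) \<partial>lborel) = 0"
        by (rule un_orthogonal[OF _ _ wm that]) (simp_all add: w_def test_fun_def)
      ultimately show ?thesis by simp
    qed
    have "(\<integral>y. indicator \<Omega> y *\<^sub>R (g y * cnj (un k 0 x y)) \<partial>lborel) = (\<integral>y. complex_of_real (indicator \<Omega> y * (w y * (norm (u y))\<^sup>2)) \<partial>lborel)"
      by (intro Bochner_Integration.integral_cong) (simp_all add: g_def u_def scaleR_conv_of_real complex_norm_square mult_ac del: of_real_power)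
    also have "\<dots> = of_real (\<integral>y. indicator \<Omega> y * (w y * (norm (u y))\<^sup>2) \<partial>lborel)" by (rule integral_complex_of_real)
    also have "(\<integral>y. indicator \<Omega> y * (w y * (norm (u y))\<^sup>2) \<partial>lborel) = enn2real (\<integral>\<^sup>+y. ennreal (indicator \<Omega> y * (w y * (norm (u y))\<^sup>2)) \<partial>lborel)"
      using w0 by (intro integral_eq_nn_integral) (measurable, auto simp: indicator_def open_Omega)
    also have "(\<integral>\<^sup>+y. ennreal (indicator \<Omega> y * (w y * (norm (u y))\<^sup>2)) \<partial>lborel) = ennreal m0"
      unfolding U[symmetric] by (intro nn_integral_cong) (auto simp: indicator_def)
    finally have main: "(\<integral>y. indicator \<Omega> y *\<^sub>R (g y * cnj (un k 0 x y)) \<partial>lborel) = of_real m0" using m0 by simp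
    have single: "((\<lambda>(k, i). \<integral>y. indicator \<Omega> y *\<^sub>R (g y * cnj (un k i x y)) \<partial>lborel) has_sum of_real m0) {(k, 0)}"
      using has_sum_finite[of "{(k, 0)}" "\<lambda>(k, i). \<integral>y. indicator \<Omega> y *\<^sub>R (g y * cnj (un k i x y)) \<partial>lborel"] main by simp
    have zero: "(case p of (k, i) \<Rightarrow> \<integral>y. indicator \<Omega> y *\<^sub>R (g y * cnj (un k i x y)) \<partial>lborel) = 0"
      if "p \<in> UNIV - {(k, 0)}" for p
    proof -
      obtain k' i where p: "p = (k', i)" by force
      then have "(k, 0) \<noteq> (k', i)" using that by auto
      then show ?thesis unfolding p prod.case by (rule term0)
    qed
    have "((\<lambda>(k, i). \<integral>y. indicator \<Omega> y *\<^sub>R (g y * cnj (un k i x y)) \<partial>lborel) has_sum of_real m0) {(k, 0)}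
      \<longleftrightarrow> ((\<lambda>(k, i). \<integral>y. indicator \<Omega> y *\<^sub>R (g y * cnj (un k i x y)) \<partial>lborel) has_sum of_real m0) UNIV"
      by (rule has_sum_cong_neutral) (use zero in blast)+
    with single have "((\<lambda>(k, i). \<integral>y. indicator \<Omega> y *\<^sub>R (g y * cnj (un k i x y)) \<partial>lborel) has_sum of_real m0) UNIV"
      by (simp only:)
    with hs show ?thesis by (rule has_sum_unique)
  qed
  have gint: "integrable lborel (\<lambda>y. indicator \<Omega> y *\<^sub>R (g y * cnj (KK y x)))"
  proof (rule integrable_L2_mult[OF gm _ gi])
    show "(\<lambda>y. indicator \<Omega> y *\<^sub>R KK y x) \<in> borel_measurable lborel" by measurable
    show "(\<integral>\<^sup>+y. ennreal ((norm (KK y x))\<^sup>2) * indicator \<Omega> y \<partial>lborel) < \<infinity>"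
      using KK_L2[OF x] by (auto intro: le_less_trans)
  qed
  have half: "0 \<le> (1 / 2 :: real)" by simp
  have "ennreal m0 = ennreal (norm Z)" using m0 by (simp add: Z)
  also have "\<dots> \<le> (\<integral>\<^sup>+y. ennreal (norm (indicator \<Omega> y *\<^sub>R (g y * cnj (KK y x)))) \<partial>lborel)"
    unfolding Z_def by (rule integral_norm_bound_ennreal[OF gint])
  also have "\<dots> \<le> (\<integral>\<^sup>+y. ennreal (1 / 2) * (ennreal (w y * (norm (u y))\<^sup>2) * indicator \<Omega> y) + ennreal (1 / 2) * (ennreal (w y * (norm (KK y x))\<^sup>2) * indicator \<Omega> y) \<partial>lborel)"
  proof (rule nn_integral_mono)
    fix y
    define a b where "a = norm (u y)" and "b = norm (KK y x)"
    have ab: "a \<ge> 0" "b \<ge> 0" by (simp_all add: a_def b_def)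
    have "0 \<le> (a - b)\<^sup>2" by simp
    then have "a * b \<le> (a\<^sup>2 + b\<^sup>2) / 2" by (simp add: power2_eq_square algebra_simps)
    then have "w y * (a * b) \<le> w y * ((a\<^sup>2 + b\<^sup>2) / 2)" using w0[of y] by (rule mult_left_mono)
    then have le: "w y * (a * b) \<le> 1 / 2 * (w y * a\<^sup>2) + 1 / 2 * (w y * b\<^sup>2)" by (simp add: field_simps)
    have n: "norm (g y * cnj (KK y x)) = w y * (a * b)" using w0[of y] by (simp add: g_def norm_mult a_def b_def)
    have pos: "0 \<le> w y * a\<^sup>2" "0 \<le> w y * b\<^sup>2" using w0[of y] by simp_all
    have "ennreal (w y * (a * b)) \<le> ennreal (1 / 2 * (w y * a\<^sup>2) + 1 / 2 * (w y * b\<^sup>2))" by (rule ennreal_leI[OF le])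
    also have "\<dots> = ennreal (1 / 2) * ennreal (w y * a\<^sup>2) + ennreal (1 / 2) * ennreal (w y * b\<^sup>2)"
      by (simp only: ennreal_plus[OF mult_nonneg_nonneg[OF half pos(1)] mult_nonneg_nonneg[OF half pos(2)]] ennreal_mult'[OF half])
    finally have fin: "ennreal (w y * (a * b)) \<le> ennreal (1 / 2) * ennreal (w y * a\<^sup>2) + ennreal (1 / 2) * ennreal (w y * b\<^sup>2)" .
    show "ennreal (norm (indicator \<Omega> y *\<^sub>R (g y * cnj (KK y x)))) \<le> ennreal (1 / 2) * (ennreal (w y * (norm (u y))\<^sup>2) * indicator \<Omega> y) + ennreal (1 / 2) * (ennreal (w y * (norm (KK y x))\<^sup>2) * indicator \<Omega> y)"
    proof (cases "y \<in> \<Omega>")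
      case True
      then have i1: "indicator \<Omega> y = (1::real)" "indicator \<Omega> y = (1::ennreal)" by simp_all
      show ?thesis using fin unfolding i1 scaleR_one n a_def b_def mult_1_right .
    qed simp
  qed
  also have "\<dots> = ennreal (1 / 2) * ennreal m0 + ennreal (1 / 2) * Q"
    unfolding U[symmetric] Q_def 
    by (rule trans[OF nn_integral_add arg_cong2[where f="(+)", OF nn_integral_cmult nn_integral_cmult]]) measurable
  also have "\<dots> = ennreal (1 / 2 * m0 + 1 / 2 * q)"
    unfolding q(2)
    by (simp only: ennreal_plus[OF mult_nonneg_nonneg[OF half m0] mult_nonneg_nonneg[OF half q(1)]] ennreal_mult'[OF half])
  finally have "ennreal m0 \<le> ennreal (1 / 2 * m0 + 1 / 2 * q)" .
  then have "m0 \<le> 1 / 2 * m0 + 1 / 2 * q" using m0 q(1) by (subst (asm) ennreal_le_iff) auto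
  then have "m0 \<le> q" by linarith
  then have "ennreal m0 \<le> Q" unfolding q(2) by (rule ennreal_leI)
  then show "ennreal (dg x k 0 / real m * L) \<le> (\<integral>\<^sup>+y. ennreal (test_fun (exp (- L)) y * (norm (KK y x))\<^sup>2) * indicator \<Omega> y \<partial>lborel)"
    by (simp only: m0_def Q_def w_def e_def)
  show "(\<integral>\<^sup>+y. ennreal (test_fun (exp (- L)) y * (norm (KK y x))\<^sup>2) * indicator \<Omega> y \<partial>lborel) < \<infinity>"
    using Qfin by (simp only: Q_def w_def e_def)
qed

lemma berezin_test_fun_ge:
  assumes k: "bb k = 1 / real m" and x: "x \<in> \<Omega>" and L: "L > 0"
  shows "dg x k 0 / (real m * Kd x) * L \<le> norm (berezin_transform \<Omega> (\<lambda>y. of_real (test_fun (exp (- L)) y)) x)"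
proof -
  let ?w = "test_fun (exp (- L))"
  obtain q where q: "q \<ge> 0" "(\<integral>\<^sup>+y. ennreal (?w y * (norm (KK y x))\<^sup>2) * indicator \<Omega> y \<partial>lborel) = ennreal q"
    using KK_test_fun_ge(2)[OF k x L]
    by (cases "\<integral>\<^sup>+y. ennreal (?w y * (norm (KK y x))\<^sup>2) * indicator \<Omega> y \<partial>lborel") auto
  have le: "dg x k 0 / real m * L \<le> q" using KK_test_fun_ge(1)[OF k x L] q by (simp add: ennreal_le_iff)
  note [measurable] = borel_measurable_lebesgue_on_Omega[OF bk_measurable2[of x]] borel_measurable_lebesgue_on_Omega[OF test_fun_measurable]
  have "berezin_transform \<Omega> (\<lambda>y. of_real (?w y)) x = (\<integral>y. complex_of_real (bk x y * ?w y) \<partial>lebesgue_on \<Omega>)"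
    by (simp add: berezin_transform_def berezin_kernel_eq)
  also have "\<dots> = of_real (\<integral>y. bk x y * ?w y \<partial>lebesgue_on \<Omega>)" by (rule integral_complex_of_real)
  also have "(\<integral>y. bk x y * ?w y \<partial>lebesgue_on \<Omega>) = enn2real (\<integral>\<^sup>+y. ennreal (bk x y * ?w y) \<partial>lebesgue_on \<Omega>)"
    by (rule integral_eq_nn_integral, measurable) (simp add: bk_nonneg test_fun_nonneg)
  also have "(\<integral>\<^sup>+y. ennreal (bk x y * ?w y) \<partial>lebesgue_on \<Omega>)
    = (\<integral>\<^sup>+y. ennreal (1 / Kd x) * (ennreal (?w y * (norm (KK y x))\<^sup>2) * indicator \<Omega> y) \<partial>lborel)"
    unfolding nn_integral_lebesgue_on_Omega using Kd_pos[OF x]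
    by (intro nn_integral_cong) (auto simp: indicator_def bk_eq[OF x] KK_sym[of x] ennreal_mult'[symmetric] mult_ac)
  also have "\<dots> = ennreal (1 / Kd x) * ennreal q"
  proof -
    note [measurable] = KK_measurable1[of x] test_fun_measurable Omega_borel
    show ?thesis unfolding q(2)[symmetric] by (intro nn_integral_cmult) measurable
  qed
  also have "\<dots> = ennreal (1 / Kd x * q)" using Kd_pos[OF x] by (intro ennreal_mult'[symmetric]) simp
  finally have "berezin_transform \<Omega> (\<lambda>y. of_real (?w y)) x = of_real (1 / Kd x * q)"
    using q(1) Kd_pos[OF x] by simp
  then have "norm (berezin_transform \<Omega> (\<lambda>y. of_real (?w y)) x) = 1 / Kd x * q"
    using q(1) Kd_pos[OF x] by (simp only: norm_of_real) simp
  moreover have "dg x k 0 / (real m * Kd x) * L = 1 / Kd x * (dg x k 0 / real m * L)" by simp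
  moreover have "1 / Kd x * (dg x k 0 / real m * L) \<le> 1 / Kd x * q"
    using Kd_pos[OF x] by (intro mult_left_mono[OF le]) simp
  ultimately show ?thesis by linarith
qed

text \<open>Boundedness would give \<open>L powr p * I \<le> D * L\<close> for all
  \<open>L > 0\<close>, with \<open>I\<close> the \<open>p\<close>-th power integral of
  \<open>\<kappa>\<close>. Since \<open>I\<close> is positive and \<open>p > 1\<close>, this fails
  for large \<open>L\<close>.\<close>

lemma berezin_unbounded:
  assumes cop: "coprime m l" and p: "1 < p" "p \<le> real (m + CARD('n) * l)"
  shows "\<not> berezin_bounded_on_Lp \<Omega> p"
proof
  let ?L = "lebesgue_on \<Omega>"
  assume "berezin_bounded_on_Lp \<Omega> p"
  then obtain C where C: "\<And>f. f \<in> Lp_space p ?L \<Longrightarrow> berezin_transform \<Omega> f \<in> Lp_space p ?L \<and>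
      Lp_norm p ?L (berezin_transform \<Omega> f) \<le> C * Lp_norm p ?L f"
    unfolding berezin_bounded_on_Lp_def by blast
  obtain k where k: "bb k = 1 / real m" using bb_minimal[OF cop] .
  define \<kappa> where "\<kappa> x = dg x k 0 / (real m * Re (KK x x))" for x
  have \<kappa>m: "\<kappa> \<in> borel_measurable borel" unfolding \<kappa>_def[abs_def] dg_def using Re_KK_measurable by measurable
  have \<kappa>_eq: "\<kappa> x = dg x k 0 / (real m * Kd x)" if "x \<in> \<Omega>" for x using that by (simp add: \<kappa>_def KK_diag)
  have \<kappa>0: "\<kappa> x \<ge> 0" if "x \<in> \<Omega>" for x unfolding \<kappa>_eq[OF that] using Kd_pos[OF that] by (simp add: dg_nonneg)
  define I where "I = (\<integral>\<^sup>+x. ennreal (\<kappa> x powr p) \<partial>?L)"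
  define c0 where "c0 = pi ^ CARD('n) / fact CARD('n) * pi"
  have c0: "c0 \<ge> 0" by (simp add: c0_def)
  have upper: "ennreal (L powr p) * I \<le> ennreal (\<bar>C\<bar> powr p * (c0 * L))" if L: "L > 0" for L
  proof -
    define f where "f y = complex_of_real (test_fun (exp (- L)) y)" for y
    have nf: "norm (f y) = test_fun (exp (- L)) y" for y by (simp add: f_def test_fun_nonneg)
    have fm: "f \<in> borel_measurable ?L"
      unfolding f_def[abs_def] using borel_measurable_lebesgue_on_Omega[OF test_fun_measurable[of "exp (- L)"]] by measurable
    have fb: "(\<integral>\<^sup>+x. ennreal (norm (f x) powr p) \<partial>?L) \<le> ennreal (c0 * L)"
      unfolding nf c0_def using p by (intro test_fun_Lp[OF _ p(2) L]) simp
    have fi: "integrable ?L (\<lambda>x. norm (f x) powr p)"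
    proof (rule integrableI_bounded)
      show "(\<lambda>x. norm (f x) powr p) \<in> borel_measurable ?L" using fm by measurable
      show "(\<integral>\<^sup>+x. ennreal (norm (norm (f x) powr p)) \<partial>?L) < \<infinity>" using fb by (auto intro: le_less_trans)
    qed
    have fLp: "f \<in> Lp_space p ?L" using fm fi by (simp add: Lp_space_def)
    define J where "J = (\<integral>x. norm (f x) powr p \<partial>?L)"
    have J: "0 \<le> J" "J \<le> c0 * L"
    proof -
      show "0 \<le> J" by (simp add: J_def)
      have "ennreal J \<le> ennreal (c0 * L)" using fb nn_integral_eq_integral[OF fi] by (simp add: J_def)
      then show "J \<le> c0 * L" using c0 L by (simp add: ennreal_le_iff)
    qed
    define b where "b = berezin_transform \<Omega> f"
    have bi: "integrable ?L (\<lambda>x. norm (b x) powr p)" and bn: "Lp_norm p ?L b \<le> C * Lp_norm p ?L f"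
      using C[OF fLp] by (simp_all add: Lp_space_def b_def)
    define H where "H = (\<integral>x. norm (b x) powr p \<partial>?L)"
    have H0: "H \<ge> 0" by (simp add: H_def)
    \<comment> \<open>The constant \<open>C\<close> comes without a sign; its absolute value is used
      so that \<open>p\<close>-th powers can be taken.\<close>
    have "H powr (1 / p) \<le> C * J powr (1 / p)" using bn by (simp add: Lp_norm_def H_def J_def)
    also have "\<dots> \<le> \<bar>C\<bar> * J powr (1 / p)" by (intro mult_right_mono) auto
    finally have "(H powr (1 / p)) powr p \<le> (\<bar>C\<bar> * J powr (1 / p)) powr p" using p by (intro powr_mono2) auto
    then have "H \<le> \<bar>C\<bar> powr p * J" using p H0 J(1) by (simp add: powr_mult powr_powr)
    also have "\<dots> \<le> \<bar>C\<bar> powr p * (c0 * L)" by (intro mult_left_mono J) simp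
    finally have H: "H \<le> \<bar>C\<bar> powr p * (c0 * L)" .
    have "ennreal (L powr p) * I = (\<integral>\<^sup>+x. ennreal (L powr p) * ennreal (\<kappa> x powr p) \<partial>?L)"
      unfolding I_def using borel_measurable_lebesgue_on_Omega[OF \<kappa>m]
      by (intro nn_integral_cmult[symmetric]) measurable
    also have "\<dots> \<le> (\<integral>\<^sup>+x. ennreal (norm (b x) powr p) \<partial>?L)"
    proof (rule nn_integral_mono)
      fix x assume "x \<in> space ?L"
      then have x: "x \<in> \<Omega>" by simp
      have "\<kappa> x * L \<le> norm (b x)" unfolding b_def f_def[abs_def] \<kappa>_eq[OF x] by (rule berezin_test_fun_ge[OF k x L])
      then have "(\<kappa> x * L) powr p \<le> norm (b x) powr p" using p \<kappa>0[OF x] L by (intro powr_mono2) auto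
      then have "L powr p * \<kappa> x powr p \<le> norm (b x) powr p" by (simp only: powr_mult mult.commute)
      then show "ennreal (L powr p) * ennreal (\<kappa> x powr p) \<le> ennreal (norm (b x) powr p)"
        by (simp add: ennreal_mult'[symmetric] ennreal_leI)
    qed
    also have "\<dots> = ennreal H" unfolding H_def by (rule nn_integral_eq_integral[OF bi]) simp
    also have "\<dots> \<le> ennreal (\<bar>C\<bar> powr p * (c0 * L))" by (rule ennreal_leI[OF H])
    finally show ?thesis .
  qed
  \<comment> \<open>The bound at \<open>L = 1\<close> already shows that \<open>I\<close> is
    finite.\<close>
  have "I < \<infinity>" using upper[of 1] by (auto simp: less_top intro: le_less_trans)
  then obtain i where i: "i \<ge> 0" "I = ennreal i" by (cases I) auto
  have "I \<noteq> 0"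
  proof
    assume "I = 0"
    then have "AE x in lborel. ennreal (\<kappa> x powr p) * indicator \<Omega> x = 0"
      unfolding I_def nn_integral_lebesgue_on_Omega using \<kappa>m Omega_borel
      by (subst (asm) nn_integral_0_iff_AE) simp_all
    \<comment> \<open>Points with \<open>z = 0\<close> are removed because \<open>dg x k 0\<close>
      vanishes there when \<open>k > 0\<close>. On the remaining nonempty open set
      \<open>\<kappa>\<close> is positive.\<close>
    define S where "S = \<Omega> \<inter> {x. fst x \<noteq> 0}"
    have "open {x :: (complex ^ 'n) \<times> complex. fst x \<noteq> 0}"
      by (intro open_Collect_neq continuous_intros)
    then have S: "open S" unfolding S_def using open_Omega by (intro open_Int)
    have "AE x in lborel. x \<notin> S"
    proof (rule AE_mp[OF \<open>AE x in lborel. ennreal (\<kappa> x powr p) * indicator \<Omega> x = 0\<close>], rule AE_I2, intro impI notI)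
      fix x assume z: "ennreal (\<kappa> x powr p) * indicator \<Omega> x = 0" and "x \<in> S"
      then have x: "x \<in> \<Omega>" "fst x \<noteq> 0" by (simp_all add: S_def)
      have "rad (snd x) > 0" using in_Omega_iff[of "fst x" "snd x"] x by (simp add: rad_pos)
      then have "Xc x > 0" using x by (simp add: Xc_def)
      then have "dg x k 0 > 0"
        unfolding dg_def using Cn_pos[of k] bb_bounds(3)[of k] Xc_Yc_in_Omega[OF x(1)] by (intro mult_pos_pos) auto
      then have "\<kappa> x > 0" unfolding \<kappa>_eq[OF x(1)] using Kd_pos[OF x(1)] m by simp
      then show False using z x(1) by simp
    qed
    then have "{x \<in> space lborel. \<not> x \<notin> S} \<in> null_sets lborel"
      using S by (subst (asm) AE_iff_null) simp_all
    then have "S \<in> null_sets lborel" by simp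
    then have "negligible S" by (simp add: negligible_iff_null_sets null_sets_completionI)
    moreover have "S \<noteq> {}"
    proof -
      have r: "rad (1 / 2) > 0" by (intro rad_pos) simp
      then obtain z :: "complex ^ 'n" where z: "norm z = rad (1 / 2) / 2" using vector_choose_size[of "rad (1 / 2) / 2"] by auto
      then have "(z, 1 / 2) \<in> S" using r by (auto simp: S_def in_Omega_iff)
      then show ?thesis by blast
    qed
    ultimately show False using open_not_negligible[OF S] by blast
  qed
  then have ipos: "i > 0" using i by (cases "i = 0") auto
  define D where "D = \<bar>C\<bar> powr p * c0"
  have D: "D \<ge> 0" using c0 by (simp add: D_def)
  \<comment> \<open>Chosen so that \<open>L powr (p - 1) = D / i + 1\<close>, just above the largest
    value the inequality permits.\<close>
  define L where "L = (D / i + 1) powr (1 / (p - 1))"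
  have L: "L > 0" using D ipos by (simp add: L_def add_nonneg_pos less_imp_neq[THEN not_sym])
  have "ennreal (L powr p * i) \<le> ennreal (D * L)"
    using upper[OF L] i by (simp add: ennreal_mult' D_def mult.assoc)
  then have "L powr p * i \<le> D * L" using D L by (simp add: ennreal_le_iff)
  moreover have "L powr p = L powr (p - 1) * L" using L by (simp add: powr_mult_base mult.commute)
  ultimately have "L * (L powr (p - 1) * i) \<le> L * D" by (simp add: mult_ac)
  then have "L powr (p - 1) * i \<le> D" using L by simp
  moreover have "L powr (p - 1) = D / i + 1"
    unfolding L_def powr_powr using p D ipos by (simp add: add_nonneg_pos)
  ultimately have "(D / i + 1) * i \<le> D" by simp
  then show False using ipos by (simp add: distrib_right)
qed

end

theorem theorem1p1:
  fixes m l :: nat and p :: real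
  assumes "m > 0" and "l > 0" and "coprime m l" and "1 < p"
  shows "berezin_bounded_on_Lp (hartogs_triangle m l :: ((complex ^ 'n) \<times> complex) set) p
         \<longleftrightarrow> p > real (m + CARD('n) * l)"
proof -
  interpret hartogs m l "TYPE('n)" by unfold_locales (use assms in auto)
  show ?thesis using berezin_bounded berezin_unbounded[OF assms(3,4)] by (meson not_less)
qed

end
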